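(* (1) Let $1\le k\le N-1$, let $K=\{x\in\mathbb{R}^N : x_1=x_2=\dots=x_k=0\}$ and $d(x)=\mathrm{dist}(x,K)$. Assume that $2\le p<N$ and $p<q\le Np/(N-p)$. Then there exists a constant $c>0$ such that for all $u\in W^{1,p}_0(\mathbb{R}^N\setminus K)$ $$\int_{\mathbb{R}^N}|\nabla u|^p\,dx-\left|\frac{k-p}{p}\right|^p\int_{\mathbb{R}^N}\frac{|u|^p}{d^p}\,dx\ \ge\ c\left(\int_{\mathbb{R}^N}|u|^q\,d^{-q-N+Nq/p}\,dx\right)^{p/q}.$$ (2) Let $\Omega$ be a bounded domain in $\mathbb{R}^N$ containing the origin, let $d(x)=|x|$ (so that $K=\{0\}$ and $k=N$), and let $D>\sup_{x\in\Omega}|x|$. Assume that $1<p<N$ and $p\le q<Np/(N-p)$. Then there exists a constant $c>0$ such that for all $u\in W^{1,p}_0(\Omega)$ $$\int_{\Omega}|\nabla u|^p\,dx-\left|\frac{N-p}{p}\right|^p\int_{\Omega}\frac{|u|^p}{|x|^p}\,dx\ \ge\ c\left(\int_{\Omega}|u|^q\,|x|^{-q-N+Nq/p}X^{1+q/p}(|x|/D)\,dx\right)^{p/q}.$$ This last inequality is optimal in the sense that $X^{1+q/p}$ cannot be replaced by a smaller power of $X$: if $\gamma<1+q/p$, there is no $c>0$ for which the inequality with $X^{\gamma}$ in place of $X^{1+q/p}$ holds for all $u\in W_0^{1,p}(\Omega)$.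
   Context: $X(t)=-1/\log t$ for $t\in(0,1)$. *)

theory Defs
  imports "HOL-Analysis.Analysis"
begin

definition grad :: "(real ^ 'n \<Rightarrow> real) \<Rightarrow> real ^ 'n \<Rightarrow> real ^ 'n" where
  "grad f x = (\<chi> i. frechet_derivative f (at x) (axis i 1))"

fun Ck :: "nat \<Rightarrow> (real ^ 'n \<Rightarrow> real) \<Rightarrow> bool" where
  "Ck 0 f \<longleftrightarrow> continuous_on UNIV f"
| "Ck (Suc k) f \<longleftrightarrow> f differentiable_on UNIV \<and> (\<forall>i. Ck k (\<lambda>x. grad f x $ i))"

text \<open>The space of smooth functions with compact support in \<open>\<Omega>\<close>; its elements are defined on
  the whole space and vanish outside \<open>\<Omega>\<close>.\<close>

definition test_functions :: "(real ^ 'n) set \<Rightarrow> (real ^ 'n \<Rightarrow> real) set" where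
  "test_functions \<Omega> = {\<phi>. (\<forall>k. Ck k \<phi>) \<and> compact (closure {x. \<phi> x \<noteq> 0}) \<and>
                            closure {x. \<phi> x \<noteq> 0} \<subseteq> \<Omega>}"

definition in_Lp :: "(real ^ 'n) set \<Rightarrow> real \<Rightarrow> (real ^ 'n \<Rightarrow> 'b::euclidean_space) \<Rightarrow> bool" where
  "in_Lp \<Omega> p f \<longleftrightarrow> f \<in> borel_measurable (lebesgue_on \<Omega>) \<and>
                   integrable (lebesgue_on \<Omega>) (\<lambda>x. norm (f x) powr p)"

definition locally_integrable :: "(real ^ 'n) set \<Rightarrow> (real ^ 'n \<Rightarrow> 'b::euclidean_space) \<Rightarrow> bool" where
  "locally_integrable \<Omega> f \<longleftrightarrow> (\<forall>C. compact C \<and> C \<subseteq> \<Omega> \<longrightarrow> f absolutely_integrable_on C)"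

definition weak_gradient ::
    "(real ^ 'n) set \<Rightarrow> (real ^ 'n \<Rightarrow> real) \<Rightarrow> (real ^ 'n \<Rightarrow> real ^ 'n) \<Rightarrow> bool" where
  "weak_gradient \<Omega> u g \<longleftrightarrow> locally_integrable \<Omega> u \<and> locally_integrable \<Omega> g \<and>
     (\<forall>\<phi>\<in>test_functions \<Omega>. \<forall>i.
        (\<integral>x. u x * grad \<phi> x $ i \<partial>lebesgue_on \<Omega>) = - (\<integral>x. g x $ i * \<phi> x \<partial>lebesgue_on \<Omega>))"

text \<open>A Sobolev function is carried together with (a representative of) its weak gradient, which
  is determined almost everywhere. Thus \<open>W1p \<Omega> p u g\<close> says that \<open>u\<close> belongs to
  \<open>W\<^sup>1\<^sup>,\<^sup>p(\<Omega>)\<close> and \<open>\<nabla>u = g\<close>; only the values on \<open>\<Omega>\<close> matter.\<close>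

definition W1p ::
    "(real ^ 'n) set \<Rightarrow> real \<Rightarrow> (real ^ 'n \<Rightarrow> real) \<Rightarrow> (real ^ 'n \<Rightarrow> real ^ 'n) \<Rightarrow> bool" where
  "W1p \<Omega> p u g \<longleftrightarrow> in_Lp \<Omega> p u \<and> in_Lp \<Omega> p g \<and> weak_gradient \<Omega> u g"

definition W1p_norm ::
    "(real ^ 'n) set \<Rightarrow> real \<Rightarrow> (real ^ 'n \<Rightarrow> real) \<Rightarrow> (real ^ 'n \<Rightarrow> real ^ 'n) \<Rightarrow> real" where
  "W1p_norm \<Omega> p u g = ((\<integral>x. \<bar>u x\<bar> powr p \<partial>lebesgue_on \<Omega>) +
                         (\<integral>x. norm (g x) powr p \<partial>lebesgue_on \<Omega>)) powr (1 / p)"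

text \<open>The closure of the test functions in the Sobolev norm.\<close>

definition W01p ::
    "(real ^ 'n) set \<Rightarrow> real \<Rightarrow> (real ^ 'n \<Rightarrow> real) \<Rightarrow> (real ^ 'n \<Rightarrow> real ^ 'n) \<Rightarrow> bool" where
  "W01p \<Omega> p u g \<longleftrightarrow> W1p \<Omega> p u g \<and>
     (\<exists>\<phi>. (\<forall>m. \<phi> m \<in> test_functions \<Omega>) \<and>
          (\<lambda>m::nat. W1p_norm \<Omega> p (\<lambda>x. u x - \<phi> m x) (\<lambda>x. g x - grad (\<phi> m) x)) \<longlonglongrightarrow> 0)"

text \<open>Integrals of nonnegative functions take values in the extended reals, so that an inequality
  whose smaller side is infinite counts as false, and a zero coefficient times a divergent integral
  is zero.\<close>

definition int_on :: "(real ^ 'n) set \<Rightarrow> (real ^ 'n \<Rightarrow> real) \<Rightarrow> ereal" where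
  "int_on A f = enn2ereal (\<integral>\<^sup>+x\<in>A. ennreal (f x) \<partial>lebesgue)"

text \<open>Powers of elements of \<open>[0, \<infinity>]\<close>, for positive exponents.\<close>

definition epowr :: "ereal \<Rightarrow> real \<Rightarrow> ereal" where
  "epowr y a = (if y = \<infinity> then \<infinity> else ereal (real_of_ereal y powr a))"

definition X_log :: "real \<Rightarrow> real" where
  "X_log t = - 1 / ln t"

end

theory Submission
  imports Defs
begin

text \<open>
  Let \<open>y\<close> be the orthogonal projection of \<open>x\<close> with \<open>\<bar>y\<bar> = d(x)\<close>, and \<open>H = (k - p) / p\<close>. Split
  \<open>\<nabla>u = a + b\<close> with \<open>a = - H u y / \<bar>y\<bar>\<^sup>2\<close>. The field \<open>\<bar>u\<bar>\<^sup>p y / \<bar>y\<bar>\<^sup>p\<close> turns the left-hand side of the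
  Hardy inequality into the integral of the convexity defect
  \<open>j = \<bar>a + b\<bar>\<^sup>p - \<bar>a\<bar>\<^sup>p - p \<bar>a\<bar>\<^sup>p\<^sup>-\<^sup>2 a \<bullet> b \<ge> 0\<close>.

  For \<open>p \<ge> 2\<close> one has \<open>j \<ge> c \<bar>b\<bar>\<^sup>p\<close>, and it remains to bound a weighted \<open>L\<^sup>q\<close> norm of \<open>u\<close> by the \<open>L\<^sup>p\<close> norm of
  \<open>b\<close>. The Gagliardo--Nirenberg inequality and an \<open>L\<^sup>1\<close> Hardy inequality, both applied to
  \<open>\<bar>y\<bar>\<^sup>m \<bar>u\<bar>\<^sup>\<sigma>\<close> with \<open>\<sigma> = 1 + q (p - 1) / p\<close>, do this unless a certain constant vanishes; here it vanishes
  only for \<open>q = p\<close> or \<open>k = N\<close>.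

  At a point, put \<open>t = ln (D / \<bar>x\<bar>)\<close>. Testing with radial fields and using
  \<open>\<bar>a\<bar>\<^sup>p\<^sup>-\<^sup>1 \<bar>b\<bar> \<le> C (sqrt (\<bar>a\<bar>\<^sup>p j) + j)\<close> gives \<open>\<integral> \<bar>a\<bar>\<^sup>p / t\<^sup>2 \<le> C \<integral> j\<close>, and the integral of \<open>\<bar>a\<bar>\<^sup>p\<close> over
  \<open>i \<le> t < i + 1\<close> is at most \<open>C (i + 1) \<integral> j\<close>. The scale-invariant Sobolev inequality on each of these shells
  and a summation over \<open>i\<close> yield the logarithmic inequality. Its optimality is seen on
  \<open>\<bar>x\<bar>\<^sup>-\<^sup>H T\<^sup>1\<^sup>/\<^sup>p \<zeta>(t / T)\<close> with a bump function \<open>\<zeta>\<close> on \<open>(1, 2)\<close>, as \<open>T\<close> tends to infinity.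
\<close>

text \<open>For \<open>p < 2\<close> the defect is only of order \<open>|a|^(p-2) |b|^2\<close> when
  \<open>b\<close> is small against \<open>a\<close>, so \<open>j >= c |b|^p\<close> fails; hence
  \<open>p >= 2\<close> in the first inequality, while the second relies on the cross term. The
  exponent \<sigma> is forced: Hoelder's inequality with exponents \<open>p / (p - 1)\<close> and
  \<open>p\<close>, applied to \<open>|u|^(\<sigma>-1) |y|^m |b|\<close>, must reproduce the target
  integrand \<open>|u|^q |y|^s\<close>. The critical constant is
  \<open>(N - k) (p - 1) (q - p) / p^2\<close>, and its vanishing for \<open>k = N\<close> is the
  obstacle that brings in the logarithm. There the power \<open>1 + q/p\<close> comes from counting:
  with \<open>Y\<close> the energy of a shell and \<open>r = q / p\<close>, Sobolev gives
  \<open>Y^r\<close>, the growth bound turns this into \<open>(i + 1)^(r - 1) Y\<close>, and the sum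
  of \<open>Y / (i + 1)^2\<close> is controlled by the Hardy inequality with weight
  \<open>1 / t^2\<close>. The estimates are proved for C^1 functions supported away from the
  singular set. They survive the closure in the Sobolev norm because the weighted integrals are
  lower semicontinuous by Fatou's lemma; at the origin, which test functions may meet,
  \<open>p < N\<close> makes a cutoff cheap.\<close>

subsection \<open>Real powers of extended nonnegative reals and Hoelder's inequality\<close>

text \<open>Unlike \<open>powr\<close>, this power satisfies \<open>epw 0 0 = 1\<close>, so that exponents may degenerate to \<open>0\<close>.\<close>

definition epw :: "ennreal \<Rightarrow> real \<Rightarrow> ennreal" where
  "epw x r = (if r = 0 then 1 else if x = top then top else ennreal (enn2real x powr r))"

lemma epw_0_right [simp]: "epw x 0 = 1"
  by (simp add: epw_def)

lemma epw_1_right [simp]: "epw x 1 = x"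
  by (cases x) (auto simp: epw_def top_unique)

lemma epw_top [simp]: "r \<noteq> 0 \<Longrightarrow> epw top r = top"
  by (simp add: epw_def)

lemma epw_0_left [simp]: "r \<noteq> 0 \<Longrightarrow> epw 0 r = 0"
  by (simp add: epw_def)

lemma epw_ennreal: "0 \<le> a \<Longrightarrow> r \<noteq> 0 \<Longrightarrow> epw (ennreal a) r = ennreal (a powr r)"
  by (simp add: epw_def)

lemma epw_eq_0_iff: "epw x r = 0 \<longleftrightarrow> x = 0 \<and> r \<noteq> 0"
  by (cases x) (auto simp: epw_def)

lemma epw_mono:
  assumes "0 \<le> r" "x \<le> y" shows "epw x r \<le> epw y r"
proof (cases y)
  case (real b)
  then obtain a where a: "x = ennreal a" "0 \<le> a"
    using assms(2) by (cases x) (auto simp: top_unique)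
  then have "a \<le> b" using real assms by (simp add: ennreal_le_iff)
  then show ?thesis using real a assms by (auto simp: epw_def intro!: ennreal_leI powr_mono2)
qed (auto simp: epw_def)

lemma epw_add:
  assumes "0 \<le> r" "0 \<le> s" shows "epw x (r + s) = epw x r * epw x s"
proof -
  consider "r = 0" | "s = 0" | "r > 0" "s > 0" using assms by linarith
  then show ?thesis
  proof cases
    case 3
    then show ?thesis
      by (cases x) (auto simp: epw_def powr_add ennreal_mult ennreal_mult_top)
  qed auto
qed

lemma epw_mult:
  assumes "0 \<le> r" shows "epw (x * y) r = epw x r * epw y r"
proof (cases "r = 0")
  case False
  then have r: "r > 0" using assms by auto
  show ?thesis
  proof (cases x)
    case x: (real a)
    show ?thesis
    proof (cases y)
      case (real b)
      then show ?thesis using x r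
        by (simp add: epw_def powr_mult flip: ennreal_mult)
    next
      case top
      then show ?thesis using x r
        by (cases "a = 0") (auto simp: epw_def ennreal_mult_top ennreal_top_mult)
    qed
  next
    case top
    show ?thesis
    proof (cases "y = 0")
      case True then show ?thesis using r by (simp add: epw_def)
    next
      case False
      then have "epw y r \<noteq> 0" by (simp add: epw_eq_0_iff)
      then show ?thesis using False r top by (simp add: epw_def ennreal_top_mult)
    qed
  qed
qed auto

lemma epw_epw:
  assumes "0 \<le> r" "0 \<le> s" shows "epw (epw x r) s = epw x (r * s)"
  by (cases x) (auto simp: epw_def powr_powr)

lemma epw_one_left [simp]: "epw 1 r = 1"
  by (simp add: epw_def)

lemma epw_prod:
  assumes "0 \<le> r" shows "epw (\<Prod>i\<in>I. f i) r = (\<Prod>i\<in>I. epw (f i) r)"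
  by (induction I rule: infinite_finite_induct) (auto simp: epw_mult assms)

lemma epw_measurable [measurable]:
  assumes [measurable]: "f \<in> borel_measurable M"
  shows "(\<lambda>x. epw (f x) r) \<in> borel_measurable M"
  unfolding epw_def by measurable

text \<open>Weighted arithmetic-geometric mean for \<open>x / a\<close> and \<open>y / b\<close>,
  cleared of denominators. The free scales \<open>a\<close> and \<open>b\<close> become the two
  integrals in Hoelder's inequality, where the bracket then integrates to \<open>1\<close>.\<close>

lemma epw_Young:
  fixes x y :: ennreal
  assumes "0 < \<theta>" "\<theta> < 1" "0 < a" "0 < b"
  shows "epw x (1 - \<theta>) * epw y \<theta> \<le> ennreal (a powr (1 - \<theta>) * b powr \<theta>) *
           (ennreal ((1 - \<theta>) / a) * x + ennreal (\<theta> / b) * y)"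
proof -
  have c: "a powr (1 - \<theta>) * b powr \<theta> > 0" using assms by simp
  show ?thesis
  proof (cases "x = top \<or> y = top")
    case True
    then have "ennreal ((1 - \<theta>) / a) * x + ennreal (\<theta> / b) * y = top"
      using assms by (auto simp: ennreal_mult_top)
    then show ?thesis using c assms by (simp only:) (simp add: ennreal_mult_top)
  next
    case False
    then obtain u v where uv: "x = ennreal u" "y = ennreal v" "0 \<le> u" "0 \<le> v"
      by (metis ennreal_cases)
    show ?thesis
    proof (cases "u = 0 \<or> v = 0")
      case True then show ?thesis using uv assms by auto
    next
      case False
      then have pos: "u > 0" "v > 0" using uv by auto
      have "(u / a) powr (1 - \<theta>) * (v / b) powr \<theta> \<le> (1 - \<theta>) * (u / a) + \<theta> * (v / b)"
        using Youngs_inequality_0[of "1 - \<theta>" \<theta> "u / a" "v / b"] pos assms by simp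
      then have "u powr (1 - \<theta>) * v powr \<theta> \<le> (a powr (1 - \<theta>) * b powr \<theta>) * ((1 - \<theta>) * (u / a) + \<theta> * (v / b))"
        using c pos assms by (simp add: powr_divide field_simps)
      moreover have "ennreal (a powr (1 - \<theta>) * b powr \<theta>) * (ennreal ((1 - \<theta>) / a) * x + ennreal (\<theta> / b) * y)
          = ennreal ((a powr (1 - \<theta>) * b powr \<theta>) * ((1 - \<theta>) * (u / a) + \<theta> * (v / b)))"
        using assms uv by (simp flip: ennreal_mult ennreal_plus)
      ultimately show ?thesis
        using uv assms by (simp add: epw_def flip: ennreal_mult)
    qed
  qed
qed

lemma nn_integral_Hoelder:
  assumes [measurable]: "f \<in> borel_measurable M" "g \<in> borel_measurable M"
    and th: "0 \<le> \<theta>" "\<theta> \<le> 1"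
  shows "(\<integral>\<^sup>+x. epw (f x) (1 - \<theta>) * epw (g x) \<theta> \<partial>M)
     \<le> epw (\<integral>\<^sup>+x. f x \<partial>M) (1 - \<theta>) * epw (\<integral>\<^sup>+x. g x \<partial>M) \<theta>"
proof -
  let ?A = "\<integral>\<^sup>+x. f x \<partial>M" and ?B = "\<integral>\<^sup>+x. g x \<partial>M"
  consider "\<theta> = 0" | "\<theta> = 1" | "0 < \<theta>" "\<theta> < 1" using th by linarith
  then show ?thesis
  proof cases
    case 3
    show ?thesis
    \<comment> \<open>If one factor is null almost everywhere, so is the product; splitting this
      case off keeps the scales for \<open>epw_Young\<close> positive.\<close>
    proof (cases "?A = 0 \<or> ?B = 0")
      case True
      then have "(AE x in M. f x = 0) \<or> (AE x in M. g x = 0)"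
        by (simp add: nn_integral_0_iff_AE)
      then have "AE x in M. epw (f x) (1 - \<theta>) * epw (g x) \<theta> = 0"
        using 3 by (auto elim!: eventually_mono)
      then have "(\<integral>\<^sup>+x. epw (f x) (1 - \<theta>) * epw (g x) \<theta> \<partial>M) = 0"
        by (simp add: nn_integral_0_iff_AE)
      then show ?thesis by simp
    next
      case F: False
      show ?thesis
      proof (cases "?A = top \<or> ?B = top")
        case True
        then have "epw ?A (1 - \<theta>) * epw ?B \<theta> = top"
          using 3 F by (auto simp: ennreal_mult_eq_top_iff epw_eq_0_iff)
        then show ?thesis by simp
      next
        case False
        then obtain a b where ab: "?A = ennreal a" "?B = ennreal b" "0 \<le> a" "0 \<le> b"
          by (metis ennreal_cases)
        then have pos: "a > 0" "b > 0" using F by (auto simp: less_le)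
        have "(\<integral>\<^sup>+x. epw (f x) (1 - \<theta>) * epw (g x) \<theta> \<partial>M) \<le>
          (\<integral>\<^sup>+x. ennreal (a powr (1 - \<theta>) * b powr \<theta>) *
           (ennreal ((1 - \<theta>) / a) * f x + ennreal (\<theta> / b) * g x) \<partial>M)"
          by (intro nn_integral_mono epw_Young 3 pos)
        also have "\<dots> = ennreal (a powr (1 - \<theta>) * b powr \<theta>) *
           (ennreal ((1 - \<theta>) / a) * ennreal a + ennreal (\<theta> / b) * ennreal b)"
          by (simp add: nn_integral_cmult nn_integral_add ab)
        also have "(ennreal ((1 - \<theta>) / a) * ennreal a + ennreal (\<theta> / b) * ennreal b) = 1"
          using pos 3 by (simp flip: ennreal_mult ennreal_plus)
        also have "ennreal (a powr (1 - \<theta>) * b powr \<theta>) * 1 = epw ?A (1 - \<theta>) * epw ?B \<theta>"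
          using ab 3 by (simp add: epw_def ennreal_mult)
        finally show ?thesis .
      qed
    qed
  qed auto
qed

text \<open>Induction peels off one factor of exponent \<open>r\<close> by the two-factor inequality
  and divides the remaining exponents by \<open>1 - r\<close>. The factor \<open>f\<close> absorbs
  whatever makes the exponents sum to \<open>1\<close>, so its exponent may be
  \<open>0\<close>.\<close>

lemma nn_integral_Hoelder_prod:
  assumes "finite s" "f \<in> borel_measurable M" "\<And>j. j \<in> s \<Longrightarrow> g j \<in> borel_measurable M"
    and "0 < r" "real (card s) * r \<le> 1"
  shows "(\<integral>\<^sup>+x. epw (f x) (1 - real (card s) * r) * (\<Prod>j\<in>s. epw (g j x) r) \<partial>M)
     \<le> epw (\<integral>\<^sup>+x. f x \<partial>M) (1 - real (card s) * r) * (\<Prod>j\<in>s. epw (\<integral>\<^sup>+x. g j x \<partial>M) r)"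
  using assms
proof (induction s arbitrary: r rule: finite_induct)
  case empty
  then show ?case by simp
next
  case (insert i s)
  note [measurable] = insert.prems(1)
  have [measurable]: "g j \<in> borel_measurable M" if "j = i \<or> j \<in> s" for j
    using insert.prems that by auto
  have c: "real (card (insert i s)) = real (card s) + 1" using insert by simp
  have le: "real (card s) * r + r \<le> 1" using insert.prems(4) unfolding c by (simp add: algebra_simps)
  show ?case
  proof (cases "r = 1")
    case True
    then have "s = {}" using le insert.hyps by auto
    then show ?thesis using True by simp
  next
    case False
    have "real (card s) * r \<ge> 0" using insert.prems(3) by simp
    then have r1: "r < 1" using le False by linarith
    \<comment> \<open>The rescaled exponent satisfies \<open>r' * (1 - r) = r\<close>. In the case
      \<open>r = 1\<close>, where it would be undefined, only one factor is left.\<close>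
    define r' where "r' = r / (1 - r)"
    have r': "0 < r'" "real (card s) * r' \<le> 1" using r1 insert.prems(3) le
      by (auto simp: r'_def field_simps)
    have e1: "(1 - real (card s) * r') * (1 - r) = 1 - (real (card s) + 1) * r"
      and e2: "r' * (1 - r) = r" using r1 by (auto simp: r'_def field_simps)
    let ?F = "\<lambda>x. epw (f x) (1 - real (card s) * r') * (\<Prod>j\<in>s. epw (g j x) r')"
    have split: "epw (a) (1 - (real (card s) + 1) * r) * (\<Prod>j\<in>insert i s. epw (b j) r)
       = epw (epw a (1 - real (card s) * r') * (\<Prod>j\<in>s. epw (b j) r')) (1 - r) * epw (b i) r" for a b
      using insert r1 r' insert.prems(3)
      by (simp add: epw_mult epw_prod epw_epw e1 e2) (simp add: mult_ac)
    have "(\<integral>\<^sup>+x. epw (f x) (1 - real (card (insert i s)) * r) * (\<Prod>j\<in>insert i s. epw (g j x) r) \<partial>M)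
      = (\<integral>\<^sup>+x. epw (?F x) (1 - r) * epw (g i x) r \<partial>M)"
      unfolding c split by (simp add: fun_eq_iff)
    also have "\<dots> \<le> epw (\<integral>\<^sup>+x. ?F x \<partial>M) (1 - r) * epw (\<integral>\<^sup>+x. g i x \<partial>M) r"
      by (rule nn_integral_Hoelder) (use r1 insert.prems(3) in auto)
    also have "\<dots> \<le> epw (epw (\<integral>\<^sup>+x. f x \<partial>M) (1 - real (card s) * r') * (\<Prod>j\<in>s. epw (\<integral>\<^sup>+x. g j x \<partial>M) r')) (1 - r) * epw (\<integral>\<^sup>+x. g i x \<partial>M) r"
      using r1 by (intro mult_right_mono epw_mono insert.IH r') (auto)
    also have "\<dots> = epw (\<integral>\<^sup>+x. f x \<partial>M) (1 - real (card (insert i s)) * r) * (\<Prod>j\<in>insert i s. epw (\<integral>\<^sup>+x. g j x \<partial>M) r)"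
      unfolding c split ..
    finally show ?thesis .
  qed
qed

subsection \<open>The Gagliardo--Nirenberg inequality\<close>

definition lineint :: "'a::euclidean_space \<Rightarrow> ('a \<Rightarrow> ennreal) \<Rightarrow> 'a \<Rightarrow> ennreal" where
  "lineint b f x = (\<integral>\<^sup>+t. f (x + t *\<^sub>R b) \<partial>lborel)"

text \<open>Integral over the affine flat through \<open>x\<close> spanned by \<open>s\<close>. The
  product measure lets a single coordinate be split off, and for \<open>s = Basis\<close>,
  \<open>x = 0\<close> the Lebesgue integral results.\<close>

definition flatint :: "'a::euclidean_space set \<Rightarrow> ('a \<Rightarrow> ennreal) \<Rightarrow> 'a \<Rightarrow> ennreal" where
  "flatint s f x = (\<integral>\<^sup>+y. f (x + (\<Sum>b\<in>s. y b *\<^sub>R b)) \<partial>PiM s (\<lambda>_. lborel))"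

lemma lineint_measurable [measurable]:
  assumes [measurable]: "f \<in> borel_measurable borel"
  shows "lineint b f \<in> borel_measurable borel"
  unfolding lineint_def by measurable

lemma lineint_commute:
  assumes [measurable]: "f \<in> borel_measurable borel"
  shows "lineint b (lineint c f) = lineint c (lineint b f)"
proof
  fix x
  have "(\<integral>\<^sup>+t. \<integral>\<^sup>+s. f (x + t *\<^sub>R b + s *\<^sub>R c) \<partial>lborel \<partial>lborel)
      = (\<integral>\<^sup>+s. \<integral>\<^sup>+t. f (x + t *\<^sub>R b + s *\<^sub>R c) \<partial>lborel \<partial>lborel)"
    by (rule lborel_pair.Fubini') measurable
  then show "lineint b (lineint c f) x = lineint c (lineint b f) x"
    by (simp add: lineint_def add_ac)
qed

lemma lineint_shift:
  assumes [measurable]: "f \<in> borel_measurable borel"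
  shows "lineint b f (x + s *\<^sub>R b) = lineint b f x"
proof -
  have "lineint b f x = (\<integral>\<^sup>+t. f (x + t *\<^sub>R b) \<partial>distr lborel borel ((+) s))"
    by (simp add: lineint_def lborel_distr_plus)
  also have "\<dots> = (\<integral>\<^sup>+t. f (x + (s + t) *\<^sub>R b) \<partial>lborel)"
    by (subst nn_integral_distr) auto
  finally show ?thesis by (simp add: lineint_def scaleR_add_left add_ac)
qed

lemma flatint_empty [simp]: "flatint {} f x = f x"
  by (simp add: flatint_def PiM_empty nn_integral_count_space_finite)

lemma flatint_insert:
  assumes [measurable]: "f \<in> borel_measurable borel" and s: "finite s" "b \<notin> s"
  shows "flatint (insert b s) f x = flatint s (lineint b f) x"
proof -
  interpret product_sigma_finite "\<lambda>_::'a. lborel :: real measure" ..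
  have "flatint (insert b s) f x =
     (\<integral>\<^sup>+y. \<integral>\<^sup>+t. f (x + (\<Sum>c\<in>insert b s. (y(b := t)) c *\<^sub>R c)) \<partial>lborel \<partial>PiM s (\<lambda>_. lborel))"
    unfolding flatint_def by (rule product_nn_integral_insert[OF s]) measurable
  also have "\<dots> = flatint s (lineint b f) x"
    unfolding flatint_def lineint_def
  proof (intro nn_integral_cong)
    fix y :: "'a \<Rightarrow> real" and t :: real
    have "(\<Sum>c\<in>s. (y(b := t)) c *\<^sub>R c) = (\<Sum>c\<in>s. y c *\<^sub>R c)"
      using s by (intro sum.cong) auto
    then show "f (x + (\<Sum>c\<in>insert b s. (y(b := t)) c *\<^sub>R c)) = f (x + (\<Sum>b\<in>s. y b *\<^sub>R b) + t *\<^sub>R b)"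
      using s by (simp add: add_ac)
  qed
  finally show ?thesis .
qed

lemma flatint_mono: "(\<And>z. f z \<le> g z) \<Longrightarrow> flatint s f x \<le> flatint s g x"
  unfolding flatint_def by (intro nn_integral_mono)

lemma flatint_Basis:
  assumes [measurable]: "f \<in> borel_measurable borel"
  shows "flatint Basis f 0 = (\<integral>\<^sup>+x. f x \<partial>lborel)"
  by (subst lborel_eq) (simp add: flatint_def nn_integral_distr)

text \<open>Each step of the induction integrates one variable out by Hoelder's inequality: the factor
  \<open>lineint b f\<close> does not depend on that variable.\<close>

lemma grid_lines:
  assumes "finite s" "s \<noteq> {}" "f \<in> borel_measurable borel" "0 < r" "(real (card s) - 1) * r \<le> 1"
  shows "flatint s (\<lambda>z. epw (f z) (1 - (real (card s) - 1) * r) * (\<Prod>b\<in>s. epw (lineint b f z) r)) x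
     \<le> epw (flatint s f x) (1 + r)"
  using assms
proof (induction s arbitrary: f rule: finite_ne_induct)
  case (singleton b)
  note [measurable] = singleton.prems(1)
  have "flatint {b} (\<lambda>z. f z * epw (lineint b f z) r) x = lineint b f x * epw (lineint b f x) r"
    by (simp add: flatint_insert, subst lineint_def, simp add: lineint_shift nn_integral_multc)
       (simp add: lineint_def)
  also have "\<dots> = epw (lineint b f x) (1 + r)"
    using singleton.prems by (simp add: epw_add)
  finally show ?case by (simp add: flatint_insert)
next
  case (insert b s)
  note [measurable] = insert.prems(1)
  have c: "real (card (insert b s)) = real (card s) + 1" using insert by simp
  have le: "real (card s) * r \<le> 1" using insert.prems(3) unfolding c by simp
  have le': "(real (card s) - 1) * r \<le> 1" using le insert.prems(2) by (simp add: algebra_simps)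
  let ?G = "\<lambda>z. epw (f z) (1 - (real (card (insert b s)) - 1) * r) * (\<Prod>c\<in>insert b s. epw (lineint c f z) r)"
  have "lineint b ?G z \<le> epw (lineint b f z) (1 - (real (card s) - 1) * r) *
          (\<Prod>c\<in>s. epw (lineint c (lineint b f) z) r)" for z
  proof -
    have "?G (z + t *\<^sub>R b) = epw (lineint b f z) r * (epw (f (z + t *\<^sub>R b)) (1 - real (card s) * r) * (\<Prod>c\<in>s. epw (lineint c f (z + t *\<^sub>R b)) r))" for t
      using insert by (simp add: lineint_shift mult_ac)
    then have "lineint b ?G z = epw (lineint b f z) r *
        (\<integral>\<^sup>+t. epw (f (z + t *\<^sub>R b)) (1 - real (card s) * r) * (\<Prod>c\<in>s. epw (lineint c f (z + t *\<^sub>R b)) r) \<partial>lborel)"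
      unfolding lineint_def[of b ?G] by (simp add: nn_integral_cmult)
    also have "\<dots> \<le> epw (lineint b f z) r * (epw (\<integral>\<^sup>+t. f (z + t *\<^sub>R b) \<partial>lborel) (1 - real (card s) * r) *
       (\<Prod>c\<in>s. epw (\<integral>\<^sup>+t. lineint c f (z + t *\<^sub>R b) \<partial>lborel) r))"
      by (intro mult_left_mono nn_integral_Hoelder_prod) (use insert le in auto)
    also have "\<dots> = epw (lineint b f z) r * epw (lineint b f z) (1 - real (card s) * r) *
       (\<Prod>c\<in>s. epw (lineint b (lineint c f) z) r)"
      by (simp add: lineint_def mult_ac)
    also have "epw (lineint b f z) r * epw (lineint b f z) (1 - real (card s) * r)
       = epw (lineint b f z) (1 - (real (card s) - 1) * r)"
      using le insert.prems(2) by (subst epw_add[symmetric]) (auto simp: algebra_simps)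
    also have "(\<Prod>c\<in>s. epw (lineint b (lineint c f) z) r) = (\<Prod>c\<in>s. epw (lineint c (lineint b f) z) r)"
      by (intro prod.cong refl arg_cong2[where f=epw] fun_cong[OF lineint_commute]) auto
    finally show ?thesis .
  qed
  then have "flatint (insert b s) ?G x \<le> flatint s (\<lambda>z. epw (lineint b f z) (1 - (real (card s) - 1) * r) *
          (\<Prod>c\<in>s. epw (lineint c (lineint b f) z) r)) x"
    using insert by (subst flatint_insert) (auto intro!: flatint_mono)
  also have "\<dots> \<le> epw (flatint s (lineint b f) x) (1 + r)"
    by (rule insert.IH) (use le' insert in auto)
  also have "\<dots> = epw (flatint (insert b s) f x) (1 + r)"
    using insert by (simp add: flatint_insert)
  finally show ?case .
qed

lemma epw_power: "0 \<le> r \<Longrightarrow> epw x r ^ n = epw x (real n * r)"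
  by (induction n) (auto simp: epw_add algebra_simps)

text \<open>The gradient is carried as data, like the weak gradient in \<open>W01p\<close>. The
  functions are total; the compact set \<open>C\<close> inside \<open>U\<close> makes weights that
  are singular off \<open>U\<close> harmless.\<close>

definition C1c :: "'a::euclidean_space set \<Rightarrow> ('a \<Rightarrow> real) \<Rightarrow> ('a \<Rightarrow> 'a) \<Rightarrow> bool" where
  "C1c U f g \<longleftrightarrow> (\<forall>x. (f has_derivative (\<lambda>h. g x \<bullet> h)) (at x)) \<and> continuous_on UNIV g \<and>
     (\<exists>C. compact C \<and> C \<subseteq> U \<and> (\<forall>x. x \<notin> C \<longrightarrow> f x = 0 \<and> g x = 0))"

lemma C1cI:
  assumes "\<And>x. (f has_derivative (\<lambda>h. g x \<bullet> h)) (at x)" "continuous_on UNIV g" "compact C" "C \<subseteq> U"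
    "\<And>x. x \<notin> C \<Longrightarrow> f x = 0" "\<And>x. x \<notin> C \<Longrightarrow> g x = 0"
  shows "C1c U f g"
  using assms unfolding C1c_def by blast

lemma C1c_support:
  assumes "C1c U f g"
  obtains C where "compact C" "C \<subseteq> U" "\<And>x. x \<notin> C \<Longrightarrow> f x = 0" "\<And>x. x \<notin> C \<Longrightarrow> g x = 0"
  using assms unfolding C1c_def by blast

lemma C1c_has_derivative: "C1c U f g \<Longrightarrow> (f has_derivative (\<lambda>h. g x \<bullet> h)) (at x)"
  by (simp add: C1c_def)

lemma C1c_continuous: "C1c U f g \<Longrightarrow> continuous_on UNIV f"
  by (auto simp: C1c_def intro!: continuous_at_imp_continuous_on intro: has_derivative_continuous)

lemma C1c_grad_continuous: "C1c U f g \<Longrightarrow> continuous_on UNIV g"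
  by (simp add: C1c_def)

lemma C1c_measurable:
  assumes "C1c U f g" shows "f \<in> borel_measurable borel" "g \<in> borel_measurable borel"
  using C1c_continuous[OF assms] C1c_grad_continuous[OF assms]
  by (auto intro: borel_measurable_continuous_onI)

lemma C1c_mono: "C1c U f g \<Longrightarrow> U \<subseteq> V \<Longrightarrow> C1c V f g"
  unfolding C1c_def by blast

text \<open>Fundamental theorem of calculus along the line, started at a point beyond the support.
  Enlarging the segment to the whole line makes the bound independent of the position on it.\<close>

lemma C1c_abs_le_lineint:
  fixes f :: "'a::euclidean_space \<Rightarrow> real"
  assumes f: "C1c U f g" and b: "b \<in> Basis"
  shows "ennreal \<bar>f x\<bar> \<le> lineint b (\<lambda>x. ennreal (norm (g x))) x"
proof -
  note [measurable] = C1c_measurable[OF f]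
  obtain C where C: "compact C" "\<And>x. x \<notin> C \<Longrightarrow> f x = 0" using C1c_support[OF f] by metis
  obtain R where R: "\<And>y. y \<in> C \<Longrightarrow> norm y \<le> R" using C(1) compact_imp_bounded bounded_iff by metis
  \<comment> \<open>Far enough along \<open>- b\<close> that the point has larger norm than every
    point of the support.\<close>
  define a where "a = - (\<bar>R\<bar> + norm x + 1)"
  have a: "a \<le> 0" "f (x + a *\<^sub>R b) = 0"
  proof -
    have "norm (x + a *\<^sub>R b) \<ge> norm (a *\<^sub>R b) - norm x"
      by (metis add.commute norm_diff_ineq)
    then have "norm (x + a *\<^sub>R b) > R" using b by (simp add: a_def)
    then show "f (x + a *\<^sub>R b) = 0" using R C(2) by fastforce
  next
    show "a \<le> 0" using norm_ge_zero[of x] unfolding a_def by linarith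
  qed
  let ?G = "\<lambda>t. g (x + t *\<^sub>R b) \<bullet> b"
  have cont: "continuous_on UNIV ?G"
    by (intro continuous_intros continuous_on_compose2[OF C1c_grad_continuous[OF f]]) auto
  have der: "((\<lambda>t. f (x + t *\<^sub>R b)) has_real_derivative ?G t) (at t)" for t
    unfolding has_field_derivative_def
    by (rule has_derivative_eq_rhs, rule has_derivative_compose[OF _ C1c_has_derivative[OF f]])
       (auto intro!: derivative_eq_intros simp: fun_eq_iff)
  have i: "integrable lborel (\<lambda>t. ?G t * indicator {a..0} t)"
    and e: "(\<integral>t. ?G t * indicator {a..0} t \<partial>lborel) = f (x + 0 *\<^sub>R b) - f (x + a *\<^sub>R b)"
    using integral_FTC_Icc_real[OF a(1) der]
      borel_integrable_atLeastAtMost[of a 0 ?G] cont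
    by (auto simp: continuous_on_eq_continuous_at isCont_def)
  have "ennreal \<bar>f x\<bar> = ennreal (norm (\<integral>t. ?G t * indicator {a..0} t \<partial>lborel))"
    using e a by simp
  also have "\<dots> \<le> (\<integral>\<^sup>+t. norm (?G t * indicator {a..0} t) \<partial>lborel)"
    by (rule integral_norm_bound_ennreal[OF i])
  also have "\<dots> \<le> (\<integral>\<^sup>+t. ennreal (norm (g (x + t *\<^sub>R b))) \<partial>lborel)"
    using b by (intro nn_integral_mono ennreal_leI)
      (auto simp: indicator_def abs_mult intro: order_trans[OF Basis_le_norm])
  finally show ?thesis by (simp add: lineint_def)
qed

text \<open>The \<open>N\<close> one-dimensional bounds, each raised to
  \<open>r = 1 / (N - 1)\<close>, are multiplied. Since \<open>(N - 1) * r = 1\<close>, the factor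
  \<open>f\<close> in \<open>grid_lines\<close> gets exponent \<open>0\<close> and only the product
  of line integrals remains.\<close>

lemma Gagliardo_Nirenberg:
  fixes f :: "'a::euclidean_space \<Rightarrow> real"
  assumes f: "C1c U f g" and N: "DIM('a) \<ge> 2"
  shows "(\<integral>\<^sup>+x. ennreal (\<bar>f x\<bar> powr (real DIM('a) / (real DIM('a) - 1))) \<partial>lborel)
     \<le> epw (\<integral>\<^sup>+x. ennreal (norm (g x)) \<partial>lborel) (real DIM('a) / (real DIM('a) - 1))"
proof -
  note [measurable] = C1c_measurable[OF f]
  let ?N = "real DIM('a)"
  define r where "r = 1 / (?N - 1)"
  have r: "r > 0" "(?N - 1) * r = 1" "?N / (?N - 1) = ?N * r" "?N * r = 1 + r" 
    using N by (auto simp: r_def field_simps)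
  let ?h = "\<lambda>x. ennreal (norm (g x))"
  have "ennreal (\<bar>f x\<bar> powr (?N * r)) \<le> (\<Prod>b\<in>Basis. epw (lineint b ?h x) r)" for x
  proof -
    have "ennreal (\<bar>f x\<bar> powr (?N * r)) = epw (ennreal \<bar>f x\<bar>) (?N * r)"
      using r by (intro epw_ennreal[symmetric]) auto
    also have "\<dots> = (\<Prod>b\<in>(Basis::'a set). epw (ennreal \<bar>f x\<bar>) r)"
      using r by (simp add: epw_power)
    also have "\<dots> \<le> (\<Prod>b\<in>Basis. epw (lineint b ?h x) r)"
      by (intro prod_mono_ennreal epw_mono C1c_abs_le_lineint[OF f]) (use r in auto)
    finally show ?thesis .
  qed
  then have "(\<integral>\<^sup>+x. ennreal (\<bar>f x\<bar> powr (?N * r)) \<partial>lborel) \<le>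
     (\<integral>\<^sup>+x. epw (?h x) (1 - (real (card (Basis::'a set)) - 1) * r) * (\<Prod>b\<in>Basis. epw (lineint b ?h x) r) \<partial>lborel)"
    using r by (intro nn_integral_mono) simp
  also have "\<dots> = flatint Basis (\<lambda>x. epw (?h x) (1 - (real (card (Basis::'a set)) - 1) * r) * (\<Prod>b\<in>Basis. epw (lineint b ?h x) r)) 0"
    by (subst flatint_Basis) auto
  also have "\<dots> \<le> epw (flatint Basis ?h 0) (1 + r)"
    by (rule grid_lines) (use r in auto)
  also have "flatint Basis ?h 0 = (\<integral>\<^sup>+x. ?h x \<partial>lborel)"
    by (rule flatint_Basis) auto
  finally show ?thesis using r by simp
qed

subsection \<open>Calculus of compactly supported functions\<close>

text \<open>The third hypothesis forces \<open>F\<close> to vanish off the compact support, so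
  continuity on \<open>U\<close> alone is enough. This is the source of integrability for the
  singular weighted integrals below.\<close>

lemma C1c_integrable:
  fixes F :: "'a::euclidean_space \<Rightarrow> 'b::{banach, second_countable_topology}"
  assumes f: "C1c U f g" and F: "continuous_on U F" and 0: "\<And>x. f x = 0 \<Longrightarrow> g x = 0 \<Longrightarrow> F x = 0"
  shows "integrable lborel F"
proof -
  obtain C where C: "compact C" "C \<subseteq> U" "\<And>x. x \<notin> C \<Longrightarrow> f x = 0" "\<And>x. x \<notin> C \<Longrightarrow> g x = 0"
    using C1c_support[OF f] by metis
  have "integrable lborel (\<lambda>x. indicator C x *\<^sub>R F x)"
    by (rule borel_integrable_compact) (use C F in \<open>auto intro: continuous_on_subset\<close>)
  also have "(\<lambda>x. indicator C x *\<^sub>R F x) = F"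
    using C 0 by (auto simp: indicator_def fun_eq_iff)
  finally show ?thesis .
qed

lemma C1c_bounded:
  fixes F :: "'a::euclidean_space \<Rightarrow> 'b::real_normed_vector"
  assumes f: "C1c U f g" and F: "continuous_on U F" and 0: "\<And>x. f x = 0 \<Longrightarrow> g x = 0 \<Longrightarrow> F x = 0"
  obtains B where "\<And>x. norm (F x) \<le> B"
proof -
  obtain C where C: "compact C" "C \<subseteq> U" "\<And>x. x \<notin> C \<Longrightarrow> f x = 0" "\<And>x. x \<notin> C \<Longrightarrow> g x = 0"
    using C1c_support[OF f] by metis
  have "bounded (F ` C)"
    using compact_continuous_image[OF continuous_on_subset[OF F C(2)] C(1)] by (rule compact_imp_bounded)
  then obtain B where B: "\<And>x. x \<in> C \<Longrightarrow> norm (F x) \<le> B" by (auto simp: bounded_iff)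
  have "norm (F x) \<le> max 0 B" for x
    using B[of x] C(3,4)[of x] 0[of x] by (cases "x \<in> C") fastforce+
  then show ?thesis by (rule that)
qed

text \<open>Outside \<open>U\<close> the factor \<open>h\<close> may be singular, but the complement
  of the support is open, the product is zero there, and \<open>U\<close> together with that
  complement covers the space.\<close>

lemma C1c_mult:
  assumes f: "C1c U f g" and U: "open U"
    and h: "\<And>x. x \<in> U \<Longrightarrow> (h has_derivative (\<lambda>v. k x \<bullet> v)) (at x)" "continuous_on U k"
  shows "C1c U (\<lambda>x. f x * h x) (\<lambda>x. h x *\<^sub>R g x + f x *\<^sub>R k x)"
proof -
  obtain C where C: "compact C" "C \<subseteq> U" "\<And>x. x \<notin> C \<Longrightarrow> f x = 0" "\<And>x. x \<notin> C \<Longrightarrow> g x = 0"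
    using C1c_support[OF f] by metis
  have open_C: "open (- C)" using C(1) compact_imp_closed by auto
  have cont_h: "continuous_on U h"
    using h(1) by (meson continuous_at_imp_continuous_on has_derivative_continuous)
  have "((\<lambda>x. f x * h x) has_derivative (\<lambda>v. (h x *\<^sub>R g x + f x *\<^sub>R k x) \<bullet> v)) (at x)" for x
  proof (cases "x \<in> U")
    case True
    show ?thesis
      by (rule has_derivative_eq_rhs[OF has_derivative_mult[OF C1c_has_derivative[OF f] h(1)[OF True]]])
         (simp add: fun_eq_iff inner_add_left algebra_simps)
  next
    case False
    then have "x \<in> - C" using C by auto
    have "((\<lambda>x. 0) has_derivative (\<lambda>v. 0)) (at x)" by simp
    then have "((\<lambda>x. f x * h x) has_derivative (\<lambda>v. 0)) (at x)"
      by (rule has_derivative_transform_within_open[OF _ open_C \<open>x \<in> - C\<close>]) (use C in auto)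
    then show ?thesis using C \<open>x \<in> - C\<close> by simp
  qed
  moreover have "continuous_on (U \<union> - C) (\<lambda>x. h x *\<^sub>R g x + f x *\<^sub>R k x)"
  proof (rule continuous_on_open_Un[OF U open_C])
    show "continuous_on U (\<lambda>x. h x *\<^sub>R g x + f x *\<^sub>R k x)"
      by (intro continuous_intros h cont_h continuous_on_subset[OF C1c_continuous[OF f]]
            continuous_on_subset[OF C1c_grad_continuous[OF f]]) auto
    show "continuous_on (- C) (\<lambda>x. h x *\<^sub>R g x + f x *\<^sub>R k x)"
      by (subst continuous_on_cong[OF refl, where g = "\<lambda>_. 0"]) (use C in auto)
  qed
  moreover have "U \<union> - C = UNIV" using C by auto
  ultimately show ?thesis
    using C by (intro C1cI[of _ _ C]) auto
qed

lemma C1c_compose: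
  assumes f: "C1c U f g" and psi: "\<And>s. (\<psi> has_real_derivative \<psi>' s) (at s)"
    and psi': "continuous_on UNIV \<psi>'" and 0: "\<psi> 0 = 0"
  shows "C1c U (\<lambda>x. \<psi> (f x)) (\<lambda>x. \<psi>' (f x) *\<^sub>R g x)"
proof -
  obtain C where C: "compact C" "C \<subseteq> U" "\<And>x. x \<notin> C \<Longrightarrow> f x = 0" "\<And>x. x \<notin> C \<Longrightarrow> g x = 0"
    using C1c_support[OF f] by metis
  have "((\<lambda>x. \<psi> (f x)) has_derivative (\<lambda>v. (\<psi>' (f x) *\<^sub>R g x) \<bullet> v)) (at x)" for x
    by (rule has_derivative_eq_rhs[OF has_derivative_compose[OF C1c_has_derivative[OF f]
          psi[of "f x", unfolded has_field_derivative_def]]]) (simp add: fun_eq_iff)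
  moreover have "continuous_on UNIV (\<lambda>x. \<psi>' (f x) *\<^sub>R g x)"
    by (intro continuous_intros C1c_grad_continuous[OF f] continuous_on_compose2[OF psi' C1c_continuous[OF f]]) auto
  ultimately show ?thesis
    using C 0 by (intro C1cI[of _ _ C]) auto
qed

lemma continuous_on_abs_powr_sgn:
  fixes r :: real
  assumes r: "r > 0" shows "continuous_on UNIV (\<lambda>s::real. \<bar>s\<bar> powr r * sgn s)"
proof -
  have eq: "(\<lambda>s::real. \<bar>s\<bar> powr r * sgn s) = (\<lambda>s. max 0 s powr r - max 0 (- s) powr r)"
    using r by (auto simp: fun_eq_iff sgn_if max_def)
  show ?thesis unfolding eq
    using r by (intro continuous_intros continuous_on_powr' continuous_on_max) auto
qed

text \<open>Away from \<open>0\<close> this is the chain rule; at \<open>0\<close> the difference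
  quotient is \<open>\<bar>h\<bar> powr (p - 1) * sgn h\<close>, which tends to \<open>0\<close>
  because \<open>p > 1\<close>.\<close>

lemma has_real_derivative_abs_powr:
  fixes s p :: real
  assumes p: "p > 1"
  shows "((\<lambda>s. \<bar>s\<bar> powr p) has_real_derivative p * (\<bar>s\<bar> powr (p - 1) * sgn s)) (at s)"
proof -
  consider "s > 0" | "s < 0" | "s = 0" by linarith
  then show ?thesis
  proof cases
    case 1
    have "((\<lambda>s. s powr p) has_real_derivative p * s powr (p - 1)) (at s)"
      using 1 by (auto intro!: derivative_eq_intros)
    then have "((\<lambda>s. \<bar>s\<bar> powr p) has_real_derivative p * s powr (p - 1)) (at s)"
      by (rule has_field_derivative_transform_within_open[where S = "{0<..}"]) (use 1 in auto)
    then show ?thesis using 1 by simp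
  next
    case 2
    have "((\<lambda>s. (-s) powr p) has_real_derivative - (p * (-s) powr (p - 1))) (at s)"
      using 2 by (auto intro!: derivative_eq_intros)
    then have "((\<lambda>s. \<bar>s\<bar> powr p) has_real_derivative - (p * (-s) powr (p - 1))) (at s)"
      by (rule has_field_derivative_transform_within_open[where S = "{..<0}"]) (use 2 in auto)
    then show ?thesis using 2 by simp
  next
    case 3
    have "isCont (\<lambda>s::real. \<bar>s\<bar> powr (p - 1) * sgn s) 0"
      using continuous_on_abs_powr_sgn[of "p - 1"] p by (auto simp: continuous_on_eq_continuous_at)
    then have "((\<lambda>h::real. \<bar>h\<bar> powr (p - 1) * sgn h) \<longlongrightarrow> 0) (at 0)"
      by (simp add: isCont_def)
    moreover have "\<bar>h\<bar> powr (p - 1) * sgn h = (\<bar>0 + h\<bar> powr p - \<bar>0\<bar> powr p) / h" if "h \<noteq> 0" for h :: real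
      using that p by (auto simp: powr_diff sgn_if)
    then have "eventually (\<lambda>h. \<bar>h\<bar> powr (p - 1) * sgn h = (\<bar>0 + h\<bar> powr p - \<bar>0\<bar> powr p) / h) (at 0)"
      by (auto simp: eventually_at_filter)
    ultimately have "((\<lambda>h::real. (\<bar>0 + h\<bar> powr p - \<bar>0\<bar> powr p) / h) \<longlongrightarrow> 0) (at 0)"
      by (rule Lim_transform_eventually)
    then show ?thesis using 3 p by (simp add: DERIV_def)
  qed
qed

text \<open>Translation invariance makes the integral of \<open>f (x + b) - f x\<close> zero. This
  difference is the integral of \<open>g (x + t b) \<bullet> b\<close> over \<open>t\<close> in
  \<open>[0, 1]\<close>, and after Fubini every inner integral over \<open>x\<close> equals the one
  in question.\<close>

lemma integral_grad_eq_0: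
  fixes f :: "'a::euclidean_space \<Rightarrow> real"
  assumes f: "C1c U f g"
  shows "(\<integral>x. g x \<bullet> b \<partial>lborel) = 0"
proof -
  note [measurable] = C1c_measurable[OF f]
  have f_cont: "continuous_on A f" and g_cont: "continuous_on A g" for A
    using C1c_continuous[OF f] C1c_grad_continuous[OF f] by (auto intro: continuous_on_subset)
  obtain C where C: "compact C" "C \<subseteq> U" "\<And>x. x \<notin> C \<Longrightarrow> f x = 0" "\<And>x. x \<notin> C \<Longrightarrow> g x = 0"
    using C1c_support[OF f] by metis
  let ?I = "\<integral>x. g x \<bullet> b \<partial>lborel"
  let ?F = "\<lambda>x t. indicator {0..1::real} t * (g (x + t *\<^sub>R b) \<bullet> b)"
  \<comment> \<open>The compact set of pairs \<open>(x, t)\<close> with \<open>x + t b\<close> in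
    the support and \<open>t\<close> in \<open>[0, 1]\<close>; outside it the integrand of the
    double integral vanishes.\<close>
  let ?K = "(\<lambda>z. (fst z - snd z *\<^sub>R b, snd z)) ` (C \<times> {0..1::real})"
  have "compact ?K"
    by (intro compact_continuous_image compact_Times C compact_Icc continuous_intros)
  then have "integrable lborel (\<lambda>z. indicator ?K z *\<^sub>R (g (fst z + snd z *\<^sub>R b) \<bullet> b))"
    by (rule borel_integrable_compact)
       (intro continuous_intros continuous_on_compose2[OF g_cont[of UNIV]], auto)
  also have "(\<lambda>z. indicator ?K z *\<^sub>R (g (fst z + snd z *\<^sub>R b) \<bullet> b)) = case_prod ?F"
  proof (intro ext, clarify)
    fix x t
    have "(x, t) \<in> ?K \<longleftrightarrow> x + t *\<^sub>R b \<in> C \<and> t \<in> {0..1}"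
      by (force simp: image_iff)
    then show "indicator ?K (x, t) *\<^sub>R (g (fst (x, t) + snd (x, t) *\<^sub>R b) \<bullet> b) = ?F x t"
      using C(4)[of "x + t *\<^sub>R b"] by (auto simp: indicator_def)
  qed
  finally have int: "integrable (lborel \<Otimes>\<^sub>M lborel) (case_prod ?F)"
    by (simp add: lborel_prod)
  have shift: "(\<integral>x. h (x + c) \<partial>lborel) = (\<integral>x. h x \<partial>lborel)" if "h \<in> borel_measurable borel" for h :: "'a \<Rightarrow> real" and c
  proof -
    have "(\<integral>x. h x \<partial>lborel) = (\<integral>x. h x \<partial>distr lborel borel ((+) c))" by (simp add: lborel_distr_plus)
    also have "\<dots> = (\<integral>x. h (c + x) \<partial>lborel)" using that by (subst integral_distr) auto
    finally show ?thesis by (simp add: add.commute)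
  qed
  have int_f: "integrable lborel f" by (rule C1c_integrable[OF f f_cont])
  have "(\<integral>x. ?F x t \<partial>lborel) = indicator {0..1} t * ?I" for t
    using shift[of "\<lambda>x. g x \<bullet> b" "t *\<^sub>R b"] by simp
  then have "(\<integral>t. (\<integral>x. ?F x t \<partial>lborel) \<partial>lborel) = (\<integral>t. indicator {0..1::real} t * ?I \<partial>lborel)"
    by (simp only:)
  also have "\<dots> = ?I" by simp
  finally have 1: "(\<integral>t. (\<integral>x. ?F x t \<partial>lborel) \<partial>lborel) = ?I" .
  have "(\<integral>t. ?F x t \<partial>lborel) = f (x + b) - f x" for x
  proof -
    let ?G = "\<lambda>t. g (x + t *\<^sub>R b) \<bullet> b"
    have cont: "continuous_on UNIV ?G"
      by (intro continuous_intros continuous_on_compose2[OF g_cont[of UNIV]]) auto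
    have der: "((\<lambda>t. f (x + t *\<^sub>R b)) has_real_derivative ?G t) (at t)" for t
      unfolding has_field_derivative_def
      by (rule has_derivative_eq_rhs, rule has_derivative_compose[OF _ C1c_has_derivative[OF f]])
         (auto intro!: derivative_eq_intros simp: fun_eq_iff)
    have "(\<integral>t. ?G t * indicator {0..1} t \<partial>lborel) = f (x + 1 *\<^sub>R b) - f (x + 0 *\<^sub>R b)"
      using integral_FTC_Icc_real[OF _ der, of 0 1] cont
      by (auto simp: continuous_on_eq_continuous_at isCont_def)
    then show ?thesis by (simp add: mult.commute)
  qed
  then have "(\<integral>x. (\<integral>t. ?F x t \<partial>lborel) \<partial>lborel) = (\<integral>x. f (x + b) - f x \<partial>lborel)" by simp
  also have "\<dots> = (\<integral>x. f (x + b) \<partial>lborel) - (\<integral>x. f x \<partial>lborel)"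
  proof (rule Bochner_Integration.integral_diff[OF _ int_f])
    have "integrable (distr lborel borel ((+) b)) f" using int_f by (simp add: lborel_distr_plus)
    then show "integrable lborel (\<lambda>x. f (x + b))"
      by (subst (asm) integrable_distr_eq) (auto simp: add.commute)
  qed
  also have "\<dots> = 0" by (simp add: shift)
  finally have 2: "(\<integral>x. (\<integral>t. ?F x t \<partial>lborel) \<partial>lborel) = 0" .
  show ?thesis using lborel_pair.Fubini_integral[OF int] 1 2 by simp
qed

subsection \<open>The distance to a coordinate subspace\<close>

text \<open>The singular set is the orthogonal complement of the span of \<open>S\<close>, so
  \<open>card S\<close> is its codimension. Taking \<open>S = Basis\<close> gives the
  origin.\<close>

locale coordinate_plane =
  fixes S :: "'a::euclidean_space set"
  assumes S_Basis: "S \<subseteq> Basis"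
begin

definition y :: "'a \<Rightarrow> 'a" where "y x = (\<Sum>b\<in>S. (x \<bullet> b) *\<^sub>R b)"

definition dst :: "'a \<Rightarrow> real" where "dst x = norm (y x)"

definition U :: "'a set" where "U = {x. y x \<noteq> 0}"

lemma finite_S: "finite S"
  using S_Basis finite_Basis by (rule finite_subset)

lemma bounded_linear_y: "bounded_linear y"
  unfolding y_def by (intro bounded_linear_sum bounded_linear_intros)

lemma continuous_on_y [continuous_intros]: "continuous_on A y"
  using bounded_linear_y by (simp add: linear_continuous_on)

lemma continuous_on_dst [continuous_intros]: "continuous_on A dst"
  unfolding dst_def by (intro continuous_intros)

lemma dst_measurable [measurable]: "dst \<in> borel_measurable borel" "y \<in> borel_measurable borel"
  by (auto intro!: borel_measurable_continuous_onI continuous_intros)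

lemma open_U: "open U"
proof -
  have "U = y -` (- {0})" by (auto simp: U_def)
  moreover have "open (y -` (- {0}))" by (rule open_vimage) (auto simp: continuous_on_y)
  ultimately show ?thesis by simp
qed

lemma y_inner_Basis: "b \<in> S \<Longrightarrow> y x \<bullet> b = x \<bullet> b"
  unfolding y_def inner_sum_left using S_Basis finite_S
  by (subst sum.cong[OF refl, where h = "\<lambda>c. if c = b then x \<bullet> b else 0"])
     (auto simp: inner_Basis subset_iff)

lemma y_inner: "y x \<bullet> v = (\<Sum>b\<in>S. (x \<bullet> b) * (v \<bullet> b))"
  unfolding y_def inner_sum_left inner_scaleR_left by (intro sum.cong refl) (simp add: inner_commute)

lemma y_inner_y: "y x \<bullet> y v = y x \<bullet> v"
  unfolding y_inner[of x "y v"] y_inner[of x v] by (intro sum.cong refl) (simp add: y_inner_Basis)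

lemma dst_power2: "(dst x)\<^sup>2 = (\<Sum>b\<in>S. (x \<bullet> b)\<^sup>2)"
  unfolding dst_def power2_norm_eq_inner y_inner_y by (simp add: y_inner power2_eq_square)

lemma dst_pos: "x \<in> U \<Longrightarrow> dst x > 0"
  by (simp add: U_def dst_def)

lemma dst_ge_0: "dst x \<ge> 0"
  by (simp add: dst_def)

lemma U_eq: "U = {x. dst x \<noteq> 0}" by (simp add: U_def dst_def)

lemma has_derivative_radial:
  assumes x: "x \<in> U" and \<rho>: "(\<rho> has_real_derivative \<rho>') (at (dst x))"
  shows "((\<lambda>x. \<rho> (dst x)) has_derivative (\<lambda>v. (\<rho>' / dst x) *\<^sub>R y x \<bullet> v)) (at x)"
proof -
  have "(dst has_derivative (\<lambda>v. sgn (y x) \<bullet> y v)) (at x)"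
    unfolding dst_def using x
    by (intro has_derivative_eq_rhs[OF has_derivative_compose[OF bounded_linear_imp_has_derivative[OF bounded_linear_y] has_derivative_norm]])
       (auto simp: U_def inner_commute)
  then have "((\<lambda>x. \<rho> (dst x)) has_derivative (\<lambda>v. \<rho>' * (sgn (y x) \<bullet> y v))) (at x)"
    using \<rho>[unfolded has_field_derivative_def] by (rule has_derivative_compose)
  moreover have "\<rho>' * (sgn (y x) \<bullet> y v) = (\<rho>' / dst x) *\<^sub>R y x \<bullet> v" for v
    by (simp add: sgn_div_norm dst_def y_inner_y divide_inverse)
  ultimately show ?thesis by simp
qed

lemma has_derivative_dst_powr:
  assumes x: "x \<in> U"
  shows "((\<lambda>x. dst x powr \<beta>) has_derivative (\<lambda>v. (\<beta> * dst x powr (\<beta> - 2)) *\<^sub>R y x \<bullet> v)) (at x)"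
proof -
  have 1: "((\<lambda>s. s powr \<beta>) has_real_derivative \<beta> * dst x powr (\<beta> - 1)) (at (dst x))"
    using dst_pos[OF x] by (auto intro!: derivative_eq_intros)
  have 2: "\<beta> * dst x powr (\<beta> - 1) / dst x = \<beta> * dst x powr (\<beta> - 2)"
    using powr_diff[of "dst x" "\<beta> - 1" 1] dst_pos[OF x] by simp
  show ?thesis using has_derivative_radial[OF x 1] unfolding 2 .
qed

lemma continuous_on_dst_powr [continuous_intros]: "continuous_on U (\<lambda>x. dst x powr \<beta>)"
  by (intro continuous_on_powr' continuous_intros) (auto dest: dst_pos simp: dst_ge_0)

text \<open>The divergence theorem for the field \<open>G \<bar>y\<bar>\<^sup>\<beta> y\<close>.\<close>

lemma integral_div_radial:
  assumes G: "C1c U G g"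
  shows "(\<integral>x. (real (card S) + \<beta>) * dst x powr \<beta> * G x + dst x powr \<beta> * (y x \<bullet> g x) \<partial>lborel) = 0"
proof -
  let ?h = "\<lambda>b x. (x \<bullet> b) * dst x powr \<beta>"
  let ?k = "\<lambda>b x. dst x powr \<beta> *\<^sub>R b + ((x \<bullet> b) * (\<beta> * dst x powr (\<beta> - 2))) *\<^sub>R y x"
  let ?g = "\<lambda>b x. ?h b x *\<^sub>R g x + G x *\<^sub>R ?k b x"
  have C: "C1c U (\<lambda>x. G x * ?h b x) (?g b)" for b
  proof (rule C1c_mult[OF G open_U])
    fix x assume x: "x \<in> U"
    have "((\<lambda>x. x \<bullet> b) has_derivative (\<lambda>v. v \<bullet> b)) (at x)"
      by (auto intro!: derivative_eq_intros)
    from has_derivative_mult[OF this has_derivative_dst_powr[OF x]]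
    show "(?h b has_derivative (\<lambda>v. ?k b x \<bullet> v)) (at x)"
      by (rule has_derivative_eq_rhs) (simp add: fun_eq_iff inner_add_left inner_commute algebra_simps)
  next
    show "continuous_on U (?k b)" by (intro continuous_intros)
  qed
  have int: "integrable lborel (\<lambda>x. ?g b x \<bullet> b)" for b
    by (rule C1c_integrable[OF C]) (auto intro!: continuous_intros continuous_on_subset[OF C1c_grad_continuous[OF G]]
        continuous_on_subset[OF C1c_continuous[OF G]])
  have "0 = (\<Sum>b\<in>S. \<integral>x. ?g b x \<bullet> b \<partial>lborel)"
    by (simp only: integral_grad_eq_0[OF C]) simp
  also have "\<dots> = (\<integral>x. (\<Sum>b\<in>S. ?g b x \<bullet> b) \<partial>lborel)"
    by (rule Bochner_Integration.integral_sum[symmetric]) (rule int)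
  also have "\<dots> = (\<integral>x. (real (card S) + \<beta>) * dst x powr \<beta> * G x + dst x powr \<beta> * (y x \<bullet> g x) \<partial>lborel)"
  proof (intro Bochner_Integration.integral_cong refl)
    fix x
    have "?g b x \<bullet> b = dst x powr \<beta> * ((x \<bullet> b) * (g x \<bullet> b)) + G x * dst x powr \<beta>
             + (G x * \<beta> * dst x powr (\<beta> - 2)) * (x \<bullet> b)\<^sup>2" if "b \<in> S" for b
      using that S_Basis by (auto simp: inner_add_left y_inner_Basis power2_eq_square algebra_simps)
    then have "(\<Sum>b\<in>S. ?g b x \<bullet> b) = (\<Sum>b\<in>S. dst x powr \<beta> * ((x \<bullet> b) * (g x \<bullet> b)) + G x * dst x powr \<beta>
             + (G x * \<beta> * dst x powr (\<beta> - 2)) * (x \<bullet> b)\<^sup>2)" by (rule sum.cong[OF refl])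
    also have "\<dots> = dst x powr \<beta> * (y x \<bullet> g x) + real (card S) * (G x * dst x powr \<beta>)
             + (G x * \<beta> * dst x powr (\<beta> - 2)) * (dst x)\<^sup>2"
      by (simp add: sum.distrib sum_distrib_left dst_power2 y_inner)
    also have "dst x powr (\<beta> - 2) * (dst x)\<^sup>2 = dst x powr \<beta>" if "dst x \<noteq> 0"
      using that dst_ge_0[of x] by (simp add: powr_diff flip: powr_numeral)
    then have "(G x * \<beta> * dst x powr (\<beta> - 2)) * (dst x)\<^sup>2 = G x * \<beta> * dst x powr \<beta>"
      by (cases "dst x = 0") (auto simp: mult.assoc)
    finally show "(\<Sum>b\<in>S. ?g b x \<bullet> b) = (real (card S) + \<beta>) * dst x powr \<beta> * G x + dst x powr \<beta> * (y x \<bullet> g x)"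
      by (simp add: algebra_simps)
  qed
  finally show ?thesis by simp
qed

end

lemma integral_Hoelder:
  fixes f g :: "'a \<Rightarrow> real"
  assumes f: "integrable M f" "\<And>x. 0 \<le> f x" and g: "integrable M g" "\<And>x. 0 \<le> g x"
    and th: "0 \<le> \<theta>" "\<theta> \<le> 1"
  shows "(\<integral>x. f x powr (1 - \<theta>) * g x powr \<theta> \<partial>M) \<le> (\<integral>x. f x \<partial>M) powr (1 - \<theta>) * (\<integral>x. g x \<partial>M) powr \<theta>"
proof -
  note [measurable] = borel_measurable_integrable[OF f(1)] borel_measurable_integrable[OF g(1)]
  let ?A = "\<integral>x. f x \<partial>M" and ?B = "\<integral>x. g x \<partial>M"
  have pos: "?A \<ge> 0" "?B \<ge> 0" using f g by auto
  show ?thesis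
  proof (cases "?A = 0 \<or> ?B = 0")
    case True
    then have "(AE x in M. f x = 0) \<or> (AE x in M. g x = 0)"
      using integral_nonneg_eq_0_iff_AE[OF f(1)] integral_nonneg_eq_0_iff_AE[OF g(1)] f g by auto
    then have "AE x in M. f x powr (1 - \<theta>) * g x powr \<theta> = 0" by (auto elim!: eventually_mono)
    then have "(\<integral>x. f x powr (1 - \<theta>) * g x powr \<theta> \<partial>M) = 0" by (rule integral_eq_zero_AE)
    then show ?thesis by simp
  next
    case False
    then have AB: "?A > 0" "?B > 0" using pos by auto
    \<comment> \<open>Only an inequality: for base \<open>0\<close> and exponent \<open>0\<close>
      the real power is \<open>0\<close> but \<open>epw\<close> is \<open>1\<close>.\<close>
    have le: "ennreal (a powr r) \<le> epw (ennreal a) r" if "a \<ge> 0" for a r :: real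
      using that by (auto simp: epw_def)
    have eq: "epw (ennreal a) r = ennreal (a powr r)" if "a > 0" for a r :: real
      using that by (auto simp: epw_def)
    have "(\<integral>\<^sup>+x. ennreal (f x powr (1 - \<theta>) * g x powr \<theta>) \<partial>M) \<le> (\<integral>\<^sup>+x. epw (ennreal (f x)) (1 - \<theta>) * epw (ennreal (g x)) \<theta> \<partial>M)"
      using f g by (intro nn_integral_mono) (auto simp: ennreal_mult intro!: mult_mono le)
    also have "\<dots> \<le> epw (\<integral>\<^sup>+x. ennreal (f x) \<partial>M) (1 - \<theta>) * epw (\<integral>\<^sup>+x. ennreal (g x) \<partial>M) \<theta>"
      by (rule nn_integral_Hoelder) (use th in auto)
    also have "\<dots> = epw (ennreal ?A) (1 - \<theta>) * epw (ennreal ?B) \<theta>"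
      using f g by (simp add: nn_integral_eq_integral)
    also have "\<dots> = ennreal (?A powr (1 - \<theta>) * ?B powr \<theta>)"
      by (simp add: eq AB ennreal_mult)
    finally have "(\<integral>\<^sup>+x. ennreal (f x powr (1 - \<theta>) * g x powr \<theta>) \<partial>M) \<le> ennreal (?A powr (1 - \<theta>) * ?B powr \<theta>)" .
    moreover have "(\<integral>x. f x powr (1 - \<theta>) * g x powr \<theta> \<partial>M) = enn2real (\<integral>\<^sup>+x. ennreal (f x powr (1 - \<theta>) * g x powr \<theta>) \<partial>M)"
      by (rule integral_eq_nn_integral) auto
    ultimately show ?thesis
      by (metis enn2real_leI mult_nonneg_nonneg powr_ge_zero)
  qed
qed

subsection \<open>A weighted Sobolev inequality\<close>

context coordinate_plane
begin

text \<open>With \<open>v = \<bar>y\<bar>\<^sup>h u\<close> one has \<open>tgrad h u \<nabla>u = \<bar>y\<bar>\<^sup>-\<^sup>h \<nabla>v\<close>.\<close>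

definition tgrad :: "real \<Rightarrow> ('a \<Rightarrow> real) \<Rightarrow> ('a \<Rightarrow> 'a) \<Rightarrow> 'a \<Rightarrow> 'a" where
  "tgrad h u g x = g x + (h * u x / (dst x)\<^sup>2) *\<^sub>R y x"

lemma C1c_continuous_on:
  assumes "C1c V u g" shows "continuous_on A u" "continuous_on A g"
  using C1c_continuous[OF assms] C1c_grad_continuous[OF assms] by (auto intro: continuous_on_subset)

lemma C1c_zero_outside: "C1c V u g \<Longrightarrow> x \<notin> V \<Longrightarrow> u x = 0 \<and> g x = 0"
  using C1c_support by (metis subsetD)

lemma continuous_on_tgrad: "C1c U u g \<Longrightarrow> continuous_on U (tgrad h u g)"
  unfolding tgrad_def[abs_def] by (intro continuous_intros C1c_continuous_on) (auto simp: U_eq)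

lemma y_inner_tgrad:
  assumes "C1c U u g" shows "y x \<bullet> g x = y x \<bullet> tgrad h u g x - h * u x"
proof (cases "x \<in> U")
  case True
  then show ?thesis using dst_pos[OF True]
    by (simp add: tgrad_def inner_add_right power2_norm_eq_inner[symmetric] dst_def)
qed (use C1c_zero_outside[OF assms] in \<open>auto simp: tgrad_def\<close>)

text \<open>The divergence theorem for \<open>\<bar>u\<bar> powr \<sigma>\<close> and the exponent
  \<open>m - 1\<close>. Expressing \<open>g\<close> through \<open>tgrad\<close> shifts the
  coefficient \<open>card S - 1 + m\<close> by \<open>- \<sigma> * h\<close>, and this is how the
  choice of \<open>h\<close> can make the constant vanish.\<close>

lemma weighted_Hardy_L1:
  assumes u: "C1c U u g" and \<sigma>: "\<sigma> > 1"
  shows "\<bar>real (card S) - 1 + m - \<sigma> * h\<bar> * (\<integral>x. \<bar>u x\<bar> powr \<sigma> * dst x powr (m - 1) \<partial>lborel)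
    \<le> \<sigma> * (\<integral>x. \<bar>u x\<bar> powr (\<sigma> - 1) * dst x powr m * norm (tgrad h u g x) \<partial>lborel)"
proof -
  let ?\<kappa> = "real (card S) - 1 + m - \<sigma> * h"
  let ?I = "\<lambda>x. \<bar>u x\<bar> powr \<sigma> * dst x powr (m - 1)"
  let ?P = "\<lambda>x. \<bar>u x\<bar> powr (\<sigma> - 1) * sgn (u x)"
  let ?R = "\<lambda>x. \<sigma> * ?P x * dst x powr (m - 1) * (y x \<bullet> tgrad h u g x)"
  have cP: "continuous_on A ?P" for A
    using continuous_on_compose2[OF continuous_on_abs_powr_sgn[of "\<sigma> - 1"] C1c_continuous_on(1)[OF u, of A]] \<sigma> by auto
  have G: "C1c U (\<lambda>x. \<bar>u x\<bar> powr \<sigma>) (\<lambda>x. (\<sigma> * ?P x) *\<^sub>R g x)"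
    by (rule C1c_compose[OF u has_real_derivative_abs_powr])
       (use \<sigma> in \<open>auto intro!: continuous_on_mult_left continuous_on_abs_powr_sgn\<close>)
  have intI: "integrable lborel ?I"
    by (rule C1c_integrable[OF G]) (auto intro!: continuous_intros C1c_continuous_on[OF G])
  have intR: "integrable lborel ?R"
    by (rule C1c_integrable[OF u]) (use \<sigma> in \<open>auto intro!: continuous_intros cP continuous_on_tgrad[OF u]\<close>)
  have "0 = (\<integral>x. (real (card S) + (m - 1)) * dst x powr (m - 1) * \<bar>u x\<bar> powr \<sigma>
      + dst x powr (m - 1) * (y x \<bullet> ((\<sigma> * ?P x) *\<^sub>R g x)) \<partial>lborel)"
    using integral_div_radial[OF G, of "m - 1"] by simp
  also have "\<dots> = (\<integral>x. ?\<kappa> * ?I x + ?R x \<partial>lborel)"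
  proof (intro Bochner_Integration.integral_cong refl)
    fix x
    have "?P x * u x = \<bar>u x\<bar> powr \<sigma>" using \<sigma> by (cases "u x = 0") (auto simp: powr_diff sgn_if)
    then show "(real (card S) + (m - 1)) * dst x powr (m - 1) * \<bar>u x\<bar> powr \<sigma>
      + dst x powr (m - 1) * (y x \<bullet> ((\<sigma> * ?P x) *\<^sub>R g x)) = ?\<kappa> * ?I x + ?R x"
      unfolding inner_scaleR_right y_inner_tgrad[OF u, where h = h] by (simp add: algebra_simps)
  qed
  also have "\<dots> = ?\<kappa> * (\<integral>x. ?I x \<partial>lborel) + (\<integral>x. ?R x \<partial>lborel)"
    using intI intR by simp
  finally have R: "(\<integral>x. ?R x \<partial>lborel) = - (?\<kappa> * (\<integral>x. ?I x \<partial>lborel))" by linarith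
  have "(\<integral>x. ?I x \<partial>lborel) \<ge> 0" by (rule Bochner_Integration.integral_nonneg) simp
  then have "\<bar>?\<kappa>\<bar> * (\<integral>x. ?I x \<partial>lborel) = \<bar>\<integral>x. ?R x \<partial>lborel\<bar>"
    unfolding R abs_minus_cancel abs_mult by simp
  also have "\<dots> \<le> (\<integral>x. \<sigma> * (\<bar>u x\<bar> powr (\<sigma> - 1) * dst x powr m * norm (tgrad h u g x)) \<partial>lborel)"
  proof (rule order_trans[OF integral_abs_bound], rule integral_mono)
    show "integrable lborel (\<lambda>x. \<bar>?R x\<bar>)" using intR by (rule integrable_abs)
    show "integrable lborel (\<lambda>x. \<sigma> * (\<bar>u x\<bar> powr (\<sigma> - 1) * dst x powr m * norm (tgrad h u g x)))"
      by (rule C1c_integrable[OF u])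
         (use \<sigma> in \<open>auto intro!: continuous_intros continuous_on_powr' C1c_continuous_on[OF u] continuous_on_tgrad[OF u]\<close>)
    fix x
    have "\<bar>y x \<bullet> tgrad h u g x\<bar> \<le> dst x * norm (tgrad h u g x)"
      unfolding dst_def by (rule Cauchy_Schwarz_ineq2)
    then have "dst x powr (m - 1) * \<bar>y x \<bullet> tgrad h u g x\<bar> \<le> dst x powr (m - 1) * (dst x * norm (tgrad h u g x))"
      by (intro mult_left_mono) auto
    also have "\<dots> \<le> dst x powr m * norm (tgrad h u g x)"
      using dst_ge_0[of x] by (cases "dst x = 0") (auto simp: powr_diff)
    finally have "\<sigma> * \<bar>u x\<bar> powr (\<sigma> - 1) * \<bar>sgn (u x)\<bar> * (dst x powr (m - 1) * \<bar>y x \<bullet> tgrad h u g x\<bar>)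
        \<le> \<sigma> * \<bar>u x\<bar> powr (\<sigma> - 1) * 1 * (dst x powr m * norm (tgrad h u g x))"
      using \<sigma> by (rule_tac mult_mono) (auto simp: sgn_if)
    then show "\<bar>?R x\<bar> \<le> \<sigma> * (\<bar>u x\<bar> powr (\<sigma> - 1) * dst x powr m * norm (tgrad h u g x))"
      using \<sigma> by (simp add: abs_mult mult_ac)
  qed
  also have "\<dots> = \<sigma> * (\<integral>x. \<bar>u x\<bar> powr (\<sigma> - 1) * dst x powr m * norm (tgrad h u g x) \<partial>lborel)" by simp
  finally show ?thesis .
qed

text \<open>Gagliardo-Nirenberg for \<open>W = |u|^\<sigma> d^m\<close>. Besides the part containing
  \<open>tgrad\<close>, the gradient of \<open>W\<close> has a radial remainder of size
  \<open>|m - \<sigma> h| |u|^\<sigma> d^(m-1)\<close>, which \<open>weighted_Hardy_L1\<close> can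
  absorb.\<close>

lemma weighted_Gagliardo_Nirenberg:
  assumes u: "C1c U u g" and \<sigma>: "\<sigma> > 1" and N: "DIM('a) \<ge> 2"
  shows "(\<integral>x. (\<bar>u x\<bar> powr \<sigma> * dst x powr m) powr (real DIM('a) / (real DIM('a) - 1)) \<partial>lborel)
    \<le> (\<sigma> * (\<integral>x. \<bar>u x\<bar> powr (\<sigma> - 1) * dst x powr m * norm (tgrad h u g x) \<partial>lborel)
        + \<bar>m - \<sigma> * h\<bar> * (\<integral>x. \<bar>u x\<bar> powr \<sigma> * dst x powr (m - 1) \<partial>lborel))
        powr (real DIM('a) / (real DIM('a) - 1))"
proof -
  let ?s = "real DIM('a) / (real DIM('a) - 1)"
  have s: "?s > 0" using N by simp
  let ?P = "\<lambda>x. \<bar>u x\<bar> powr (\<sigma> - 1) * sgn (u x)"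
  let ?gW = "\<lambda>x. dst x powr m *\<^sub>R ((\<sigma> * ?P x) *\<^sub>R g x) + \<bar>u x\<bar> powr \<sigma> *\<^sub>R ((m * dst x powr (m - 2)) *\<^sub>R y x)"
  let ?J = "\<lambda>x. \<bar>u x\<bar> powr (\<sigma> - 1) * dst x powr m * norm (tgrad h u g x)"
  let ?I = "\<lambda>x. \<bar>u x\<bar> powr \<sigma> * dst x powr (m - 1)"
  have G: "C1c U (\<lambda>x. \<bar>u x\<bar> powr \<sigma>) (\<lambda>x. (\<sigma> * ?P x) *\<^sub>R g x)"
    by (rule C1c_compose[OF u has_real_derivative_abs_powr])
       (use \<sigma> in \<open>auto intro!: continuous_on_mult_left continuous_on_abs_powr_sgn\<close>)
  have W: "C1c U (\<lambda>x. \<bar>u x\<bar> powr \<sigma> * dst x powr m) ?gW"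
    by (rule C1c_mult[OF G open_U has_derivative_dst_powr]) (auto intro!: continuous_intros)
  have intgW: "integrable lborel (\<lambda>x. norm (?gW x))"
    using C1c_integrable[OF W C1c_continuous_on(2)[OF W]] by (intro integrable_norm)
  have intJ: "integrable lborel ?J"
      by (rule C1c_integrable[OF u])
         (use \<sigma> in \<open>auto intro!: continuous_intros continuous_on_powr' C1c_continuous_on[OF u] continuous_on_tgrad[OF u]\<close>)
  have intI: "integrable lborel ?I"
    by (rule C1c_integrable[OF G]) (auto intro!: continuous_intros C1c_continuous_on[OF G])
  have intWs: "integrable lborel (\<lambda>x. (\<bar>u x\<bar> powr \<sigma> * dst x powr m) powr ?s)"
    by (rule C1c_integrable[OF W], rule continuous_on_powr'[OF C1c_continuous_on(1)[OF W] continuous_on_const]) (use N in auto)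
  have le: "norm (?gW x) \<le> \<sigma> * ?J x + \<bar>m - \<sigma> * h\<bar> * ?I x" for x
  proof (cases "x \<in> U")
    case True
    have Pu: "?P x * u x = \<bar>u x\<bar> powr \<sigma>" using \<sigma> by (cases "u x = 0") (auto simp: powr_diff sgn_if)
    have d2: "dst x powr (m - 2) = dst x powr m / (dst x)\<^sup>2"
      using dst_pos[OF True] by (simp add: powr_diff)
    have gx: "g x = tgrad h u g x - (h * u x / (dst x)\<^sup>2) *\<^sub>R y x" by (simp add: tgrad_def)
    have "?gW x = (\<sigma> * ?P x * dst x powr m) *\<^sub>R tgrad h u g x
        - (\<sigma> * h * (?P x * u x) * dst x powr m / (dst x)\<^sup>2) *\<^sub>R y x
        + (m * \<bar>u x\<bar> powr \<sigma> * dst x powr m / (dst x)\<^sup>2) *\<^sub>R y x"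
      unfolding d2 by (subst gx) (simp add: scaleR_diff_right mult_ac)
    also have "\<dots> = (\<sigma> * ?P x * dst x powr m) *\<^sub>R tgrad h u g x
        + ((m - \<sigma> * h) * \<bar>u x\<bar> powr \<sigma> * dst x powr (m - 2)) *\<^sub>R y x"
      unfolding Pu d2 by (simp add: algebra_simps diff_divide_distrib flip: scaleR_add_left scaleR_diff_left)
    finally have gW: "?gW x = (\<sigma> * ?P x * dst x powr m) *\<^sub>R tgrad h u g x
        + ((m - \<sigma> * h) * \<bar>u x\<bar> powr \<sigma> * dst x powr (m - 2)) *\<^sub>R y x" .
    have "norm (?gW x) \<le> norm ((\<sigma> * ?P x * dst x powr m) *\<^sub>R tgrad h u g x)
       + norm (((m - \<sigma> * h) * \<bar>u x\<bar> powr \<sigma> * dst x powr (m - 2)) *\<^sub>R y x)"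
      unfolding gW by (rule norm_triangle_ineq)
    also have "norm ((\<sigma> * ?P x * dst x powr m) *\<^sub>R tgrad h u g x) \<le> \<sigma> * ?J x"
      using \<sigma> by (auto simp: abs_mult sgn_if mult_ac)
    also have "norm (((m - \<sigma> * h) * \<bar>u x\<bar> powr \<sigma> * dst x powr (m - 2)) *\<^sub>R y x) = \<bar>m - \<sigma> * h\<bar> * ?I x"
      using dst_pos[OF True] by (simp add: abs_mult dst_def[symmetric] powr_diff power2_eq_square)
    finally show ?thesis by simp
  next
    case False
    then show ?thesis using C1c_zero_outside[OF u False] by simp
  qed
  have "(\<integral>x. norm (?gW x) \<partial>lborel) \<le> (\<integral>x. \<sigma> * ?J x + \<bar>m - \<sigma> * h\<bar> * ?I x \<partial>lborel)"
    by (rule integral_mono) (use intgW intJ intI le in auto)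
  also have "\<dots> = \<sigma> * (\<integral>x. ?J x \<partial>lborel) + \<bar>m - \<sigma> * h\<bar> * (\<integral>x. ?I x \<partial>lborel)"
    using intJ intI by simp
  finally have 1: "(\<integral>x. norm (?gW x) \<partial>lborel) \<le> \<dots>" .
  have "ennreal (\<integral>x. (\<bar>u x\<bar> powr \<sigma> * dst x powr m) powr ?s \<partial>lborel)
      = (\<integral>\<^sup>+x. ennreal (\<bar>\<bar>u x\<bar> powr \<sigma> * dst x powr m\<bar> powr ?s) \<partial>lborel)"
    using intWs by (subst nn_integral_eq_integral[symmetric]) auto
  also have "\<dots> \<le> epw (\<integral>\<^sup>+x. ennreal (norm (?gW x)) \<partial>lborel) ?s"
    by (rule Gagliardo_Nirenberg[OF W N])
  also have "\<dots> = epw (ennreal (\<integral>x. norm (?gW x) \<partial>lborel)) ?s"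
    using intgW by (subst nn_integral_eq_integral) auto
  also have "\<dots> = ennreal ((\<integral>x. norm (?gW x) \<partial>lborel) powr ?s)"
    using s by (intro epw_ennreal) auto
  finally have "(\<integral>x. (\<bar>u x\<bar> powr \<sigma> * dst x powr m) powr ?s \<partial>lborel) \<le> (\<integral>x. norm (?gW x) \<partial>lborel) powr ?s"
    by (simp add: ennreal_le_iff)
  also have "\<dots> \<le> (\<sigma> * (\<integral>x. ?J x \<partial>lborel) + \<bar>m - \<sigma> * h\<bar> * (\<integral>x. ?I x \<partial>lborel)) powr ?s"
    using s 1 by (intro powr_mono2) auto
  finally show ?thesis .
qed

text \<open>Interpolating between the two previous lemmas, applied with
  \<open>\<sigma> = 1 + q (p - 1) / p\<close>, and absorbing the power of the left-hand side produced by Hoelder.\<close>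

lemma weighted_Sobolev:
  fixes p q h :: real
  defines "N \<equiv> real DIM('a)"
  defines "\<sigma> \<equiv> 1 + q * (p - 1) / p"
  defines "m \<equiv> 1 - N + \<sigma> * (N - p) / p"
  defines "s \<equiv> - q - N + N * q / p"
  assumes N2: "DIM('a) \<ge> 2" and p: "1 < p" "p < N" and q: "p \<le> q" "q \<le> N * p / (N - p)"
    and \<kappa>: "real (card S) - 1 + m - \<sigma> * h \<noteq> 0"
  shows "\<exists>C>0. \<forall>u g. C1c U u g \<longrightarrow>
     (\<integral>x. \<bar>u x\<bar> powr q * dst x powr s \<partial>lborel) powr (p / q) \<le> C * (\<integral>x. norm (tgrad h u g x) powr p \<partial>lborel)"
proof -
  define \<kappa> where "\<kappa> = \<bar>real (card S) - 1 + m - \<sigma> * h\<bar>"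
  have \<kappa>0: "\<kappa> > 0" using \<kappa> by (simp add: \<kappa>_def)
  have q0: "q > 1" using p q by simp
  have \<sigma>: "\<sigma> > 1" using p q0 by (simp add: \<sigma>_def)
  define n where "n = N / (N - 1)"
  have N1: "N > 1" using p by simp
  have n: "n > 1" using N1 by (simp add: n_def field_simps)
  define r where "r = q / \<sigma>"
  have r0: "r > 0" using q0 \<sigma> by (simp add: r_def)
  \<comment> \<open>Solves \<open>1 - \<theta> + n * \<theta> = r\<close>, so that \<open>Q\<close>
    interpolates between \<open>I\<close> with exponent \<open>1 - \<theta>\<close> and
    \<open>G\<close> with exponent \<theta>. The upper bound on \<open>q\<close> is what gives
    \<open>\<theta> <= 1\<close>.\<close>
  define \<theta> where "\<theta> = (r - 1) * (N - 1)"
  have "q \<ge> \<sigma>" using q p by (simp add: \<sigma>_def field_simps)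
  then have r1: "r \<ge> 1" using \<sigma> by (simp add: r_def field_simps)
  have th0: "\<theta> \<ge> 0" using r1 N1 by (simp add: \<theta>_def)
  have rn: "r \<le> n"
  proof -
    have "q * (N - p) \<le> N * p" using q(2) p by (simp add: field_simps)
    then have "q * p * (N - 1) \<le> N * (p + q * (p - 1))" by (simp add: algebra_simps)
    also have "\<dots> = N * (\<sigma> * p)" using p by (simp add: \<sigma>_def field_simps)
    finally have "p * (q * (N - 1)) \<le> p * (N * \<sigma>)" by (simp add: mult_ac)
    then have "q * (N - 1) \<le> N * \<sigma>" using p by simp
    then show ?thesis using \<sigma> N1 by (simp add: r_def n_def field_simps)
  qed
  have th1: "\<theta> \<le> 1" using rn N1 by (simp add: \<theta>_def n_def field_simps)
  have rth: "1 - \<theta> + n * \<theta> = r" using N1 by (simp add: \<theta>_def n_def field_simps)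
  have eq_u: "\<sigma> * (1 - \<theta>) + \<sigma> * n * \<theta> = q"
  proof -
    have "\<sigma> * (1 - \<theta>) + \<sigma> * n * \<theta> = \<sigma> * (1 - \<theta> + n * \<theta>)" by (simp add: algebra_simps)
    then show ?thesis using \<sigma> unfolding rth by (simp add: r_def)
  qed
  have mN: "m + N - 1 = \<sigma> * (N - p) / p" by (simp add: m_def)
  have eq_d: "(m - 1) * (1 - \<theta>) + m * n * \<theta> = s"
  proof -
    have "(m - 1) * (1 - \<theta>) + m * n * \<theta> = m * (1 - \<theta> + n * \<theta>) - (1 - \<theta>)" by (simp add: algebra_simps)
    also have "\<dots> = r * (m + N - 1) - N" unfolding rth by (simp add: \<theta>_def algebra_simps)
    also have "r * (m + N - 1) = q * (N - p) / p" unfolding mN using \<sigma> by (simp add: r_def)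
    finally show ?thesis using p by (simp add: s_def field_simps)
  qed
  \<comment> \<open>This identity and \<open>eq_d'\<close> dictate \<sigma> and \<open>m\<close>:
    Hoelder splits \<open>J\<close> into the power \<open>1 - 1/p\<close> of \<open>Q\<close> and
    the \<open>L^p\<close> norm of \<open>tgrad\<close>.\<close>
  have eq_u': "(\<sigma> - 1) = q * (1 - 1 / p)" using p by (simp add: \<sigma>_def field_simps)
  have eq_d': "m = s * (1 - 1 / p)"
  proof -
    have 1: "(N - p) / p = N * (1 / p) - 1" "\<sigma> = 1 + q * (1 - 1 / p)" "s = - q - N + N * q * (1 / p)"
      using p by (auto simp: \<sigma>_def s_def field_simps)
    have "m = 1 - N + \<sigma> * ((N - p) / p)" by (simp add: m_def)
    then show ?thesis unfolding 1 by (simp only: algebra_simps)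
  qed
  \<comment> \<open>The power of \<open>Q\<close> that survives the division by the one on the right
    is \<open>r / q\<close>, which is positive, so the absorption succeeds.\<close>
  have rq: "1 - (1 - 1 / p) * r = r / q"
  proof -
    have "1 - (1 - 1 / p) * r = (\<sigma> - q * (1 - 1 / p)) / \<sigma>"
      using \<sigma> by (simp add: r_def diff_divide_distrib mult.commute)
    also have "\<dots> = r / q" using \<sigma> q0 by (simp add: r_def flip: eq_u')
    finally show ?thesis .
  qed
  \<comment> \<open>The Hardy inequality bounds \<open>I\<close> by \<open>c2 * J\<close>, which
    merges the two terms of the Gagliardo-Nirenberg bound into \<open>c1 * J\<close>;
    \<open>c3\<close> comes from the interpolation.\<close>
  define c1 where "c1 = \<sigma> + \<bar>m - \<sigma> * h\<bar> * (\<sigma> / \<kappa>)"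
  define c2 where "c2 = \<sigma> / \<kappa>"
  define c3 where "c3 = c2 powr (1 - \<theta>) * c1 powr (n * \<theta>)"
  have c: "c1 > 0" "c2 > 0" using \<sigma> \<kappa>0 unfolding c1_def c2_def by (auto intro!: add_pos_nonneg)
  then have c3: "c3 > 0" by (simp add: c3_def)
  show ?thesis
  proof (intro exI[of _ "c3 powr (p / r)"] conjI allI impI)
    show "c3 powr (p / r) > 0" using c3 by simp
    fix u g assume u: "C1c U u g"
    define Q where "Q = (\<integral>x. \<bar>u x\<bar> powr q * dst x powr s \<partial>lborel)"
    define B where "B = (\<integral>x. norm (tgrad h u g x) powr p \<partial>lborel)"
    define J where "J = (\<integral>x. \<bar>u x\<bar> powr (\<sigma> - 1) * dst x powr m * norm (tgrad h u g x) \<partial>lborel)"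
    define I where "I = (\<integral>x. \<bar>u x\<bar> powr \<sigma> * dst x powr (m - 1) \<partial>lborel)"
    define G where "G = (\<integral>x. (\<bar>u x\<bar> powr \<sigma> * dst x powr m) powr n \<partial>lborel)"
    have nonneg: "Q \<ge> 0" "B \<ge> 0" "J \<ge> 0" "I \<ge> 0" "G \<ge> 0"
      unfolding Q_def B_def J_def I_def G_def by (auto intro!: Bochner_Integration.integral_nonneg)
    note ci = continuous_intros continuous_on_powr' C1c_continuous_on[OF u] continuous_on_tgrad[OF u]
    have iI: "integrable lborel (\<lambda>x. \<bar>u x\<bar> powr \<sigma> * dst x powr (m - 1))"
      by (rule C1c_integrable[OF u]) (use \<sigma> in \<open>auto intro!: ci\<close>)
    have iQ: "integrable lborel (\<lambda>x. \<bar>u x\<bar> powr q * dst x powr s)"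
      by (rule C1c_integrable[OF u]) (use q0 in \<open>auto intro!: ci\<close>)
    have iB: "integrable lborel (\<lambda>x. norm (tgrad h u g x) powr p)"
      by (rule C1c_integrable[OF u]) (use p in \<open>auto intro!: ci simp: tgrad_def U_eq\<close>)
    have iG: "integrable lborel (\<lambda>x. (\<bar>u x\<bar> powr \<sigma> * dst x powr m) powr n)"
      by (rule C1c_integrable[OF u]) (use \<sigma> n in \<open>auto intro!: ci\<close>)
    have I_le: "I \<le> c2 * J"
      using weighted_Hardy_L1[OF u \<sigma>, of m h] \<kappa>0 by (simp add: I_def J_def c2_def \<kappa>_def field_simps)
    have "G \<le> (\<sigma> * J + \<bar>m - \<sigma> * h\<bar> * I) powr n"
      using weighted_Gagliardo_Nirenberg[OF u \<sigma> N2, of m h] by (simp add: G_def J_def I_def n_def N_def)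
    also have "\<dots> \<le> (c1 * J) powr n"
    proof (rule powr_mono2)
      have "\<bar>m - \<sigma> * h\<bar> * I \<le> \<bar>m - \<sigma> * h\<bar> * (c2 * J)" using I_le by (intro mult_left_mono) auto
      then show "\<sigma> * J + \<bar>m - \<sigma> * h\<bar> * I \<le> c1 * J" by (simp add: c1_def c2_def algebra_simps)
    qed (use n nonneg \<sigma> in auto)
    finally have G_le: "G \<le> (c1 * J) powr n" .
    have "Q = (\<integral>x. (\<bar>u x\<bar> powr \<sigma> * dst x powr (m - 1)) powr (1 - \<theta>) *
        ((\<bar>u x\<bar> powr \<sigma> * dst x powr m) powr n) powr \<theta> \<partial>lborel)"
      unfolding Q_def
    proof (intro Bochner_Integration.integral_cong refl)
      fix x
      have "(\<bar>u x\<bar> powr \<sigma> * dst x powr (m - 1)) powr (1 - \<theta>) * ((\<bar>u x\<bar> powr \<sigma> * dst x powr m) powr n) powr \<theta>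
          = (\<bar>u x\<bar> powr (\<sigma> * (1 - \<theta>)) * \<bar>u x\<bar> powr (\<sigma> * n * \<theta>)) * (dst x powr ((m - 1) * (1 - \<theta>)) * dst x powr (m * n * \<theta>))"
        by (simp add: powr_mult powr_powr mult_ac)
      also have "\<dots> = \<bar>u x\<bar> powr q * dst x powr s"
        by (simp only: powr_add[symmetric] eq_u eq_d)
      finally show "\<bar>u x\<bar> powr q * dst x powr s = (\<bar>u x\<bar> powr \<sigma> * dst x powr (m - 1)) powr (1 - \<theta>) *
        ((\<bar>u x\<bar> powr \<sigma> * dst x powr m) powr n) powr \<theta>" ..
    qed
    also have "\<dots> \<le> I powr (1 - \<theta>) * G powr \<theta>"
      unfolding I_def G_def by (rule integral_Hoelder[OF iI _ iG]) (use th0 th1 in auto)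
    also have "\<dots> \<le> (c2 * J) powr (1 - \<theta>) * ((c1 * J) powr n) powr \<theta>"
      using I_le G_le nonneg th0 th1 by (intro mult_mono powr_mono2) auto
    also have "\<dots> = c3 * (J powr (1 - \<theta>) * J powr (n * \<theta>))"
      using c nonneg by (simp add: c3_def powr_mult powr_powr mult_ac)
    also have "\<dots> = c3 * J powr r" by (simp only: powr_add[symmetric] rth)
    finally have Q_le: "Q \<le> c3 * J powr r" .
    have "J = (\<integral>x. (\<bar>u x\<bar> powr q * dst x powr s) powr (1 - 1 / p) * (norm (tgrad h u g x) powr p) powr (1 / p) \<partial>lborel)"
      unfolding J_def using p by (simp add: powr_mult powr_powr eq_u' flip: eq_d')
    also have "\<dots> \<le> Q powr (1 - 1 / p) * B powr (1 / p)"
      unfolding Q_def B_def by (rule integral_Hoelder[OF iQ _ iB]) (use p in auto)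
    finally have J_le: "J \<le> Q powr (1 - 1 / p) * B powr (1 / p)" .
    show "Q powr (p / q) \<le> c3 powr (p / r) * B"
    \<comment> \<open>Dividing by a power of \<open>Q\<close> needs \<open>Q > 0\<close>; that
      \<open>Q\<close> is a finite integral is \<open>iQ\<close>, a consequence of compact
      support.\<close>
    proof (cases "Q = 0")
      case False
      then have Q0: "Q > 0" using nonneg by simp
      have "Q \<le> c3 * (Q powr (1 - 1 / p) * B powr (1 / p)) powr r"
        using Q_le J_le nonneg r0 c3 by (elim order_trans) (intro mult_left_mono powr_mono2, auto)
      also have "\<dots> = c3 * B powr (r / p) * Q powr ((1 - 1 / p) * r)"
        using nonneg by (simp add: powr_mult powr_powr mult_ac)
      finally have "Q powr 1 / Q powr ((1 - 1 / p) * r) \<le> c3 * B powr (r / p)"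
        using Q0 by (simp add: field_simps)
      then have "Q powr (r / q) \<le> c3 * B powr (r / p)"
        unfolding powr_diff[symmetric] rq .
      then have "(Q powr (r / q)) powr (p / r) \<le> (c3 * B powr (r / p)) powr (p / r)"
        using p r0 by (intro powr_mono2) auto
      then show ?thesis using p r0 c3 nonneg q0 by (simp add: powr_powr powr_mult)
    qed (use nonneg c3 p q0 in auto)
  qed
qed

end

subsection \<open>The convexity defect of the power of the norm\<close>

text \<open>The Bregman distance of \<open>norm powr p\<close> between \<open>a + b\<close> and
  \<open>a\<close>. At \<open>a = 0\<close> the linear term is \<open>0\<close> for every
  \<open>p\<close>.\<close>

definition bregman :: "real \<Rightarrow> 'a::real_inner \<Rightarrow> 'a \<Rightarrow> real" where
  "bregman p a b = norm (a + b) powr p - norm a powr p - p * norm a powr (p - 2) * (a \<bullet> b)"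

text \<open>Young's inequality for the factorization
  \<open>r = (r powr p) powr (1 / p) * 1 powr (1 - 1 / p)\<close>.\<close>

lemma Bernoulli_powr:
  fixes r p :: real
  assumes p: "p \<ge> 1" and r: "r \<ge> 0"
  shows "r powr p \<ge> 1 + p * (r - 1)"
proof (cases "r = 0")
  case False
  have "(r powr p) powr (1 / p) * 1 powr (1 - 1 / p) \<le> (1 / p) * r powr p + (1 - 1 / p) * 1"
    by (rule Youngs_inequality_0) (use assms False in auto)
  then have "r \<le> (1 / p) * r powr p + (1 - 1 / p)" using assms by (simp add: powr_powr)
  then have "p * r \<le> p * ((1 / p) * r powr p + (1 - 1 / p))" using p by (intro mult_left_mono) auto
  then show ?thesis using p by (simp add: algebra_simps)
qed (use p in auto)

lemma powr_Taylor2: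
  fixes r p :: real
  assumes r: "r > 0" "r \<noteq> 1"
  shows "\<exists>\<xi>. min r 1 < \<xi> \<and> \<xi> < max r 1 \<and>
    r powr p - 1 - p * (r - 1) = p * (p - 1) / 2 * \<xi> powr (p - 2) * (r - 1)\<^sup>2"
proof -
  define df where "df = (\<lambda>m::nat. if m = 0 then (\<lambda>s. s powr p) else if m = 1 then (\<lambda>s. p * s powr (p - 1))
     else (\<lambda>s. p * ((p - 1) * s powr (p - 2))))"
  have "\<exists>t. (if r < 1 then r < t \<and> t < 1 else 1 < t \<and> t < r) \<and>
     r powr p = (\<Sum>m<2. df m 1 / fact m * (r - 1) ^ m) + df 2 t / fact 2 * (r - 1) ^ 2"
  proof (rule Taylor[where a = "min r 1" and b = "max r 1"])
    show "df 0 = (\<lambda>s. s powr p)" by (simp add: df_def)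
    show "\<forall>m t. m < 2 \<and> min r 1 \<le> t \<and> t \<le> max r 1 \<longrightarrow> (df m has_real_derivative df (Suc m) t) (at t)"
    proof (intro allI impI)
      fix m :: nat and t :: real assume t: "m < 2 \<and> min r 1 \<le> t \<and> t \<le> max r 1"
      then have "t > 0" using r by (auto simp: min_def split: if_splits)
      have "m = 0 \<or> m = 1" using t by auto
      then show "(df m has_real_derivative df (Suc m) t) (at t)"
        using \<open>t > 0\<close> by (auto simp: df_def intro!: derivative_eq_intros)
    qed
  qed (use r in auto)
  then obtain t where t: "if r < 1 then r < t \<and> t < 1 else 1 < t \<and> t < r"
    "r powr p = (\<Sum>m<2. df m 1 / fact m * (r - 1) ^ m) + df 2 t / fact 2 * (r - 1) ^ 2" by blast
  have "(\<Sum>m<2. df m 1 / fact m * (r - 1) ^ m) = 1 + p * (r - 1)"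
    by (simp add: df_def numeral_2_eq_2)
  moreover have "df 2 t / fact 2 = p * (p - 1) / 2 * t powr (p - 2)" by (simp add: df_def)
  ultimately show ?thesis using t r by (intro exI[of _ t]) (auto simp: min_def max_def split: if_splits)
qed

text \<open>The first form separates a one-dimensional radial defect from a tangential square, both
  nonnegative. The second contains the defect of the power \<open>p / 2\<close> at
  \<open>r\<^sup>2\<close>, which is convex for \<open>p >= 2\<close>, plus the full square of
  \<open>norm f\<close>.\<close>

lemma bregman_unit:
  fixes e f :: "'a::real_inner"
  assumes e: "norm e = 1"
  defines "r \<equiv> norm (e + f)"
  shows "bregman p e f = (r powr p - 1 - p * (r - 1)) + p / 2 * ((norm f)\<^sup>2 - (r - 1)\<^sup>2)"
    and "bregman p e f = ((r\<^sup>2) powr (p / 2) - 1 - p / 2 * (r\<^sup>2 - 1)) + p / 2 * (norm f)\<^sup>2"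
    and "\<bar>r - 1\<bar> \<le> norm f"
proof -
  have "r\<^sup>2 = 1 + 2 * (e \<bullet> f) + (norm f)\<^sup>2"
    using e unfolding r_def by (simp add: power2_norm_eq_inner inner_simps inner_commute norm_eq_1)
  then have ef: "e \<bullet> f = (r\<^sup>2 - 1 - (norm f)\<^sup>2) / 2" by simp
  have b: "bregman p e f = r powr p - 1 - p * (e \<bullet> f)" using e by (simp add: bregman_def r_def)
  show "bregman p e f = (r powr p - 1 - p * (r - 1)) + p / 2 * ((norm f)\<^sup>2 - (r - 1)\<^sup>2)"
    unfolding b ef by (simp add: field_simps power2_eq_square)
  have "(r\<^sup>2) powr (p / 2) = r powr p"
    using powr_powr[of r 2 "p / 2"] by (simp add: r_def)
  then show "bregman p e f = ((r\<^sup>2) powr (p / 2) - 1 - p / 2 * (r\<^sup>2 - 1)) + p / 2 * (norm f)\<^sup>2"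
    unfolding b ef by (simp add: field_simps)
  show "\<bar>r - 1\<bar> \<le> norm f"
    using norm_triangle_ineq3[of "e + f" e] e by (simp add: r_def)
qed

lemma bregman_unit_nonneg:
  assumes e: "norm e = 1" and p: "p \<ge> 1"
  shows "bregman p e f \<ge> 0"
proof -
  have "(norm (e + f) - 1)\<^sup>2 \<le> (norm f)\<^sup>2"
    using bregman_unit(3)[OF e, of f] by (metis abs_ge_zero norm_ge_zero power2_abs power_mono)
  then have "p / 2 * ((norm f)\<^sup>2 - (norm (e + f) - 1)\<^sup>2) \<ge> 0" using p by simp
  then show ?thesis
    unfolding bregman_unit(1)[OF e] using Bernoulli_powr[OF p, of "norm (e + f)"] by simp
qed

text \<open>For \<open>p >= 2\<close> the second form in \<open>bregman_unit\<close> gives the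
  constant \<open>p / 2\<close> at once. For \<open>p < 2\<close> the first form is used: the second
  derivative of the radial power is bounded below on \<open>(0, M + 1]\<close>.\<close>

lemma bregman_unit_small:
  assumes p: "p > 1" and M: "M > 0"
  shows "\<exists>c>0. \<forall>e f::'a::real_inner. norm e = 1 \<and> norm f \<le> M \<longrightarrow> c * (norm f)\<^sup>2 \<le> bregman p e f"
proof (cases "p \<ge> 2")
  case True
  show ?thesis
  proof (intro exI[of _ "p / 2"] conjI allI impI)
    fix e f :: 'a assume *: "norm e = 1 \<and> norm f \<le> M"
    have "((norm (e + f))\<^sup>2) powr (p / 2) \<ge> 1 + p / 2 * ((norm (e + f))\<^sup>2 - 1)"
      by (rule Bernoulli_powr) (use True in auto)
    then show "p / 2 * (norm f)\<^sup>2 \<le> bregman p e f" using bregman_unit(2)[of e p f] * by simp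
  qed (use p in auto)
next
  case False
  define c where "c = p * (p - 1) / 2 * (M + 1) powr (p - 2)"
  have M1: "(M + 1) powr (p - 2) \<le> 1" using powr_mono[of "p - 2" 0 "M + 1"] M False by simp
  have c: "c > 0" using p M by (simp add: c_def)
  have key: "r powr p - 1 - p * (r - 1) \<ge> c * (r - 1)\<^sup>2" if r: "0 \<le> r" "r \<le> M + 1" for r
  proof -
    consider "r = 0" | "r = 1" | "r > 0" "r \<noteq> 1" using r by linarith
    then show ?thesis
    proof cases
      \<comment> \<open>The Taylor formula needs \<open>r > 0\<close>; at \<open>r = 0\<close> the
        defect is \<open>p - 1\<close>, and \<open>p < 2\<close> gives
        \<open>c <= p - 1\<close>.\<close>
      case 1
      have "c \<le> p * (p - 1) / 2 * 1" unfolding c_def using M1 p by (intro mult_left_mono) auto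
      also have "\<dots> \<le> p - 1" using mult_nonneg_nonneg[of "2 - p" "p - 1"] False p by (simp add: field_simps)
      finally show ?thesis using 1 p by simp
    next
      case 3
      then obtain \<xi> where xi: "min r 1 < \<xi>" "\<xi> < max r 1"
        "r powr p - 1 - p * (r - 1) = p * (p - 1) / 2 * \<xi> powr (p - 2) * (r - 1)\<^sup>2"
        using powr_Taylor2 by blast
      have "(M + 1) powr (p - 2) \<le> \<xi> powr (p - 2)"
        using xi 3 r M False by (intro powr_mono2') (auto simp: min_def max_def split: if_splits)
      then show ?thesis unfolding xi(3) c_def using p by (intro mult_right_mono mult_left_mono) auto
    qed auto
  qed
  show ?thesis
  proof (intro exI[of _ "min c (p / 2)"] conjI allI impI)
    fix e f :: 'a assume *: "norm e = 1 \<and> norm f \<le> M"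
    define r where "r = norm (e + f)"
    have r: "\<bar>r - 1\<bar> \<le> norm f" using bregman_unit(3)[of e f] * by (simp add: r_def)
    then have r2: "(r - 1)\<^sup>2 \<le> (norm f)\<^sup>2" by (metis abs_ge_zero power2_abs power_mono)
    have "min c (p / 2) * (norm f)\<^sup>2 = min c (p / 2) * (r - 1)\<^sup>2 + min c (p / 2) * ((norm f)\<^sup>2 - (r - 1)\<^sup>2)"
      by (simp add: algebra_simps)
    also have "\<dots> \<le> c * (r - 1)\<^sup>2 + p / 2 * ((norm f)\<^sup>2 - (r - 1)\<^sup>2)"
      using r2 by (intro add_mono mult_right_mono) auto
    also have "\<dots> \<le> bregman p e f"
    proof -
      have "0 \<le> r" "r \<le> M + 1" using r * by (auto simp: r_def)
      then show ?thesis using bregman_unit(1)[of e p f] * key[of r] by (simp add: r_def)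
    qed
    finally show "min c (p / 2) * (norm f)\<^sup>2 \<le> bregman p e f" .
  qed (use c p in auto)
qed

text \<open>For \<open>t = norm f\<close> the defect is at least
  \<open>(t - 1) powr p - 1 - p * t\<close>. Its quotient by \<open>t powr p\<close> tends to
  \<open>1\<close>, hence eventually exceeds \<open>1/2\<close>.\<close>

lemma bregman_unit_large:
  assumes p: "p > (1::real)"
  shows "\<exists>M\<ge>1. \<forall>e f::'a::real_inner. norm e = 1 \<and> norm f \<ge> M \<longrightarrow> norm f powr p \<le> 2 * bregman p e f"
proof -
  have "((\<lambda>M::real. (1 - 1 / M) powr p - M powr - p - p * M powr (1 - p)) \<longlongrightarrow> (1 - 0) powr p - 0 - p * 0) at_top"
    using p by (intro tendsto_intros tendsto_neg_powr filterlim_ident tendsto_divide_0[OF tendsto_const]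
       filterlim_at_top_imp_at_infinity) auto
  then have "eventually (\<lambda>M::real. (1 - 1 / M) powr p - M powr - p - p * M powr (1 - p) > 1 / 2) at_top"
    by (rule order_tendstoD) simp
  then obtain M0 where M0: "\<And>M::real. M \<ge> M0 \<Longrightarrow> (1 - 1 / M) powr p - M powr - p - p * M powr (1 - p) > 1 / 2"
    by (auto simp: eventually_at_top_linorder)
  show ?thesis
  proof (intro exI[of _ "max 1 M0"] conjI allI impI)
    fix e f :: 'a assume *: "norm e = 1 \<and> max 1 M0 \<le> norm f"
    define t where "t = norm f"
    have t: "t \<ge> 1" "t \<ge> M0" using * by (auto simp: t_def)
    have e: "norm e = 1" using * by simp
    have "e \<bullet> f \<le> t" using norm_cauchy_schwarz[of e f] e by (simp add: t_def)
    then have ef: "p * (e \<bullet> f) \<le> p * t" using p by (intro mult_left_mono) auto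
    have "norm (e + f) \<ge> t - 1" using norm_triangle_ineq4[of "e + f" e] e by (simp add: t_def)
    then have "norm (e + f) powr p \<ge> (t - 1) powr p" using t p by (intro powr_mono2) auto
    then have "bregman p e f \<ge> (t - 1) powr p - 1 - p * t" using e ef by (simp add: bregman_def)
    also have "(t - 1) powr p - 1 - p * t = t powr p * ((1 - 1 / t) powr p - t powr - p - p * t powr (1 - p))"
    proof -
      have "(t - 1) powr p = (t * (1 - 1 / t)) powr p" using t by (simp add: right_diff_distrib)
      also have "\<dots> = t powr p * (1 - 1 / t) powr p" using t by (subst powr_mult) auto
      finally have 1: "(t - 1) powr p = t powr p * (1 - 1 / t) powr p" .
      have 2: "t powr p * t powr - p = 1" "t powr p * (p * t powr (1 - p)) = p * t"
        using t by (simp_all add: mult.left_commute[of _ p] flip: powr_add)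
      show ?thesis unfolding right_diff_distrib 1 2 ..
    qed
    finally have "bregman p e f \<ge> t powr p * ((1 - 1 / t) powr p - t powr - p - p * t powr (1 - p))" .
    moreover have "t powr p * ((1 - 1 / t) powr p - t powr - p - p * t powr (1 - p)) \<ge> t powr p * (1 / 2)"
      using M0[OF t(2)] by (intro mult_left_mono) auto
    ultimately show "norm f powr p \<le> 2 * bregman p e f" by (simp add: t_def)
  qed auto
qed

text \<open>For \<open>r <= 1/2\<close> the defect is bounded while
  \<open>(r - 1)\<^sup>2 >= 1/4\<close>; next Taylor's formula applies; for \<open>p >= 2\<close>
  and \<open>r > 2\<close> the power itself dominates. For \<open>p < 2\<close> the factor
  \<open>\<xi> powr (p - 2)\<close> stays bounded for all \<open>r > 1/2\<close>, so the quadratic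
  term suffices.\<close>

lemma bregman_unit_upper:
  assumes p: "p > (1::real)"
  shows "\<exists>C>0. \<forall>e f::'a::real_inner. norm e = 1 \<longrightarrow>
     bregman p e f \<le> C * ((norm f)\<^sup>2 + (if p \<ge> 2 then norm f powr p else 0))"
proof -
  define C where "C = 4 * p + p * (p - 1) / 2 * 2 powr \<bar>p - 2\<bar> + 2 powr p"
  have C: "C \<ge> 4 * p" "C \<ge> p * (p - 1) / 2 * 2 powr \<bar>p - 2\<bar>" "C \<ge> 2 powr p" "C > 0"
    using p by (auto simp: C_def intro!: add_pos_nonneg)
  have key: "r powr p - 1 - p * (r - 1) \<le> C * ((r - 1)\<^sup>2 + (if p \<ge> 2 then \<bar>r - 1\<bar> powr p else 0))" if r: "0 \<le> r" for r
  proof -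
    have nn: "(if p \<ge> 2 then \<bar>r - 1\<bar> powr p else 0) \<ge> 0" by auto
    consider "r = 1" | "r \<le> 1 / 2" | "1 / 2 < r" "r \<noteq> 1" "p < 2 \<or> r \<le> 2" | "p \<ge> 2" "r > 2" by linarith
    then show ?thesis
    proof cases
      case 2
      have "r powr p \<le> 1" using 2 r p by (intro powr_le1) auto
      moreover have "p * r \<ge> 0" using r p by simp
      ultimately have "r powr p - 1 - p * (r - 1) \<le> p" by (simp add: right_diff_distrib)
      also have "\<dots> \<le> C * (1 / 4)" using C(1) by simp
      also have "\<dots> \<le> C * (r - 1)\<^sup>2"
      proof (intro mult_left_mono)
        have "(1 / 2)\<^sup>2 \<le> (1 - r)\<^sup>2" using 2 by (intro power_mono) auto
        then show "1 / 4 \<le> (r - 1)\<^sup>2" by (subst power2_commute) (simp add: power2_eq_square)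
      qed (use C in auto)
      also have "\<dots> \<le> C * ((r - 1)\<^sup>2 + (if p \<ge> 2 then \<bar>r - 1\<bar> powr p else 0))"
        using C nn by (intro mult_left_mono) auto
      finally show ?thesis .
    next
      case 3
      then obtain \<xi> where xi: "min r 1 < \<xi>" "\<xi> < max r 1"
        "r powr p - 1 - p * (r - 1) = p * (p - 1) / 2 * \<xi> powr (p - 2) * (r - 1)\<^sup>2"
        using powr_Taylor2[of r] by auto
      have xi0: "\<xi> > 1 / 2" using xi 3 by (auto simp: min_def split: if_splits)
      have "\<xi> powr (p - 2) \<le> 2 powr \<bar>p - 2\<bar>"
      proof (cases "p \<ge> 2")
        case True
        then have "\<xi> \<le> 2" using 3 xi by auto
        then show ?thesis using xi0 True by (auto intro!: powr_mono2)
      next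
        case False
        then have "\<xi> powr (p - 2) \<le> (1 / 2) powr (p - 2)" using xi0 by (intro powr_mono2') auto
        also have "\<dots> = 2 powr \<bar>p - 2\<bar>" using False by (simp add: powr_divide powr_minus_divide[symmetric])
        finally show ?thesis .
      qed
      then have "p * (p - 1) / 2 * \<xi> powr (p - 2) \<le> p * (p - 1) / 2 * 2 powr \<bar>p - 2\<bar>"
        using p by (intro mult_left_mono) auto
      also have "\<dots> \<le> C" by (rule C)
      finally have "r powr p - 1 - p * (r - 1) \<le> C * (r - 1)\<^sup>2"
        unfolding xi(3) by (intro mult_right_mono) auto
      also have "\<dots> \<le> C * ((r - 1)\<^sup>2 + (if p \<ge> 2 then \<bar>r - 1\<bar> powr p else 0))"
        using C nn by (intro mult_left_mono) auto
      finally show ?thesis .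
    next
      case 4
      have "r powr p - 1 - p * (r - 1) \<le> r powr p" using 4 p mult_nonneg_nonneg[of p "r - 1"] by linarith
      also have "\<dots> \<le> (2 * (r - 1)) powr p" using 4 by (intro powr_mono2) auto
      also have "\<dots> = 2 powr p * \<bar>r - 1\<bar> powr p" using 4 by (subst powr_mult) auto
      also have "\<dots> \<le> C * ((r - 1)\<^sup>2 + (if p \<ge> 2 then \<bar>r - 1\<bar> powr p else 0))"
        using 4 C by (intro mult_mono) auto
      finally show ?thesis .
    qed (use C nn in auto)
  qed
  show ?thesis
  proof (intro exI[of _ "C + p / 2"] conjI allI impI)
    fix e f :: 'a assume e: "norm e = 1"
    define r where "r = norm (e + f)"
    let ?t = "if p \<ge> 2 then norm f powr p else 0"
    have r: "\<bar>r - 1\<bar> \<le> norm f" using bregman_unit(3)[OF e, of f] by (simp add: r_def)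
    then have r2: "(r - 1)\<^sup>2 \<le> (norm f)\<^sup>2" by (metis abs_ge_zero power2_abs power_mono)
    have rp: "(if p \<ge> 2 then \<bar>r - 1\<bar> powr p else 0) \<le> ?t" using r by (auto intro!: powr_mono2)
    have "bregman p e f \<le> C * ((r - 1)\<^sup>2 + (if p \<ge> 2 then \<bar>r - 1\<bar> powr p else 0)) + p / 2 * ((norm f)\<^sup>2 - (r - 1)\<^sup>2)"
      using bregman_unit(1)[OF e, of p f] key[of r] by (simp add: r_def)
    also have "\<dots> \<le> C * ((norm f)\<^sup>2 + ?t) + p / 2 * ((norm f)\<^sup>2 + ?t)"
    proof (intro add_mono mult_left_mono)
      have "0 \<le> ?t" by simp
      then show "(norm f)\<^sup>2 - (r - 1)\<^sup>2 \<le> (norm f)\<^sup>2 + ?t" using zero_le_power2[of "r - 1"] by linarith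
    qed (use r2 rp C p in auto)
    finally show "bregman p e f \<le> (C + p / 2) * ((norm f)\<^sup>2 + ?t)" by (simp add: algebra_simps)
  qed (use C p in auto)
qed

text \<open>Homogeneity of degree \<open>p\<close>, by which the pointwise estimates reduce to
  \<open>norm a = 1\<close>.\<close>

lemma bregman_scale:
  assumes a: "a \<noteq> 0"
  shows "bregman p a b = norm a powr p * bregman p (a /\<^sub>R norm a) (b /\<^sub>R norm a)"
proof -
  have "a + b = norm a *\<^sub>R (a /\<^sub>R norm a + b /\<^sub>R norm a)" using a by (simp add: scaleR_add_right)
  then have "norm (a + b) powr p = norm a powr p * norm (a /\<^sub>R norm a + b /\<^sub>R norm a) powr p"
    by (metis abs_norm_cancel norm_scaleR powr_mult)
  moreover have "norm a powr (p - 2) * (a \<bullet> b) = norm a powr p * ((a /\<^sub>R norm a) \<bullet> (b /\<^sub>R norm a))"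
    using a by (simp add: powr_diff power2_eq_square field_simps)
  ultimately show ?thesis
    using a unfolding bregman_def right_diff_distrib mult.assoc
    by (simp only: norm_scaleR norm_inverse abs_norm_cancel) (simp add: mult.left_commute[of p])
qed

lemma norm_powr_scale: "a \<noteq> 0 \<Longrightarrow> norm a powr p * norm (b /\<^sub>R norm a) powr p = norm b powr p"
  by (simp add: powr_mult[symmetric] mult.assoc[symmetric])

lemma bregman_0: "p > 1 \<Longrightarrow> bregman p 0 b = norm b powr p"
  by (simp add: bregman_def)

lemma bregman_nonneg:
  assumes p: "p > 1" shows "bregman p a b \<ge> 0"
proof (cases "a = 0")
  case False
  then show ?thesis using p by (simp add: bregman_scale[OF False] bregman_unit_nonneg)
qed (simp add: bregman_0 p)

text \<open>On \<open>norm f <= M\<close> the power is at most \<open>M powr (p - 2)\<close> times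
  the square, which is where \<open>p >= 2\<close> enters; beyond \<open>M\<close> the defect is
  comparable with the power.\<close>

lemma norm_powr_le_bregman:
  assumes p: "p \<ge> (2::real)"
  shows "\<exists>C>0. \<forall>a b::'a::real_inner. norm b powr p \<le> C * bregman p a b"
proof -
  have p1: "p > 1" using p by simp
  obtain M where M: "M \<ge> 1" "\<And>e f::'a. norm e = 1 \<Longrightarrow> norm f \<ge> M \<Longrightarrow> norm f powr p \<le> 2 * bregman p e f"
    using bregman_unit_large[OF p1] by metis
  obtain c where c: "c > 0" "\<And>e f::'a. norm e = 1 \<Longrightarrow> norm f \<le> M \<Longrightarrow> c * (norm f)\<^sup>2 \<le> bregman p e f"
    using bregman_unit_small[OF p1, of M] M(1) by fastforce
  define C where "C = 2 + M powr (p - 2) / c"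
  have C: "C \<ge> 2" "C \<ge> M powr (p - 2) / c" "C > 0" using c M by (auto simp: C_def intro!: add_pos_nonneg)
  have unit: "norm f powr p \<le> C * bregman p e f" if e: "norm e = 1" for e f :: 'a
  proof -
    have nn: "bregman p e f \<ge> 0" using bregman_unit_nonneg[OF e, of p] p by simp
    show ?thesis
    proof (cases "norm f \<ge> M")
      case True
      have "2 * bregman p e f \<le> C * bregman p e f" using C nn by (intro mult_right_mono) auto
      then show ?thesis using M(2)[OF e True] by linarith
    next
      case False
      have "norm f powr p = norm f powr (p - 2) * (norm f)\<^sup>2"
        by (cases "f = 0") (auto simp: powr_diff)
      also have "\<dots> \<le> M powr (p - 2) * (bregman p e f / c)"
        using False p c(2)[OF e, of f] c(1) by (intro mult_mono powr_mono2) (auto simp: field_simps)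
      also have "\<dots> \<le> C * bregman p e f"
        using mult_right_mono[OF C(2) nn] by simp
      finally show ?thesis .
    qed
  qed
  show ?thesis
  proof (intro exI[of _ C] conjI allI C)
    fix a b :: 'a
    show "norm b powr p \<le> C * bregman p a b"
    proof (cases "a = 0")
      case True
      then show ?thesis using mult_right_mono[of 1 C "norm b powr p"] C p1 by (simp add: bregman_0)
    next
      case False
      have "norm b powr p = norm a powr p * norm (b /\<^sub>R norm a) powr p"
        using False by (rule norm_powr_scale[symmetric])
      also have "\<dots> \<le> norm a powr p * (C * bregman p (a /\<^sub>R norm a) (b /\<^sub>R norm a))"
        using False by (intro mult_left_mono unit) auto
      finally show ?thesis using False by (simp add: bregman_scale[OF False] mult_ac)
    qed
  qed
qed

text \<open>The added \<open>norm a powr p\<close> pays for the range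
  \<open>norm b <= M * norm a\<close>, so the estimate covers all \<open>p > 1\<close>. On a
  logarithmic shell the integral of the added term is under control.\<close>

lemma norm_powr_le_bregman_add:
  assumes p: "p > (1::real)"
  shows "\<exists>C>0. \<forall>a b::'a::real_inner. norm b powr p \<le> C * (bregman p a b + norm a powr p)"
proof -
  obtain M where M: "M \<ge> 1" "\<And>e f::'a. norm e = 1 \<Longrightarrow> norm f \<ge> M \<Longrightarrow> norm f powr p \<le> 2 * bregman p e f"
    using bregman_unit_large[OF p] by metis
  define C where "C = 2 + M powr p"
  have C: "C \<ge> 2" "C \<ge> M powr p" "C > 0" using M by (auto simp: C_def intro!: add_pos_nonneg)
  have unit: "norm f powr p \<le> C * (bregman p e f + 1)" if e: "norm e = 1" for e f :: 'a
  proof -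
    have nn: "bregman p e f \<ge> 0" using bregman_unit_nonneg[OF e, of p] p by simp
    show ?thesis
    proof (cases "norm f \<ge> M")
      case True
      have "2 * bregman p e f \<le> C * (bregman p e f + 1)" using C nn by (intro mult_mono) auto
      then show ?thesis using M(2)[OF e True] by linarith
    next
      case False
      have "norm f powr p \<le> M powr p" using False p by (intro powr_mono2) auto
      also have "\<dots> \<le> C * 1" using C by simp
      also have "\<dots> \<le> C * (bregman p e f + 1)" using C nn by (intro mult_left_mono) auto
      finally show ?thesis .
    qed
  qed
  show ?thesis
  proof (intro exI[of _ C] conjI allI C)
    fix a b :: 'a
    show "norm b powr p \<le> C * (bregman p a b + norm a powr p)"
    proof (cases "a = 0")
      case True
      then show ?thesis using mult_right_mono[of 1 C "norm b powr p"] C p by (simp add: bregman_0)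
    next
      case False
      have "norm b powr p = norm a powr p * norm (b /\<^sub>R norm a) powr p"
        using False by (rule norm_powr_scale[symmetric])
      also have "\<dots> \<le> norm a powr p * (C * (bregman p (a /\<^sub>R norm a) (b /\<^sub>R norm a) + 1))"
        using False by (intro mult_left_mono unit) auto
      finally show ?thesis using False by (simp add: bregman_scale[OF False] algebra_simps)
    qed
  qed
qed

text \<open>After scaling to \<open>norm a = 1\<close>: for bounded \<open>norm f\<close> the defect
  dominates its square, which gives the square root, and for large \<open>norm f\<close> it
  dominates \<open>norm f powr p\<close>, hence \<open>norm f\<close>. The square root is prepared
  for the Cauchy-Schwarz inequality.\<close>

lemma cross_term_le_bregman:
  assumes p: "p > (1::real)"
  shows "\<exists>C>0. \<forall>a b::'a::real_inner. norm a powr (p - 1) * norm b \<le>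
     C * (sqrt (norm a powr p * bregman p a b) + bregman p a b)"
proof -
  obtain M where M: "M \<ge> 1" "\<And>e f::'a. norm e = 1 \<Longrightarrow> norm f \<ge> M \<Longrightarrow> norm f powr p \<le> 2 * bregman p e f"
    using bregman_unit_large[OF p] by metis
  obtain c where c: "c > 0" "\<And>e f::'a. norm e = 1 \<Longrightarrow> norm f \<le> M \<Longrightarrow> c * (norm f)\<^sup>2 \<le> bregman p e f"
    using bregman_unit_small[OF p, of M] M(1) by fastforce
  define C where "C = 2 + 1 / sqrt c"
  have C: "C \<ge> 2" "C \<ge> 1 / sqrt c" "C > 0" using c by (auto simp: C_def intro!: add_pos_nonneg)
  have unit: "norm f \<le> C * (sqrt (bregman p e f) + bregman p e f)" if e: "norm e = 1" for e f :: 'a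
  proof -
    have nn: "bregman p e f \<ge> 0" using bregman_unit_nonneg[OF e, of p] p by simp
    show ?thesis
    proof (cases "norm f \<ge> M")
      case True
      have "norm f powr 1 \<le> norm f powr p" using True M p by (intro powr_mono) auto
      also have "\<dots> \<le> 2 * bregman p e f" by (rule M(2)[OF e True])
      also have "\<dots> \<le> C * (sqrt (bregman p e f) + bregman p e f)" using C nn by (intro mult_mono) auto
      finally show ?thesis using True M by simp
    next
      case False
      then have "sqrt (c * (norm f)\<^sup>2) \<le> sqrt (bregman p e f)" using c(2)[OF e, of f] by simp
      then have "norm f \<le> 1 / sqrt c * sqrt (bregman p e f)"
        using c(1) by (simp add: real_sqrt_mult field_simps)
      also have "\<dots> \<le> C * (sqrt (bregman p e f) + bregman p e f)" using C nn by (intro mult_mono) auto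
      finally show ?thesis .
    qed
  qed
  show ?thesis
  proof (intro exI[of _ C] conjI allI C)
    fix a b :: 'a
    show "norm a powr (p - 1) * norm b \<le> C * (sqrt (norm a powr p * bregman p a b) + bregman p a b)"
    proof (cases "a = 0")
      case True
      then show ?thesis using C p by (simp add: bregman_0)
    next
      case False
      have "norm a powr (p - 1) * norm b = norm a powr p * norm (b /\<^sub>R norm a)"
        using False by (simp add: powr_diff divide_inverse mult_ac)
      also have "\<dots> \<le> norm a powr p * (C * (sqrt (bregman p (a /\<^sub>R norm a) (b /\<^sub>R norm a)) + bregman p (a /\<^sub>R norm a) (b /\<^sub>R norm a)))"
        using False by (intro mult_left_mono unit) auto
      finally have "norm a powr (p - 1) * norm b \<le> C * (norm a powr p * sqrt (bregman p (a /\<^sub>R norm a) (b /\<^sub>R norm a))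
          + norm a powr p * bregman p (a /\<^sub>R norm a) (b /\<^sub>R norm a))" by (simp add: algebra_simps)
      moreover have "sqrt (A * (A * X)) = A * sqrt X" if "A \<ge> 0" for A X :: real
        using that by (simp add: real_sqrt_mult flip: mult.assoc)
      ultimately show ?thesis by (simp add: bregman_scale[OF False])
    qed
  qed
qed

text \<open>Serves the extremal family, whose \<open>b\<close> carries an extra factor
  \<open>1 / T\<close>, so that the quadratic term has the right size.\<close>

lemma bregman_upper:
  assumes p: "p > (1::real)"
  shows "\<exists>C>0. \<forall>a b::'a::real_inner. a \<noteq> 0 \<longrightarrow>
     bregman p a b \<le> C * (norm a powr (p - 2) * (norm b)\<^sup>2 + (if p \<ge> 2 then norm b powr p else 0))"
proof -
  obtain C where C: "C > 0" "\<And>e f::'a. norm e = 1 \<Longrightarrow>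
     bregman p e f \<le> C * ((norm f)\<^sup>2 + (if p \<ge> 2 then norm f powr p else 0))"
    using bregman_unit_upper[OF p] by metis
  show ?thesis
  proof (intro exI[of _ C] conjI allI impI C)
    fix a b :: 'a assume a: "a \<noteq> 0"
    have "bregman p a b \<le> norm a powr p * (C * ((norm (b /\<^sub>R norm a))\<^sup>2 + (if p \<ge> 2 then norm (b /\<^sub>R norm a) powr p else 0)))"
      unfolding bregman_scale[OF a] using a by (intro mult_left_mono C(2)) auto
    also have "\<dots> = C * (norm a powr p * (norm (b /\<^sub>R norm a))\<^sup>2 + (if p \<ge> 2 then norm a powr p * norm (b /\<^sub>R norm a) powr p else 0))"
      by (simp add: algebra_simps)
    also have "norm a powr p * (norm (b /\<^sub>R norm a))\<^sup>2 = norm a powr (p - 2) * (norm b)\<^sup>2"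
      using a by (simp add: powr_diff field_simps)
    also have "norm a powr p * norm (b /\<^sub>R norm a) powr p = norm b powr p"
      using a by (rule norm_powr_scale)
    finally show "bregman p a b \<le> C * (norm a powr (p - 2) * (norm b)\<^sup>2 + (if p \<ge> 2 then norm b powr p else 0))" .
  qed
qed

subsection \<open>The Hardy identity\<close>

context coordinate_plane
begin

text \<open>For \<open>u = dst powr (- h)\<close> this is the gradient of \<open>u\<close> and
  \<open>tgrad\<close> vanishes; with \<open>h = H\<close> that function is the virtual extremal of
  Hardy's inequality, and \<open>tgrad\<close> measures the deviation from it.\<close>

definition rgrad :: "real \<Rightarrow> ('a \<Rightarrow> real) \<Rightarrow> 'a \<Rightarrow> 'a" where
  "rgrad h u x = - (h * u x / (dst x)\<^sup>2) *\<^sub>R y x"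

lemma rgrad_add_tgrad: "rgrad h u x + tgrad h u g x = g x"
  by (simp add: rgrad_def tgrad_def)

lemma norm_rgrad: "x \<in> U \<Longrightarrow> norm (rgrad h u x) = \<bar>h\<bar> * \<bar>u x\<bar> / dst x"
  using dst_pos[of x] by (simp add: rgrad_def abs_mult dst_def[symmetric] power2_eq_square)

lemma norm_rgrad_powr: "x \<in> U \<Longrightarrow> norm (rgrad h u x) powr p = \<bar>h\<bar> powr p * (\<bar>u x\<bar> powr p / dst x powr p)"
  using dst_ge_0[of x] by (simp add: norm_rgrad powr_mult powr_divide)

lemma continuous_on_rgrad: "C1c V u g \<Longrightarrow> continuous_on U (rgrad h u)"
  unfolding rgrad_def[abs_def] by (intro continuous_intros C1c_continuous_on) (auto simp: U_eq)

lemma continuous_on_norm_powr: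
  "continuous_on A f \<Longrightarrow> r > 0 \<Longrightarrow> continuous_on A (\<lambda>x. norm (f x) powr r)"
  by (intro continuous_on_powr' continuous_intros) auto

lemma integrable_norm_powr:
  fixes f :: "'a \<Rightarrow> 'b::real_normed_vector"
  assumes "C1c U u g" "continuous_on U f" "r > 0" "\<And>x. u x = 0 \<Longrightarrow> g x = 0 \<Longrightarrow> f x = 0"
  shows "integrable lborel (\<lambda>x. norm (f x) powr r)"
  by (rule C1c_integrable[OF assms(1) continuous_on_norm_powr[OF assms(2,3)]]) (use assms in auto)

lemma integrable_grad_powr: "C1c U u g \<Longrightarrow> r > 0 \<Longrightarrow> integrable lborel (\<lambda>x. norm (g x) powr r)"
  by (rule integrable_norm_powr) (auto intro: C1c_continuous_on)

lemma integrable_tgrad_powr: "C1c U u g \<Longrightarrow> r > 0 \<Longrightarrow> integrable lborel (\<lambda>x. norm (tgrad h u g x) powr r)"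
  using integrable_norm_powr[OF _ continuous_on_tgrad, of u g] by (auto simp: tgrad_def)

text \<open>The divergence theorem for \<open>\<bar>u\<bar> powr p * \<rho> (dst x)\<close> with
  exponent \<open>- p\<close>. Since \<open>p * H = card S - p\<close>, the term in which neither
  \<rho> nor \<open>u\<close> is differentiated cancels; \<open>\<rho>'\<close> stays paired with
  the potential and \<rho> with \<open>tgrad\<close>.\<close>

lemma integral_radial_test:
  fixes p :: real and \<rho> \<rho>' :: "real \<Rightarrow> real"
  defines "H \<equiv> (real (card S) - p) / p"
  assumes T: "open T" "T \<subseteq> {0<..}" and u: "C1c (dst -` T) u g" and p: "p > 1"
    and \<rho>: "\<And>s. s \<in> T \<Longrightarrow> (\<rho> has_real_derivative \<rho>' s) (at s)" "continuous_on T \<rho>'"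
  shows "(\<integral>x. \<bar>u x\<bar> powr p * dst x powr (1 - p) * \<rho>' (dst x)
     + p * (dst x powr (- p) * \<rho> (dst x) * (\<bar>u x\<bar> powr (p - 1) * sgn (u x) * (y x \<bullet> tgrad H u g x))) \<partial>lborel) = 0"
proof -
  let ?V = "dst -` T"
  have V: "open ?V" by (rule open_vimage[OF T(1)]) (rule continuous_on_dst)
  have VU: "?V \<subseteq> U" using T(2) by (auto simp: U_eq)
  let ?P = "\<lambda>x. \<bar>u x\<bar> powr (p - 1) * sgn (u x)"
  have up: "C1c ?V (\<lambda>x. \<bar>u x\<bar> powr p) (\<lambda>x. (p * ?P x) *\<^sub>R g x)"
    by (rule C1c_compose[OF u has_real_derivative_abs_powr])
       (use p in \<open>auto intro!: continuous_on_mult_left continuous_on_abs_powr_sgn\<close>)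
  let ?g = "\<lambda>x. \<rho> (dst x) *\<^sub>R ((p * ?P x) *\<^sub>R g x) + \<bar>u x\<bar> powr p *\<^sub>R ((\<rho>' (dst x) / dst x) *\<^sub>R y x)"
  have "C1c ?V (\<lambda>x. \<bar>u x\<bar> powr p * \<rho> (dst x)) ?g"
  proof (rule C1c_mult[OF up V])
    show "((\<lambda>x. \<rho> (dst x)) has_derivative (\<lambda>v. (\<rho>' (dst x) / dst x) *\<^sub>R y x \<bullet> v)) (at x)" if "x \<in> ?V" for x
      by (rule has_derivative_radial) (use that VU \<rho> in auto)
    show "continuous_on ?V (\<lambda>x. (\<rho>' (dst x) / dst x) *\<^sub>R y x)"
      using T(2) by (intro continuous_intros continuous_on_compose2[OF \<rho>(2)]) auto
  qed
  then have G: "C1c U (\<lambda>x. \<bar>u x\<bar> powr p * \<rho> (dst x)) ?g" using VU by (rule C1c_mono)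
  have uU: "C1c U u g" using u VU by (rule C1c_mono)
  have "(\<integral>x. \<bar>u x\<bar> powr p * dst x powr (1 - p) * \<rho>' (dst x)
     + p * (dst x powr (- p) * \<rho> (dst x) * (?P x * (y x \<bullet> tgrad H u g x))) \<partial>lborel)
    = (\<integral>x. (real (card S) + - p) * dst x powr (- p) * (\<bar>u x\<bar> powr p * \<rho> (dst x)) + dst x powr (- p) * (y x \<bullet> ?g x) \<partial>lborel)"
  proof (intro Bochner_Integration.integral_cong refl)
    fix x
    show "\<bar>u x\<bar> powr p * dst x powr (1 - p) * \<rho>' (dst x)
     + p * (dst x powr (- p) * \<rho> (dst x) * (?P x * (y x \<bullet> tgrad H u g x)))
     = (real (card S) + - p) * dst x powr (- p) * (\<bar>u x\<bar> powr p * \<rho> (dst x)) + dst x powr (- p) * (y x \<bullet> ?g x)"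
    proof (cases "x \<in> U")
      case True
      have d: "dst x > 0" using True by (rule dst_pos)
      have Pu: "?P x * u x = \<bar>u x\<bar> powr p" using p by (cases "u x = 0") (auto simp: powr_diff sgn_if)
      have yy: "y x \<bullet> y x = (dst x)\<^sup>2" by (simp add: dst_def power2_norm_eq_inner)
      have pH: "p * H = real (card S) - p" using p by (simp add: H_def)
      have "y x \<bullet> ?g x = p * \<rho> (dst x) * (?P x * (y x \<bullet> tgrad H u g x)) - p * H * \<rho> (dst x) * (?P x * u x)
          + \<bar>u x\<bar> powr p * \<rho>' (dst x) * dst x"
        using d by (simp add: inner_add_right y_inner_tgrad[OF uU, where h = H] yy power2_eq_square algebra_simps)
      also have "\<dots> = p * \<rho> (dst x) * (?P x * (y x \<bullet> tgrad H u g x)) - (real (card S) - p) * \<rho> (dst x) * \<bar>u x\<bar> powr p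
          + \<bar>u x\<bar> powr p * \<rho>' (dst x) * dst x" unfolding Pu pH ..
      finally have yg: "y x \<bullet> ?g x = \<dots>" .
      have d1: "dst x powr (1 - p) = dst x powr (- p) * dst x"
        using d powr_add[of "dst x" "- p" 1] by (simp add: add.commute)
      show ?thesis unfolding yg d1 by (simp add: algebra_simps)
    next
      case False
      then show ?thesis using p C1c_zero_outside[OF uU False] by simp
    qed
  qed
  also have "\<dots> = 0" by (rule integral_div_radial[OF G])
  finally show ?thesis .
qed

text \<open>The linear term of the Bregman distance is, up to a constant, the integrand whose
  integral vanishes by \<open>integral_radial_test\<close> with \<open>\<rho> = 1\<close>.\<close>

lemma bregman_field_eq:
  fixes p :: real
  defines "H \<equiv> (real (card S) - p) / p"
  assumes u: "C1c U u g" and p: "p > 1"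
  shows "bregman p (rgrad H u x) (tgrad H u g x) =
      norm (g x) powr p - \<bar>H\<bar> powr p * (\<bar>u x\<bar> powr p / dst x powr p)
      + p * \<bar>H\<bar> powr (p - 2) * H * (dst x powr (- p) * (\<bar>u x\<bar> powr (p - 1) * sgn (u x) * (y x \<bullet> tgrad H u g x)))"
proof (cases "x \<in> U")
  case True
  let ?P = "\<lambda>x. \<bar>u x\<bar> powr (p - 1) * sgn (u x)"
  have d: "dst x > 0" using True by (rule dst_pos)
  have "p * norm (rgrad H u x) powr (p - 2) * (rgrad H u x \<bullet> tgrad H u g x)
     = - (p * \<bar>H\<bar> powr (p - 2) * H * (dst x powr (- p) * (?P x * (y x \<bullet> tgrad H u g x))))"
  proof (cases "u x = 0 \<or> H = 0")
    case True
    then show ?thesis by (auto simp: rgrad_def)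
  next
    case False
    have s: "\<bar>u x\<bar> powr (p - 2) * u x = ?P x"
      using False by (auto simp: powr_diff sgn_if power2_eq_square)
    have e: "dst x powr (p - 2) * (dst x)\<^sup>2 = dst x powr p"
      using d by (simp add: powr_diff)
    have "p * norm (rgrad H u x) powr (p - 2) * (rgrad H u x \<bullet> tgrad H u g x)
      = - (p * \<bar>H\<bar> powr (p - 2) * H * (\<bar>u x\<bar> powr (p - 2) * u x) / (dst x powr (p - 2) * (dst x)\<^sup>2) * (y x \<bullet> tgrad H u g x))"
      unfolding norm_rgrad_powr[OF \<open>x \<in> U\<close>] using d by (simp add: rgrad_def mult_ac)
    then show ?thesis
      unfolding s e by (simp add: powr_minus divide_inverse mult_ac)
  qed
  then show ?thesis unfolding bregman_def rgrad_add_tgrad norm_rgrad_powr[OF True] by simp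
next
  case False
  then show ?thesis using C1c_zero_outside[OF u False] p by (simp add: bregman_def rgrad_def tgrad_def)
qed

lemma bregman_field_zero: "p > 1 \<Longrightarrow> u x = 0 \<Longrightarrow> g x = 0 \<Longrightarrow> bregman p (rgrad H u x) (tgrad H u g x) = 0"
  by (simp add: bregman_def rgrad_def tgrad_def)

lemma continuous_on_abs_powr_sgn_compose:
  assumes u: "C1c V u g" and p: "p > 1"
  shows "continuous_on A (\<lambda>x. \<bar>u x\<bar> powr (p - 1) * sgn (u x))"
  using continuous_on_compose2[OF continuous_on_abs_powr_sgn[of "p - 1"] C1c_continuous_on(1)[OF u, of A]] p by auto

lemma continuous_on_potential:
  assumes "C1c V u g" "p > 0"
  shows "continuous_on U (\<lambda>x. \<bar>u x\<bar> powr p / dst x powr p)"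
  by (intro continuous_on_divide continuous_on_powr' continuous_on_rabs C1c_continuous_on[OF assms(1)]
       continuous_on_dst continuous_on_const) (use assms dst_pos in \<open>auto simp: dst_ge_0 less_imp_neq[symmetric]\<close>)

text \<open>Read off from \<open>bregman_field_eq\<close> rather than from the definition: for
  \<open>p < 2\<close> the factor \<open>norm a powr (p - 2)\<close> is not continuous where
  \<open>a = 0\<close>.\<close>

lemma continuous_on_bregman_field:
  fixes p :: real
  defines "H \<equiv> (real (card S) - p) / p"
  assumes u: "C1c U u g" and p: "p > 1"
  shows "continuous_on U (\<lambda>x. bregman p (rgrad H u x) (tgrad H u g x))"
  unfolding bregman_field_eq[OF u p] H_def
  by (intro continuous_on_add continuous_on_diff continuous_on_mult continuous_on_const continuous_on_inner
      continuous_on_norm_powr C1c_continuous_on[OF u]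
      continuous_on_potential[OF u] continuous_on_tgrad[OF u] continuous_on_dst_powr continuous_on_y
      continuous_on_abs_powr_sgn_compose[OF u p]) (use p in auto)

text \<open>The second claim is the Hardy identity: choosing \<open>\<rho> = 1\<close> in
  \<open>integral_radial_test\<close> removes the linear term.\<close>

lemma integrable_bregman:
  assumes u: "C1c U u g" and p: "p > 1"
  defines "H \<equiv> (real (card S) - p) / p"
  shows "integrable lborel (\<lambda>x. bregman p (rgrad H u x) (tgrad H u g x))"
    and "(\<integral>x. norm (g x) powr p \<partial>lborel) - \<bar>H\<bar> powr p * (\<integral>x. \<bar>u x\<bar> powr p / dst x powr p \<partial>lborel)
       = (\<integral>x. bregman p (rgrad H u x) (tgrad H u g x) \<partial>lborel)"
proof -
  let ?R = "\<lambda>x. dst x powr (- p) * (\<bar>u x\<bar> powr (p - 1) * sgn (u x) * (y x \<bullet> tgrad H u g x))"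
  have iR: "integrable lborel ?R"
    by (rule C1c_integrable[OF u])
       (use p in \<open>auto intro!: continuous_intros continuous_on_abs_powr_sgn_compose[OF u p] continuous_on_tgrad[OF u]\<close>)
  have ig: "integrable lborel (\<lambda>x. norm (g x) powr p)" using u p by (intro integrable_grad_powr) auto
  have iu: "integrable lborel (\<lambda>x. \<bar>u x\<bar> powr p / dst x powr p)"
    by (rule C1c_integrable[OF u continuous_on_potential[OF u]]) (use p in auto)
  note br = bregman_field_eq[OF u p, folded H_def]
  show "integrable lborel (\<lambda>x. bregman p (rgrad H u x) (tgrad H u g x))"
    unfolding br using ig iu iR by (simp del: times_divide_eq_right)
  have "C1c (dst -` {0<..}) u g" by (rule C1c_mono[OF u]) (auto dest: dst_pos)
  from integral_radial_test[OF _ _ this p, of "\<lambda>_. 1" "\<lambda>_. 0"] p have R0: "(\<integral>x. ?R x \<partial>lborel) = 0"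
    by (simp add: H_def)
  show "(\<integral>x. norm (g x) powr p \<partial>lborel) - \<bar>H\<bar> powr p * (\<integral>x. \<bar>u x\<bar> powr p / dst x powr p \<partial>lborel)
       = (\<integral>x. bregman p (rgrad H u x) (tgrad H u g x) \<partial>lborel)"
    unfolding br using ig iu iR R0 by (simp del: times_divide_eq_right)
qed

text \<open>The defect dominates \<open>norm (tgrad H u g x) powr p\<close>, so
  \<open>weighted_Sobolev\<close> with \<open>h = H\<close> concludes once its constant is known to
  be nonzero.\<close>

lemma Hardy_Sobolev_C1c:
  fixes p q :: real
  defines "N \<equiv> real DIM('a)" and "H \<equiv> (real (card S) - p) / p"
  assumes S: "S \<noteq> {}" "card S < DIM('a)" and p: "2 \<le> p" "p < N" and q: "p < q" "q \<le> N * p / (N - p)"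
  shows "\<exists>c>0. \<forall>u g. C1c U u g \<longrightarrow>
     \<bar>H\<bar> powr p * (\<integral>x. \<bar>u x\<bar> powr p / dst x powr p \<partial>lborel)
       + c * (\<integral>x. \<bar>u x\<bar> powr q * dst x powr (- q - N + N * q / p) \<partial>lborel) powr (p / q)
     \<le> (\<integral>x. norm (g x) powr p \<partial>lborel)"
proof -
  let ?\<sigma> = "1 + q * (p - 1) / p"
  have "card S \<ge> 1" using S(1) finite_S by (simp add: Suc_leI card_gt_0_iff)
  then have N2: "DIM('a) \<ge> 2" using S(2) by linarith
  have kN: "real (card S) < N" using S(2) by (simp add: N_def)
  \<comment> \<open>Equal to \<open>(N - k) * (\<sigma> / p - 1)\<close> with
    \<open>k = card S\<close>; the factors are positive because \<open>k < N\<close> and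
    \<open>q > p\<close>.\<close>
  have "real (card S) - 1 + (1 - N + ?\<sigma> * (N - p) / p) - ?\<sigma> * H = (N - real (card S)) * ((p - 1) * (q - p) / (p * p))"
    using p by (simp add: H_def field_simps)
  also have "\<dots> > 0" using kN p q by (intro mult_pos_pos divide_pos_pos) auto
  finally have \<kappa>: "real (card S) - 1 + (1 - N + ?\<sigma> * (N - p) / p) - ?\<sigma> * H \<noteq> 0" by simp
  obtain C where C: "C > 0" "\<And>u g. C1c U u g \<Longrightarrow>
     (\<integral>x. \<bar>u x\<bar> powr q * dst x powr (- q - N + N * q / p) \<partial>lborel) powr (p / q) \<le> C * (\<integral>x. norm (tgrad H u g x) powr p \<partial>lborel)"
    using weighted_Sobolev[of p q H] N2 p q \<kappa> unfolding N_def by auto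
  obtain B where B: "B > 0" "\<And>a b::'a. norm b powr p \<le> B * bregman p a b"
    using norm_powr_le_bregman[OF p(1)] by metis
  show ?thesis
  proof (intro exI[of _ "1 / (C * B)"] conjI allI impI)
    fix u g assume u: "C1c U u g"
    have p1: "p > 1" using p by simp
    have "(\<integral>x. norm (tgrad H u g x) powr p \<partial>lborel) \<le> (\<integral>x. B * bregman p (rgrad H u x) (tgrad H u g x) \<partial>lborel)"
      using integrable_bregman(1)[OF u p1] integrable_tgrad_powr[OF u, of p] p B
      by (intro integral_mono) (auto simp: H_def)
    also have "\<dots> = B * (\<integral>x. bregman p (rgrad H u x) (tgrad H u g x) \<partial>lborel)" by simp
    finally have "C * (\<integral>x. norm (tgrad H u g x) powr p \<partial>lborel) \<le> C * (B * (\<integral>x. bregman p (rgrad H u x) (tgrad H u g x) \<partial>lborel))"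
      using C by (intro mult_left_mono) auto
    with C(2)[OF u] have "(\<integral>x. \<bar>u x\<bar> powr q * dst x powr (- q - N + N * q / p) \<partial>lborel) powr (p / q)
       \<le> C * B * (\<integral>x. bregman p (rgrad H u x) (tgrad H u g x) \<partial>lborel)" by simp
    then have "1 / (C * B) * (\<integral>x. \<bar>u x\<bar> powr q * dst x powr (- q - N + N * q / p) \<partial>lborel) powr (p / q)
       \<le> (\<integral>x. bregman p (rgrad H u x) (tgrad H u g x) \<partial>lborel)"
      using C B by (simp add: field_simps)
    then show "\<bar>H\<bar> powr p * (\<integral>x. \<bar>u x\<bar> powr p / dst x powr p \<partial>lborel)
       + 1 / (C * B) * (\<integral>x. \<bar>u x\<bar> powr q * dst x powr (- q - N + N * q / p) \<partial>lborel) powr (p / q)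
     \<le> (\<integral>x. norm (g x) powr p \<partial>lborel)"
      using integrable_bregman(2)[OF u p1] unfolding H_def by linarith
  qed (use C B in auto)
qed

end

section \<open>Testing with radial fields\<close>

context coordinate_plane
begin

text \<open>In \<open>integral_radial_test\<close> the part with \<open>\<rho>'\<close> is minus the
  part with \<open>tgrad\<close>. The latter is bounded pointwise by
  \<open>cross_term_le_bregman\<close>, and Cauchy-Schwarz on the square root puts all of \<rho>
  next to \<open>norm (rgrad H u x) powr p\<close>. The constant is uniform in \<open>T\<close>,
  \<rho> and \<open>u\<close>.\<close>

lemma radial_test_bound:
  fixes p :: real
  defines "H \<equiv> (real (card S) - p) / p"
  assumes p: "p > 1" and H: "H \<noteq> 0"
  shows "\<exists>C>0. \<forall>T \<rho> \<rho>' u g. open T \<and> T \<subseteq> {0<..} \<and> C1c (dst -` T) u g \<and>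
     (\<forall>s\<in>T. (\<rho> has_real_derivative \<rho>' s) (at s)) \<and> continuous_on T \<rho>' \<longrightarrow>
     \<bar>\<integral>x. \<bar>u x\<bar> powr p * dst x powr (1 - p) * \<rho>' (dst x) \<partial>lborel\<bar>
     \<le> C * (sqrt (\<integral>x. (\<rho> (dst x))\<^sup>2 * norm (rgrad H u x) powr p \<partial>lborel)
              * sqrt (\<integral>x. bregman p (rgrad H u x) (tgrad H u g x) \<partial>lborel)
           + (\<integral>x. \<bar>\<rho> (dst x)\<bar> * bregman p (rgrad H u x) (tgrad H u g x) \<partial>lborel))"
proof -
  obtain C where C: "C > 0" "\<And>a b::'a. norm a powr (p - 1) * norm b \<le> C * (sqrt (norm a powr p * bregman p a b) + bregman p a b)"
    using cross_term_le_bregman[OF p] by metis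
  \<comment> \<open>The factor \<open>\<bar>H\<bar> powr (1 - p)\<close> converts
    \<open>(\<bar>u x\<bar> / dst x) powr (p - 1)\<close> into
    \<open>norm (rgrad H u x) powr (p - 1)\<close>; here \<open>H \<noteq> 0\<close> is
    essential.\<close>
  define C1 where "C1 = p * \<bar>H\<bar> powr (1 - p) * C"
  have C1: "C1 > 0" using p H C by (simp add: C1_def)
  show ?thesis
  proof (intro exI[of _ C1] conjI allI impI C1, elim conjE)
    fix T \<rho> \<rho>' u g
    assume T: "open T" "T \<subseteq> {0<..}" and u: "C1c (dst -` T) u g"
      and \<rho>: "\<forall>s\<in>T. (\<rho> has_real_derivative \<rho>' s) (at s)" "continuous_on T \<rho>'"
    let ?V = "dst -` T"
    have VU: "?V \<subseteq> U" using T(2) by (auto simp: U_eq)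
    have uU: "C1c U u g" using u VU by (rule C1c_mono)
    let ?a = "rgrad H u" and ?b = "tgrad H u g"
    let ?j = "\<lambda>x. bregman p (?a x) (?b x)"
    let ?R1 = "\<lambda>x. \<bar>u x\<bar> powr p * dst x powr (1 - p) * \<rho>' (dst x)"
    let ?R2 = "\<lambda>x. p * (dst x powr (- p) * \<rho> (dst x) * (\<bar>u x\<bar> powr (p - 1) * sgn (u x) * (y x \<bullet> ?b x)))"
    have c_rho: "continuous_on ?V (\<lambda>x. \<rho> (dst x))"
      by (rule continuous_on_compose2[OF DERIV_continuous_on continuous_on_dst, of T \<rho> \<rho>'])
         (use \<rho>(1) in \<open>auto intro: has_field_derivative_at_within\<close>)
    have c_rho': "continuous_on ?V (\<lambda>x. \<rho>' (dst x))"
      by (rule continuous_on_compose2[OF \<rho>(2) continuous_on_dst]) auto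
    have cj: "continuous_on ?V ?j" and ca: "continuous_on ?V ?a" and cb: "continuous_on ?V ?b"
      and cd: "continuous_on ?V (\<lambda>x. dst x powr \<beta>)" for \<beta>
      using continuous_on_bregman_field[OF uU p] continuous_on_rgrad[OF uU] continuous_on_tgrad[OF uU] continuous_on_dst_powr
        continuous_on_subset[OF _ VU] by (auto simp: H_def)
    have cap: "continuous_on ?V (\<lambda>x. norm (?a x) powr p)" using p by (intro continuous_on_norm_powr ca) auto
    have z: "?j x = 0" "?a x = 0" "?b x = 0" if "u x = 0" "g x = 0" for x
      using bregman_field_zero[of p u x g H] p that by (auto simp: rgrad_def tgrad_def)
    have jpos: "?j x \<ge> 0" for x by (rule bregman_nonneg[OF p])
    have i1: "integrable lborel ?R1"
      by (rule C1c_integrable[OF u]) (use p in \<open>auto intro!: continuous_intros cd c_rho' continuous_on_powr' C1c_continuous_on[OF u]\<close>)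
    have i2: "integrable lborel ?R2"
      by (rule C1c_integrable[OF u]) (use p in \<open>auto intro!: continuous_on_mult continuous_on_const continuous_on_inner cd c_rho
            continuous_on_y cb continuous_on_abs_powr_sgn_compose[OF u p]\<close>)
    have i3: "integrable lborel (\<lambda>x. \<bar>\<rho> (dst x)\<bar> * sqrt (norm (?a x) powr p * ?j x))"
      by (rule C1c_integrable[OF u]) (use z in \<open>auto intro!: continuous_intros c_rho cap cj\<close>)
    have i4: "integrable lborel (\<lambda>x. \<bar>\<rho> (dst x)\<bar> * ?j x)"
      by (rule C1c_integrable[OF u]) (use z in \<open>auto intro!: continuous_intros c_rho cj\<close>)
    have i5: "integrable lborel (\<lambda>x. (\<rho> (dst x))\<^sup>2 * norm (?a x) powr p)"
      by (rule C1c_integrable[OF u]) (use z in \<open>auto intro!: continuous_intros c_rho cap\<close>)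
    have i6: "integrable lborel ?j"
      by (rule C1c_integrable[OF u]) (use z in \<open>auto intro!: continuous_intros cj\<close>)
    have "(\<integral>x. ?R1 x + ?R2 x \<partial>lborel) = 0"
      unfolding H_def by (rule integral_radial_test[OF T u p]) (use \<rho> in auto)
    then have "\<bar>\<integral>x. ?R1 x \<partial>lborel\<bar> = \<bar>\<integral>x. ?R2 x \<partial>lborel\<bar>"
      using i1 i2 by (subst (asm) Bochner_Integration.integral_add) auto
    also have "\<dots> \<le> (\<integral>x. C1 * (\<bar>\<rho> (dst x)\<bar> * sqrt (norm (?a x) powr p * ?j x) + \<bar>\<rho> (dst x)\<bar> * ?j x) \<partial>lborel)"
    proof (rule order_trans[OF integral_abs_bound], rule integral_mono)
      show "integrable lborel (\<lambda>x. \<bar>?R2 x\<bar>)" using i2 by (rule integrable_abs)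
      show "integrable lborel (\<lambda>x. C1 * (\<bar>\<rho> (dst x)\<bar> * sqrt (norm (?a x) powr p * ?j x) + \<bar>\<rho> (dst x)\<bar> * ?j x))"
        using i3 i4 by simp
      fix x
      show "\<bar>?R2 x\<bar> \<le> C1 * (\<bar>\<rho> (dst x)\<bar> * sqrt (norm (?a x) powr p * ?j x) + \<bar>\<rho> (dst x)\<bar> * ?j x)"
      proof (cases "x \<in> U")
        case True
        have d: "dst x > 0" using True by (rule dst_pos)
        have "\<bar>sgn (u x) * (y x \<bullet> ?b x)\<bar> \<le> 1 * (dst x * norm (?b x))"
          unfolding abs_mult by (intro mult_mono) (auto simp: sgn_if dst_def Cauchy_Schwarz_ineq2)
        then have "p * dst x powr (- p) * \<bar>\<rho> (dst x)\<bar> * \<bar>u x\<bar> powr (p - 1) * \<bar>sgn (u x) * (y x \<bullet> ?b x)\<bar>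
           \<le> p * dst x powr (- p) * \<bar>\<rho> (dst x)\<bar> * \<bar>u x\<bar> powr (p - 1) * (1 * (dst x * norm (?b x)))"
          using p by (intro mult_left_mono) auto
        also have "\<dots> = \<bar>\<rho> (dst x)\<bar> * (p * \<bar>H\<bar> powr (1 - p) * (norm (?a x) powr (p - 1) * norm (?b x)))"
        proof -
          have 1: "\<bar>H\<bar> powr (1 - p) * \<bar>H\<bar> powr (p - 1) = 1" using H by (simp flip: powr_add)
          have 2: "dst x powr (- p) * dst x = inverse (dst x powr (p - 1))"
            using d by (simp add: powr_diff powr_minus field_simps)
          have "\<bar>\<rho> (dst x)\<bar> * (p * \<bar>H\<bar> powr (1 - p) * (norm (?a x) powr (p - 1) * norm (?b x)))
            = p * \<bar>\<rho> (dst x)\<bar> * \<bar>u x\<bar> powr (p - 1) * norm (?b x) * inverse (dst x powr (p - 1)) * (\<bar>H\<bar> powr (1 - p) * \<bar>H\<bar> powr (p - 1))"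
            unfolding norm_rgrad_powr[OF True] by (simp add: divide_inverse mult_ac)
          then show ?thesis unfolding 1 2[symmetric] by (simp only: mult_1_right mult_1_left mult_ac)
        qed
        also have "\<dots> \<le> \<bar>\<rho> (dst x)\<bar> * (p * \<bar>H\<bar> powr (1 - p) * (C * (sqrt (norm (?a x) powr p * ?j x) + ?j x)))"
          using p by (intro mult_left_mono C) auto
        finally show ?thesis using p by (simp add: abs_mult C1_def algebra_simps)
      next
        case False
        then show ?thesis using C1c_zero_outside[OF uU False] z[of x] p by simp
      qed
    qed
    also have "\<dots> = C1 * ((\<integral>x. \<bar>\<rho> (dst x)\<bar> * sqrt (norm (?a x) powr p * ?j x) \<partial>lborel) + (\<integral>x. \<bar>\<rho> (dst x)\<bar> * ?j x \<partial>lborel))"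
      using i3 i4 by simp
    also have "(\<integral>x. \<bar>\<rho> (dst x)\<bar> * sqrt (norm (?a x) powr p * ?j x) \<partial>lborel)
      = (\<integral>x. ((\<rho> (dst x))\<^sup>2 * norm (?a x) powr p) powr (1 - 1/2) * ?j x powr (1/2) \<partial>lborel)"
      by (intro Bochner_Integration.integral_cong refl) (simp add: powr_half_sqrt jpos real_sqrt_mult)
    also have "\<dots> \<le> (\<integral>x. (\<rho> (dst x))\<^sup>2 * norm (?a x) powr p \<partial>lborel) powr (1 - 1/2) * (\<integral>x. ?j x \<partial>lborel) powr (1/2)"
      by (rule integral_Hoelder[OF i5 _ i6]) (use jpos in auto)
    also have "\<dots> = sqrt (\<integral>x. (\<rho> (dst x))\<^sup>2 * norm (?a x) powr p \<partial>lborel) * sqrt (\<integral>x. ?j x \<partial>lborel)"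
      by (simp add: powr_half_sqrt Bochner_Integration.integral_nonneg jpos)
    finally show "\<bar>\<integral>x. ?R1 x \<partial>lborel\<bar> \<le> C1 * (sqrt (\<integral>x. (\<rho> (dst x))\<^sup>2 * norm (?a x) powr p \<partial>lborel) * sqrt (\<integral>x. ?j x \<partial>lborel)
        + (\<integral>x. \<bar>\<rho> (dst x)\<bar> * ?j x \<partial>lborel))"
      using C1 by simp
  qed
qed

end

subsection \<open>Logarithmic weights at a point\<close>

lemma powr_add_le:
  fixes a b p :: real
  assumes "a \<ge> 0" "b \<ge> 0" "p \<ge> 0" shows "(a + b) powr p \<le> 2 powr p * (a powr p + b powr p)"
proof -
  have "(a + b) powr p \<le> (2 * max a b) powr p" using assms by (intro powr_mono2) auto
  also have "\<dots> = 2 powr p * max a b powr p" using assms by (simp add: powr_mult)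
  also have "\<dots> \<le> 2 powr p * (a powr p + b powr p)"
    by (intro mult_left_mono) (auto simp: max_def)
  finally show ?thesis .
qed

text \<open>A C^1 cutoff for the logarithmic variable: supported in
  \<open>\<bar>\<tau>\<bar> <= 3/2\<close> and at least \<open>1/2\<close> for
  \<open>\<bar>\<tau>\<bar> <= 1/2\<close>, so it fits a shell of length \<open>1\<close> inside one
  of length \<open>3\<close>. The number \<open>4/9\<close> is the inverse square of
  \<open>3/2\<close>.\<close>

definition bump :: "real \<Rightarrow> real" where "bump \<tau> = (max 0 (1 - 4/9 * \<tau>\<^sup>2))\<^sup>2"

definition bump' :: "real \<Rightarrow> real" where "bump' \<tau> = 2 * max 0 (1 - 4/9 * \<tau>\<^sup>2) * (- (8/9) * \<tau>)"

lemma has_real_derivative_max_0_power2: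
  "((\<lambda>s::real. (max 0 s)\<^sup>2) has_real_derivative 2 * max 0 s) (at s)"
proof -
  consider "s > 0" | "s < 0" | "s = 0" by linarith
  then show ?thesis
  proof cases
    case 1
    have "((\<lambda>s::real. s\<^sup>2) has_real_derivative 2 * s) (at s)" by (auto intro!: derivative_eq_intros)
    then have "((\<lambda>s::real. (max 0 s)\<^sup>2) has_real_derivative 2 * s) (at s)"
      by (rule has_field_derivative_transform_within_open[where S = "{0<..}"]) (use 1 in auto)
    then show ?thesis using 1 by simp
  next
    case 2
    have "((\<lambda>s::real. 0) has_real_derivative 0) (at s)" by simp
    then have "((\<lambda>s::real. (max 0 s)\<^sup>2) has_real_derivative 0) (at s)"
      by (rule has_field_derivative_transform_within_open[where S = "{..<0}"]) (use 2 in auto)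
    then show ?thesis using 2 by simp
  next
    case 3
    have "((\<lambda>h::real. max 0 h) \<longlongrightarrow> max 0 0) (at 0)" by (intro tendsto_intros)
    moreover have "eventually (\<lambda>h::real. max 0 h = ((max 0 (0 + h))\<^sup>2 - (max 0 0)\<^sup>2) / h) (at 0)"
      by (auto simp: eventually_at_filter max_def power2_eq_square)
    ultimately have "((\<lambda>h::real. ((max 0 (0 + h))\<^sup>2 - (max 0 0)\<^sup>2) / h) \<longlongrightarrow> max 0 0) (at 0)"
      by (rule Lim_transform_eventually)
    then show ?thesis using 3 by (simp add: DERIV_def)
  qed
qed

lemma bump_derivative: "(bump has_real_derivative bump' \<tau>) (at \<tau>)"
proof -
  have "((\<lambda>\<tau>::real. 1 - 4/9 * \<tau>\<^sup>2) has_real_derivative - (8/9) * \<tau>) (at \<tau>)"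
    by (auto intro!: derivative_eq_intros)
  from DERIV_chain2[OF has_real_derivative_max_0_power2 this] show ?thesis
    by (simp add: bump_def[abs_def] bump'_def)
qed

lemma continuous_on_bump': "continuous_on A bump'"
  unfolding bump'_def[abs_def] by (intro continuous_intros)

lemma bump_outside:
  assumes "\<bar>\<tau>\<bar> \<ge> 3/2" shows "bump \<tau> = 0" "bump' \<tau> = 0"
proof -
  have "(3/2)\<^sup>2 \<le> \<bar>\<tau>\<bar>\<^sup>2" using assms by (intro power_mono) auto
  then have "max 0 (1 - 4/9 * \<tau>\<^sup>2) = 0" by (simp add: power2_eq_square)
  then show "bump \<tau> = 0" "bump' \<tau> = 0" by (auto simp: bump_def bump'_def)
qed

lemma bump_bounds: "0 \<le> bump \<tau>" "bump \<tau> \<le> 1" "\<bar>bump' \<tau>\<bar> \<le> 3"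
proof -
  have m: "max 0 (1 - 4/9 * \<tau>\<^sup>2) \<le> 1" "max 0 (1 - 4/9 * \<tau>\<^sup>2) \<ge> 0" by (auto simp: max_def)
  show "0 \<le> bump \<tau>" by (simp add: bump_def)
  show "bump \<tau> \<le> 1" unfolding bump_def using m by (intro power_le_one) auto
  show "\<bar>bump' \<tau>\<bar> \<le> 3"
  proof (cases "\<bar>\<tau>\<bar> \<ge> 3/2")
    case False
    have "\<bar>bump' \<tau>\<bar> = 2 * max 0 (1 - 4/9 * \<tau>\<^sup>2) * (8/9 * \<bar>\<tau>\<bar>)"
      using m by (simp add: bump'_def abs_mult)
    also have "\<dots> \<le> 2 * 1 * (8/9 * (3/2))" using False m by (intro mult_mono) auto
    finally show ?thesis by simp
  qed (simp add: bump_outside)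
qed

lemma bump_lower: assumes "\<bar>\<tau>\<bar> \<le> 1/2" shows "1/2 \<le> bump \<tau>"
proof -
  have "\<bar>\<tau>\<bar>\<^sup>2 \<le> (1/2)\<^sup>2" using assms by (intro power_mono) auto
  then have "\<tau>\<^sup>2 \<le> 1/4" by (simp add: power_divide)
  then have "8/9 \<le> max 0 (1 - 4/9 * \<tau>\<^sup>2)" by (intro max.coboundedI2) simp
  then have "(8/9)\<^sup>2 \<le> bump \<tau>" unfolding bump_def by (rule power_mono) simp
  then show ?thesis by (simp add: power2_eq_square)
qed

text \<open>For \<open>t <= 2 * (c + 1)\<close> the trivial bound \<open>pi\<close> is already below
  the right-hand side. Beyond that \<open>t - c >= t / 2\<close>, and
  \<open>pi / 2 - arctan s = arctan (1 / s) <= 1 / s\<close> for \<open>s > 0\<close>.\<close>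

lemma arctan_tail:
  fixes t c :: real
  assumes "t > 0" "c \<ge> 0"
  shows "\<bar>arctan (t - c) - pi / 2\<bar> \<le> 2 * pi * (c + 1) / t" "\<bar>arctan (t - c) - pi / 2\<bar> \<le> pi"
proof -
  have b: "- (pi / 2) < arctan (t - c)" "arctan (t - c) < pi / 2" by (rule arctan_lbound, rule arctan_ubound)
  then show le: "\<bar>arctan (t - c) - pi / 2\<bar> \<le> pi" by auto
  show "\<bar>arctan (t - c) - pi / 2\<bar> \<le> 2 * pi * (c + 1) / t"
  proof (cases "t \<le> 2 * (c + 1)")
    case True
    then have "pi * t \<le> pi * (2 * (c + 1))" by (intro mult_left_mono) auto
    then have "pi \<le> 2 * pi * (c + 1) / t" using assms by (simp add: field_simps)
    then show ?thesis using le by linarith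
  next
    case False
    then have tc: "t - c \<ge> t / 2" "t - c > 0" using assms by auto
    have "arctan (1 / (t - c)) = pi / 2 - arctan (t - c)"
      using arctan_inverse[of "t - c"] tc by (simp add: inverse_eq_divide)
    then have "\<bar>arctan (t - c) - pi / 2\<bar> = arctan (1 / (t - c))" using b by simp
    also have "\<dots> \<le> 1 / (t - c)" using tc by (intro arctan_le_self) auto
    also have "\<dots> \<le> 1 / (t / 2)" using tc assms by (intro divide_left_mono) auto
    also have "\<dots> \<le> 2 * pi * (c + 1) / t"
    proof -
      have "1 * 1 \<le> pi * (c + 1)" using pi_ge_two assms by (intro mult_mono) auto
      then show ?thesis using assms by (simp add: field_simps)
    qed
    finally show ?thesis .
  qed
qed

text \<open>The gap \<open>R < D\<close> keeps \<open>ell\<close> above the positive constant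
  \<open>t0\<close> on \<open>V\<close>, so negative powers of \<open>ell\<close> stay bounded up to
  the outer boundary.\<close>

locale punctured_ball = coordinate_plane S for S :: "'a::euclidean_space set" +
  fixes p H D R :: real
  assumes p: "1 < p" and H_def: "H = (real (card S) - p) / p" and H0: "H \<noteq> 0"
    and R: "0 < R" "R < D"
begin

definition V :: "'a set" where "V = dst -` {0<..<R}"

definition ell :: "'a \<Rightarrow> real" where "ell x = ln (D / dst x)"

definition A :: "('a \<Rightarrow> real) \<Rightarrow> 'a \<Rightarrow> real" where "A u x = norm (rgrad H u x) powr p"

definition J :: "('a \<Rightarrow> real) \<Rightarrow> ('a \<Rightarrow> 'a) \<Rightarrow> 'a \<Rightarrow> real" where
  "J u g x = bregman p (rgrad H u x) (tgrad H u g x)"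

definition t0 :: real where "t0 = ln (D / R)"

lemma t0: "t0 > 0" using R by (simp add: t0_def)

lemma open_V: "open V" unfolding V_def by (rule open_vimage) (auto intro: continuous_on_dst)

lemma V_U: "V \<subseteq> U" by (auto simp: V_def U_eq)

lemma ell_gt: "x \<in> V \<Longrightarrow> ell x > t0"
  using R by (auto simp: V_def ell_def t0_def ln_div)

lemma ell_pos: "x \<in> V \<Longrightarrow> ell x > 0"
  using ell_gt t0 by fastforce

lemma continuous_on_ell: "continuous_on V ell"
  unfolding ell_def[abs_def] using R by (intro continuous_intros) (auto simp: V_def)

lemma ell_measurable [measurable]: "ell \<in> borel_measurable borel"
  unfolding ell_def[abs_def] by measurable

lemma A_nonneg: "A u x \<ge> 0" and J_nonneg: "J u g x \<ge> 0"
  by (auto simp: A_def J_def bregman_nonneg p)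

lemma A_eq: "x \<in> V \<Longrightarrow> A u x = \<bar>H\<bar> powr p * (\<bar>u x\<bar> powr p * dst x powr (- p))"
  using V_U norm_rgrad_powr[of x H u p] by (auto simp: A_def powr_minus divide_inverse)

lemma zero_outside:
  assumes "C1c V u g" "x \<notin> V" shows "u x = 0" "g x = 0" "A u x = 0" "J u g x = 0"
proof -
  show z: "u x = 0" "g x = 0" using C1c_zero_outside[OF assms] by auto
  show "A u x = 0" using p z by (simp add: A_def rgrad_def)
  show "J u g x = 0" using p z by (simp add: J_def bregman_field_zero)
qed

lemma zero_at: "u x = 0 \<Longrightarrow> A u x = 0" "u x = 0 \<Longrightarrow> g x = 0 \<Longrightarrow> J u g x = 0"
  using p bregman_field_zero[of p u x g H] by (auto simp: A_def J_def) (simp add: rgrad_def)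

lemma C1c_U: "C1c V u g \<Longrightarrow> C1c U u g" using V_U by (rule C1c_mono[rotated])

lemma continuous_on_AJ:
  assumes "C1c V u g" shows "continuous_on V (A u)" "continuous_on V (J u g)"
proof -
  have "continuous_on U (A u)" unfolding A_def[abs_def] using p
    by (intro continuous_on_norm_powr continuous_on_rgrad[OF C1c_U[OF assms]]) auto
  moreover have "continuous_on U (J u g)"
    using continuous_on_bregman_field[OF C1c_U[OF assms] p] unfolding J_def[abs_def] H_def[symmetric] .
  ultimately show "continuous_on V (A u)" "continuous_on V (J u g)"
    using V_U continuous_on_subset by blast+
qed

lemma integrable_AJ:
  assumes "C1c V u g" shows "integrable lborel (A u)" "integrable lborel (J u g)"
  by (rule C1c_integrable[OF assms]; use assms in \<open>auto intro: continuous_on_AJ zero_at\<close>)+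

definition Jt :: "('a \<Rightarrow> real) \<Rightarrow> ('a \<Rightarrow> 'a) \<Rightarrow> real" where "Jt u g = (\<integral>x. J u g x \<partial>lborel)"

lemma Jt_nonneg: "Jt u g \<ge> 0" unfolding Jt_def by (rule Bochner_Integration.integral_nonneg) (rule J_nonneg)

text \<open>\<open>radial_test_bound\<close> on \<open>(0, R)\<close> with
  \<open>\<rho>' = \<psi> s / s\<close>: the weight \<open>dst powr (1 - p) * \<rho>'\<close>
  becomes \<open>dst powr (- p) * \<psi>\<close>, and the potential turns into \<open>A u\<close> up
  to the factor \<open>\<bar>H\<bar> powr p\<close>.\<close>

lemma radial_test:
  obtains C where "C > 0" "\<And>\<rho> \<psi> u g B. C1c V u g \<Longrightarrow> continuous_on {0<..<R} \<psi> \<Longrightarrow>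
     (\<And>s. s\<in>{0<..<R} \<Longrightarrow> (\<rho> has_real_derivative \<psi> s / s) (at s)) \<Longrightarrow> (\<And>s. s\<in>{0<..<R} \<Longrightarrow> \<bar>\<rho> s\<bar> \<le> B) \<Longrightarrow>
     \<bar>\<integral>x. A u x * \<psi> (dst x) \<partial>lborel\<bar>
     \<le> C * (sqrt (\<integral>x. (\<rho> (dst x))\<^sup>2 * A u x \<partial>lborel) * sqrt (Jt u g) + B * Jt u g)"
proof -
  obtain C where C0: "C > 0" and C1: "\<forall>T \<rho> \<rho>' u g. open T \<and> T \<subseteq> {0<..} \<and> C1c (dst -` T) u g \<and>
     (\<forall>s\<in>T. (\<rho> has_real_derivative \<rho>' s) (at s)) \<and> continuous_on T \<rho>' \<longrightarrow>
     \<bar>\<integral>x. \<bar>u x\<bar> powr p * dst x powr (1 - p) * \<rho>' (dst x) \<partial>lborel\<bar>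
     \<le> C * (sqrt (\<integral>x. (\<rho> (dst x))\<^sup>2 * norm (rgrad H u x) powr p \<partial>lborel)
              * sqrt (\<integral>x. bregman p (rgrad H u x) (tgrad H u g x) \<partial>lborel)
           + (\<integral>x. \<bar>\<rho> (dst x)\<bar> * bregman p (rgrad H u x) (tgrad H u g x) \<partial>lborel))"
    using radial_test_bound[OF p H0[unfolded H_def]] unfolding H_def[symmetric] by (elim exE conjE) (rule that)
  have Hp: "\<bar>H\<bar> powr p > 0" using H0 by simp
  show ?thesis
  proof (rule that[of "\<bar>H\<bar> powr p * C"])
    show "\<bar>H\<bar> powr p * C > 0" using Hp C0 by simp
    fix \<rho> \<psi> :: "real \<Rightarrow> real" and u g and B :: real
    assume u: "C1c V u g" and psi: "continuous_on {0<..<R} \<psi>"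
      and rho: "\<And>s. s\<in>{0<..<R} \<Longrightarrow> (\<rho> has_real_derivative \<psi> s / s) (at s)" and B: "\<And>s. s\<in>{0<..<R} \<Longrightarrow> \<bar>\<rho> s\<bar> \<le> B"
    let ?T = "{0<..<R}"
    have c_rho: "continuous_on V (\<lambda>x. \<rho> (dst x))"
      by (rule continuous_on_compose2[OF DERIV_continuous_on continuous_on_dst, of ?T \<rho> "\<lambda>s. \<psi> s / s"])
         (use rho in \<open>auto simp: V_def intro: has_field_derivative_at_within\<close>)
    have "(\<integral>x. A u x * \<psi> (dst x) \<partial>lborel)
       = (\<integral>x. \<bar>H\<bar> powr p * (\<bar>u x\<bar> powr p * dst x powr (1 - p) * (\<psi> (dst x) / dst x)) \<partial>lborel)"
    proof (intro Bochner_Integration.integral_cong refl)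
      fix x
      show "A u x * \<psi> (dst x) = \<bar>H\<bar> powr p * (\<bar>u x\<bar> powr p * dst x powr (1 - p) * (\<psi> (dst x) / dst x))"
      proof (cases "x \<in> V")
        case True
        then have d: "dst x > 0" by (simp add: V_def)
        then have "dst x powr (1 - p) / dst x = dst x powr (- p)"
          using powr_diff[of "dst x" "1 - p" 1] by simp
        then show ?thesis unfolding A_eq[OF True] by (simp add: divide_inverse mult_ac)
      qed (use zero_outside[OF u] p in auto)
    qed
    then have "\<bar>\<integral>x. A u x * \<psi> (dst x) \<partial>lborel\<bar> = \<bar>H\<bar> powr p * \<bar>\<integral>x. \<bar>u x\<bar> powr p * dst x powr (1 - p) * (\<psi> (dst x) / dst x) \<partial>lborel\<bar>"
      by (simp add: abs_mult del: times_divide_eq_right)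
    also have "\<dots> \<le> \<bar>H\<bar> powr p * (C * (sqrt (\<integral>x. (\<rho> (dst x))\<^sup>2 * A u x \<partial>lborel) * sqrt (Jt u g)
           + (\<integral>x. \<bar>\<rho> (dst x)\<bar> * J u g x \<partial>lborel)))"
      unfolding A_def Jt_def J_def
      by (intro mult_left_mono C1[rule_format, of ?T]) (use rho u psi in \<open>auto simp: V_def intro!: continuous_intros\<close>)
    also have "\<dots> \<le> \<bar>H\<bar> powr p * (C * (sqrt (\<integral>x. (\<rho> (dst x))\<^sup>2 * A u x \<partial>lborel) * sqrt (Jt u g) + B * Jt u g))"
    proof -
      have "(\<integral>x. \<bar>\<rho> (dst x)\<bar> * J u g x \<partial>lborel) \<le> (\<integral>x. B * J u g x \<partial>lborel)"
      proof (rule integral_mono)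
        show "integrable lborel (\<lambda>x. \<bar>\<rho> (dst x)\<bar> * J u g x)"
          by (rule C1c_integrable[OF u]) (auto intro!: continuous_intros c_rho continuous_on_AJ[OF u] simp: zero_at)
        show "integrable lborel (\<lambda>x. B * J u g x)" using integrable_AJ[OF u] by simp
        show "\<bar>\<rho> (dst x)\<bar> * J u g x \<le> B * J u g x" for x
          using B zero_outside(4)[OF u, of x] J_nonneg[of u g x] by (cases "x \<in> V") (auto simp: V_def intro!: mult_right_mono)
      qed
      then have "(\<integral>x. \<bar>\<rho> (dst x)\<bar> * J u g x \<partial>lborel) \<le> B * Jt u g" by (simp add: Jt_def)
      then show ?thesis using C0 Hp by (intro mult_left_mono add_left_mono) auto
    qed
    finally show "\<bar>\<integral>x. A u x * \<psi> (dst x) \<partial>lborel\<bar>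
      \<le> \<bar>H\<bar> powr p * C * (sqrt (\<integral>x. (\<rho> (dst x))\<^sup>2 * A u x \<partial>lborel) * sqrt (Jt u g) + B * Jt u g)"
      by (simp add: mult.assoc)
  qed
qed

text \<open>The choice \<open>\<rho> = - 1 / ln (D / s)\<close> has
  \<open>\<psi> = - \<rho>\<^sup>2\<close>, so the integral to be bounded reappears under the square
  root on the right and can be absorbed.\<close>

lemma log_Hardy:
  "\<exists>C>0. \<forall>u g. C1c V u g \<longrightarrow> (\<integral>x. A u x / (ell x)\<^sup>2 \<partial>lborel) \<le> C * Jt u g"
proof (rule radial_test)
  fix C assume C: "C > 0" "\<And>\<rho> \<psi> u g B. C1c V u g \<Longrightarrow> continuous_on {0<..<R} \<psi> \<Longrightarrow>
     (\<And>s. s\<in>{0<..<R} \<Longrightarrow> (\<rho> has_real_derivative \<psi> s / s) (at s)) \<Longrightarrow> (\<And>s. s\<in>{0<..<R} \<Longrightarrow> \<bar>\<rho> s\<bar> \<le> B) \<Longrightarrow>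
     \<bar>\<integral>x. A u x * \<psi> (dst x) \<partial>lborel\<bar>
     \<le> C * (sqrt (\<integral>x. (\<rho> (dst x))\<^sup>2 * A u x \<partial>lborel) * sqrt (Jt u g) + B * Jt u g)"
  show ?thesis
  proof (intro exI[of _ "C\<^sup>2 + 2 * C / t0"] conjI allI impI)
    show "C\<^sup>2 + 2 * C / t0 > 0" using C t0 by (auto intro!: add_pos_pos)
    fix u g assume u: "C1c V u g"
    let ?L = "\<integral>x. A u x / (ell x)\<^sup>2 \<partial>lborel"
    have L0: "?L \<ge> 0" by (intro Bochner_Integration.integral_nonneg) (simp add: A_nonneg)
    have ln: "ln (D / s) > t0" "ln (D / s) > 0" if "s \<in> {0<..<R}" for s
    proof -
      show "ln (D / s) > t0" using that R by (auto simp: t0_def ln_div)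
      then show "ln (D / s) > 0" using t0 by simp
    qed
    have "\<bar>\<integral>x. A u x * (- 1 / (ln (D / dst x))\<^sup>2) \<partial>lborel\<bar>
      \<le> C * (sqrt (\<integral>x. (- 1 / ln (D / dst x))\<^sup>2 * A u x \<partial>lborel) * sqrt (Jt u g) + 1 / t0 * Jt u g)"
    proof (rule C(2)[OF u])
      show "continuous_on {0<..<R} (\<lambda>s. - 1 / (ln (D / s))\<^sup>2)"
        using R ln by (intro continuous_intros) auto
      fix s assume s: "s \<in> {0<..<R}"
      note l = ln[OF s]
      show "\<bar>- 1 / ln (D / s)\<bar> \<le> 1 / t0" using l t0 by (simp add: frac_le)
      show "((\<lambda>s. - 1 / ln (D / s)) has_real_derivative - 1 / (ln (D / s))\<^sup>2 / s) (at s)"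
        using s R l by (auto intro!: derivative_eq_intros simp: power2_eq_square field_simps)
    qed
    then have "?L \<le> C * (sqrt ?L * sqrt (Jt u g) + 1 / t0 * Jt u g)"
      using L0 by (simp add: ell_def power_divide mult.commute)
    \<comment> \<open>The inequality \<open>2 x y <= x\<^sup>2 + y\<^sup>2\<close> leaves only half
      of \<open>?L\<close> on the right.\<close>
    moreover have "C * (sqrt ?L * sqrt (Jt u g)) \<le> ?L / 2 + C\<^sup>2 * Jt u g / 2"
    proof -
      have "0 \<le> (sqrt ?L - C * sqrt (Jt u g))\<^sup>2" by simp
      also have "\<dots> = ?L + C\<^sup>2 * Jt u g - 2 * (C * (sqrt ?L * sqrt (Jt u g)))"
        using L0 Jt_nonneg[of u g] by (simp add: power2_diff power_mult_distrib)
      finally show ?thesis by simp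
    qed
    moreover have "(C\<^sup>2 + 2 * C / t0) * Jt u g = C\<^sup>2 * Jt u g + 2 * (C * (1 / t0 * Jt u g))"
      by (simp add: algebra_simps)
    ultimately show "?L \<le> (C\<^sup>2 + 2 * C / t0) * Jt u g" unfolding distrib_left by linarith
  qed
qed

text \<open>The test function \<open>arctan (ell - j) - pi / 2\<close> has derivative of order one where \<open>ell\<close> is close
  to \<open>j\<close>, and is \<open>O((j + 1) / ell)\<close>, so that the lemma \<open>log_Hardy\<close> controls its square.\<close>

lemma shell_bound:
  "\<exists>C>0. \<forall>u g (j::nat). C1c V u g \<longrightarrow> (\<integral>x. A u x / (1 + (ell x - real j)\<^sup>2) \<partial>lborel) \<le> C * (real j + 1) * Jt u g"
proof (rule radial_test)
  fix C assume C: "C > 0" "\<And>\<rho> \<psi> u g B. C1c V u g \<Longrightarrow> continuous_on {0<..<R} \<psi> \<Longrightarrow>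
     (\<And>s. s\<in>{0<..<R} \<Longrightarrow> (\<rho> has_real_derivative \<psi> s / s) (at s)) \<Longrightarrow> (\<And>s. s\<in>{0<..<R} \<Longrightarrow> \<bar>\<rho> s\<bar> \<le> B) \<Longrightarrow>
     \<bar>\<integral>x. A u x * \<psi> (dst x) \<partial>lborel\<bar>
     \<le> C * (sqrt (\<integral>x. (\<rho> (dst x))\<^sup>2 * A u x \<partial>lborel) * sqrt (Jt u g) + B * Jt u g)"
  obtain C' where C': "C' > 0" "\<And>u g. C1c V u g \<Longrightarrow> (\<integral>x. A u x / (ell x)\<^sup>2 \<partial>lborel) \<le> C' * Jt u g"
    using log_Hardy by auto
  show ?thesis
  proof (intro exI[of _ "C * (2 * pi * sqrt C' + pi)"] conjI allI impI)
    show "C * (2 * pi * sqrt C' + pi) > 0" using C C' by (intro mult_pos_pos add_pos_pos) auto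
    fix u g and j :: nat assume u: "C1c V u g"
    have pos: "0 \<le> (\<integral>x. A u x / (1 + (ell x - real j)\<^sup>2) \<partial>lborel)"
      by (intro Bochner_Integration.integral_nonneg divide_nonneg_nonneg A_nonneg) auto
    have "\<bar>\<integral>x. A u x * (- 1 / (1 + (ln (D / dst x) - real j)\<^sup>2)) \<partial>lborel\<bar>
      \<le> C * (sqrt (\<integral>x. (arctan (ln (D / dst x) - real j) - pi / 2)\<^sup>2 * A u x \<partial>lborel) * sqrt (Jt u g) + pi * Jt u g)"
    proof (rule C(2)[OF u])
      have ne: "1 + (r::real)\<^sup>2 \<noteq> 0" for r by (metis add_pos_nonneg less_irrefl zero_le_power2 zero_less_one)
      show "continuous_on {0<..<R} (\<lambda>s. - 1 / (1 + (ln (D / s) - real j)\<^sup>2))"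
        using R ne by (intro continuous_intros) auto
      fix s assume s: "s \<in> {0<..<R}"
      then have "ln (D / s) > 0" using R by simp
      then show "\<bar>arctan (ln (D / s) - real j) - pi / 2\<bar> \<le> pi" by (rule arctan_tail) simp
      have "((\<lambda>s. ln (D / s) - real j) has_real_derivative - 1 / s) (at s)"
        using s R by (auto intro!: derivative_eq_intros simp: field_simps power2_eq_square)
      then have "((\<lambda>s. arctan (ln (D / s) - real j)) has_real_derivative inverse (1 + (ln (D / s) - real j)\<^sup>2) * (- 1 / s)) (at s)"
        by (rule DERIV_chain2[OF DERIV_arctan])
      from DERIV_diff[OF this DERIV_const[of "pi / 2"]]
      show "((\<lambda>s. arctan (ln (D / s) - real j) - pi / 2) has_real_derivative - 1 / (1 + (ln (D / s) - real j)\<^sup>2) / s) (at s)"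
        by (rule DERIV_cong) (simp add: inverse_eq_divide)
    qed
    then have 1: "(\<integral>x. A u x / (1 + (ell x - real j)\<^sup>2) \<partial>lborel)
      \<le> C * (sqrt (\<integral>x. (arctan (ell x - real j) - pi / 2)\<^sup>2 * A u x \<partial>lborel) * sqrt (Jt u g) + pi * Jt u g)"
      using pos by (simp add: ell_def)
    have "(\<integral>x. (arctan (ell x - real j) - pi / 2)\<^sup>2 * A u x \<partial>lborel)
       \<le> (\<integral>x. (2 * pi * (real j + 1))\<^sup>2 * (A u x / (ell x)\<^sup>2) \<partial>lborel)"
    proof (rule integral_mono)
      show "integrable lborel (\<lambda>x. (arctan (ell x - real j) - pi / 2)\<^sup>2 * A u x)"
        by (rule C1c_integrable[OF u]) (auto intro!: continuous_intros continuous_on_ell continuous_on_AJ[OF u] simp: zero_at)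
      show "integrable lborel (\<lambda>x. (2 * pi * (real j + 1))\<^sup>2 * (A u x / (ell x)\<^sup>2))"
        by (rule C1c_integrable[OF u]) (auto intro!: continuous_intros continuous_on_ell continuous_on_AJ[OF u] simp: zero_at dest: ell_pos)
      fix x
      show "(arctan (ell x - real j) - pi / 2)\<^sup>2 * A u x \<le> (2 * pi * (real j + 1))\<^sup>2 * (A u x / (ell x)\<^sup>2)"
      proof (cases "x \<in> V")
        case True
        have "\<bar>arctan (ell x - real j) - pi / 2\<bar>\<^sup>2 \<le> (2 * pi * (real j + 1) / ell x)\<^sup>2"
          by (intro power_mono arctan_tail ell_pos True) auto
        then have "(arctan (ell x - real j) - pi / 2)\<^sup>2 * A u x \<le> (2 * pi * (real j + 1) / ell x)\<^sup>2 * A u x"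
          by (intro mult_right_mono A_nonneg) auto
        then show ?thesis by (simp add: power_divide)
      qed (simp add: zero_outside[OF u])
    qed
    also have "\<dots> = (2 * pi * (real j + 1))\<^sup>2 * (\<integral>x. A u x / (ell x)\<^sup>2 \<partial>lborel)"
      by (rule Bochner_Integration.integral_mult_right_zero)
    also have "\<dots> \<le> (2 * pi * (real j + 1))\<^sup>2 * (C' * Jt u g)"
      by (intro mult_left_mono C'(2) u) auto
    finally have "sqrt (\<integral>x. (arctan (ell x - real j) - pi / 2)\<^sup>2 * A u x \<partial>lborel) \<le> sqrt ((2 * pi * (real j + 1))\<^sup>2 * (C' * Jt u g))"
      by (rule real_sqrt_le_mono)
    also have "\<dots> = 2 * pi * (real j + 1) * (sqrt C' * sqrt (Jt u g))"
      by (simp only: real_sqrt_mult real_sqrt_abs) (simp add: abs_mult)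
    finally have "sqrt (\<integral>x. (arctan (ell x - real j) - pi / 2)\<^sup>2 * A u x \<partial>lborel) \<le> 2 * pi * (real j + 1) * (sqrt C' * sqrt (Jt u g))" .
    then have "sqrt (\<integral>x. (arctan (ell x - real j) - pi / 2)\<^sup>2 * A u x \<partial>lborel) * sqrt (Jt u g)
        \<le> 2 * pi * (real j + 1) * (sqrt C' * sqrt (Jt u g)) * sqrt (Jt u g)"
      using Jt_nonneg[of u g] by (intro mult_right_mono) auto
    also have "\<dots> = 2 * pi * sqrt C' * (real j + 1) * Jt u g"
      using Jt_nonneg[of u g] by (simp add: mult.assoc)
    finally have 2: "sqrt (\<integral>x. (arctan (ell x - real j) - pi / 2)\<^sup>2 * A u x \<partial>lborel) * sqrt (Jt u g)
       \<le> 2 * pi * sqrt C' * (real j + 1) * Jt u g" .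
    have "sqrt (\<integral>x. (arctan (ell x - real j) - pi / 2)\<^sup>2 * A u x \<partial>lborel) * sqrt (Jt u g) + pi * Jt u g
       \<le> 2 * pi * sqrt C' * (real j + 1) * Jt u g + pi * (real j + 1) * Jt u g"
    proof -
      have "pi * Jt u g \<le> pi * (real j + 1) * Jt u g" using Jt_nonneg[of u g] by (intro mult_right_mono) auto
      then show ?thesis using 2 by linarith
    qed
    then have "C * (sqrt (\<integral>x. (arctan (ell x - real j) - pi / 2)\<^sup>2 * A u x \<partial>lborel) * sqrt (Jt u g) + pi * Jt u g)
       \<le> C * (2 * pi * sqrt C' * (real j + 1) * Jt u g + pi * (real j + 1) * Jt u g)"
      using C by (intro mult_left_mono) auto
    with 1 show "(\<integral>x. A u x / (1 + (ell x - real j)\<^sup>2) \<partial>lborel) \<le> C * (2 * pi * sqrt C' + pi) * (real j + 1) * Jt u g"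
      by (simp add: algebra_simps)
  qed
qed

end

section \<open>Localisation to logarithmic shells\<close>

context punctured_ball
begin

definition shell :: "nat \<Rightarrow> 'a set" where "shell j = {x. real j \<le> ell x \<and> ell x < real j + 1}"

definition wide_shell :: "nat \<Rightarrow> 'a set" where "wide_shell j = {x. real j - 1 < ell x \<and> ell x < real j + 2}"

lemma shell_sets [measurable]: "shell j \<in> sets borel" "wide_shell j \<in> sets borel"
  unfolding shell_def wide_shell_def by measurable

text \<open>Cut off by \<open>bump\<close> in the variable \<open>ell\<close> and apply
  \<open>weighted_Sobolev\<close> with \<open>h = 0\<close>, where \<open>tgrad\<close> is the
  gradient itself and the constant is positive. The cutoff has gradient at most
  \<open>3 / dst x\<close>, so it contributes a multiple of \<open>norm (rgrad H u x)\<close>; this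
  scale invariance makes the constant independent of \<open>j\<close>.\<close>

lemma shell_Sobolev:
  fixes q :: real
  defines "N \<equiv> real DIM('a)"
  assumes k: "card S = DIM('a)" and N2: "DIM('a) \<ge> 2" and pN: "p < N" and q: "p \<le> q" "q \<le> N * p / (N - p)"
  shows "\<exists>C>0. \<forall>u g (j::nat). C1c V u g \<longrightarrow>
     (\<integral>x. \<bar>u x\<bar> powr q * dst x powr (- q - N + N * q / p) * indicator (shell j) x \<partial>lborel) powr (p / q)
     \<le> C * (\<integral>x. (J u g x + A u x) * indicator (wide_shell j) x \<partial>lborel)"
proof -
  let ?s = "- q - N + N * q / p"
  have q0: "q > 0" using p q by simp
  have "real (card S) - 1 + (1 - N + (1 + q * (p - 1) / p) * (N - p) / p) - (1 + q * (p - 1) / p) * 0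
     = (1 + q * (p - 1) / p) * (N - p) / p" using k by (simp add: N_def)
  also have "\<dots> > 0" using p q0 pN by (intro divide_pos_pos mult_pos_pos add_pos_pos) auto
  finally have \<kappa>: "real (card S) - 1 + (1 - N + (1 + q * (p - 1) / p) * (N - p) / p) - (1 + q * (p - 1) / p) * 0 \<noteq> 0" by simp
  obtain C1 where C1: "C1 > 0" "\<And>u g. C1c U u g \<Longrightarrow>
     (\<integral>x. \<bar>u x\<bar> powr q * dst x powr ?s \<partial>lborel) powr (p / q) \<le> C1 * (\<integral>x. norm (tgrad 0 u g x) powr p \<partial>lborel)"
    using weighted_Sobolev[of p q 0] N2 p pN q \<kappa> unfolding N_def by auto
  obtain C2 where C2: "C2 > 0" "\<And>a b::'a. norm b powr p \<le> C2 * (bregman p a b + norm a powr p)"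
    using norm_powr_le_bregman_add[OF p] by metis
  \<comment> \<open>The number \<open>3\<close> bounds \<open>bump'\<close>, and
    \<open>\<bar>u x\<bar> / dst x\<close> is
    \<open>norm (rgrad H u x) / \<bar>H\<bar>\<close>.\<close>
  define c where "c = 1 + 3 / \<bar>H\<bar>"
  define C3 where "C3 = c powr p * (2 powr p * (1 + C2))"
  have c: "c \<ge> 1" by (simp add: c_def)
  have C3: "C3 > 0" using c C2 by (simp add: C3_def)
  show ?thesis
  proof (intro exI[of _ "2 powr p * (C1 * C3)"] conjI allI impI)
    show "2 powr p * (C1 * C3) > 0" using C1 C3 by simp
    fix u g and j :: nat assume u: "C1c V u g"
    \<comment> \<open>Centred in the shell: \<open>shell j\<close> becomes
      \<open>[-1/2, 1/2)\<close> and \<open>wide_shell j\<close> becomes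
      \<open>(-3/2, 3/2)\<close>.\<close>
    define \<tau> where "\<tau> x = ell x - real j - 1/2" for x
    define h where "h x = bump (\<tau> x)" for x
    define w where "w x = u x * h x" for x
    define gw where "gw x = h x *\<^sub>R g x + u x *\<^sub>R ((- bump' (\<tau> x) / dst x / dst x) *\<^sub>R y x)" for x
    have \<tau>_meas [measurable]: "\<tau> \<in> borel_measurable borel" unfolding \<tau>_def[abs_def] by measurable
    have c_tau: "continuous_on V \<tau>" unfolding \<tau>_def[abs_def] by (intro continuous_intros continuous_on_ell)
    have wC: "C1c V w gw"
      unfolding w_def[abs_def] gw_def[abs_def]
    proof (rule C1c_mult[OF u open_V])
      fix x assume x: "x \<in> V"
      then have d: "dst x > 0" by (simp add: V_def)
      have "((\<lambda>s. ln (D / s) - real j - 1/2) has_real_derivative - 1 / dst x) (at (dst x))"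
        using d R by (auto intro!: derivative_eq_intros simp: field_simps power2_eq_square)
      then have "((\<lambda>s. bump (ln (D / s) - real j - 1/2)) has_real_derivative bump' (ln (D / dst x) - real j - 1/2) * (- 1 / dst x)) (at (dst x))"
        by (rule DERIV_chain2[OF bump_derivative])
      then have "((\<lambda>s. bump (ln (D / s) - real j - 1/2)) has_real_derivative - bump' (ln (D / dst x) - real j - 1/2) / dst x) (at (dst x))"
        by simp
      from has_derivative_radial[OF _ this] x V_U show "(h has_derivative (\<lambda>v. (- bump' (\<tau> x) / dst x / dst x) *\<^sub>R y x \<bullet> v)) (at x)"
        unfolding h_def[abs_def] \<tau>_def ell_def by auto
    next
      show "continuous_on V (\<lambda>x. (- bump' (\<tau> x) / dst x / dst x) *\<^sub>R y x)"
        by (intro continuous_intros continuous_on_compose2[OF continuous_on_bump'[of UNIV] c_tau]) (auto simp: V_def)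
    qed
    then have wU: "C1c U w gw" by (rule C1c_U)
    have 1: "(\<integral>x. \<bar>w x\<bar> powr q * dst x powr ?s \<partial>lborel) powr (p / q) \<le> C1 * (\<integral>x. norm (gw x) powr p \<partial>lborel)"
      using C1(2)[OF wU] by (simp add: tgrad_def)
    have le: "norm (gw x) powr p \<le> C3 * ((J u g x + A u x) * indicator (wide_shell j) x)" for x
    proof (cases "x \<in> V \<and> x \<in> wide_shell j")
      case True
      then have x: "x \<in> V" "x \<in> U" using V_U by auto
      have d: "dst x > 0" using x by (simp add: V_def)
      let ?a = "norm (rgrad H u x)" and ?b = "norm (tgrad H u g x)"
      have "norm (gw x) \<le> norm (h x *\<^sub>R g x) + norm (u x *\<^sub>R ((- bump' (\<tau> x) / dst x / dst x) *\<^sub>R y x))"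
        unfolding gw_def by (rule norm_triangle_ineq)
      also have "norm (h x *\<^sub>R g x) \<le> 1 * (?a + ?b)"
        unfolding norm_scaleR h_def rgrad_add_tgrad[of H u x g, symmetric]
        by (intro mult_mono norm_triangle_ineq) (auto simp: bump_bounds)
      also have "norm (u x *\<^sub>R ((- bump' (\<tau> x) / dst x / dst x) *\<^sub>R y x)) = \<bar>bump' (\<tau> x)\<bar> * (\<bar>u x\<bar> / dst x)"
        using d by (simp add: dst_def[symmetric] abs_mult)
      also have "\<dots> \<le> 3 * (\<bar>u x\<bar> / dst x)" using d by (intro mult_right_mono bump_bounds) auto
      also have "\<bar>u x\<bar> / dst x = ?a / \<bar>H\<bar>" using H0 by (simp add: norm_rgrad[OF x(2)])
      finally have "norm (gw x) \<le> 1 * (?a + ?b) + 3 * (?a / \<bar>H\<bar>)" by simp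
      also have "\<dots> \<le> c * (?a + ?b)" unfolding c_def by (simp add: algebra_simps)
      finally have "norm (gw x) powr p \<le> (c * (?a + ?b)) powr p" using p by (intro powr_mono2) auto
      also have "\<dots> = c powr p * (?a + ?b) powr p" using c by (simp add: powr_mult)
      also have "\<dots> \<le> c powr p * (2 powr p * (?a powr p + ?b powr p))"
        using p by (intro mult_left_mono powr_add_le) auto
      also have "\<dots> \<le> c powr p * (2 powr p * (A u x + C2 * (J u g x + A u x)))"
        unfolding A_def J_def by (intro mult_left_mono add_mono C2) auto
      also have "\<dots> \<le> c powr p * (2 powr p * ((1 + C2) * (J u g x + A u x)))"
        using J_nonneg[of u g x] by (intro mult_left_mono) (auto simp: algebra_simps)
      finally show ?thesis using True by (simp add: C3_def mult.assoc)
    next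
      case False
      have "gw x = 0"
      proof (cases "x \<in> V")
        case True
        then have "\<bar>\<tau> x\<bar> \<ge> 3/2" using False by (auto simp: wide_shell_def \<tau>_def)
        then show ?thesis by (simp add: gw_def h_def bump_outside)
      qed (simp add: gw_def zero_outside[OF u])
      then show ?thesis using p C3 J_nonneg[of u g x] A_nonneg[of u x] by simp
    qed
    have iJA: "integrable lborel (\<lambda>x. (J u g x + A u x) * indicator (wide_shell j) x)"
      using integrable_AJ[OF u] by (intro integrable_real_mult_indicator) auto
    have "(\<integral>x. norm (gw x) powr p \<partial>lborel) \<le> (\<integral>x. C3 * ((J u g x + A u x) * indicator (wide_shell j) x) \<partial>lborel)"
      using iJA integrable_grad_powr[OF wU, of p] p by (intro integral_mono le) auto
    also have "\<dots> = C3 * (\<integral>x. (J u g x + A u x) * indicator (wide_shell j) x \<partial>lborel)"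
      by (rule Bochner_Integration.integral_mult_right_zero)
    finally have 2: "(\<integral>x. norm (gw x) powr p \<partial>lborel) \<le> \<dots>" .
    let ?Q = "\<integral>x. \<bar>u x\<bar> powr q * dst x powr ?s * indicator (shell j) x \<partial>lborel"
    have iq: "integrable lborel (\<lambda>x. \<bar>f x\<bar> powr q * dst x powr ?s)" if "C1c V f f'" for f f'
      by (rule C1c_integrable[OF that])
         (use q0 V_U in \<open>auto intro!: continuous_intros continuous_on_powr' C1c_continuous_on[OF that] dst_ge_0
            continuous_on_subset[OF continuous_on_dst_powr]\<close>)
    have Q0: "?Q \<ge> 0" by (intro Bochner_Integration.integral_nonneg) auto
    have "?Q \<le> (\<integral>x. 2 powr q * (\<bar>w x\<bar> powr q * dst x powr ?s) \<partial>lborel)"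
    proof (rule integral_mono)
      show "integrable lborel (\<lambda>x. \<bar>u x\<bar> powr q * dst x powr ?s * indicator (shell j) x)"
        using iq[OF u] by (intro integrable_real_mult_indicator) auto
      show "integrable lborel (\<lambda>x. 2 powr q * (\<bar>w x\<bar> powr q * dst x powr ?s))" using iq[OF wC] by simp
      fix x
      show "\<bar>u x\<bar> powr q * dst x powr ?s * indicator (shell j) x \<le> 2 powr q * (\<bar>w x\<bar> powr q * dst x powr ?s)"
      proof (cases "x \<in> shell j")
        case True
        then have "\<bar>\<tau> x\<bar> \<le> 1/2" unfolding abs_le_iff by (auto simp: shell_def \<tau>_def)
        then have "1/2 \<le> h x" unfolding h_def by (rule bump_lower)
        then have "\<bar>u x\<bar> * 1 \<le> \<bar>u x\<bar> * (2 * h x)" by (intro mult_left_mono) auto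
        then have "\<bar>u x\<bar> \<le> 2 * \<bar>w x\<bar>" using bump_bounds(1)[of "\<tau> x"] by (simp add: w_def abs_mult h_def)
        then have "\<bar>u x\<bar> powr q \<le> (2 * \<bar>w x\<bar>) powr q" using q0 by (intro powr_mono2) auto
        then have "\<bar>u x\<bar> powr q * dst x powr ?s \<le> (2 powr q * \<bar>w x\<bar> powr q) * dst x powr ?s"
          by (intro mult_right_mono) (auto simp: powr_mult)
        then show ?thesis using True by (simp add: mult.assoc)
      qed simp
    qed
    also have "\<dots> = 2 powr q * (\<integral>x. \<bar>w x\<bar> powr q * dst x powr ?s \<partial>lborel)"
      by (rule Bochner_Integration.integral_mult_right_zero)
    finally have "?Q powr (p / q) \<le> (2 powr q * (\<integral>x. \<bar>w x\<bar> powr q * dst x powr ?s \<partial>lborel)) powr (p / q)"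
      using p q0 Q0 by (intro powr_mono2) auto
    also have "\<dots> = 2 powr p * (\<integral>x. \<bar>w x\<bar> powr q * dst x powr ?s \<partial>lborel) powr (p / q)"
      using q0 by (simp add: powr_mult powr_powr Bochner_Integration.integral_nonneg)
    also have "\<dots> \<le> 2 powr p * (C1 * (C3 * (\<integral>x. (J u g x + A u x) * indicator (wide_shell j) x \<partial>lborel)))"
      using 1 2 C1 by (intro mult_left_mono) (auto intro: order_trans)
    finally show "?Q powr (p / q) \<le> 2 powr p * (C1 * C3) * (\<integral>x. (J u g x + A u x) * indicator (wide_shell j) x \<partial>lborel)"
      by (simp add: mult.assoc)
  qed
qed

text \<open>At most three of the wide shells contain a given point, and there \<open>j + 1\<close> is comparable to \<open>ell\<close>.\<close>

lemma sum_wide_shell: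
  assumes "ell x > 0"
  shows "(\<Sum>j<n. indicator (wide_shell j) x / (real j + 1)\<^sup>2) \<le> 3 * (min 1 (4 / (ell x)\<^sup>2) :: real)"
proof -
  define m where "m = nat \<lfloor>ell x\<rfloor>"
  have m: "real m \<le> ell x" "ell x < real m + 1" using assms by (auto simp: m_def)
  let ?B = "min 1 (4 / (ell x)\<^sup>2) :: real"
  have B0: "?B \<ge> 0" by simp
  \<comment> \<open>With \<open>m\<close> the integer part of \<open>ell x\<close>, membership in
    \<open>wide_shell j\<close> confines \<open>j\<close> to \<open>m - 1\<close>, \<open>m\<close>,
    \<open>m + 1\<close>; for \<open>m = 0\<close> truncated subtraction leaves \<open>0\<close> and
    \<open>1\<close>.\<close>
  have "(\<Sum>j<n. indicator (wide_shell j) x / (real j + 1)\<^sup>2) \<le> (\<Sum>j<n. if j \<in> {m - 1..m + 1} then ?B else 0)"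
  proof (rule sum_mono)
    fix j
    show "indicator (wide_shell j) x / (real j + 1)\<^sup>2 \<le> (if j \<in> {m - 1..m + 1} then ?B else 0)"
    proof (cases "x \<in> wide_shell j")
      case True
      then have j: "real j - 1 < ell x" "ell x < real j + 2" by (auto simp: wide_shell_def)
      then have "j \<in> {m - 1..m + 1}" using m by auto
      moreover have "1 / (real j + 1)\<^sup>2 \<le> 1" by simp
      moreover have "1 / (real j + 1)\<^sup>2 \<le> 4 / (ell x)\<^sup>2"
      proof -
        have "(ell x)\<^sup>2 \<le> (2 * (real j + 1))\<^sup>2" using j assms by (intro power_mono) auto
        also have "\<dots> = 4 * (real j + 1)\<^sup>2" unfolding power_mult_distrib by simp
        finally show ?thesis using assms by (simp add: divide_simps)
      qed
      ultimately show ?thesis using True by simp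
    qed (use B0 in auto)
  qed
  also have "\<dots> = real (card ({..<n} \<inter> {m - 1..m + 1})) * ?B"
    by (simp add: sum.If_cases Int_def)
  also have "\<dots> \<le> 3 * ?B"
  proof (intro mult_right_mono B0)
    have "card ({..<n} \<inter> {m - 1..m + 1}) \<le> card {m - 1..m + 1}" by (intro card_mono) auto
    also have "\<dots> \<le> 3" by simp
    finally show "real (card ({..<n} \<inter> {m - 1..m + 1})) \<le> 3" by linarith
  qed
  finally show ?thesis .
qed

text \<open>Three bounds meet: \<open>shell_Sobolev\<close> controls the integral over
  \<open>shell j\<close> by a multiple of \<open>Y j powr r\<close>, \<open>shell_bound\<close>
  makes \<open>Y j\<close> grow at most linearly in \<open>j\<close>, and \<open>log_Hardy\<close>
  bounds the sum of \<open>Y j / (j + 1)\<^sup>2\<close>.\<close>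

lemma Hardy_Sobolev_log:
  fixes q :: real
  defines "N \<equiv> real DIM('a)"
  assumes k: "card S = DIM('a)" and N2: "DIM('a) \<ge> 2" and pN: "p < N" and q: "p \<le> q" "q \<le> N * p / (N - p)"
  shows "\<exists>C>0. \<forall>u g. C1c V u g \<longrightarrow>
     (\<integral>x. \<bar>u x\<bar> powr q * dst x powr (- q - N + N * q / p) * X_log (dst x / D) powr (1 + q / p) \<partial>lborel) powr (p / q)
     \<le> C * Jt u g"
proof -
  let ?s = "- q - N + N * q / p"
  define r where "r = q / p"
  have r: "r \<ge> 1" using p q by (simp add: r_def)
  have q0: "q > 0" using p q by simp
  obtain C1 where C1: "C1 > 0" "\<And>u g. C1c V u g \<Longrightarrow> (\<integral>x. A u x / (ell x)\<^sup>2 \<partial>lborel) \<le> C1 * Jt u g"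
    using log_Hardy by auto
  obtain C2 where C2: "C2 > 0" "\<And>u g j. C1c V u g \<Longrightarrow> (\<integral>x. A u x / (1 + (ell x - real j)\<^sup>2) \<partial>lborel) \<le> C2 * (real j + 1) * Jt u g"
    using shell_bound by auto
  obtain C3 where C3: "C3 > 0" "\<And>u g j. C1c V u g \<Longrightarrow>
     (\<integral>x. \<bar>u x\<bar> powr q * dst x powr ?s * indicator (shell j) x \<partial>lborel) powr (p / q)
     \<le> C3 * (\<integral>x. (J u g x + A u x) * indicator (wide_shell j) x \<partial>lborel)"
    using shell_Sobolev[of q] k N2 pN q unfolding N_def by auto
  \<comment> \<open>From \<open>ell x > t0\<close> follows \<open>c0 * (ell x + 1) <= ell x\<close>,
    so \<open>ell\<close> is bounded below by a multiple of \<open>j + 1\<close> on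
    \<open>shell j\<close>, also for \<open>j = 0\<close>.\<close>
  define c0 where "c0 = t0 / (1 + t0)"
  have c0: "c0 > 0" using t0 by (simp add: c0_def)
  \<comment> \<open>On \<open>wide_shell j\<close> the denominator
    \<open>1 + (ell x - j)\<^sup>2\<close> is at most \<open>5\<close>. The overlap of the wide
    shells is \<open>3\<close>, and \<open>12 = 3 * 4\<close> comes from
    \<open>ell x <= 2 * (j + 1)\<close>.\<close>
  define C4 where "C4 = 1 + 5 * C2"
  define C5 where "C5 = 3 + 12 * C1"
  have C45: "C4 > 0" "C5 > 0" using C1 C2 by (auto simp: C4_def C5_def)
  define C6 where "C6 = c0 powr (- (1 + r)) * (C3 powr r * (C4 powr (r - 1) * C5))"
  have C6: "C6 > 0" using c0 C3 C45 by (simp add: C6_def)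
  show ?thesis
  proof (intro exI[of _ "C6 powr (p / q)"] conjI allI impI)
    show "C6 powr (p / q) > 0" using C6 by simp
    fix u g assume u: "C1c V u g"
    let ?X = "\<lambda>x. X_log (dst x / D)"
    let ?f = "\<lambda>x. \<bar>u x\<bar> powr q * dst x powr ?s"
    let ?Q = "\<integral>x. ?f x * ?X x powr (1 + r) \<partial>lborel"
    define a where "a j = (\<integral>x. ?f x * indicator (shell j) x \<partial>lborel)" for j
    define Y where "Y j = (\<integral>x. (J u g x + A u x) * indicator (wide_shell j) x \<partial>lborel)" for j
    have a0: "a j \<ge> 0" for j unfolding a_def by (intro Bochner_Integration.integral_nonneg) auto
    have Y0: "Y j \<ge> 0" for j unfolding Y_def
      by (intro Bochner_Integration.integral_nonneg mult_nonneg_nonneg add_nonneg_nonneg J_nonneg A_nonneg) auto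
    have iY: "integrable lborel (\<lambda>x. (J u g x + A u x) * indicator (wide_shell j) x)" for j
      using integrable_AJ[OF u] by (intro integrable_real_mult_indicator) auto
    have iA: "integrable lborel (\<lambda>x. A u x / (ell x)\<^sup>2)"
      by (rule C1c_integrable[OF u]) (auto intro!: continuous_intros continuous_on_ell continuous_on_AJ[OF u] simp: zero_at dest: ell_pos)
    have ne: "1 + (z::real)\<^sup>2 \<noteq> 0" for z by (metis add_pos_nonneg less_irrefl zero_le_power2 zero_less_one)
    have iA': "integrable lborel (\<lambda>x. A u x / (1 + (ell x - real j)\<^sup>2))" for j
      by (rule C1c_integrable[OF u]) (use ne in \<open>auto intro!: continuous_intros continuous_on_ell continuous_on_AJ[OF u] simp: zero_at\<close>)
    have iJ: "integrable lborel (J u g)" by (rule integrable_AJ[OF u])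
    have XV: "?X x = 1 / ell x" if "x \<in> V" for x
    proof -
      have "dst x > 0" using that by (simp add: V_def)
      then show ?thesis using R by (simp add: X_log_def ell_def ln_div)
         (metis minus_diff_eq minus_divide_right)
    qed
    have if': "integrable lborel ?f"
      by (rule C1c_integrable[OF u])
         (use q0 V_U in \<open>auto intro!: continuous_intros continuous_on_powr' C1c_continuous_on[OF u] dst_ge_0
            continuous_on_subset[OF continuous_on_dst_powr]\<close>)
    \<comment> \<open>Compact support in \<open>V\<close> keeps \<open>ell\<close> bounded, so
      finitely many shells suffice and no infinite sum appears.\<close>
    obtain n where n: "\<And>x. u x \<noteq> 0 \<Longrightarrow> ell x < real n"
    proof -
      obtain K where K: "compact K" "K \<subseteq> V" "\<And>x. x \<notin> K \<Longrightarrow> u x = 0" using C1c_support[OF u] by metis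
      have "bounded (ell ` K)"
        by (intro compact_imp_bounded compact_continuous_image continuous_on_subset[OF continuous_on_ell] K)
      then obtain b where "\<And>x. x \<in> K \<Longrightarrow> norm (ell x) \<le> b" by (auto simp: bounded_iff)
      moreover obtain n where "b < real n" using reals_Archimedean2 by blast
      ultimately show ?thesis using K(3) by (intro that[of n]) force
    qed
    have Yle: "Y j \<le> C4 * (real j + 1) * Jt u g" for j
    proof -
      have "Y j \<le> (\<integral>x. J u g x + 5 * (A u x / (1 + (ell x - real j)\<^sup>2)) \<partial>lborel)"
        unfolding Y_def
      proof (rule integral_mono[OF iY])
        show "integrable lborel (\<lambda>x. J u g x + 5 * (A u x / (1 + (ell x - real j)\<^sup>2)))" using iJ iA'[of j] by (simp del: times_divide_eq_right)
        fix x
        show "(J u g x + A u x) * indicator (wide_shell j) x \<le> J u g x + 5 * (A u x / (1 + (ell x - real j)\<^sup>2))"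
        proof (cases "x \<in> wide_shell j")
          case True
          then have "\<bar>ell x - real j\<bar> \<le> 2" unfolding abs_le_iff by (auto simp: wide_shell_def)
          then have "\<bar>ell x - real j\<bar>\<^sup>2 \<le> 2\<^sup>2" by (intro power_mono) auto
          then have l: "1 + (ell x - real j)\<^sup>2 \<le> 5" by simp
          have "A u x = 5 * (A u x / 5)" by simp
          also have "\<dots> \<le> 5 * (A u x / (1 + (ell x - real j)\<^sup>2))"
            using l A_nonneg[of u x] by (intro mult_left_mono divide_left_mono mult_pos_pos add_pos_nonneg) auto
          finally show ?thesis using True by simp
        next
          case False
          have "0 \<le> A u x / (1 + (ell x - real j)\<^sup>2)" by (intro divide_nonneg_nonneg A_nonneg) auto
          then show ?thesis using False J_nonneg[of u g x] by simp
        qed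
      qed
      also have "\<dots> = Jt u g + 5 * (\<integral>x. A u x / (1 + (ell x - real j)\<^sup>2) \<partial>lborel)"
        using iJ iA'[of j] by (simp add: Jt_def del: times_divide_eq_right)
      also have "\<dots> \<le> Jt u g + 5 * (C2 * (real j + 1) * Jt u g)" using C2(2)[OF u] by simp
      also have "\<dots> \<le> (real j + 1) * Jt u g + 5 * (C2 * (real j + 1) * Jt u g)"
        using mult_right_mono[of 1 "real j + 1" "Jt u g"] Jt_nonneg[of u g] by simp
      finally show ?thesis by (simp add: C4_def algebra_simps)
    qed
    have Ysum: "(\<Sum>j<n. Y j / (real j + 1)\<^sup>2) \<le> C5 * Jt u g"
    proof -
      have "(\<Sum>j<n. Y j / (real j + 1)\<^sup>2) = (\<Sum>j<n. \<integral>x. (J u g x + A u x) * indicator (wide_shell j) x / (real j + 1)\<^sup>2 \<partial>lborel)"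
        by (simp add: Y_def)
      also have "\<dots> = (\<integral>x. (\<Sum>j<n. (J u g x + A u x) * indicator (wide_shell j) x / (real j + 1)\<^sup>2) \<partial>lborel)"
        using iY by (intro Bochner_Integration.integral_sum[symmetric]) auto
      also have "\<dots> \<le> (\<integral>x. 3 * J u g x + 12 * (A u x / (ell x)\<^sup>2) \<partial>lborel)"
      proof (rule integral_mono)
        show "integrable lborel (\<lambda>x. \<Sum>j<n. (J u g x + A u x) * indicator (wide_shell j) x / (real j + 1)\<^sup>2)"
          using iY by (intro Bochner_Integration.integrable_sum) auto
        show "integrable lborel (\<lambda>x. 3 * J u g x + 12 * (A u x / (ell x)\<^sup>2))" using iJ iA by (simp del: times_divide_eq_right)
        fix x
        show "(\<Sum>j<n. (J u g x + A u x) * indicator (wide_shell j) x / (real j + 1)\<^sup>2) \<le> 3 * J u g x + 12 * (A u x / (ell x)\<^sup>2)"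
        proof (cases "x \<in> V")
          case True
          have "(\<Sum>j<n. (J u g x + A u x) * indicator (wide_shell j) x / (real j + 1)\<^sup>2)
            = J u g x * (\<Sum>j<n. indicator (wide_shell j) x / (real j + 1)\<^sup>2) + A u x * (\<Sum>j<n. indicator (wide_shell j) x / (real j + 1)\<^sup>2)"
            by (simp add: sum_distrib_left sum.distrib[symmetric] algebra_simps add_divide_distrib)
          also have "\<dots> \<le> J u g x * (3 * 1) + A u x * (3 * (4 / (ell x)\<^sup>2))"
            using sum_wide_shell[OF ell_pos[OF True], of n]
            by (intro add_mono mult_left_mono J_nonneg A_nonneg) auto
          finally show ?thesis by (simp add: mult.commute)
        qed (simp add: zero_outside[OF u])
      qed
      also have "\<dots> = 3 * Jt u g + 12 * (\<integral>x. A u x / (ell x)\<^sup>2 \<partial>lborel)"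
        using iJ iA by (simp add: Jt_def del: times_divide_eq_right)
      also have "\<dots> \<le> 3 * Jt u g + 12 * (C1 * Jt u g)" using C1(2)[OF u] by simp
      finally show ?thesis by (simp add: C5_def algebra_simps)
    qed
    have aY: "a j \<le> C3 powr r * Y j powr r" for j
    proof -
      have "a j powr (p / q) \<le> C3 * Y j" using C3(2)[OF u, of j] by (simp add: a_def Y_def)
      then have "(a j powr (p / q)) powr r \<le> (C3 * Y j) powr r" using r by (intro powr_mono2) auto
      then show ?thesis using a0[of j] Y0[of j] p q0 by (simp add: powr_powr r_def powr_mult C3(1) less_imp_le)
    qed
    have "?Q \<le> (\<integral>x. (\<Sum>j<n. (c0 * (real j + 1)) powr (- (1 + r)) * (?f x * indicator (shell j) x)) \<partial>lborel)"
    proof (rule integral_mono')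
      show "integrable lborel (\<lambda>x. \<Sum>j<n. (c0 * (real j + 1)) powr (- (1 + r)) * (?f x * indicator (shell j) x))"
        using if' by (intro Bochner_Integration.integrable_sum integrable_mult_right integrable_real_mult_indicator) auto
      fix x
      show "0 \<le> (\<Sum>j<n. (c0 * (real j + 1)) powr (- (1 + r)) * (?f x * indicator (shell j) x))"
        by (intro sum_nonneg) auto
      show "?f x * ?X x powr (1 + r) \<le> (\<Sum>j<n. (c0 * (real j + 1)) powr (- (1 + r)) * (?f x * indicator (shell j) x))"
      proof (cases "u x = 0")
        case False
        then have x: "x \<in> V" using zero_outside(1)[OF u] by blast
        define m where "m = nat \<lfloor>ell x\<rfloor>"
        have m: "real m \<le> ell x" "ell x < real m + 1" using ell_pos[OF x] by (auto simp: m_def)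
        have mn: "m < n" using m n[OF False] by simp
        have xm: "x \<in> shell m" using m by (simp add: shell_def)
        have "c0 * (real m + 1) \<le> c0 * (ell x + 1)" using c0 m by (intro mult_left_mono) auto
        also have "\<dots> \<le> ell x"
          using t0 ell_gt[OF x] by (simp add: c0_def field_simps)
        finally have "ell x powr (- (1 + r)) \<le> (c0 * (real m + 1)) powr (- (1 + r))"
          using c0 r by (intro powr_mono2') auto
        moreover have "?X x powr (1 + r) = ell x powr (- (1 + r))"
          using ell_pos[OF x] powr_minus_divide[of "ell x" "1 + r"] unfolding XV[OF x] by (simp add: powr_divide)
        ultimately have "?f x * ?X x powr (1 + r) \<le> (c0 * (real m + 1)) powr (- (1 + r)) * (?f x * indicator (shell m) x)"
          using xm mult_left_mono[of "ell x powr (- (1 + r))" "(c0 * (real m + 1)) powr (- (1 + r))" "?f x"]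
          by (simp add: mult.commute)
        also have "\<dots> \<le> (\<Sum>j<n. (c0 * (real j + 1)) powr (- (1 + r)) * (?f x * indicator (shell j) x))"
          using mn by (intro member_le_sum) auto
        finally show ?thesis .
      qed (use q0 in simp)
    qed
    also have "\<dots> = (\<Sum>j<n. (c0 * (real j + 1)) powr (- (1 + r)) * a j)"
      unfolding a_def using if'
      by (subst Bochner_Integration.integral_sum) (auto intro!: integrable_mult_right integrable_real_mult_indicator)
    also have "\<dots> \<le> (\<Sum>j<n. c0 powr (- (1 + r)) * (C3 powr r * ((C4 * Jt u g) powr (r - 1) * (Y j / (real j + 1)\<^sup>2))))"
    proof (rule sum_mono)
      fix j
      let ?k = "real j + 1"
      have k0: "?k > 0" by simp
      \<comment> \<open>Here \<open>Y j powr r\<close> is split as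
        \<open>Y j powr (r - 1) * Y j\<close>, and the linear growth of \<open>Y j\<close> is spent
        on the first factor only.\<close>
      have "?k powr (- (1 + r)) * Y j powr r \<le> (C4 * Jt u g) powr (r - 1) * (Y j / ?k\<^sup>2)"
      proof (cases "Y j = 0")
        case False
        then have Yp: "Y j > 0" using Y0[of j] by simp
        have "?k powr (- (1 + r)) * Y j powr r = (Y j / ?k) powr (r - 1) * (Y j / ?k\<^sup>2)"
        proof -
          have "Y j powr r = Y j powr (r - 1) * Y j" using Yp by (simp add: powr_diff)
          moreover have "?k powr (- (1 + r)) = ?k powr (- (r - 1)) / ?k\<^sup>2"
          proof -
            have "?k powr (- (1 + r)) = ?k powr (- (r - 1) - 2)" by simp
            also have "\<dots> = ?k powr (- (r - 1)) / ?k powr 2" by (rule powr_diff)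
            finally show ?thesis by simp
          qed
          ultimately show ?thesis using Yp k0 by (simp only: powr_divide powr_minus) (simp add: divide_inverse mult_ac)
        qed
        also have "\<dots> \<le> (C4 * Jt u g) powr (r - 1) * (Y j / ?k\<^sup>2)"
        proof (intro mult_right_mono powr_mono2)
          show "Y j / ?k \<le> C4 * Jt u g" using Yle[of j] by (simp add: field_simps)
        qed (use r Y0[of j] in auto)
        finally show ?thesis .
      qed (use r in simp)
      then have "c0 powr (- (1 + r)) * (C3 powr r * (?k powr (- (1 + r)) * Y j powr r))
         \<le> c0 powr (- (1 + r)) * (C3 powr r * ((C4 * Jt u g) powr (r - 1) * (Y j / ?k\<^sup>2)))"
        by (intro mult_left_mono) auto
      moreover have "(c0 * ?k) powr (- (1 + r)) * a j \<le> (c0 * ?k) powr (- (1 + r)) * (C3 powr r * Y j powr r)"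
        by (intro mult_left_mono aY) auto
      moreover have "(c0 * ?k) powr (- (1 + r)) = c0 powr (- (1 + r)) * ?k powr (- (1 + r))"
        using c0 by (simp add: powr_mult)
      ultimately show "(c0 * ?k) powr (- (1 + r)) * a j \<le> c0 powr (- (1 + r)) * (C3 powr r * ((C4 * Jt u g) powr (r - 1) * (Y j / ?k\<^sup>2)))"
        by (simp add: mult_ac)
    qed
    also have "\<dots> = c0 powr (- (1 + r)) * (C3 powr r * ((C4 * Jt u g) powr (r - 1) * (\<Sum>j<n. Y j / (real j + 1)\<^sup>2)))"
      by (simp add: sum_distrib_left)
    also have "\<dots> \<le> c0 powr (- (1 + r)) * (C3 powr r * ((C4 * Jt u g) powr (r - 1) * (C5 * Jt u g)))"
      by (intro mult_left_mono Ysum) auto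
    also have "\<dots> = C6 * Jt u g powr r"
    proof -
      have "Jt u g powr r = Jt u g powr (r - 1) * Jt u g"
        using Jt_nonneg[of u g] r by (cases "Jt u g = 0") (auto simp: powr_diff)
      then show ?thesis using C45 Jt_nonneg[of u g] by (simp add: C6_def powr_mult mult_ac)
    qed
    finally have "?Q \<le> C6 * Jt u g powr r" .
    moreover have "?Q \<ge> 0" by (intro Bochner_Integration.integral_nonneg) auto
    ultimately have "?Q powr (p / q) \<le> (C6 * Jt u g powr r) powr (p / q)"
      using p q0 by (intro powr_mono2) auto
    also have "\<dots> = C6 powr (p / q) * Jt u g"
      using C6 Jt_nonneg[of u g] p q0 by (simp add: powr_mult powr_powr r_def)
    finally show "(\<integral>x. \<bar>u x\<bar> powr q * dst x powr ?s * X_log (dst x / D) powr (1 + q / p) \<partial>lborel) powr (p / q)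
       \<le> C6 powr (p / q) * Jt u g" by (simp add: r_def)
  qed
qed

end

subsection \<open>Passing to the limit\<close>

text \<open>The tangent line at the convex combination \<open>z\<close> lies below the power, by
  \<open>Bernoulli_powr\<close> at \<open>r / z\<close>; averaging the two tangent values returns
  \<open>z powr p\<close>.\<close>

lemma powr_convex_comb:
  fixes s t \<theta> p :: real
  assumes p: "p \<ge> 1" and s: "s \<ge> 0" and t: "t \<ge> 0" and th: "0 < \<theta>" "\<theta> < 1"
  shows "((1 - \<theta>) * s + \<theta> * t) powr p \<le> (1 - \<theta>) * s powr p + \<theta> * t powr p"
proof -
  define z where "z = (1 - \<theta>) * s + \<theta> * t"
  have z0: "z \<ge> 0" using assms by (simp add: z_def)
  show ?thesis
  proof (cases "z = 0")
    case True
    then show ?thesis using assms by (simp add: z_def[symmetric])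
  next
    case False
    then have z: "z > 0" using z0 by simp
    have tangent: "r powr p \<ge> z powr p * (1 + p * (r / z - 1))" if "r \<ge> 0" for r
    proof -
      have "z powr p * (1 + p * (r / z - 1)) \<le> z powr p * (r / z) powr p"
        using Bernoulli_powr[OF p, of "r / z"] that z by (intro mult_left_mono) auto
      also have "\<dots> = r powr p" using z by (simp add: powr_divide)
      finally show ?thesis .
    qed
    have "z powr p = (1 - \<theta>) * (z powr p * (1 + p * (s / z - 1))) + \<theta> * (z powr p * (1 + p * (t / z - 1)))"
    proof -
      have "(1 - \<theta>) * (s / z) + \<theta> * (t / z) = 1"
        using z by (simp add: z_def add_divide_distrib[symmetric])
      moreover have "(1 - \<theta>) * (z powr p * (1 + p * (s / z - 1))) + \<theta> * (z powr p * (1 + p * (t / z - 1)))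
        = z powr p * (1 - p + p * ((1 - \<theta>) * (s / z) + \<theta> * (t / z)))" by (simp only: algebra_simps)
      ultimately show ?thesis by simp
    qed
    also have "\<dots> \<le> (1 - \<theta>) * s powr p + \<theta> * t powr p"
      using th by (intro add_mono mult_left_mono tangent s t) auto
    finally show ?thesis by (simp add: z_def)
  qed
qed

text \<open>Convexity at the points \<open>norm x / (1 - \<theta>)\<close> and
  \<open>norm y / \<theta>\<close>. For small \<theta> the coefficient of \<open>x\<close> is close
  to \<open>1\<close>, at the price of a large one for \<open>y\<close>.\<close>

lemma norm_add_powr_le:
  fixes x y :: "'a::real_normed_vector"
  assumes p: "p \<ge> 1" and th: "0 < \<theta>" "\<theta> < 1"
  shows "norm (x + y) powr p \<le> (1 - \<theta>) powr (1 - p) * norm x powr p + \<theta> powr (1 - p) * norm y powr p"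
proof -
  have "norm (x + y) powr p \<le> ((1 - \<theta>) * (norm x / (1 - \<theta>)) + \<theta> * (norm y / \<theta>)) powr p"
    using p th by (intro powr_mono2) (auto simp: norm_triangle_ineq)
  also have "\<dots> \<le> (1 - \<theta>) * (norm x / (1 - \<theta>)) powr p + \<theta> * (norm y / \<theta>) powr p"
    by (rule powr_convex_comb) (use p th in auto)
  also have "\<dots> = (1 - \<theta>) powr (1 - p) * norm x powr p + \<theta> powr (1 - p) * norm y powr p"
    using th by (simp add: powr_divide powr_diff)
  finally show ?thesis .
qed

text \<open>For \<open>h = 0\<close> the first integral is left unconstrained, because it may diverge.\<close>

definition HS_ineq :: "real \<Rightarrow> real \<Rightarrow> real \<Rightarrow> real \<Rightarrow> ('a::euclidean_space \<Rightarrow> real) \<Rightarrow> ('a \<Rightarrow> real) \<Rightarrow> ('a \<Rightarrow> real) \<Rightarrow> ('a \<Rightarrow> 'a) \<Rightarrow> bool" where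
  "HS_ineq p q h c w w' v G \<longleftrightarrow> (\<exists>a b. 0 \<le> a \<and> 0 \<le> b \<and>
     (h = 0 \<or> (\<integral>\<^sup>+x. ennreal (\<bar>v x\<bar> powr p * w x) \<partial>lebesgue) \<le> ennreal a) \<and>
     (\<integral>\<^sup>+x. ennreal (\<bar>v x\<bar> powr q * w' x) \<partial>lebesgue) \<le> ennreal b \<and>
     h * a + c * b powr (p / q) \<le> (\<integral>x. norm (G x) powr p \<partial>lebesgue))"

lemma Fatou_powr:
  fixes v :: "'a \<Rightarrow> real"
  assumes [measurable]: "\<And>m. u m \<in> borel_measurable M" "v \<in> borel_measurable M" "w \<in> borel_measurable M"
    and lim: "AE x in M. (\<lambda>m. u m x) \<longlonglongrightarrow> v x" and p: "p > 0"
  shows "(\<integral>\<^sup>+x. ennreal (\<bar>v x\<bar> powr p * w x) \<partial>M) \<le> liminf (\<lambda>m. \<integral>\<^sup>+x. ennreal (\<bar>u m x\<bar> powr p * w x) \<partial>M)"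
proof -
  have "(\<integral>\<^sup>+x. ennreal (\<bar>v x\<bar> powr p * w x) \<partial>M) = (\<integral>\<^sup>+x. liminf (\<lambda>m. ennreal (\<bar>u m x\<bar> powr p * w x)) \<partial>M)"
  proof (rule nn_integral_cong_AE, use lim in eventually_elim)
    fix x assume "(\<lambda>m. u m x) \<longlonglongrightarrow> v x"
    then have "(\<lambda>m. ennreal (\<bar>u m x\<bar> powr p * w x)) \<longlonglongrightarrow> ennreal (\<bar>v x\<bar> powr p * w x)"
      by (intro tendsto_intros tendsto_powr') (use p in auto)
    then show "ennreal (\<bar>v x\<bar> powr p * w x) = liminf (\<lambda>m. ennreal (\<bar>u m x\<bar> powr p * w x))"
      by (intro lim_imp_Liminf[symmetric]) auto
  qed
  also have "\<dots> \<le> liminf (\<lambda>m. \<integral>\<^sup>+x. ennreal (\<bar>u m x\<bar> powr p * w x) \<partial>M)"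
    by (rule nn_integral_liminf) measurable
  finally show ?thesis .
qed

text \<open>The factor \<open>(1 - \<theta>) powr (1 - p)\<close> tends to \<open>1\<close>, which replaces Minkowski's inequality.\<close>

lemma HS_ineq_limit:
  fixes v :: "'a::euclidean_space \<Rightarrow> real" and G :: "'a \<Rightarrow> 'a"
  assumes ineq: "\<And>m. HS_ineq p q h c w w' (u m) (Gs m)"
    and meas: "\<And>m. u m \<in> borel_measurable lebesgue" "v \<in> borel_measurable lebesgue"
      "w \<in> borel_measurable lebesgue" "w' \<in> borel_measurable lebesgue"
      "\<And>m. Gs m \<in> borel_measurable lebesgue" "G \<in> borel_measurable lebesgue"
    and lim: "AE x in lebesgue. (\<lambda>m. u m x) \<longlonglongrightarrow> v x"
    and p: "1 < p" "p \<le> q" and hc: "0 \<le> h" "0 < c"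
    and iG: "integrable lebesgue (\<lambda>x. norm (G x) powr p)"
    and iD: "\<And>m. integrable lebesgue (\<lambda>x. norm (G x - Gs m x) powr p)"
    and D0: "(\<lambda>m. \<integral>x. norm (G x - Gs m x) powr p \<partial>lebesgue) \<longlonglongrightarrow> 0"
  shows "HS_ineq p q h c w w' v G"
proof -
  note [measurable] = meas
  let ?a = "\<integral>\<^sup>+x. ennreal (\<bar>v x\<bar> powr p * w x) \<partial>lebesgue"
  let ?b = "\<integral>\<^sup>+x. ennreal (\<bar>v x\<bar> powr q * w' x) \<partial>lebesgue"
  let ?R = "\<integral>x. norm (G x) powr p \<partial>lebesgue"
  let ?D = "\<lambda>m. \<integral>x. norm (G x - Gs m x) powr p \<partial>lebesgue"
  have q: "q > 0" "p / q > 0" "p / q \<le> 1" using p by auto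
  have R0: "?R \<ge> 0" by (intro Bochner_Integration.integral_nonneg) auto
  obtain am bm where ab: "\<And>m. 0 \<le> am m" "\<And>m. 0 \<le> bm m"
     "\<And>m. h = 0 \<or> (\<integral>\<^sup>+x. ennreal (\<bar>u m x\<bar> powr p * w x) \<partial>lebesgue) \<le> ennreal (am m)"
     "\<And>m. (\<integral>\<^sup>+x. ennreal (\<bar>u m x\<bar> powr q * w' x) \<partial>lebesgue) \<le> ennreal (bm m)"
     "\<And>m. h * am m + c * bm m powr (p / q) \<le> (\<integral>x. norm (Gs m x) powr p \<partial>lebesgue)"
  proof -
    define P where "P m a b \<longleftrightarrow> 0 \<le> a \<and> 0 \<le> b \<and>
     (h = 0 \<or> (\<integral>\<^sup>+x. ennreal (\<bar>u m x\<bar> powr p * w x) \<partial>lebesgue) \<le> ennreal a) \<and>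
     (\<integral>\<^sup>+x. ennreal (\<bar>u m x\<bar> powr q * w' x) \<partial>lebesgue) \<le> ennreal b \<and>
     h * a + c * b powr (p / q) \<le> (\<integral>x. norm (Gs m x) powr p \<partial>lebesgue)" for m a b
    have "\<forall>m. \<exists>a b. P m a b" using ineq unfolding HS_ineq_def P_def by blast
    then obtain am bm where "\<And>m. P m (am m) (bm m)" by metis
    then show ?thesis unfolding P_def by (intro that[of am bm]) auto
  qed
  \<comment> \<open>Numbers strictly below the limit integrals are eventually below the integrals of
    the \<open>u m\<close>, by Fatou. Admitting the value \<open>0\<close> for \<alpha> or \<beta>
    isolates one term, which later proves the integrals finite.\<close>
  have key: "h * \<alpha> + c * \<beta> powr (p / q) \<le> ?R"
    if \<alpha>: "0 \<le> \<alpha>" "h = 0 \<or> \<alpha> = 0 \<or> ennreal \<alpha> < ?a" and \<beta>: "0 \<le> \<beta>" "\<beta> = 0 \<or> ennreal \<beta> < ?b" for \<alpha> \<beta>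
  proof -
    let ?X = "h * \<alpha> + c * \<beta> powr (p / q)"
    have eva: "eventually (\<lambda>m. h * \<alpha> \<le> h * am m) sequentially"
    proof (cases "h = 0 \<or> \<alpha> = 0")
      case False
      then have "ennreal \<alpha> < liminf (\<lambda>m. \<integral>\<^sup>+x. ennreal (\<bar>u m x\<bar> powr p * w x) \<partial>lebesgue)"
        using \<alpha>(2) Fatou_powr[OF meas(1-3) lim, of p] p by (auto intro: less_le_trans)
      then have "eventually (\<lambda>m. ennreal \<alpha> < (\<integral>\<^sup>+x. ennreal (\<bar>u m x\<bar> powr p * w x) \<partial>lebesgue)) sequentially"
        by (rule less_LiminfD)
      then show ?thesis
      proof eventually_elim
        case (elim m)
        then have "ennreal \<alpha> < ennreal (am m)" using ab(3)[of m] False by (auto intro: less_le_trans)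
        then show ?case using hc \<alpha> by (intro mult_left_mono) (auto simp: ennreal_less_iff)
      qed
    qed (use hc ab in auto)
    have evb: "eventually (\<lambda>m. \<beta> powr (p / q) \<le> bm m powr (p / q)) sequentially"
    proof (cases "\<beta> = 0")
      case False
      then have "ennreal \<beta> < liminf (\<lambda>m. \<integral>\<^sup>+x. ennreal (\<bar>u m x\<bar> powr q * w' x) \<partial>lebesgue)"
        using \<beta>(2) Fatou_powr[OF meas(1,2,4) lim, of q] q by (auto intro: less_le_trans)
      then have "eventually (\<lambda>m. ennreal \<beta> < (\<integral>\<^sup>+x. ennreal (\<bar>u m x\<bar> powr q * w' x) \<partial>lebesgue)) sequentially"
        by (rule less_LiminfD)
      then show ?thesis
      proof eventually_elim
        case (elim m)
        then have "ennreal \<beta> < ennreal (bm m)" using ab(4)[of m] by (auto intro: less_le_trans)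
        then show ?case using \<beta> q by (intro powr_mono2) (auto simp: ennreal_less_iff)
      qed
    qed simp
    have th: "?X \<le> (1 - \<theta>) powr (1 - p) * ?R" if \<theta>: "0 < \<theta>" "\<theta> < 1" for \<theta>
    proof -
      have Gm: "(\<integral>x. norm (Gs m x) powr p \<partial>lebesgue) \<le> (1 - \<theta>) powr (1 - p) * ?R + \<theta> powr (1 - p) * ?D m" for m
      proof -
        have "(\<integral>x. norm (Gs m x) powr p \<partial>lebesgue)
          \<le> (\<integral>x. (1 - \<theta>) powr (1 - p) * norm (G x) powr p + \<theta> powr (1 - p) * norm (G x - Gs m x) powr p \<partial>lebesgue)"
        proof (rule integral_mono')
          show "integrable lebesgue (\<lambda>x. (1 - \<theta>) powr (1 - p) * norm (G x) powr p + \<theta> powr (1 - p) * norm (G x - Gs m x) powr p)"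
            using iG iD[of m] by simp
          show "norm (Gs m x) powr p \<le> (1 - \<theta>) powr (1 - p) * norm (G x) powr p + \<theta> powr (1 - p) * norm (G x - Gs m x) powr p" for x
            using norm_add_powr_le[of p \<theta> "G x" "- (G x - Gs m x)"] p \<theta> by (simp add: norm_minus_commute)
        qed auto
        also have "\<dots> = (1 - \<theta>) powr (1 - p) * ?R + \<theta> powr (1 - p) * ?D m"
          using iG iD[of m] by simp
        finally show ?thesis .
      qed
      have "(\<lambda>m. (1 - \<theta>) powr (1 - p) * ?R + \<theta> powr (1 - p) * ?D m) \<longlonglongrightarrow> (1 - \<theta>) powr (1 - p) * ?R + \<theta> powr (1 - p) * 0"
        by (intro tendsto_intros D0)
      moreover have "eventually (\<lambda>m. ?X \<le> (1 - \<theta>) powr (1 - p) * ?R + \<theta> powr (1 - p) * ?D m) sequentially"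
        using eva evb
      proof eventually_elim
        case (elim m)
        have "c * \<beta> powr (p / q) \<le> c * bm m powr (p / q)" using elim(2) hc by (intro mult_left_mono) auto
        then show ?case using elim(1) ab(5)[of m] Gm[of m] by linarith
      qed
      ultimately have "?X \<le> (1 - \<theta>) powr (1 - p) * ?R + \<theta> powr (1 - p) * 0"
        by (intro tendsto_lowerbound[of _ _ sequentially]) auto
      then show ?thesis by simp
    qed
    \<comment> \<open>Only after \<open>m\<close> has gone to infinity may \<theta> tend to
      \<open>0\<close>: the error term carried the unbounded factor
      \<open>\<theta> powr (1 - p)\<close>.\<close>
    have "((\<lambda>\<theta>. (1 - \<theta>) powr (1 - p) * ?R) \<longlongrightarrow> (1 - 0) powr (1 - p) * ?R) (at_right 0)"
      by (intro tendsto_intros) auto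
    moreover have "eventually (\<lambda>\<theta>. ?X \<le> (1 - \<theta>) powr (1 - p) * ?R) (at_right 0)"
      using eventually_at_right_real[of 0 1] by (auto elim!: eventually_mono intro: th)
    ultimately have "?X \<le> (1 - 0) powr (1 - p) * ?R"
      by (intro tendsto_lowerbound[of _ _ "at_right 0"]) auto
    then show ?thesis by simp
  qed
  have b_fin: "?b \<noteq> \<infinity>"
  proof
    assume b: "?b = \<infinity>"
    \<comment> \<open>Chosen so that \<open>c * \<beta> powr (p / q)\<close> exceeds the right-hand
      side by \<open>1\<close>.\<close>
    define \<beta> where "\<beta> = ((?R + 1) / c) powr (q / p)"
    have "c * \<beta> powr (p / q) = ?R + 1" using R0 hc p by (simp add: \<beta>_def powr_powr)
    moreover have "h * 0 + c * \<beta> powr (p / q) \<le> ?R" by (rule key) (auto simp: b \<beta>_def)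
    ultimately show False by simp
  qed
  then obtain b where b: "?b = ennreal b" "b \<ge> 0" by (cases ?b) auto
  have a_fin: "?a \<noteq> \<infinity>" if "h \<noteq> 0"
  proof
    assume a: "?a = \<infinity>"
    have "h * ((?R + 1) / h) + c * 0 powr (p / q) \<le> ?R" by (rule key) (use R0 hc a in auto)
    then show False using that q by simp
  qed
  define a where "a = (if h = 0 then 0 else enn2real ?a)"
  have a: "h = 0 \<or> ?a = ennreal a" "a \<ge> 0" using a_fin by (auto simp: a_def less_top)
  have "h * a + c * b powr (p / q) \<le> ?R"
  \<comment> \<open>The integrals are approached strictly from below by \<open>z * a\<close> and
    \<open>z * b\<close>; since \<open>p / q <= 1\<close> gives \<open>z <= z powr (p / q)\<close>,
    the left-hand side shrinks by no more than the factor \<open>z\<close>.\<close>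
  proof (rule field_le_mult_one_interval)
    fix z :: real assume z: "0 < z" "z < 1"
    have lt: "z * t = 0 \<or> ennreal (z * t) < ennreal t" if "t \<ge> 0" for t
      using z that by (cases "t = 0") (auto intro!: ennreal_lessI)
    have "h * (z * a) + c * (z * b) powr (p / q) \<le> ?R"
      using lt[OF a(2)] lt[OF b(2)] a b z by (intro key) auto
    moreover have "z * b powr (p / q) \<le> (z * b) powr (p / q)"
    proof -
      have "z powr 1 \<le> z powr (p / q)" using z q by (intro powr_mono') auto
      then show ?thesis using z b q by (auto simp: powr_mult intro!: mult_right_mono)
    qed
    then have "c * (z * b powr (p / q)) \<le> c * (z * b) powr (p / q)" using hc by (intro mult_left_mono) auto
    ultimately show "z * (h * a + c * b powr (p / q)) \<le> ?R" by (simp add: algebra_simps)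
  qed
  then show ?thesis unfolding HS_ineq_def using a b by (intro exI[of _ a] exI[of _ b]) auto
qed

subsection \<open>Test functions and Sobolev functions\<close>

text \<open>Off the closed support the function is locally zero, so uniqueness of the derivative
  makes \<open>grad\<close> vanish there as well.\<close>

lemma test_function_C1c:
  fixes \<phi> :: "real ^ 'n \<Rightarrow> real"
  assumes "\<phi> \<in> test_functions \<Omega>" shows "C1c \<Omega> \<phi> (grad \<phi>)"
proof -
  let ?C = "closure {x. \<phi> x \<noteq> 0}"
  have C: "compact ?C" "?C \<subseteq> \<Omega>" and "Ck (Suc 0) \<phi>"
    using assms unfolding test_functions_def by blast+
  then have d: "\<phi> differentiable (at x)" and c: "continuous_on UNIV (\<lambda>x. grad \<phi> x $ i)" for x i
    by (auto simp: differentiable_on_def)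
  have lin: "frechet_derivative \<phi> (at x) h = grad \<phi> x \<bullet> h" for x h
  proof -
    have l: "linear (frechet_derivative \<phi> (at x))" by (rule linear_frechet_derivative[OF d])
    have "frechet_derivative \<phi> (at x) h = frechet_derivative \<phi> (at x) (\<Sum>i\<in>UNIV. h $ i *\<^sub>R axis i 1)"
      by (subst (1) basis_expansion[symmetric]) (simp add: scalar_mult_eq_scaleR)
    also have "\<dots> = (\<Sum>i\<in>UNIV. h $ i * frechet_derivative \<phi> (at x) (axis i 1))"
      by (simp add: linear_sum[OF l] linear_scale[OF l])
    also have "\<dots> = grad \<phi> x \<bullet> h" by (simp add: grad_def inner_vec_def mult.commute)
    finally show ?thesis .
  qed
  have der: "(\<phi> has_derivative (\<lambda>h. grad \<phi> x \<bullet> h)) (at x)" for x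
    using d[of x] unfolding frechet_derivative_works lin[abs_def] .
  show ?thesis
  proof (rule C1cI[OF der _ C])
    show "continuous_on UNIV (grad \<phi>)"
      using continuous_on_vec_lambda[of UNIV "\<lambda>i x. grad \<phi> x $ i"] c by simp
    fix x assume x: "x \<notin> ?C"
    then show "\<phi> x = 0" using closure_subset[of "{x. \<phi> x \<noteq> 0}"] by auto
    have "((\<lambda>x. 0) has_derivative (\<lambda>h. 0)) (at x)" by simp
    then have "(\<phi> has_derivative (\<lambda>h. 0)) (at x)"
      by (rule has_derivative_transform_within_open[of _ _ _ _ "- ?C"])
         (use x closure_subset[of "{x. \<phi> x \<noteq> 0}"] in \<open>auto simp: open_Compl\<close>)
    then have "(\<lambda>h. 0) = (\<lambda>h. grad \<phi> x \<bullet> h)" using der by (rule has_derivative_unique)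
    then show "grad \<phi> x = 0" by (metis inner_eq_zero_iff)
  qed
qed

lemma HS_ineq_C1c:
  assumes u: "C1c V u g" and i: "integrable lborel (\<lambda>x. \<bar>u x\<bar> powr p * w x)" "integrable lborel (\<lambda>x. \<bar>u x\<bar> powr q * w' x)"
    and w: "\<And>x. w x \<ge> 0" "\<And>x. w' x \<ge> 0"
    and le: "h * (\<integral>x. \<bar>u x\<bar> powr p * w x \<partial>lborel) + c * (\<integral>x. \<bar>u x\<bar> powr q * w' x \<partial>lborel) powr (p / q)
       \<le> (\<integral>x. norm (g x) powr p \<partial>lborel)"
  shows "HS_ineq p q h c w w' u g"
proof -
  note [measurable] = C1c_measurable[OF u]
  have nn: "(\<integral>\<^sup>+x. ennreal (f x) \<partial>lebesgue) \<le> ennreal (\<integral>x. f x \<partial>lborel)"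
    if "integrable lborel f" "\<And>x. f x \<ge> 0" for f :: "'a \<Rightarrow> real"
  proof -
    have "(\<integral>\<^sup>+x. ennreal (f x) \<partial>lebesgue) = (\<integral>\<^sup>+x. ennreal (f x) \<partial>lborel)"
      using that by (intro nn_integral_completion)
    also have "\<dots> = ennreal (\<integral>x. f x \<partial>lborel)" using that by (intro nn_integral_eq_integral) auto
    finally show ?thesis by simp
  qed
  have "(\<integral>x. norm (g x) powr p \<partial>lebesgue) = (\<integral>x. norm (g x) powr p \<partial>lborel)"
    by (rule integral_completion) measurable
  then show ?thesis
    unfolding HS_ineq_def using nn[OF i(1)] nn[OF i(2)] w le
    by (intro exI[of _ "\<integral>x. \<bar>u x\<bar> powr p * w x \<partial>lborel"] exI[of _ "\<integral>x. \<bar>u x\<bar> powr q * w' x \<partial>lborel"])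
       (auto intro!: Bochner_Integration.integral_nonneg)
qed

lemma borel_measurable_lebesgue: "f \<in> borel_measurable borel \<Longrightarrow> f \<in> borel_measurable lebesgue"
  by (rule measurable_completion) simp

lemma W01p_integrable_grad:
  assumes "open \<Omega>" "W01p \<Omega> p u g" "1 < p"
  shows "integrable lebesgue (\<lambda>x. norm (indicator \<Omega> x *\<^sub>R g x) powr p)"
proof -
  have \<Omega>i: "\<Omega> \<inter> space lebesgue \<in> sets lebesgue" using assms(1) by simp
  have "integrable (lebesgue_on \<Omega>) (\<lambda>x. norm (g x) powr p)"
    using assms(2) by (auto simp: W01p_def W1p_def in_Lp_def)
  then have "integrable lebesgue (\<lambda>x. indicator \<Omega> x *\<^sub>R norm (g x) powr p)"
    by (subst (asm) integrable_restrict_space[OF \<Omega>i])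
  also have "(\<lambda>x. indicator \<Omega> x *\<^sub>R norm (g x) powr p) = (\<lambda>x. norm (indicator \<Omega> x *\<^sub>R g x) powr p)"
    using assms(3) by (auto simp: indicator_def fun_eq_iff)
  finally show ?thesis .
qed

text \<open>Convergence in the Sobolev norm gives \<open>L^p\<close> convergence of the gradients
  and, along a subsequence, convergence almost everywhere of the functions, as
  \<open>HS_ineq_limit\<close> asks. Extension by zero outside \<Omega> agrees with the test
  functions there.\<close>

lemma HS_ineq_W01p:
  fixes u :: "real ^ 'n \<Rightarrow> real" and g :: "real ^ 'n \<Rightarrow> real ^ 'n"
  assumes test: "\<And>\<phi>. \<phi> \<in> test_functions \<Omega> \<Longrightarrow> HS_ineq p q h c w w' \<phi> (grad \<phi>)"
    and \<Omega>: "open \<Omega>" and w: "w \<in> borel_measurable borel" "w' \<in> borel_measurable borel"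
    and p: "1 < p" "p \<le> q" and hc: "0 \<le> h" "0 < c" and W: "W01p \<Omega> p u g"
  shows "HS_ineq p q h c w w' (\<lambda>x. indicator \<Omega> x * u x) (\<lambda>x. indicator \<Omega> x *\<^sub>R g x)"
proof -
  have \<Omega>s [measurable]: "\<Omega> \<in> sets borel" "\<Omega> \<in> sets lebesgue" using \<Omega> by auto
  have \<Omega>i: "\<Omega> \<inter> space lebesgue \<in> sets lebesgue" by simp
  from W have um: "u \<in> borel_measurable (lebesgue_on \<Omega>)" and ui: "integrable (lebesgue_on \<Omega>) (\<lambda>x. norm (u x) powr p)"
    and gm: "g \<in> borel_measurable (lebesgue_on \<Omega>)" and gi: "integrable (lebesgue_on \<Omega>) (\<lambda>x. norm (g x) powr p)"
    by (auto simp: W01p_def W1p_def in_Lp_def)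
  from W obtain \<phi> where \<phi>: "\<And>m. \<phi> m \<in> test_functions \<Omega>"
    and N0: "(\<lambda>m. W1p_norm \<Omega> p (\<lambda>x. u x - \<phi> m x) (\<lambda>x. g x - grad (\<phi> m) x)) \<longlonglongrightarrow> 0"
    by (auto simp: W01p_def)
  note C = test_function_C1c[OF \<phi>]
  note [measurable] = C1c_measurable[OF C]
  note lm = borel_measurable_lebesgue
  have fm: "\<phi> m \<in> borel_measurable (lebesgue_on \<Omega>)" "grad (\<phi> m) \<in> borel_measurable (lebesgue_on \<Omega>)" for m
    by (auto intro!: measurable_restrict_space1 lm C1c_measurable[OF C])
  have diff_int: "integrable (lebesgue_on \<Omega>) (\<lambda>x. norm (f x - k x) powr p)"
    if f: "f \<in> borel_measurable (lebesgue_on \<Omega>)" "integrable (lebesgue_on \<Omega>) (\<lambda>x. norm (f x) powr p)"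
    and k: "k \<in> borel_measurable borel" "integrable lborel (\<lambda>x. norm (k x) powr p)"
    for f k :: "real ^ 'n \<Rightarrow> 'z::euclidean_space"
  proof (rule Bochner_Integration.integrable_bound)
    have km: "k \<in> borel_measurable (lebesgue_on \<Omega>)" using k(1) by (intro measurable_restrict_space1 lm)
    have "integrable lebesgue (\<lambda>x. norm (k x) powr p)"
      using k by (subst integrable_completion) auto
    then have "integrable (lebesgue_on \<Omega>) (\<lambda>x. norm (k x) powr p)"
      by (intro integrable_restrict_space[OF \<Omega>i, THEN iffD2] integrable_mult_indicator) auto
    then show "integrable (lebesgue_on \<Omega>) (\<lambda>x. 2 powr p * (norm (f x) powr p + norm (k x) powr p))"
      using f by simp
    show "(\<lambda>x. norm (f x - k x) powr p) \<in> borel_measurable (lebesgue_on \<Omega>)"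
      using f(1) km by measurable
    show "AE x in lebesgue_on \<Omega>. norm (norm (f x - k x) powr p) \<le> norm (2 powr p * (norm (f x) powr p + norm (k x) powr p))"
    proof (rule AE_I2)
      fix x
      have "norm (f x - k x) powr p \<le> (norm (f x) + norm (k x)) powr p"
        using p by (intro powr_mono2 norm_triangle_ineq4) auto
      also have "\<dots> \<le> 2 powr p * (norm (f x) powr p + norm (k x) powr p)"
        using p by (intro powr_add_le) auto
      finally show "norm (norm (f x - k x) powr p) \<le> norm (2 powr p * (norm (f x) powr p + norm (k x) powr p))" by simp
    qed
  qed
  have phi_int1: "integrable lborel (\<lambda>x. norm (\<phi> m x) powr p)" for m
    by (rule C1c_integrable[OF C1c_mono[OF C subset_UNIV]
          continuous_on_powr'[OF continuous_on_norm[OF C1c_continuous[OF C]] continuous_on_const]])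
       (use p in auto)
  have phi_int2: "integrable lborel (\<lambda>x. norm (grad (\<phi> m) x) powr p)" for m
    by (rule C1c_integrable[OF C1c_mono[OF C subset_UNIV]
          continuous_on_powr'[OF continuous_on_norm[OF C1c_grad_continuous[OF C]] continuous_on_const]])
       (use p in auto)
  have iu: "integrable (lebesgue_on \<Omega>) (\<lambda>x. norm (u x - \<phi> m x) powr p)" for m
    by (rule diff_int[OF um ui C1c_measurable(1)[OF C] phi_int1])
  have ig: "integrable (lebesgue_on \<Omega>) (\<lambda>x. norm (g x - grad (\<phi> m) x) powr p)" for m
    by (rule diff_int[OF gm gi C1c_measurable(2)[OF C] phi_int2])
  let ?du = "\<lambda>m. \<integral>x. norm (u x - \<phi> m x) powr p \<partial>lebesgue_on \<Omega>"
  let ?dg = "\<lambda>m. \<integral>x. norm (g x - grad (\<phi> m) x) powr p \<partial>lebesgue_on \<Omega>"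
  have nn: "?du m \<ge> 0" "?dg m \<ge> 0" for m by (auto intro!: Bochner_Integration.integral_nonneg)
  \<comment> \<open>The norm is a \<open>p\<close>-th root of a sum of two nonnegative integrals;
    undoing the root forces both of them to \<open>0\<close>.\<close>
  have "(\<lambda>m. (W1p_norm \<Omega> p (\<lambda>x. u x - \<phi> m x) (\<lambda>x. g x - grad (\<phi> m) x)) powr p) \<longlonglongrightarrow> 0 powr p"
    using N0 p by (intro tendsto_powr' tendsto_intros) (auto simp: W1p_norm_def)
  moreover have "(W1p_norm \<Omega> p (\<lambda>x. u x - \<phi> m x) (\<lambda>x. g x - grad (\<phi> m) x)) powr p = ?du m + ?dg m" for m
    using p nn[of m] by (simp add: W1p_norm_def powr_powr)
  ultimately have sum0: "(\<lambda>m. ?du m + ?dg m) \<longlonglongrightarrow> 0" by simp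
  have du0: "?du \<longlonglongrightarrow> 0" and dg0: "?dg \<longlonglongrightarrow> 0"
    by (rule tendsto_sandwich[OF _ _ tendsto_const sum0]; use nn in \<open>auto intro: always_eventually add_increasing add_increasing2\<close>)+
  have "\<exists>r::nat\<Rightarrow>nat. strict_mono r \<and> (AE x in lebesgue_on \<Omega>. (\<lambda>n. norm (u x - \<phi> (r n) x) powr p) \<longlonglongrightarrow> 0)"
    by (rule tendsto_L1_AE_subseq) (use iu du0 in auto)
  then obtain r :: "nat \<Rightarrow> nat" where r: "strict_mono r" "AE x in lebesgue_on \<Omega>. (\<lambda>n. norm (u x - \<phi> (r n) x) powr p) \<longlonglongrightarrow> 0"
    by blast
  have conv: "(\<lambda>n. a n) \<longlonglongrightarrow> b" if "(\<lambda>n. norm (b - a n) powr p) \<longlonglongrightarrow> 0" for a and b :: real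
  proof -
    have "(\<lambda>n. (norm (b - a n) powr p) powr (1 / p)) \<longlonglongrightarrow> 0 powr (1 / p)"
      using that p by (intro tendsto_powr' tendsto_intros) auto
    then have "(\<lambda>n. norm (b - a n)) \<longlonglongrightarrow> 0" using p by (simp add: powr_powr)
    then have "(\<lambda>n. b - a n) \<longlonglongrightarrow> 0" by (rule tendsto_norm_zero_cancel)
    then have "(\<lambda>n. b - (b - a n)) \<longlonglongrightarrow> b - 0" by (intro tendsto_intros)
    then show ?thesis by simp
  qed
  have ae: "AE x in lebesgue. (\<lambda>n. \<phi> (r n) x) \<longlonglongrightarrow> indicator \<Omega> x * u x"
  proof -
    have "AE x in lebesgue. x \<in> \<Omega> \<longrightarrow> (\<lambda>n. norm (u x - \<phi> (r n) x) powr p) \<longlonglongrightarrow> 0"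
      using r(2) by (subst (asm) AE_restrict_space_iff) auto
    then show ?thesis
    proof eventually_elim
      case (elim x)
      have "(\<lambda>n. \<phi> (r n) x) = (\<lambda>n. 0)" if "x \<notin> \<Omega>"
        using C1c_support[OF C] that by (metis subsetD)
      then show ?case using elim conv[of "u x" "\<lambda>n. \<phi> (r n) x"] by (cases "x \<in> \<Omega>") auto
    qed
  qed
  have zero: "grad (\<phi> m) x = 0" if "x \<notin> \<Omega>" for m x using C1c_support[OF C] that by (metis subsetD)
  have eq: "norm (indicator \<Omega> x *\<^sub>R g x - grad (\<phi> m) x) powr p = indicator \<Omega> x *\<^sub>R norm (g x - grad (\<phi> m) x) powr p" for x m
    using zero[of x m] p by (auto simp: indicator_def)
  show ?thesis
  proof (rule HS_ineq_limit[where u = "\<lambda>n. \<phi> (r n)" and Gs = "\<lambda>n. grad (\<phi> (r n))"])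
    show "HS_ineq p q h c w w' (\<phi> (r m)) (grad (\<phi> (r m)))" for m by (rule test[OF \<phi>])
    show "(\<lambda>x. indicator \<Omega> x * u x) \<in> borel_measurable lebesgue"
      using um borel_measurable_restrict_space_iff[OF \<Omega>i, of u] by simp
    show "(\<lambda>x. indicator \<Omega> x *\<^sub>R g x) \<in> borel_measurable lebesgue"
      using gm borel_measurable_restrict_space_iff[OF \<Omega>i, of g] by simp
    show "integrable lebesgue (\<lambda>x. norm (indicator \<Omega> x *\<^sub>R g x) powr p)"
      by (rule W01p_integrable_grad[OF \<Omega> W p(1)])
    show "integrable lebesgue (\<lambda>x. norm (indicator \<Omega> x *\<^sub>R g x - grad (\<phi> (r m)) x) powr p)" for m
      unfolding eq using ig[of "r m"] by (subst (asm) integrable_restrict_space[OF \<Omega>i])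
    have "(\<lambda>m. ?dg (r m)) \<longlonglongrightarrow> 0" using LIMSEQ_subseq_LIMSEQ[OF dg0 r(1)] by (simp add: o_def)
    then show "(\<lambda>m. \<integral>x. norm (indicator \<Omega> x *\<^sub>R g x - grad (\<phi> (r m)) x) powr p \<partial>lebesgue) \<longlonglongrightarrow> 0"
      unfolding eq by (subst (asm) integral_restrict_space[OF \<Omega>i])
  qed (use ae p hc w in \<open>auto intro!: lm C1c_measurable[OF C]\<close>)
qed

text \<open>The three integrals are finite, except that the one of \<open>f\<close> may diverge when
  \<open>h = 0\<close>; then \<open>0 * \<infinity> = 0\<close> in the extended reals removes the
  term.\<close>

lemma HS_ineq_int_on:
  fixes u :: "real ^ 'n \<Rightarrow> real" and g :: "real ^ 'n \<Rightarrow> real ^ 'n"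
  assumes HS: "HS_ineq p q h c w w' v G" and iG: "integrable lebesgue (\<lambda>x. norm (G x) powr p)"
    and hc: "0 \<le> h" "0 < c" and pq: "0 < p" "0 < q"
    and v: "int_on \<Omega> (\<lambda>x. f x) = enn2ereal (\<integral>\<^sup>+x. ennreal (\<bar>v x\<bar> powr p * w x) \<partial>lebesgue)"
    and v': "int_on \<Omega> (\<lambda>x. f' x) = enn2ereal (\<integral>\<^sup>+x. ennreal (\<bar>v x\<bar> powr q * w' x) \<partial>lebesgue)"
    and G: "int_on \<Omega> (\<lambda>x. k x) = enn2ereal (\<integral>\<^sup>+x. ennreal (norm (G x) powr p) \<partial>lebesgue)"
  shows "int_on \<Omega> k - ereal h * int_on \<Omega> f \<ge> ereal c * epowr (int_on \<Omega> f') (p / q)"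
proof -
  obtain a b where ab: "0 \<le> a" "0 \<le> b"
     "h = 0 \<or> (\<integral>\<^sup>+x. ennreal (\<bar>v x\<bar> powr p * w x) \<partial>lebesgue) \<le> ennreal a"
     "(\<integral>\<^sup>+x. ennreal (\<bar>v x\<bar> powr q * w' x) \<partial>lebesgue) \<le> ennreal b"
     "h * a + c * b powr (p / q) \<le> (\<integral>x. norm (G x) powr p \<partial>lebesgue)"
    using HS unfolding HS_ineq_def by blast
  have 1: "int_on \<Omega> k = ereal (\<integral>x. norm (G x) powr p \<partial>lebesgue)"
    unfolding G using iG by (subst nn_integral_eq_integral) (auto simp: Bochner_Integration.integral_nonneg)
  obtain a' where a': "0 \<le> a'" "h * a' \<le> h * a" "ereal h * int_on \<Omega> f = ereal (h * a')"
  proof (cases "h = 0")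
    case True
    then show ?thesis by (intro that[of 0]) (auto simp flip: zero_ereal_def)
  next
    case False
    then obtain a' where "(\<integral>\<^sup>+x. ennreal (\<bar>v x\<bar> powr p * w x) \<partial>lebesgue) = ennreal a'" "0 \<le> a'" "a' \<le> a"
      using ab(1,3) by (cases "\<integral>\<^sup>+x. ennreal (\<bar>v x\<bar> powr p * w x) \<partial>lebesgue") (auto simp: ennreal_le_iff top_unique)
    then show ?thesis using hc by (intro that[of a']) (auto simp: v intro: mult_left_mono)
  qed
  obtain b' where b': "(\<integral>\<^sup>+x. ennreal (\<bar>v x\<bar> powr q * w' x) \<partial>lebesgue) = ennreal b'" "0 \<le> b'" "b' \<le> b"
    using ab(2,4) by (cases "\<integral>\<^sup>+x. ennreal (\<bar>v x\<bar> powr q * w' x) \<partial>lebesgue") (auto simp: ennreal_le_iff top_unique)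
  have 2: "epowr (int_on \<Omega> f') (p / q) = ereal (b' powr (p / q))"
    unfolding v' b'(1) using b'(2) by (simp add: epowr_def)
  have "c * b' powr (p / q) \<le> c * b powr (p / q)"
    using hc pq b' by (intro mult_left_mono powr_mono2) auto
  then have "c * b' powr (p / q) \<le> (\<integral>x. norm (G x) powr p \<partial>lebesgue) - h * a'" using ab(5) a'(2) by linarith
  then show ?thesis unfolding 1 2 a'(3) by simp
qed

lemma int_on_eq:
  assumes "\<And>x. x \<in> A \<Longrightarrow> f x = F x" "\<And>x. x \<notin> A \<Longrightarrow> F x = 0"
  shows "int_on A f = enn2ereal (\<integral>\<^sup>+x. ennreal (F x) \<partial>lebesgue)"
  unfolding int_on_def using assms
  by (intro arg_cong[where f = enn2ereal] nn_integral_cong) (auto simp: indicator_def)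

text \<open>The nearest point is \<open>x - y x\<close>; no point of the plane is nearer because the
  projection \<open>y\<close> does not increase norms.\<close>

lemma (in coordinate_plane) infdist_eq_dst: "infdist x {z. y z = 0} = dst x"
proof (rule antisym)
  have b: "y (x - z) = y x - y z" for x z using bounded_linear_y by (simp add: linear_diff bounded_linear.linear)
  have yy: "y (y x) = y x" for x
  proof -
    have "(\<Sum>b\<in>S. (y x \<bullet> b) *\<^sub>R b) = (\<Sum>b\<in>S. (x \<bullet> b) *\<^sub>R b)"
      by (intro sum.cong refl) (simp add: y_inner_Basis)
    then show ?thesis unfolding y_def[of "y x", symmetric] y_def[of x, symmetric] .
  qed
  have "infdist x {z. y z = 0} \<le> dist x (x - y x)"
    by (rule infdist_le) (simp add: b yy)
  then show "infdist x {z. y z = 0} \<le> dst x" by (simp add: dist_norm dst_def)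
  have "0 \<in> {z. y z = 0}" by (simp add: y_def)
  then have ne: "{z. y z = 0} \<noteq> {}" by auto
  have "norm (y v) \<le> norm v" for v
  proof -
    have "(norm (y v))\<^sup>2 = y v \<bullet> v" by (simp add: power2_norm_eq_inner y_inner_y)
    also have "\<dots> \<le> norm (y v) * norm v" by (rule norm_cauchy_schwarz)
    finally show ?thesis by (cases "norm (y v) = 0") (auto simp: power2_eq_square)
  qed
  then have "dst x \<le> dist x z" if "y z = 0" for z
    using that b[of x z] by (metis diff_zero dist_norm dst_def)
  then show "dst x \<le> infdist x {z. y z = 0}"
    unfolding infdist_notempty[OF ne] using ne by (intro cINF_greatest) auto
qed

text \<open>The coordinate directions that are zero on \<open>K\<close> form \<open>S\<close>. For
  \<open>k = p\<close> the Hardy constant \<open>h\<close> is \<open>0\<close>, the case in which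
  the potential term may diverge.\<close>

lemma Hardy_Sobolev_plane:
  fixes idx :: "nat \<Rightarrow> 'n::finite" and p q :: real and K :: "(real ^ 'n) set"
  assumes N: "N = CARD('n)" and idx: "bij_betw idx {1..N} UNIV" and k: "1 \<le> k" "k \<le> N - 1"
    and K: "K = {x. \<forall>i\<in>{1..k}. x $ idx i = 0}" and d: "d = (\<lambda>x. infdist x K)"
    and p: "2 \<le> p" "p < real N" and q: "p < q" "q \<le> real N * p / (real N - p)"
  shows "\<exists>c::real. c > 0 \<and> (\<forall>u g. W01p (UNIV - K) p u g \<longrightarrow>
          int_on UNIV (\<lambda>x. norm (g x) powr p)
            - ereal (\<bar>(real k - p) / p\<bar> powr p) * int_on UNIV (\<lambda>x. \<bar>u x\<bar> powr p / d x powr p)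
          \<ge> ereal c * epowr (int_on UNIV
                (\<lambda>x. \<bar>u x\<bar> powr q * d x powr (- q - real N + real N * q / p))) (p / q))"
proof -
  define S :: "(real ^ 'n) set" where "S = (\<lambda>i. axis (idx i) 1) ` {1..k}"
  interpret coordinate_plane S
    by standard (auto simp: S_def Basis_vec_def)
  have inj: "inj_on idx {1..k}" using idx k inj_on_subset[of idx "{1..N}" "{1..k}"] by (auto simp: bij_betw_def)
  have cardS: "card S = k"
  proof -
    have "inj_on (\<lambda>i. axis (idx i) (1::real) :: real ^ 'n) {1..k}"
    proof (rule inj_onI)
      fix i j assume ij: "i \<in> {1..k}" "j \<in> {1..k}" and "axis (idx i) (1::real) = (axis (idx j) 1 :: real ^ 'n)"
      then have "idx i = idx j" by (simp add: axis_eq_axis)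
      then show "i = j" using inj_onD[OF inj _ ij] by blast
    qed
    then show ?thesis unfolding S_def by (simp add: card_image)
  qed
  have "y x = 0 \<longleftrightarrow> (\<forall>b\<in>S. x \<bullet> b = 0)" for x
  proof
    assume "y x = 0"
    then show "\<forall>b\<in>S. x \<bullet> b = 0" using y_inner_Basis[of _ x] by (metis inner_zero_left)
  next
    assume "\<forall>b\<in>S. x \<bullet> b = 0"
    then show "y x = 0" unfolding y_def by (intro sum.neutral) simp
  qed
  then have K_y: "K = {x. y x = 0}" unfolding K S_def by (auto simp: inner_axis)
  have UK: "UNIV - K = U" by (auto simp: K_y U_def)
  have d_dst: "d = dst" unfolding d K_y infdist_eq_dst ..
  define h where "h = \<bar>(real k - p) / p\<bar> powr p"
  define s where "s = - q - real N + real N * q / p"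
  define w where "w x = inverse (dst x powr p)" for x
  define w' where "w' x = dst x powr s" for x
  have DN: "real DIM(real ^ 'n) = real N" using N by simp
  have "S \<noteq> {}" using k by (auto simp: S_def)
  moreover have "card S < DIM(real ^ 'n)" using k N cardS by simp
  ultimately obtain c where c: "c > 0" "\<And>u g. C1c U u g \<Longrightarrow>
     h * (\<integral>x. \<bar>u x\<bar> powr p / dst x powr p \<partial>lborel) + c * (\<integral>x. \<bar>u x\<bar> powr q * dst x powr s \<partial>lborel) powr (p / q)
     \<le> (\<integral>x. norm (g x) powr p \<partial>lborel)"
    using Hardy_Sobolev_C1c[of p q] p q unfolding cardS DN h_def s_def by auto
  have p0: "1 < p" "p \<le> q" "0 < p" "0 < q" using p q by auto
  have h0: "h \<ge> 0" by (simp add: h_def)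
  have test: "HS_ineq p q h c w w' \<phi> (grad \<phi>)" if "\<phi> \<in> test_functions (UNIV - K)" for \<phi>
  proof -
    have u: "C1c U \<phi> (grad \<phi>)" using test_function_C1c[OF that] by (simp add: UK)
    show ?thesis
    proof (rule HS_ineq_C1c[OF u])
      show "integrable lborel (\<lambda>x. \<bar>\<phi> x\<bar> powr p * w x)"
        using C1c_integrable[OF u continuous_on_potential[OF u p0(3)]] p0 by (simp add: w_def divide_inverse)
      show "integrable lborel (\<lambda>x. \<bar>\<phi> x\<bar> powr q * w' x)"
        unfolding w'_def by (rule C1c_integrable[OF u]) (use p0 in \<open>auto intro!: continuous_intros continuous_on_powr' C1c_continuous_on[OF u]\<close>)
    qed (use c(2)[OF u] in \<open>auto simp: w_def w'_def divide_inverse\<close>)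
  qed
  have openK: "open (UNIV - K)" unfolding UK by (rule open_U)
  have wm: "w \<in> borel_measurable borel" "w' \<in> borel_measurable borel"
    unfolding w_def[abs_def] w'_def[abs_def] by measurable
  \<comment> \<open>The integrals run over the whole space while \<open>u\<close> and
    \<open>g\<close> are arbitrary on \<open>K\<close>; for the gradient integral this is harmless
    because \<open>K\<close> is a null set.\<close>
  have "K \<subseteq> {x. x \<bullet> axis (idx 1) 1 = 0}" using k by (auto simp: K inner_axis)
  then have negK: "negligible K"
  proof (rule negligible_subset[rotated])
    have "axis (idx 1) 1 \<in> (Basis :: (real ^ 'n) set)" by (simp add: axis_in_Basis_iff)
    then show "negligible {x :: real ^ 'n. x \<bullet> axis (idx 1) 1 = 0}" by (rule negligible_standard_hyperplane)
  qed
  then have AEK: "AE x in lebesgue. x \<notin> K"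
    by (intro AE_not_in) (simp add: negligible_iff_null_sets)
  show ?thesis
  proof (intro exI[of _ c] conjI allI impI c(1))
    fix u g assume W: "W01p (UNIV - K) p u g"
    let ?v = "\<lambda>x. indicator (UNIV - K) x * u x" and ?G = "\<lambda>x. indicator (UNIV - K) x *\<^sub>R g x"
    have HS: "HS_ineq p q h c w w' ?v ?G"
      by (rule HS_ineq_W01p[OF test openK wm p0(1,2) h0 c(1) W])
    \<comment> \<open>On \<open>K\<close> the default values \<open>x / 0 = 0\<close> and
      \<open>0 powr s = 0\<close> make both weighted integrands vanish.\<close>
    have d0: "dst x = 0" if "x \<in> K" for x using that by (simp add: K_y dst_def)
    have "ereal c * epowr (int_on UNIV (\<lambda>x. \<bar>u x\<bar> powr q * dst x powr s)) (p / q)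
      \<le> int_on UNIV (\<lambda>x. norm (g x) powr p) - ereal h * int_on UNIV (\<lambda>x. \<bar>u x\<bar> powr p / dst x powr p)"
    proof (rule HS_ineq_int_on[OF HS W01p_integrable_grad[OF openK W p0(1)] h0 c(1) p0(3,4)])
      show "int_on UNIV (\<lambda>x. \<bar>u x\<bar> powr p / dst x powr p) = enn2ereal (\<integral>\<^sup>+x. ennreal (\<bar>?v x\<bar> powr p * w x) \<partial>lebesgue)"
        by (rule int_on_eq) (use d0 in \<open>auto simp: indicator_def w_def divide_inverse\<close>)
      show "int_on UNIV (\<lambda>x. \<bar>u x\<bar> powr q * dst x powr s) = enn2ereal (\<integral>\<^sup>+x. ennreal (\<bar>?v x\<bar> powr q * w' x) \<partial>lebesgue)"
        by (rule int_on_eq) (use d0 in \<open>auto simp: indicator_def w'_def\<close>)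
      show "int_on UNIV (\<lambda>x. norm (g x) powr p) = enn2ereal (\<integral>\<^sup>+x. ennreal (norm (?G x) powr p) \<partial>lebesgue)"
        unfolding int_on_def using AEK
        by (intro arg_cong[where f = enn2ereal] nn_integral_cong_AE) (auto elim!: eventually_mono)
    qed
    then show "ereal c * epowr (int_on UNIV (\<lambda>x. \<bar>u x\<bar> powr q * d x powr (- q - real N + real N * q / p))) (p / q)
      \<le> int_on UNIV (\<lambda>x. norm (g x) powr p) - ereal (\<bar>(real k - p) / p\<bar> powr p) * int_on UNIV (\<lambda>x. \<bar>u x\<bar> powr p / d x powr p)"
      unfolding d_dst h_def s_def .
  qed
qed

subsection \<open>Functions vanishing near the origin\<close>

text \<open>A C^1 switch from \<open>0\<close> for \<open>s <= 1\<close> to \<open>1\<close> for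
  \<open>s >= 2\<close>. It is applied to multiples of \<open>x \<bullet> x\<close>, which is smooth
  at the origin too.\<close>

definition cutoff :: "real \<Rightarrow> real" where "cutoff s = 1 - (max 0 (1 - (max 0 (s - 1))\<^sup>2))\<^sup>2"

definition cutoff' :: "real \<Rightarrow> real" where "cutoff' s = 4 * max 0 (s - 1) * max 0 (1 - (max 0 (s - 1))\<^sup>2)"

lemma cutoff_derivative: "(cutoff has_real_derivative cutoff' s) (at s)"
proof -
  have "((\<lambda>s. s - 1) has_real_derivative 1) (at s)" by (auto intro!: derivative_eq_intros)
  from DERIV_chain2[OF has_real_derivative_max_0_power2 this]
  have "((\<lambda>s. (max 0 (s - 1))\<^sup>2) has_real_derivative 2 * max 0 (s - 1)) (at s)" by simp
  from DERIV_diff[OF DERIV_const[of 1] this]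
  have "((\<lambda>s. 1 - (max 0 (s - 1))\<^sup>2) has_real_derivative - (2 * max 0 (s - 1))) (at s)" by simp
  from DERIV_chain2[OF has_real_derivative_max_0_power2 this]
  have "((\<lambda>s. (max 0 (1 - (max 0 (s - 1))\<^sup>2))\<^sup>2) has_real_derivative
     2 * max 0 (1 - (max 0 (s - 1))\<^sup>2) * - (2 * max 0 (s - 1))) (at s)" .
  from DERIV_diff[OF DERIV_const[of 1] this] show ?thesis by (simp add: cutoff_def[abs_def] cutoff'_def mult_ac)
qed

lemma continuous_on_cutoff': "continuous_on A cutoff'"
  unfolding cutoff'_def[abs_def] by (intro continuous_intros)

lemma cutoff_low: "s \<le> 1 \<Longrightarrow> cutoff s = 0 \<and> cutoff' s = 0"
  by (simp add: cutoff_def cutoff'_def)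

lemma cutoff_high: assumes "s \<ge> 2" shows "cutoff s = 1 \<and> cutoff' s = 0"
proof -
  have "1\<^sup>2 \<le> (max 0 (s - 1))\<^sup>2" using assms by (intro power_mono) auto
  then have "max 0 (1 - (max 0 (s - 1))\<^sup>2) = 0" by simp
  then show ?thesis by (simp add: cutoff_def cutoff'_def)
qed

lemma cutoff_bounds: "0 \<le> cutoff s" "cutoff s \<le> 1" "\<bar>cutoff' s\<bar> \<le> 4"
proof -
  have m: "max 0 (1 - (max 0 (s - 1))\<^sup>2) \<le> 1" "max 0 (1 - (max 0 (s - 1))\<^sup>2) \<ge> 0" by (auto simp: max_def)
  show "cutoff s \<le> 1" by (simp add: cutoff_def)
  have "(max 0 (1 - (max 0 (s - 1))\<^sup>2))\<^sup>2 \<le> 1" using m by (intro power_le_one) auto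
  then show "0 \<le> cutoff s" by (simp add: cutoff_def)
  show "\<bar>cutoff' s\<bar> \<le> 4"
  proof (cases "s \<ge> 2")
    case False
    have "\<bar>cutoff' s\<bar> = 4 * max 0 (s - 1) * max 0 (1 - (max 0 (s - 1))\<^sup>2)" using m by (simp add: cutoff'_def abs_mult)
    also have "\<dots> \<le> 4 * 1 * 1" using m False by (intro mult_mono) auto
    finally show ?thesis by simp
  qed (use cutoff_high[of s] in simp)
qed

text \<open>At scale \<open>c n\<close> the cutoff changes the gradient only on a ball of radius
  \<open>2 / c n\<close>, and by at most a multiple of \<open>c n\<close>. The error is of order
  \<open>c n powr (p - N)\<close> and tends to \<open>0\<close> as \<open>p < N\<close>: a point has
  zero \<open>p\<close>-capacity.\<close>

lemma cutoff_approx: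
  fixes \<phi> :: "'a::euclidean_space \<Rightarrow> real"
  assumes \<phi>: "C1c \<Omega> \<phi> g" and \<Omega>: "\<And>x. x \<in> \<Omega> \<Longrightarrow> norm x < R" and p: "1 < p" "p < real DIM('a)"
  shows "\<exists>u gu. (\<forall>n::nat. C1c {x. 0 < norm x \<and> norm x < R} (u n) (gu n)) \<and>
     (\<forall>x. x \<noteq> 0 \<longrightarrow> (\<lambda>n. u n x) \<longlonglongrightarrow> \<phi> x) \<and>
     (\<lambda>n. \<integral>x. norm (g x - gu n x) powr p \<partial>lborel) \<longlonglongrightarrow> 0"
proof -
  define c where "c n = real (Suc n)" for n
  have c: "c n \<ge> 1" for n by (simp add: c_def)
  have cpos: "c n > 0" for n by (simp add: c_def)
  define \<sigma> where "\<sigma> n x = (c n)\<^sup>2 * (x \<bullet> x)" for n and x :: 'a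
  have \<sigma>_norm: "\<sigma> n x = (c n * norm x)\<^sup>2" for n x by (simp add: \<sigma>_def power_mult_distrib power2_norm_eq_inner)
  define u where "u n x = \<phi> x * cutoff (\<sigma> n x)" for n x
  define gu where "gu n x = cutoff (\<sigma> n x) *\<^sub>R g x + \<phi> x *\<^sub>R ((cutoff' (\<sigma> n x) * (2 * (c n)\<^sup>2)) *\<^sub>R x)" for n x
  let ?V = "{x::'a. 0 < norm x \<and> norm x < R}"
  obtain K where K: "compact K" "K \<subseteq> \<Omega>" "\<And>x. x \<notin> K \<Longrightarrow> \<phi> x = 0" "\<And>x. x \<notin> K \<Longrightarrow> g x = 0"
    using C1c_support[OF \<phi>] by metis
  have \<phi>U: "C1c UNIV \<phi> g" using \<phi> by (rule C1c_mono) simp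
  have c_sig: "continuous_on A (\<sigma> n)" for A n unfolding \<sigma>_def by (intro continuous_intros)
  have U: "C1c UNIV (u n) (gu n)" for n
    unfolding u_def[abs_def] gu_def[abs_def]
  proof (rule C1c_mult[OF \<phi>U])
    fix x
    have "(\<sigma> n has_derivative (\<lambda>v. (c n)\<^sup>2 * (2 * (x \<bullet> v)))) (at x)"
      unfolding \<sigma>_def[abs_def] by (auto intro!: derivative_eq_intros simp: inner_commute)
    from has_derivative_compose[OF this cutoff_derivative[unfolded has_field_derivative_def]]
    show "((\<lambda>x. cutoff (\<sigma> n x)) has_derivative (\<lambda>v. (cutoff' (\<sigma> n x) * (2 * (c n)\<^sup>2)) *\<^sub>R x \<bullet> v)) (at x)"
      by (rule has_derivative_eq_rhs) (simp add: fun_eq_iff)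
  next
    show "continuous_on UNIV (\<lambda>x. (cutoff' (\<sigma> n x) * (2 * (c n)\<^sup>2)) *\<^sub>R x)"
      by (intro continuous_intros continuous_on_compose2[OF continuous_on_cutoff'[of UNIV] c_sig]) auto
  qed simp
  have V: "C1c ?V (u n) (gu n)" for n
  proof (rule C1cI[OF C1c_has_derivative[OF U] C1c_grad_continuous[OF U]])
    let ?K = "K \<inter> {x. 1 / c n \<le> norm x}"
    show "compact ?K"
      by (intro compact_Int_closed K closed_Collect_le continuous_intros)
    show "?K \<subseteq> ?V"
    proof
      fix x assume x: "x \<in> ?K"
      have "0 < 1 / c n" using cpos by simp
      also have "\<dots> \<le> norm x" using x by simp
      finally show "x \<in> ?V" using x K(2) \<Omega> by auto
    qed
    have "u n x = 0 \<and> gu n x = 0" if "x \<notin> ?K" for x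
    proof (cases "x \<in> K")
      case True
      then have "norm x < 1 / c n" using that by auto
      then have "c n * norm x < 1" using cpos[of n] by (simp add: field_simps)
      then have "(c n * norm x)\<^sup>2 \<le> 1" using cpos[of n] by (intro power_le_one) auto
      then show ?thesis using cutoff_low[of "\<sigma> n x"] by (simp add: u_def gu_def \<sigma>_norm)
    qed (simp add: u_def gu_def K)
    then show "\<And>x. x \<notin> ?K \<Longrightarrow> u n x = 0" "\<And>x. x \<notin> ?K \<Longrightarrow> gu n x = 0" by auto
  qed
  have lim: "(\<lambda>n. u n x) \<longlonglongrightarrow> \<phi> x" if "x \<noteq> 0" for x
  proof -
    obtain n0 where n0: "2 / norm x < real n0" using reals_Archimedean2 by blast
    have "u n x = \<phi> x" if "n \<ge> n0" for n
    proof -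
      have "2 / norm x < c n" using n0 that by (simp add: c_def)
      then have "2 \<le> c n * norm x" using \<open>x \<noteq> 0\<close> by (simp add: field_simps)
      then have "2\<^sup>2 \<le> (c n * norm x)\<^sup>2" by (intro power_mono) auto
      then have "2 \<le> \<sigma> n x" by (simp add: \<sigma>_norm)
      then show ?thesis using cutoff_high[of "\<sigma> n x"] by (simp add: u_def)
    qed
    then have "eventually (\<lambda>n. u n x = \<phi> x) sequentially" by (auto simp: eventually_sequentially)
    then show ?thesis by (rule tendsto_eventually)
  qed
  obtain B0 where B0: "\<And>x. norm (\<phi> x) \<le> B0" by (rule C1c_bounded[OF \<phi>U C1c_continuous[OF \<phi>U]]) auto
  obtain B1 where B1: "\<And>x. norm (g x) \<le> B1" by (rule C1c_bounded[OF \<phi>U C1c_grad_continuous[OF \<phi>U]]) auto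
  have B: "B0 \<ge> 0" "B1 \<ge> 0" using B0[of 0] B1[of 0] norm_ge_zero order_trans by blast+
  let ?N = "real DIM('a)"
  \<comment> \<open>The number \<open>16 = 4 * 2 * 2\<close> collects the bound on
    \<open>cutoff'\<close>, the derivative of the square, and
    \<open>c n * norm x <= 2\<close>.\<close>
  let ?B = "B1 + 16 * B0"
  define Cc where "Cc = ?B powr p * (unit_ball_vol ?N * 2 powr ?N)"
  have le: "norm (g x - gu n x) powr p \<le> (?B * c n) powr p * indicator (cball 0 (2 / c n)) x" for n x
  proof (cases "x \<in> cball 0 (2 / c n)")
    case True
    then have cx: "c n * norm x \<le> 2" using cpos[of n] by (simp add: field_simps)
    have "g x - gu n x = (1 - cutoff (\<sigma> n x)) *\<^sub>R g x - \<phi> x *\<^sub>R ((cutoff' (\<sigma> n x) * (2 * (c n)\<^sup>2)) *\<^sub>R x)"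
      by (simp add: gu_def algebra_simps)
    then have "norm (g x - gu n x) \<le> norm ((1 - cutoff (\<sigma> n x)) *\<^sub>R g x) + norm (\<phi> x *\<^sub>R ((cutoff' (\<sigma> n x) * (2 * (c n)\<^sup>2)) *\<^sub>R x))"
      by (metis norm_triangle_ineq4)
    also have "norm ((1 - cutoff (\<sigma> n x)) *\<^sub>R g x) \<le> 1 * B1"
      unfolding norm_scaleR using cutoff_bounds[of "\<sigma> n x"] B by (intro mult_mono B1) auto
    also have "norm (\<phi> x *\<^sub>R ((cutoff' (\<sigma> n x) * (2 * (c n)\<^sup>2)) *\<^sub>R x)) = \<bar>\<phi> x\<bar> * (\<bar>cutoff' (\<sigma> n x)\<bar> * (2 * c n * (c n * norm x)))"
      using cpos[of n] by (simp add: abs_mult power2_eq_square)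
    also have "\<dots> \<le> B0 * (4 * (2 * c n * 2))"
      using cpos[of n] B B0[of x] cx cutoff_bounds[of "\<sigma> n x"] by (intro mult_mono) auto
    finally have "norm (g x - gu n x) \<le> B1 + 16 * B0 * c n" by simp
    also have "\<dots> \<le> B1 * c n + 16 * B0 * c n" using B c[of n] by (simp add: mult_le_cancel_left1)
    finally have "norm (g x - gu n x) \<le> ?B * c n" by (simp add: algebra_simps)
    then show ?thesis using True p by (simp add: powr_mono2)
  next
    case False
    then have "2 < c n * norm x" using cpos[of n] by (simp add: field_simps)
    then have "2\<^sup>2 \<le> (c n * norm x)\<^sup>2" by (intro power_mono) auto
    then have "2 \<le> \<sigma> n x" by (simp add: \<sigma>_norm)
    then have "gu n x = g x" using cutoff_high[of "\<sigma> n x"] by (simp add: gu_def)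
    then show ?thesis using p by simp
  qed
  have bound: "(\<integral>x. norm (g x - gu n x) powr p \<partial>lborel) \<le> Cc * c n powr (p - ?N)" for n
  proof -
    have "(\<integral>x. norm (g x - gu n x) powr p \<partial>lborel) \<le> (\<integral>x. (?B * c n) powr p * indicator (cball (0::'a) (2 / c n)) x \<partial>lborel)"
    proof (rule integral_mono')
      show "integrable lborel (\<lambda>x::'a. (?B * c n) powr p * indicator (cball 0 (2 / c n)) x :: real)"
        by (intro integrable_mult_right integrable_real_indicator emeasure_lborel_cball_finite) auto
    qed (use le in auto)
    also have "\<dots> = (?B * c n) powr p * measure lborel (cball (0::'a) (2 / c n))" by simp
    also have "measure lborel (cball (0::'a) (2 / c n)) = unit_ball_vol ?N * (2 / c n) powr ?N"
      using cpos[of n] by (simp add: content_cball powr_realpow)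
    also have "(?B * c n) powr p * (unit_ball_vol ?N * (2 / c n) powr ?N) = Cc * c n powr (p - ?N)"
      using B cpos[of n] by (simp add: Cc_def powr_mult powr_divide powr_diff)
    finally show ?thesis .
  qed
  have "(\<lambda>n. Cc * c n powr (p - ?N)) \<longlonglongrightarrow> Cc * 0"
  proof (intro tendsto_intros tendsto_neg_powr)
    show "filterlim c at_top sequentially"
      unfolding c_def[abs_def] by (intro filterlim_compose[OF filterlim_real_sequentially] filterlim_Suc)
  qed (use p in auto)
  then have up: "(\<lambda>n. Cc * c n powr (p - ?N)) \<longlonglongrightarrow> 0" by simp
  have "(\<lambda>n. \<integral>x. norm (g x - gu n x) powr p \<partial>lborel) \<longlonglongrightarrow> 0"
  proof (rule tendsto_sandwich[OF _ _ tendsto_const up])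
    show "eventually (\<lambda>n. 0 \<le> (\<integral>x. norm (g x - gu n x) powr p \<partial>lborel)) sequentially"
      by (intro always_eventually allI Bochner_Integration.integral_nonneg) simp
    show "eventually (\<lambda>n. (\<integral>x. norm (g x - gu n x) powr p \<partial>lborel) \<le> Cc * c n powr (p - ?N)) sequentially"
      by (intro always_eventually allI bound)
  qed
  then have lim0: "(\<lambda>n. \<integral>x. norm (g x - gu n x) powr p \<partial>lborel) \<longlonglongrightarrow> 0" .
  show ?thesis using V lim lim0 by blast
qed

text \<open>Two limits: from functions supported off the origin to test functions of \<Omega> by
  \<open>cutoff_approx\<close>, then to the Sobolev closure by \<open>HS_ineq_W01p\<close>. The
  weights are singular at the origin, so the first step already goes through
  \<open>HS_ineq_limit\<close>.\<close>

lemma Hardy_Sobolev_point: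
  fixes \<Omega> :: "(real ^ 'n) set" and p q D :: real
  assumes N: "N = CARD('n)" and \<Omega>: "open \<Omega>" "bounded \<Omega>" "0 \<in> \<Omega>" and D: "D > (SUP x\<in>\<Omega>. norm x)"
    and p: "1 < p" "p < real N" and q: "p \<le> q" "q < real N * p / (real N - p)"
  shows "\<exists>c::real. c > 0 \<and> (\<forall>u g. W01p \<Omega> p u g \<longrightarrow>
          int_on \<Omega> (\<lambda>x. norm (g x) powr p)
            - ereal (\<bar>(real N - p) / p\<bar> powr p) * int_on \<Omega> (\<lambda>x. \<bar>u x\<bar> powr p / norm x powr p)
          \<ge> ereal c * epowr (int_on \<Omega>
                (\<lambda>x. \<bar>u x\<bar> powr q * norm x powr (- q - real N + real N * q / p)
                       * X_log (norm x / D) powr (1 + q / p))) (p / q))"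
proof -
  have bdd: "bdd_above (norm ` \<Omega>)" using \<Omega>(2) by (auto simp: bounded_iff bdd_above_def)
  \<comment> \<open>Midway between the supremum and \<open>D\<close>: \<Omega> lies in the ball of
    radius \<open>R\<close>, and \<open>R < D\<close> is the gap required by
    \<open>punctured_ball\<close>.\<close>
  define R where "R = ((SUP x\<in>\<Omega>. norm x) + D) / 2"
  have le_sup: "norm x \<le> (SUP x\<in>\<Omega>. norm x)" if "x \<in> \<Omega>" for x by (rule cSUP_upper[OF that bdd])
  have R: "0 < R" "R < D" using le_sup[OF \<Omega>(3)] D by (auto simp: R_def)
  have \<Omega>R: "norm x < R" if "x \<in> \<Omega>" for x using le_sup[OF that] D by (simp add: R_def)
  have card: "card (Basis :: (real ^ 'n) set) = N" using N by simp
  define H where "H = (real N - p) / p"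
  note H_eq = H_def
  have H: "H \<noteq> 0" using p by (simp add: H_def)
  note hyps = p
  interpret punctured_ball "Basis :: (real ^ 'n) set" p H D R
    by standard (use p H R card in \<open>auto simp: H_def\<close>)
  have y_id: "y x = x" for x by (simp add: y_def euclidean_representation)
  have dst_norm: "dst = norm" by (simp add: dst_def fun_eq_iff y_id)
  have V_eq: "V = {x. 0 < norm x \<and> norm x < R}" by (auto simp: V_def dst_norm)
  define h where "h = \<bar>(real N - p) / p\<bar> powr p"
  define s where "s = - q - real N + real N * q / p"
  define w where "w x = inverse (norm x powr p)" for x :: "real ^ 'n"
  define w' where "w' x = norm x powr s * X_log (norm x / D) powr (1 + q / p)" for x :: "real ^ 'n"
  have DN: "real DIM(real ^ 'n) = real N" using N by simp
  have N2: "DIM(real ^ 'n) \<ge> 2" using hyps N by simp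
  obtain C where C: "C > 0" "\<And>u g. C1c V u g \<Longrightarrow> (\<integral>x. \<bar>u x\<bar> powr q * w' x \<partial>lborel) powr (p / q) \<le> C * Jt u g"
    using Hardy_Sobolev_log[of q] N2 hyps q card N unfolding DN s_def w'_def dst_norm by (auto simp: mult.assoc)
  define c where "c = 1 / C"
  have c: "c > 0" using C by (simp add: c_def)
  have p0: "1 < p" "p \<le> q" "0 < p" "0 < q" using hyps q by auto
  have h0: "h \<ge> 0" by (simp add: h_def)
  have wm: "w \<in> borel_measurable borel" "w' \<in> borel_measurable borel"
    unfolding w_def[abs_def] w'_def[abs_def] X_log_def by measurable
  have HS_V: "HS_ineq p q h c w w' u g" if u: "C1c V u g" for u g
  proof (rule HS_ineq_C1c[OF u])
    note uU = C1c_U[OF u]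
    show "integrable lborel (\<lambda>x. \<bar>u x\<bar> powr p * w x)"
      using C1c_integrable[OF uU continuous_on_potential[OF uU p0(3)]] p0 by (simp add: w_def divide_inverse dst_norm)
    have cX: "continuous_on V (\<lambda>x. X_log (norm x / D) powr (1 + q / p))"
    proof -
      have "ln (norm x / D) < 0" if "x \<in> V" for x using that R by (auto simp: V_eq ln_div)
      then show ?thesis unfolding X_log_def
        by (intro continuous_on_powr' continuous_intros) (use R in \<open>auto simp: V_eq divide_nonpos_neg less_imp_neq\<close>)
    qed
    show "integrable lborel (\<lambda>x. \<bar>u x\<bar> powr q * w' x)"
      unfolding w'_def
    proof (rule C1c_integrable[OF u])
      show "continuous_on V (\<lambda>x. \<bar>u x\<bar> powr q * (norm x powr s * X_log (norm x / D) powr (1 + q / p)))"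
        using p0 by (intro continuous_on_mult cX continuous_on_powr' continuous_intros C1c_continuous_on[OF u]) (auto simp: V_eq)
    qed (use p0 in auto)
    have "c * (\<integral>x. \<bar>u x\<bar> powr q * w' x \<partial>lborel) powr (p / q) \<le> Jt u g"
      using C(2)[OF u] C(1) by (simp add: c_def field_simps)
    moreover have "(\<integral>x. norm (g x) powr p \<partial>lborel) - h * (\<integral>x. \<bar>u x\<bar> powr p * w x \<partial>lborel) = Jt u g"
      using integrable_bregman(2)[OF uU p0(1)] unfolding Jt_def J_def h_def w_def card H_eq[symmetric]
      by (simp add: dst_norm divide_inverse)
    ultimately show "h * (\<integral>x. \<bar>u x\<bar> powr p * w x \<partial>lborel) + c * (\<integral>x. \<bar>u x\<bar> powr q * w' x \<partial>lborel) powr (p / q)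
       \<le> (\<integral>x. norm (g x) powr p \<partial>lborel)" by linarith
  qed (auto simp: w_def w'_def)
  note lm = borel_measurable_lebesgue
  have test: "HS_ineq p q h c w w' \<phi> (grad \<phi>)" if \<phi>: "\<phi> \<in> test_functions \<Omega>" for \<phi>
  proof -
    have C\<phi>: "C1c \<Omega> \<phi> (grad \<phi>)" by (rule test_function_C1c[OF \<phi>])
    obtain us gs where ug: "\<And>n::nat. C1c V (us n) (gs n)" "\<And>x. x \<noteq> 0 \<Longrightarrow> (\<lambda>n. us n x) \<longlonglongrightarrow> \<phi> x"
       "(\<lambda>n. \<integral>x. norm (grad \<phi> x - gs n x) powr p \<partial>lborel) \<longlonglongrightarrow> 0"
      using cutoff_approx[OF C\<phi> \<Omega>R hyps(1)] hyps N unfolding V_eq by auto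
    note m = C1c_measurable[OF C\<phi>] C1c_measurable[OF ug(1)]
    have int: "integrable lebesgue (\<lambda>x. norm (f x) powr p)"
      if "continuous_on UNIV f" "\<And>x. x \<notin> \<Omega> \<Longrightarrow> f x = 0" "compact L" "\<And>x. x \<notin> L \<Longrightarrow> f x = 0" for f :: "real ^ 'n \<Rightarrow> real ^ 'n" and L
    proof -
      have cf: "continuous_on UNIV (\<lambda>x. norm (f x) powr p)"
        using that(1) p by (intro continuous_on_powr' continuous_intros) auto
      have "integrable lborel (\<lambda>x. indicator L x *\<^sub>R (norm (f x) powr p))"
        by (rule borel_integrable_compact[OF that(3)]) (rule continuous_on_subset[OF cf], simp)
      also have "(\<lambda>x. indicator L x *\<^sub>R (norm (f x) powr p)) = (\<lambda>x. norm (f x) powr p)"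
        using that(4) p by (auto simp: indicator_def fun_eq_iff)
      finally show ?thesis
        by (subst integrable_completion) (auto intro!: borel_measurable_continuous_onI cf)
    qed
    obtain L where L: "compact L" "L \<subseteq> \<Omega>" "\<And>x. x \<notin> L \<Longrightarrow> \<phi> x = 0" "\<And>x. x \<notin> L \<Longrightarrow> grad \<phi> x = 0"
      using C1c_support[OF C\<phi>] by metis
    show ?thesis
    proof (rule HS_ineq_limit[where u = us and Gs = gs])
      show "HS_ineq p q h c w w' (us n) (gs n)" for n by (rule HS_V[OF ug(1)])
      have "AE x in lborel. x \<noteq> (0 :: real ^ 'n)" by (rule AE_lborel_singleton)
      then have "AE x in lebesgue. x \<noteq> (0 :: real ^ 'n)" by (rule AE_completion)
      then show "AE x in lebesgue. (\<lambda>n. us n x) \<longlonglongrightarrow> \<phi> x" by eventually_elim (rule ug(2))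
      show "integrable lebesgue (\<lambda>x. norm (grad \<phi> x) powr p)"
        by (rule int[OF C1c_grad_continuous[OF C\<phi>] _ L(1,4)]) (use L in auto)
      show "integrable lebesgue (\<lambda>x. norm (grad \<phi> x - gs n x) powr p)" for n
      proof -
        obtain L' where L': "compact L'" "\<And>x. x \<notin> L' \<Longrightarrow> gs n x = 0"
          using C1c_support[OF ug(1)[of n]] by metis
        have i1: "integrable lborel (\<lambda>x. indicator (L \<union> L') x *\<^sub>R (norm (grad \<phi> x - gs n x) powr p))"
          using p by (intro borel_integrable_compact compact_Un L(1) L'(1) continuous_on_powr' continuous_intros
            continuous_on_subset[OF C1c_grad_continuous[OF C\<phi>]] continuous_on_subset[OF C1c_grad_continuous[OF ug(1)]]) auto
        have i2: "(\<lambda>x. indicator (L \<union> L') x *\<^sub>R (norm (grad \<phi> x - gs n x) powr p)) = (\<lambda>x. norm (grad \<phi> x - gs n x) powr p)"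
          using L(4) L'(2) p by (auto simp: indicator_def fun_eq_iff)
        show ?thesis using i1 unfolding i2 by (subst integrable_completion) (use m in auto)
      qed
      have "(\<integral>x. norm (grad \<phi> x - gs n x) powr p \<partial>lebesgue) = (\<integral>x. norm (grad \<phi> x - gs n x) powr p \<partial>lborel)" for n
        by (rule integral_completion) (use m in measurable)
      then show "(\<lambda>n. \<integral>x. norm (grad \<phi> x - gs n x) powr p \<partial>lebesgue) \<longlonglongrightarrow> 0" using ug(3) by simp
    qed (intro lm m wm p0(1,2) h0 c)+
  qed
  show ?thesis
  proof (intro exI[of _ c] conjI allI impI c)
    fix u g assume W: "W01p \<Omega> p u g"
    let ?v = "\<lambda>x. indicator \<Omega> x * u x" and ?G = "\<lambda>x. indicator \<Omega> x *\<^sub>R g x"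
    have HS: "HS_ineq p q h c w w' ?v ?G"
      by (rule HS_ineq_W01p[OF test \<Omega>(1) wm p0(1,2) h0 c W])
    have "ereal c * epowr (int_on \<Omega> (\<lambda>x. \<bar>u x\<bar> powr q * norm x powr s * X_log (norm x / D) powr (1 + q / p))) (p / q)
      \<le> int_on \<Omega> (\<lambda>x. norm (g x) powr p) - ereal h * int_on \<Omega> (\<lambda>x. \<bar>u x\<bar> powr p / norm x powr p)"
      by (rule HS_ineq_int_on[OF HS W01p_integrable_grad[OF \<Omega>(1) W p0(1)] h0 c p0(3,4)]; rule int_on_eq)
         (use p0 in \<open>auto simp: w_def w'_def divide_inverse mult.assoc\<close>)
    then show "ereal c * epowr (int_on \<Omega> (\<lambda>x. \<bar>u x\<bar> powr q * norm x powr (- q - real N + real N * q / p)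
                       * X_log (norm x / D) powr (1 + q / p))) (p / q)
      \<le> int_on \<Omega> (\<lambda>x. norm (g x) powr p) - ereal (\<bar>(real N - p) / p\<bar> powr p) * int_on \<Omega> (\<lambda>x. \<bar>u x\<bar> powr p / norm x powr p)"
      unfolding h_def s_def .
  qed
qed

subsection \<open>Smooth radial functions\<close>

text \<open>Level \<open>0\<close> says nothing, not even continuity, so a C^k function is obtained
  from level \<open>Suc k\<close>. The derivative is existentially quantified so that each closure
  rule can supply its own formula.\<close>

fun smooth_upto :: "nat \<Rightarrow> real set \<Rightarrow> (real \<Rightarrow> real) \<Rightarrow> bool" where
  "smooth_upto 0 A f \<longleftrightarrow> True"
| "smooth_upto (Suc k) A f \<longleftrightarrow> (\<exists>f'. (\<forall>x\<in>A. (f has_real_derivative f' x) (at x)) \<and> smooth_upto k A f')"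

lemma smooth_upto_SucI: "(\<And>x. x \<in> A \<Longrightarrow> (f has_real_derivative f' x) (at x)) \<Longrightarrow> smooth_upto k A f' \<Longrightarrow> smooth_upto (Suc k) A f"
  by auto

lemma smooth_upto_SucE:
  assumes "smooth_upto (Suc k) A f"
  obtains f' where "\<And>x. x \<in> A \<Longrightarrow> (f has_real_derivative f' x) (at x)" "smooth_upto k A f'"
  using assms by auto

lemma smooth_upto_Suc_imp: "smooth_upto (Suc k) A f \<Longrightarrow> smooth_upto k A f"
  by (induction k arbitrary: f) auto

lemma smooth_upto_const: "smooth_upto k A (\<lambda>_. c)"
proof (induction k arbitrary: c)
  case (Suc k)
  then show ?case by (intro smooth_upto_SucI[where f' = "\<lambda>_. 0"]) auto
qed simp

lemma smooth_upto_ident: "smooth_upto k A (\<lambda>x. x)"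
proof (cases k)
  case (Suc n)
  then show ?thesis using smooth_upto_const[of n A 1] by (auto intro!: exI[of _ "\<lambda>_. 1"])
qed simp

lemma smooth_upto_add: "smooth_upto k A f \<Longrightarrow> smooth_upto k A g \<Longrightarrow> smooth_upto k A (\<lambda>x. f x + g x)"
proof (induction k arbitrary: f g)
  case (Suc k)
  obtain f' where f': "\<And>x. x \<in> A \<Longrightarrow> (f has_real_derivative f' x) (at x)" "smooth_upto k A f'"
    by (rule smooth_upto_SucE[OF Suc.prems(1)]) blast
  obtain g' where g': "\<And>x. x \<in> A \<Longrightarrow> (g has_real_derivative g' x) (at x)" "smooth_upto k A g'"
    by (rule smooth_upto_SucE[OF Suc.prems(2)]) blast
  note * = f' g'
  show ?case
    by (rule smooth_upto_SucI[where f' = "\<lambda>x. f' x + g' x"])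
       (intro DERIV_add *, assumption+, intro Suc.IH *)
qed simp

lemma smooth_upto_mult: "smooth_upto k A f \<Longrightarrow> smooth_upto k A g \<Longrightarrow> smooth_upto k A (\<lambda>x. f x * g x)"
proof (induction k arbitrary: f g)
  case (Suc k)
  obtain f' where f': "\<And>x. x \<in> A \<Longrightarrow> (f has_real_derivative f' x) (at x)" "smooth_upto k A f'"
    by (rule smooth_upto_SucE[OF Suc.prems(1)]) blast
  obtain g' where g': "\<And>x. x \<in> A \<Longrightarrow> (g has_real_derivative g' x) (at x)" "smooth_upto k A g'"
    by (rule smooth_upto_SucE[OF Suc.prems(2)]) blast
  note * = f' g'
  note fg = Suc.prems[THEN smooth_upto_Suc_imp]
  show ?case
    by (rule smooth_upto_SucI[where f' = "\<lambda>x. f' x * g x + g' x * f x"])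
       (intro DERIV_mult *, assumption+, intro smooth_upto_add Suc.IH * fg)
qed simp

lemma smooth_upto_compose: "smooth_upto k A g \<Longrightarrow> smooth_upto k B f \<Longrightarrow> (\<And>x. x \<in> A \<Longrightarrow> g x \<in> B) \<Longrightarrow> smooth_upto k A (\<lambda>x. f (g x))"
proof (induction k arbitrary: f g)
  case (Suc k)
  obtain f' where f': "\<And>x. x \<in> B \<Longrightarrow> (f has_real_derivative f' x) (at x)" "smooth_upto k B f'"
    by (rule smooth_upto_SucE[OF Suc.prems(2)]) blast
  obtain g' where g': "\<And>x. x \<in> A \<Longrightarrow> (g has_real_derivative g' x) (at x)" "smooth_upto k A g'"
    by (rule smooth_upto_SucE[OF Suc.prems(1)]) blast
  note * = f' g'
  have "smooth_upto k A g" by (rule smooth_upto_Suc_imp[OF Suc.prems(1)])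
  show ?case
  proof (rule smooth_upto_SucI[where f' = "\<lambda>x. f' (g x) * g' x"])
    show "((\<lambda>x. f (g x)) has_real_derivative f' (g x) * g' x) (at x)" if "x \<in> A" for x
      by (rule DERIV_chain2[OF *(1)[OF Suc.prems(3)[OF that]] *(3)[OF that]])
    have "smooth_upto k A (\<lambda>x. f' (g x))" by (rule Suc.IH[OF \<open>smooth_upto k A g\<close> *(2)]) (rule Suc.prems(3))
    then show "smooth_upto k A (\<lambda>x. f' (g x) * g' x)" by (rule smooth_upto_mult[OF _ *(4)])
  qed
qed simp

lemma smooth_upto_cong: "open A \<Longrightarrow> smooth_upto k A f \<Longrightarrow> (\<And>x. x \<in> A \<Longrightarrow> f x = g x) \<Longrightarrow> smooth_upto k A g"
proof (cases k)
  case (Suc n)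
  assume A: "open A" and f: "smooth_upto k A f" and eq: "\<And>x. x \<in> A \<Longrightarrow> f x = g x"
  then obtain f' where *: "\<And>x. x \<in> A \<Longrightarrow> (f has_real_derivative f' x) (at x)" "smooth_upto n A f'" using Suc by auto
  have "(g has_real_derivative f' x) (at x)" if "x \<in> A" for x
    by (rule has_field_derivative_transform_within_open[OF *(1)[OF that] A that]) (rule eq)
  then show ?thesis using * Suc by auto
qed simp

text \<open>Derivatives are unique, so the two choices agree on the overlap and glue. This joins the
  formula for \<open>s > 0\<close> with the zero function around and below \<open>0\<close>.\<close>

lemma smooth_upto_Un: "open A \<Longrightarrow> open B \<Longrightarrow> smooth_upto k A f \<Longrightarrow> smooth_upto k B f \<Longrightarrow> smooth_upto k (A \<union> B) f"
proof (induction k arbitrary: f)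
  case (Suc k)
  obtain f' where f': "\<And>x. x \<in> A \<Longrightarrow> (f has_real_derivative f' x) (at x)" "smooth_upto k A f'"
    by (rule smooth_upto_SucE[OF Suc.prems(3)]) blast
  obtain f'' where f'': "\<And>x. x \<in> B \<Longrightarrow> (f has_real_derivative f'' x) (at x)" "smooth_upto k B f''"
    by (rule smooth_upto_SucE[OF Suc.prems(4)]) blast
  note * = f' f''
  define F where "F x = (if x \<in> A then f' x else f'' x)" for x
  have "smooth_upto k A F" by (rule smooth_upto_cong[OF Suc.prems(1) *(2)]) (simp add: F_def)
  moreover have "smooth_upto k B F"
    by (rule smooth_upto_cong[OF Suc.prems(2) *(4)]) (use DERIV_unique[OF *(3) *(1)] in \<open>auto simp: F_def\<close>)
  ultimately have "smooth_upto k (A \<union> B) F" using Suc.IH Suc.prems(1,2) by blast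
  then show ?case using * by (intro smooth_upto_SucI[of _ _ F]) (auto simp: F_def)
qed simp

lemma smooth_upto_exp: "smooth_upto k A exp"
proof (induction k)
  case (Suc k)
  then show ?case by (intro smooth_upto_SucI[of A exp exp]) auto
qed simp

lemma smooth_upto_inverse: "smooth_upto k {0<..} inverse"
proof (induction k)
  case (Suc k)
  have "(inverse has_real_derivative - 1 * (inverse x * inverse x)) (at x)" if "x \<in> {0<..}" for x :: real
    using that DERIV_inverse[of x] by (simp add: power2_eq_square numeral_2_eq_2)
  then show ?case
    by (rule smooth_upto_SucI[where f' = "\<lambda>x. - 1 * (inverse x * inverse x)"]) (assumption | intro smooth_upto_mult smooth_upto_const Suc)+
qed simp

lemma smooth_upto_ln: "smooth_upto k {0<..} ln"
proof (cases k)
  case (Suc n)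
  have "(ln has_real_derivative inverse x) (at x)" if "x \<in> {0<..}" for x :: real
    using that by (auto intro!: derivative_eq_intros simp: divide_inverse)
  then show ?thesis using smooth_upto_inverse[of n] Suc by auto
qed simp

lemma smooth_upto_powr: "smooth_upto k {0<..} (\<lambda>s. s powr a)"
proof (rule smooth_upto_cong)
  show "smooth_upto k {0<..} (\<lambda>s. exp (a * ln s))"
    by (rule smooth_upto_compose[OF _ smooth_upto_exp[of k UNIV]]) (intro smooth_upto_mult smooth_upto_const smooth_upto_ln, simp)
qed (auto simp: powr_def)

text \<open>The functions \<open>s^(-m) exp (- 1 / s)\<close> extended by zero: differentiation
  stays within their linear combinations, so smoothness at \<open>0\<close> needs the single limit
  \<open>flat_tendsto\<close>.\<close>

definition flat :: "nat \<Rightarrow> real \<Rightarrow> real" where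
  "flat m s = (if s > 0 then inverse s ^ m * exp (- inverse s) else 0)"

lemma flat_tendsto: "((\<lambda>s. flat m s) \<longlongrightarrow> 0) (at 0)"
proof -
  have "((\<lambda>x::real. x ^ m / exp x) \<longlongrightarrow> 0) at_top" by (rule tendsto_power_div_exp_0)
  then have "((\<lambda>s::real. inverse s ^ m / exp (inverse s)) \<longlongrightarrow> 0) (at_right 0)"
    by (rule filterlim_compose[OF _ filterlim_inverse_at_top_right])
  moreover have "eventually (\<lambda>s::real. inverse s ^ m / exp (inverse s) = flat m s) (at_right 0)"
    by (auto simp: eventually_at_filter flat_def exp_minus divide_inverse)
  ultimately have "((\<lambda>s. flat m s) \<longlongrightarrow> 0) (at_right 0)" by (rule Lim_transform_eventually)
  moreover have "((\<lambda>s. flat m s) \<longlongrightarrow> 0) (at_left 0)"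
  proof (rule Lim_transform_eventually[OF tendsto_const[of 0]])
    show "eventually (\<lambda>s. 0 = flat m s) (at_left 0)" by (auto simp: eventually_at_filter flat_def)
  qed
  ultimately show ?thesis by (simp add: filterlim_split_at)
qed

text \<open>At \<open>0\<close> the difference quotient of \<open>flat m\<close> is
  \<open>flat (Suc m)\<close>, which tends to \<open>0\<close>.\<close>

lemma flat_derivative: "(flat m has_real_derivative - real m * flat (Suc m) s + flat (Suc (Suc m)) s) (at s)"
proof -
  consider "s > 0" | "s < 0" | "s = 0" by linarith
  then show ?thesis
  proof cases
    case 1
    have i: "(inverse has_real_derivative - (inverse s ^ 2)) (at s)"
      using 1 DERIV_inverse[of s] by (simp add: numeral_2_eq_2)
    have "((\<lambda>s. inverse s ^ m) has_real_derivative - real m * inverse s ^ Suc m) (at s)"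
    proof (cases m)
      case (Suc n)
      have "((\<lambda>s. inverse s ^ m) has_real_derivative real m * ((- (inverse s ^ 2)) * inverse s ^ (m - Suc 0))) (at s)"
        by (rule DERIV_power[OF i])
      then show ?thesis by (rule DERIV_cong) (use Suc in \<open>simp add: power2_eq_square algebra_simps\<close>)
    qed simp
    moreover have "((\<lambda>s. exp (- inverse s)) has_real_derivative exp (- inverse s) * (inverse s ^ 2)) (at s)"
      using DERIV_chain2[OF DERIV_exp DERIV_minus[OF i]] by simp
    ultimately have "((\<lambda>s. inverse s ^ m * exp (- inverse s)) has_real_derivative
       - real m * inverse s ^ Suc m * exp (- inverse s) + exp (- inverse s) * (inverse s ^ 2) * inverse s ^ m) (at s)"
      by (rule DERIV_mult)
    then have "((\<lambda>s. inverse s ^ m * exp (- inverse s)) has_real_derivative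
       - real m * flat (Suc m) s + flat (Suc (Suc m)) s) (at s)"
      by (rule DERIV_cong) (use 1 in \<open>simp add: flat_def power2_eq_square mult_ac\<close>)
    then show ?thesis
      by (rule has_field_derivative_transform_within_open[where S = "{0<..}"]) (use 1 in \<open>auto simp: flat_def\<close>)
  next
    case 2
    have "((\<lambda>s::real. 0) has_real_derivative 0) (at s)" by simp
    then have "(flat m has_real_derivative 0) (at s)"
      by (rule has_field_derivative_transform_within_open[where S = "{..<0}"]) (use 2 in \<open>auto simp: flat_def\<close>)
    then show ?thesis using 2 by (simp add: flat_def)
  next
    case 3
    have "eventually (\<lambda>h. flat (Suc m) h = (flat m (0 + h) - flat m 0) / h) (at 0)"
      by (auto simp: eventually_at_filter flat_def divide_inverse)
    then have "((\<lambda>h. (flat m (0 + h) - flat m 0) / h) \<longlongrightarrow> 0) (at 0)"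
      by (rule Lim_transform_eventually[OF flat_tendsto])
    then show ?thesis using 3 by (simp add: DERIV_def flat_def)
  qed
qed

lemma smooth_upto_flat: "smooth_upto k A (flat m)"
proof (induction k arbitrary: m)
  case (Suc k)
  show ?case
    by (rule smooth_upto_SucI[OF flat_derivative]) (intro smooth_upto_add smooth_upto_mult smooth_upto_const Suc)
qed simp

section \<open>Smoothness of radial functions in several variables\<close>

lemma grad_eqI: "(f has_derivative f') (at x) \<Longrightarrow> grad f x $ i = f' (axis i 1)"
  by (simp add: grad_def frechet_derivative_at[symmetric])

lemma Ck_Suc_imp: "Ck (Suc k) f \<Longrightarrow> Ck k f"
  by (induction k arbitrary: f) (auto intro: differentiable_imp_continuous_on)

lemma Ck_SucI:
  assumes "\<And>x. (f has_derivative f' x) (at x)" "\<And>i. Ck k (\<lambda>x. f' x (axis i 1))"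
  shows "Ck (Suc k) f"
proof -
  have "(\<lambda>x. grad f x $ i) = (\<lambda>x. f' x (axis i 1))" for i using grad_eqI[OF assms(1)] by auto
  moreover have "f differentiable_on UNIV"
    using assms(1) by (auto simp: differentiable_on_def differentiable_def)
  ultimately show ?thesis using assms(2) by auto
qed

lemma Ck_SucD:
  assumes "Ck (Suc k) f"
  shows "(f has_derivative frechet_derivative f (at x)) (at x)" "Ck k (\<lambda>x. frechet_derivative f (at x) (axis i 1))"
proof -
  show "(f has_derivative frechet_derivative f (at x)) (at x)"
    using assms by (auto simp: differentiable_on_def frechet_derivative_works[symmetric])
  have "Ck k (\<lambda>x. grad f x $ i)" using assms by auto
  then show "Ck k (\<lambda>x. frechet_derivative f (at x) (axis i 1))" by (simp add: grad_def)
qed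

lemma Ck_const: "Ck k (\<lambda>_. c)"
proof (induction k arbitrary: c)
  case (Suc k)
  show ?case by (rule Ck_SucI[where f' = "\<lambda>_ _. 0"]) (auto intro: Suc)
qed auto

lemma Ck_add: "Ck k f \<Longrightarrow> Ck k g \<Longrightarrow> Ck k (\<lambda>x. f x + g x)"
proof (induction k arbitrary: f g)
  case (Suc k)
  show ?case
    by (rule Ck_SucI[OF has_derivative_add[OF Ck_SucD(1)[OF Suc.prems(1)] Ck_SucD(1)[OF Suc.prems(2)]]])
       (rule Suc.IH[OF Ck_SucD(2)[OF Suc.prems(1)] Ck_SucD(2)[OF Suc.prems(2)]])
qed (auto intro: continuous_intros)

lemma Ck_mult: "Ck k f \<Longrightarrow> Ck k g \<Longrightarrow> Ck k (\<lambda>x. f x * g x)"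
proof (induction k arbitrary: f g)
  case (Suc k)
  note fg = Suc.prems[THEN Ck_Suc_imp]
  show ?case
    by (rule Ck_SucI[OF has_derivative_mult[OF Ck_SucD(1)[OF Suc.prems(1)] Ck_SucD(1)[OF Suc.prems(2)]]])
       (intro Ck_add Suc.IH fg Ck_SucD(2)[OF Suc.prems(1)] Ck_SucD(2)[OF Suc.prems(2)])
qed (auto intro: continuous_intros)

lemma Ck_component: "Ck k (\<lambda>x :: real ^ 'n. x $ i)"
proof (cases k)
  case (Suc n)
  have "((\<lambda>x. x $ i) has_derivative (\<lambda>h. h $ i)) (at x)" for x :: "real ^ 'n"
    by (rule bounded_linear_imp_has_derivative[OF bounded_linear_vec_nth])
  then show ?thesis unfolding Suc by (rule Ck_SucI) (rule Ck_const)
qed (auto intro: continuous_intros)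

lemma has_derivative_norm_square_compose:
  fixes x :: "'a::real_inner"
  assumes "(h has_real_derivative h') (at (x \<bullet> x))"
  shows "((\<lambda>x. h (x \<bullet> x)) has_derivative (\<lambda>v. ((2 * h') *\<^sub>R x) \<bullet> v)) (at x)"
proof -
  have "((\<lambda>x. x \<bullet> x) has_derivative (\<lambda>v. 2 * (x \<bullet> v))) (at x)"
    by (auto intro!: derivative_eq_intros simp: inner_commute)
  from has_derivative_compose[OF this assms[unfolded has_field_derivative_def]]
  show ?thesis by (rule has_derivative_eq_rhs) (simp add: fun_eq_iff)
qed

text \<open>The partial derivatives are \<open>2 * h' (x \<bullet> x) * x $ i\<close>, again radial
  up to a coordinate factor, so the induction closes.\<close>

lemma Ck_radial: "smooth_upto (Suc k) UNIV h \<Longrightarrow> Ck k (\<lambda>x :: real ^ 'n. h (x \<bullet> x))"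
proof (induction k arbitrary: h)
  case 0
  then obtain h' where "\<And>s. (h has_real_derivative h' s) (at s)" by auto
  then have "isCont h s" for s by (rule DERIV_isCont)
  then have "continuous_on UNIV h" by (simp add: continuous_at_imp_continuous_on)
  then have "continuous_on UNIV (\<lambda>x :: real ^ 'n. h (x \<bullet> x))"
    by (rule continuous_on_compose2) (auto intro: continuous_intros)
  then show ?case by simp
next
  case (Suc k)
  then obtain h' where h': "\<And>s. (h has_real_derivative h' s) (at s)" "smooth_upto (Suc k) UNIV h'" by auto
  show ?case
  proof (rule Ck_SucI[OF has_derivative_norm_square_compose[OF h'(1)]])
    fix i
    have "Ck k (\<lambda>x :: real ^ 'n. 2 * h' (x \<bullet> x) * x $ i)"
      by (intro Ck_mult Ck_component Ck_const Suc.IH h'(2))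
    then show "Ck k (\<lambda>x :: real ^ 'n. ((2 * h' (x \<bullet> x)) *\<^sub>R x) \<bullet> axis i 1)"
      by (simp add: inner_axis)
  qed
qed

subsection \<open>The weak gradient of a test function\<close>

lemma integral_by_parts_C1c:
  assumes f: "C1c U f f'" and k: "C1c W k k'"
  shows "(\<integral>x. f x * (k' x \<bullet> b) \<partial>lborel) = - (\<integral>x. (f' x \<bullet> b) * k x \<partial>lborel)"
proof -
  have fU: "C1c UNIV f f'" using f by (rule C1c_mono) simp
  have "C1c UNIV (\<lambda>x. f x * k x) (\<lambda>x. k x *\<^sub>R f' x + f x *\<^sub>R k' x)"
    by (rule C1c_mult[OF fU open_UNIV C1c_has_derivative[OF k] C1c_grad_continuous[OF k]])
  from integral_grad_eq_0[OF this, of b]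
  have "(\<integral>x. f x * (k' x \<bullet> b) + (f' x \<bullet> b) * k x \<partial>lborel) = 0"
    by (simp add: inner_add_left mult_ac add_ac)
  moreover have "integrable lborel (\<lambda>x. f x * (k' x \<bullet> b))" "integrable lborel (\<lambda>x. (f' x \<bullet> b) * k x)"
    by (rule C1c_integrable[OF fU], intro continuous_intros C1c_continuous[OF f] C1c_grad_continuous[OF k], simp)
       (rule C1c_integrable[OF fU], intro continuous_intros C1c_continuous[OF k] C1c_grad_continuous[OF f], simp)
  ultimately show ?thesis by simp
qed

text \<open>Integration by parts identifies the classical gradient as the weak one; the constant
  sequence is the approximation.\<close>

lemma test_function_W01p:
  fixes \<phi> :: "real ^ 'n \<Rightarrow> real"
  assumes \<phi>: "\<phi> \<in> test_functions \<Omega>" and \<Omega>: "open \<Omega>" and p: "1 < p"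
  shows "W01p \<Omega> p \<phi> (grad \<phi>)"
proof -
  note C = test_function_C1c[OF \<phi>]
  have CU: "C1c UNIV \<phi> (grad \<phi>)" using C by (rule C1c_mono) simp
  have \<Omega>i: "\<Omega> \<inter> space lebesgue \<in> sets lebesgue" using \<Omega> by simp
  note lm = borel_measurable_lebesgue
  have on: "integrable (lebesgue_on \<Omega>) f" if "integrable lborel f" for f :: "real ^ 'n \<Rightarrow> real"
  proof -
    have "integrable lebesgue f" using that by (simp add: integrable_completion)
    then show ?thesis by (intro integrable_restrict_space[OF \<Omega>i, THEN iffD2] integrable_mult_indicator) (use \<Omega> in auto)
  qed
  have int_eq: "(\<integral>x. f x \<partial>lebesgue_on \<Omega>) = (\<integral>x. f x \<partial>lborel)"
    if "f \<in> borel_measurable borel" "\<And>x. x \<notin> \<Omega> \<Longrightarrow> f x = 0" for f :: "real ^ 'n \<Rightarrow> real"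
  proof -
    have "(\<integral>x. f x \<partial>lebesgue_on \<Omega>) = (\<integral>x. indicator \<Omega> x *\<^sub>R f x \<partial>lebesgue)"
      by (rule integral_restrict_space[OF \<Omega>i])
    also have "(\<lambda>x. indicator \<Omega> x *\<^sub>R f x) = f" using that(2) by (auto simp: indicator_def fun_eq_iff)
    also have "(\<integral>x. f x \<partial>lebesgue) = (\<integral>x. f x \<partial>lborel)" using that(1) by (intro integral_completion) simp
    finally show ?thesis .
  qed
  have Lp1: "integrable lborel (\<lambda>x. norm (\<phi> x) powr p)"
    by (rule C1c_integrable[OF CU continuous_on_powr'[OF continuous_on_norm[OF C1c_continuous[OF C]] continuous_on_const]])
       (use p in auto)
  have Lp2: "integrable lborel (\<lambda>x. norm (grad \<phi> x) powr p)"
    by (rule C1c_integrable[OF CU continuous_on_powr'[OF continuous_on_norm[OF C1c_grad_continuous[OF C]] continuous_on_const]])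
       (use p in auto)
  have abs: "f absolutely_integrable_on L" if "continuous_on UNIV f" "compact L" for f :: "real ^ 'n \<Rightarrow> 'z::euclidean_space" and L
  proof -
    have "integrable lborel (\<lambda>x. indicator L x *\<^sub>R f x)"
      by (rule borel_integrable_compact[OF that(2)]) (rule continuous_on_subset[OF that(1)], simp)
    then show ?thesis unfolding set_integrable_def by (simp add: integrable_completion)
  qed
  have weak: "weak_gradient \<Omega> \<phi> (grad \<phi>)"
    unfolding weak_gradient_def locally_integrable_def
  proof (intro conjI allI impI ballI)
    show "\<phi> absolutely_integrable_on L" if "compact L \<and> L \<subseteq> \<Omega>" for L
      using that by (intro abs C1c_continuous[OF C]) auto
    show "grad \<phi> absolutely_integrable_on L" if "compact L \<and> L \<subseteq> \<Omega>" for L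
      using that by (intro abs C1c_grad_continuous[OF C]) auto
    fix \<psi> i assume \<psi>: "\<psi> \<in> test_functions \<Omega>"
    note P = test_function_C1c[OF \<psi>]
    have z: "\<phi> x = 0" "grad \<phi> x = 0" if "x \<notin> \<Omega>" for x using C1c_support[OF C] that by (metis subsetD)+
    have m1: "(\<lambda>x. \<phi> x * grad \<psi> x $ i) \<in> borel_measurable borel" "(\<lambda>x. grad \<phi> x $ i * \<psi> x) \<in> borel_measurable borel"
      by (intro borel_measurable_continuous_onI continuous_intros C1c_continuous[OF C] C1c_grad_continuous[OF P]
          C1c_continuous[OF P] C1c_grad_continuous[OF C])+
    have "(\<integral>x. \<phi> x * grad \<psi> x $ i \<partial>lborel) = - (\<integral>x. grad \<phi> x $ i * \<psi> x \<partial>lborel)"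
      using integral_by_parts_C1c[OF C P, of "axis i 1"] by (simp add: inner_axis)
    then show "(\<integral>x. \<phi> x * grad \<psi> x $ i \<partial>lebesgue_on \<Omega>) = - (\<integral>x. grad \<phi> x $ i * \<psi> x \<partial>lebesgue_on \<Omega>)"
      using int_eq[OF m1(1)] int_eq[OF m1(2)] z by simp
  qed
  have "W1p \<Omega> p \<phi> (grad \<phi>)"
    unfolding W1p_def in_Lp_def using weak on[OF Lp1] on[OF Lp2]
    by (auto intro!: measurable_restrict_space1 lm C1c_measurable[OF C])
  moreover have "(\<lambda>m::nat. W1p_norm \<Omega> p (\<lambda>x. \<phi> x - \<phi> x) (\<lambda>x. grad \<phi> x - grad \<phi> x)) \<longlonglongrightarrow> 0"
    using p by (simp add: W1p_norm_def)
  ultimately show ?thesis unfolding W01p_def using \<phi> by (intro conjI exI[of _ "\<lambda>_. \<phi>"]) auto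
qed

subsection \<open>Optimality of the logarithmic weight\<close>

text \<open>The ratio of the radii is \<open>e\<close>, not \<open>2\<close>: in the variable
  \<open>ln (D / norm x)\<close> these are the unit intervals, half-open so that the integer part
  selects exactly one.\<close>

definition dyadic :: "real \<Rightarrow> nat \<Rightarrow> 'a::real_normed_vector set" where
  "dyadic D j = {x. D * exp (- real (Suc j)) < norm x \<and> norm x \<le> D * exp (- real j)}"

lemma dyadic_iff:
  assumes "D > 0" "x \<noteq> 0"
  shows "x \<in> dyadic D j \<longleftrightarrow> real j \<le> ln (D / norm x) \<and> ln (D / norm x) < real j + 1"
proof -
  have nx: "norm x = D * exp (- ln (D / norm x))" using assms by (simp add: exp_minus)
  have "x \<in> dyadic D j \<longleftrightarrow> - real (Suc j) < - ln (D / norm x) \<and> - ln (D / norm x) \<le> - real j"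
    unfolding dyadic_def mem_Collect_eq by (subst (1 2) nx) (use assms in simp)
  then show ?thesis by auto
qed

text \<open>The density \<open>norm x powr (- N)\<close> is scale invariant, so all shells have mass
  of the same order; volumes of balls give the bounds. Counting shells thereby replaces integration
  in polar coordinates.\<close>

lemma dyadic_mass:
  fixes D :: real
  assumes D: "D > 0"
  defines "N \<equiv> real DIM('a::euclidean_space)"
  shows "\<exists>m M. 0 < m \<and> 0 < M \<and> (\<forall>j. integrable lborel (\<lambda>x::'a. norm x powr (- N) * indicator (dyadic D j :: 'a set) x) \<and>
     m \<le> (\<integral>x. norm x powr (- N) * indicator (dyadic D j :: 'a set) x \<partial>lborel) \<and>
     (\<integral>x. norm x powr (- N) * indicator (dyadic D j :: 'a set) x \<partial>lborel) \<le> M)"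
proof -
  define \<beta> where "\<beta> = unit_ball_vol N * (1 - exp (- N))"
  have N0: "N > 0" by (simp add: N_def)
  have \<beta>0: "\<beta> > 0" using N0 by (simp add: \<beta>_def)
  show ?thesis
  proof (rule exI[of _ \<beta>], rule exI[of _ "\<beta> * exp N"], intro conjI allI)
    fix j
    let ?r = "D * exp (- real j)" and ?r' = "D * exp (- real (Suc j))"
    have r: "0 < ?r'" "?r' \<le> ?r" using D by auto
    have sd: "dyadic D j = cball (0::'a) ?r - cball 0 ?r'" by (auto simp: dyadic_def)
    have meas [measurable]: "(dyadic D j :: 'a set) \<in> sets borel" unfolding sd by auto
    have fin: "emeasure lborel (dyadic D j :: 'a set) < \<infinity>"
      using emeasure_mono[of "dyadic D j" "cball (0::'a) ?r" lborel] emeasure_lborel_cball_finite[of "0::'a" ?r]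
      by (auto simp: sd intro: le_less_trans)
    have "measure lborel (dyadic D j :: 'a set) = measure lborel (cball (0::'a) ?r) - measure lborel (cball (0::'a) ?r')"
      unfolding sd using r emeasure_lborel_cball_finite[of "0::'a" ?r] by (intro measure_Diff) auto
    also have "\<dots> = unit_ball_vol N * ?r powr N - unit_ball_vol N * ?r' powr N"
      using r D by (simp add: content_cball N_def powr_realpow)
    also have "?r' powr N = ?r powr N * exp (- N)"
    proof -
      have "?r' = ?r * exp (- 1)" by (simp add: exp_add[symmetric])
      then have "?r' powr N = ?r powr N * exp (- 1) powr N" using D by (simp add: powr_mult)
      then show ?thesis by (simp add: exp_powr_real)
    qed
    finally have vol: "measure lborel (dyadic D j :: 'a set) = \<beta> * ?r powr N" by (simp add: \<beta>_def algebra_simps)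
    have rN: "?r powr (- N) * ?r powr N = 1" using D by (simp flip: powr_add)
    have r'N: "?r' powr (- N) = ?r powr (- N) * exp N"
    proof -
      have "?r' = ?r * exp (- 1)" by (simp add: exp_add[symmetric])
      then have "?r' powr (- N) = ?r powr (- N) * exp (- 1) powr (- N)" using D by (simp add: powr_mult)
      then show ?thesis by (simp add: exp_powr_real)
    qed
    have lo: "?r powr (- N) * indicator (dyadic D j :: 'a set) x \<le> norm x powr (- N) * indicator (dyadic D j :: 'a set) x"
     and hi: "norm x powr (- N) * indicator (dyadic D j :: 'a set) x \<le> ?r' powr (- N) * indicator (dyadic D j :: 'a set) x" for x :: 'a
      using r N0 by (auto simp: dyadic_def indicator_def intro!: powr_mono2' intro: less_trans[OF r(1)])
    have ic: "integrable lborel (\<lambda>x::'a. c * indicator (dyadic D j :: 'a set) x)" for c :: real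
      using fin by (intro integrable_mult_right integrable_real_indicator) auto
    show int: "integrable lborel (\<lambda>x::'a. norm x powr (- N) * indicator (dyadic D j :: 'a set) x)"
      by (rule Bochner_Integration.integrable_bound[OF ic[of "?r' powr (- N)"]])
         (use hi in \<open>auto intro!: AE_I2\<close>)
    have "\<beta> = (\<integral>x. ?r powr (- N) * indicator (dyadic D j :: 'a set) x \<partial>lborel)"
      using vol rN by simp
    also have "\<dots> \<le> (\<integral>x. norm x powr (- N) * indicator (dyadic D j :: 'a set) x \<partial>lborel)"
      by (rule integral_mono[OF ic int lo])
    finally show "\<beta> \<le> (\<integral>x. norm x powr (- N) * indicator (dyadic D j :: 'a set) x \<partial>lborel)" .
    have "(\<integral>x. norm x powr (- N) * indicator (dyadic D j :: 'a set) x \<partial>lborel) \<le> (\<integral>x. ?r' powr (- N) * indicator (dyadic D j :: 'a set) x \<partial>lborel)"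
      by (rule integral_mono[OF int ic hi])
    also have "\<dots> = \<beta> * exp N" unfolding r'N using vol rN by simp
    finally show "(\<integral>x. norm x powr (- N) * indicator (dyadic D j :: 'a set) x \<partial>lborel) \<le> \<beta> * exp N" .
  qed (use \<beta>0 in auto)
qed

section \<open>The profile of the extremal functions\<close>

definition half_profile :: "real \<Rightarrow> real" where "half_profile \<tau> = flat 0 (\<tau> - 1) * flat 0 (2 - \<tau>)"

definition half_profile' :: "real \<Rightarrow> real" where
  "half_profile' \<tau> = flat 2 (\<tau> - 1) * flat 0 (2 - \<tau>) - flat 0 (\<tau> - 1) * flat 2 (2 - \<tau>)"

text \<open>The profile is the square of a smooth bump on \<open>(1, 2)\<close>, which keeps
  \<open>profile powr (p - 2) * profile'\<^sup>2\<close> bounded for \<open>p < 2\<close>.\<close>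

definition profile :: "real \<Rightarrow> real" where "profile \<tau> = (half_profile \<tau>)\<^sup>2"

definition profile' :: "real \<Rightarrow> real" where "profile' \<tau> = 2 * half_profile \<tau> * half_profile' \<tau>"

lemma smooth_upto_profile: "smooth_upto k UNIV profile"
proof -
  have 1: "smooth_upto k UNIV (\<lambda>\<tau>. flat 0 (\<tau> - 1))"
    by (rule smooth_upto_compose[OF _ smooth_upto_flat[of k UNIV]]) (use smooth_upto_add[OF smooth_upto_ident smooth_upto_const, of k UNIV "- 1"] in auto)
  have 2: "smooth_upto k UNIV (\<lambda>\<tau>. flat 0 (2 - \<tau>))"
    by (rule smooth_upto_compose[OF _ smooth_upto_flat[of k UNIV]])
       (use smooth_upto_add[OF smooth_upto_const smooth_upto_mult[OF smooth_upto_const smooth_upto_ident], of k UNIV 2 "- 1"] in auto)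
  show ?thesis unfolding profile_def[abs_def] half_profile_def power2_eq_square by (intro smooth_upto_mult 1 2)
qed

lemma profile_derivative: "(profile has_real_derivative profile' \<tau>) (at \<tau>)"
proof -
  have f: "(flat 0 has_real_derivative flat 2 s) (at s)" for s
    using flat_derivative[of 0 s] by (simp add: numeral_2_eq_2)
  have "((\<lambda>\<tau>. flat 0 (\<tau> - 1)) has_real_derivative flat 2 (\<tau> - 1) * 1) (at \<tau>)"
    by (rule DERIV_chain2[OF f]) (auto intro!: derivative_eq_intros)
  moreover have "((\<lambda>\<tau>. flat 0 (2 - \<tau>)) has_real_derivative flat 2 (2 - \<tau>) * - 1) (at \<tau>)"
    by (rule DERIV_chain2[OF f]) (auto intro!: derivative_eq_intros)
  ultimately have "(half_profile has_real_derivative (flat 2 (\<tau> - 1) * 1) * flat 0 (2 - \<tau>) + (flat 2 (2 - \<tau>) * - 1) * flat 0 (\<tau> - 1)) (at \<tau>)"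
    unfolding half_profile_def[abs_def] by (rule DERIV_mult)
  then have "(half_profile has_real_derivative half_profile' \<tau>) (at \<tau>)"
    by (rule DERIV_cong) (simp add: half_profile'_def)
  from DERIV_power[OF this, of 2] show ?thesis
    unfolding profile_def[abs_def] by (rule DERIV_cong) (simp add: profile'_def)
qed

lemma flat_bounds: "0 \<le> flat m s" "flat 0 s \<le> 1" "flat 2 s \<le> 2"
proof -
  show "0 \<le> flat m s" "flat 0 s \<le> 1" by (auto simp: flat_def)
  show "flat 2 s \<le> 2"
  proof (cases "s > 0")
    case True
    have "1 + inverse s + (inverse s)\<^sup>2 / 2 \<le> exp (inverse s)"
      by (rule exp_lower_Taylor_quadratic) (use True in simp)
    moreover have "inverse s > 0" using True by simp
    ultimately have "(inverse s)\<^sup>2 \<le> 2 * exp (inverse s)" by linarith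
    then show ?thesis using True by (simp add: flat_def exp_minus field_simps)
  qed (simp add: flat_def)
qed

lemma half_profile_bounds: "0 \<le> half_profile \<tau>" "half_profile \<tau> \<le> 1" "\<bar>half_profile' \<tau>\<bar> \<le> 4"
proof -
  show "0 \<le> half_profile \<tau>" "half_profile \<tau> \<le> 1"
    unfolding half_profile_def using flat_bounds by (auto intro!: mult_nonneg_nonneg mult_le_one)
  have "flat 2 (\<tau> - 1) * flat 0 (2 - \<tau>) \<le> 2 * 1" "flat 0 (\<tau> - 1) * flat 2 (2 - \<tau>) \<le> 1 * 2"
    using flat_bounds by (intro mult_mono; simp)+
  moreover have "0 \<le> flat 2 (\<tau> - 1) * flat 0 (2 - \<tau>)" "0 \<le> flat 0 (\<tau> - 1) * flat 2 (2 - \<tau>)"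
    using flat_bounds by auto
  ultimately show "\<bar>half_profile' \<tau>\<bar> \<le> 4" unfolding half_profile'_def by linarith
qed

lemma half_profile_pos: "0 < half_profile \<tau> \<longleftrightarrow> 1 < \<tau> \<and> \<tau> < 2"
  by (auto simp: half_profile_def flat_def)

lemma profile_nonzero: "profile \<tau> \<noteq> 0 \<Longrightarrow> 1 < \<tau> \<and> \<tau> < 2"
  using half_profile_pos[of \<tau>] half_profile_bounds(1)[of \<tau>] by (auto simp: profile_def less_le)

lemma profile_zero: "profile \<tau> = 0 \<Longrightarrow> profile' \<tau> = 0"
  by (simp add: profile_def profile'_def)

lemma profile_bounds: "0 \<le> profile \<tau>" "\<bar>profile' \<tau>\<bar> \<le> 8"
proof -
  show "0 \<le> profile \<tau>" by (simp add: profile_def)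
  have "\<bar>profile' \<tau>\<bar> = 2 * half_profile \<tau> * \<bar>half_profile' \<tau>\<bar>" using half_profile_bounds(1) by (simp add: profile'_def abs_mult)
  also have "\<dots> \<le> 2 * 1 * 4" using half_profile_bounds by (intro mult_mono) auto
  finally show "\<bar>profile' \<tau>\<bar> \<le> 8" by simp
qed

text \<open>In the product \<open>half_profile\<close> has the total exponent
  \<open>2 * (p - 1)\<close>, which is positive, so nothing blows up near its zeros.\<close>

lemma profile_weighted:
  assumes "p > 1" "profile \<tau> \<noteq> 0"
  shows "profile \<tau> powr (p - 2) * (profile' \<tau>)\<^sup>2 \<le> 64"
proof -
  have pos: "half_profile \<tau> > 0" using assms(2) half_profile_bounds(1)[of \<tau>] by (auto simp: profile_def less_le)
  have "profile \<tau> powr (p - 2) = half_profile \<tau> powr (2 * (p - 2))"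
    using pos powr_powr[of "half_profile \<tau>" 2 "p - 2"] by (simp add: profile_def)
  moreover have "(profile' \<tau>)\<^sup>2 = 4 * (half_profile \<tau> powr 2 * (half_profile' \<tau>)\<^sup>2)"
    using pos by (simp add: profile'_def power_mult_distrib)
  ultimately have "profile \<tau> powr (p - 2) * (profile' \<tau>)\<^sup>2 = 4 * ((half_profile \<tau> powr (2 * (p - 2)) * half_profile \<tau> powr 2) * (half_profile' \<tau>)\<^sup>2)"
    by simp
  also have "half_profile \<tau> powr (2 * (p - 2)) * half_profile \<tau> powr 2 = half_profile \<tau> powr (2 * (p - 1))"
    unfolding powr_add[symmetric] by (simp add: algebra_simps)
  also have "4 * (half_profile \<tau> powr (2 * (p - 1)) * (half_profile' \<tau>)\<^sup>2) \<le> 4 * (1 * 4\<^sup>2)"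
  proof (intro mult_left_mono mult_mono)
    show "half_profile \<tau> powr (2 * (p - 1)) \<le> 1" using half_profile_bounds[of \<tau>] assms by (intro powr_le1) auto
    have "\<bar>half_profile' \<tau>\<bar>\<^sup>2 \<le> 4\<^sup>2" using half_profile_bounds by (intro power_mono) auto
    then show "(half_profile' \<tau>)\<^sup>2 \<le> 4\<^sup>2" by simp
  qed auto
  finally show ?thesis by simp
qed

lemma profile_lower:
  assumes "5/4 \<le> \<tau>" "\<tau> \<le> 7/4" shows "exp (- 16) \<le> profile \<tau>"
proof -
  have e: "exp (- 4) \<le> flat 0 s" if "s \<ge> 1/4" for s
  proof -
    have "inverse s \<le> 4" using that by (simp add: field_simps)
    then show ?thesis using that by (simp add: flat_def)
  qed
  have "exp (- 4) * exp (- 4) \<le> half_profile \<tau>"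
    unfolding half_profile_def using assms by (intro mult_mono e) (auto simp: flat_bounds)
  then have "(exp (- 4) * exp (- 4))\<^sup>2 \<le> profile \<tau>" unfolding profile_def by (intro power_mono) auto
  moreover have "(exp (- 4) * exp (- 4))\<^sup>2 = exp (- 16 :: real)"
    unfolding power2_eq_square by (simp flip: exp_add)
  ultimately show ?thesis by simp
qed

text \<open>The variable is \<open>s = x \<bullet> x\<close>, hence the halves:
  \<open>s powr (- (H / 2))\<close> is \<open>norm x powr (- H)\<close> and
  \<open>ln D - ln s / 2\<close> is \<open>ln (D / norm x)\<close>. The amplitude
  \<open>T powr (1 / p)\<close> is the largest power that keeps the defect bounded as
  \<open>T\<close> grows.\<close>

definition extremal_radial :: "real \<Rightarrow> real \<Rightarrow> real \<Rightarrow> real \<Rightarrow> real \<Rightarrow> real" where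
  "extremal_radial p H D T s = (if s > 0 then T powr (1 / p) * (s powr (- (H / 2)) * profile ((ln D - ln s / 2) / T)) else 0)"

lemma smooth_upto_extremal_radial:
  assumes "D > 0" "T > 0" shows "smooth_upto k UNIV (extremal_radial p H D T)"
proof -
  \<comment> \<open>Below \<open>?d\<close> the logarithm exceeds \<open>2 * T\<close> and the
    profile is zero, so the function continues smoothly by zero across \<open>s = 0\<close>.\<close>
  let ?d = "D\<^sup>2 * exp (- (4 * T))"
  have tau: "smooth_upto k {0<..} (\<lambda>s. (ln D - ln s / 2) / T)"
  proof -
    have "smooth_upto k {0<..} (\<lambda>s. ln D / T + (- 1 / (2 * T)) * ln s)" by (intro smooth_upto_add smooth_upto_mult smooth_upto_const smooth_upto_ln)
    also have "(\<lambda>s. ln D / T + (- 1 / (2 * T)) * ln s) = (\<lambda>s. (ln D - ln s / 2) / T)"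
      using assms by (simp add: fun_eq_iff field_simps)
    finally show ?thesis .
  qed
  have "smooth_upto k {0<..} (\<lambda>s. T powr (1 / p) * (s powr (- (H / 2)) * profile ((ln D - ln s / 2) / T)))"
    by (intro smooth_upto_mult smooth_upto_const smooth_upto_powr smooth_upto_compose[OF tau smooth_upto_profile]) auto
  then have 1: "smooth_upto k {0<..} (extremal_radial p H D T)"
    by (rule smooth_upto_cong[rotated]) (auto simp: extremal_radial_def)
  have "smooth_upto k {..<?d} (\<lambda>_. 0)" by (rule smooth_upto_const)
  then have 2: "smooth_upto k {..<?d} (extremal_radial p H D T)"
  proof (rule smooth_upto_cong[rotated])
    fix s assume s: "s \<in> {..<?d}"
    show "0 = extremal_radial p H D T s"
    proof (cases "s > 0")
      case True
      have "ln s < ln ?d" using s True by simp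
      also have "ln ?d = 2 * ln D - 4 * T" using assms by (simp add: ln_mult ln_realpow)
      finally have "2 < (ln D - ln s / 2) / T" using assms by (simp add: field_simps)
      then have "profile ((ln D - ln s / 2) / T) = 0" using profile_nonzero by force
      then show ?thesis by (simp add: extremal_radial_def)
    qed (simp add: extremal_radial_def)
  qed simp
  have "smooth_upto k ({0<..} \<union> {..<?d}) (extremal_radial p H D T)" by (rule smooth_upto_Un[OF _ _ 1 2]) auto
  moreover have "?d > 0" using assms by simp
  then have "{0<..} \<union> {..<?d} = UNIV" by auto
  ultimately show ?thesis by simp
qed

lemma extremal_radial_derivative:
  assumes "s > 0" "T > 0"
  shows "(extremal_radial p H D T has_real_derivative
     T powr (1 / p) * (- (H / 2) * (s powr (- (H / 2)) / s) * profile ((ln D - ln s / 2) / T)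
       - s powr (- (H / 2)) / s * profile' ((ln D - ln s / 2) / T) / (2 * T))) (at s)"
proof -
  let ?\<tau> = "(ln D - ln s / 2) / T"
  have t: "((\<lambda>s. (ln D - ln s / 2) / T) has_real_derivative - 1 / (2 * T * s)) (at s)"
    using assms by (auto intro!: derivative_eq_intros simp: field_simps)
  have w: "((\<lambda>s. s powr (- (H / 2))) has_real_derivative - (H / 2) * (s powr (- (H / 2)) / s)) (at s)"
  proof -
    have 1: "((\<lambda>s. s powr (- (H / 2))) has_real_derivative - (H / 2) * s powr (- (H / 2) - 1)) (at s)"
      using assms by (auto intro!: derivative_eq_intros)
    have 2: "s powr (- (H / 2) - 1) = s powr (- (H / 2)) / s"
      using assms powr_diff[of s "- (H / 2)" 1] by simp
    show ?thesis using 1 unfolding 2 .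
  qed
  have "((\<lambda>s. T powr (1 / p) * (s powr (- (H / 2)) * profile ((ln D - ln s / 2) / T))) has_real_derivative
     T powr (1 / p) * (- (H / 2) * (s powr (- (H / 2)) / s) * profile ?\<tau> + profile' ?\<tau> * (- 1 / (2 * T * s)) * s powr (- (H / 2)))) (at s)"
    by (rule DERIV_cmult[OF DERIV_mult[OF w DERIV_chain2[OF profile_derivative t]]])
  then have "((\<lambda>s. T powr (1 / p) * (s powr (- (H / 2)) * profile ((ln D - ln s / 2) / T))) has_real_derivative
     T powr (1 / p) * (- (H / 2) * (s powr (- (H / 2)) / s) * profile ?\<tau> - s powr (- (H / 2)) / s * profile' ?\<tau> / (2 * T))) (at s)"
    by (rule DERIV_cong) (use assms in \<open>simp add: field_simps\<close>)
  then show ?thesis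
    by (rule has_field_derivative_transform_within_open[where S = "{0<..}"]) (use assms in \<open>auto simp: extremal_radial_def\<close>)
qed

definition extremal :: "real \<Rightarrow> real \<Rightarrow> real \<Rightarrow> real \<Rightarrow> real ^ 'n \<Rightarrow> real" where
  "extremal p H D T x = extremal_radial p H D T (x \<bullet> x)"

lemma tau_norm:
  assumes "D > 0" "x \<noteq> 0" shows "(ln D - ln (x \<bullet> x) / 2) / T = ln (D / norm x) / T"
proof -
  have "ln (x \<bullet> x) = 2 * ln (norm x)" using assms by (simp add: dot_square_norm ln_realpow)
  then show ?thesis using assms by (simp add: ln_div)
qed

lemma inner_powr_half: "x \<noteq> 0 \<Longrightarrow> (x \<bullet> x) powr (- (H / 2)) = norm x powr (- H)"
  using powr_powr[of "norm x" 2 "- (H / 2)"] by (simp add: dot_square_norm)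

lemma extremal_eq:
  assumes "D > 0" "x \<noteq> 0"
  shows "extremal p H D T x = T powr (1 / p) * (norm x powr (- H) * profile (ln (D / norm x) / T))"
  using assms by (simp add: extremal_def extremal_radial_def tau_norm inner_powr_half)

lemma extremal_0: "extremal p H D T 0 = 0"
  by (simp add: extremal_def extremal_radial_def)

lemma extremal_grad:
  assumes "D > 0" "x \<noteq> 0" "T > 0"
  shows "grad (extremal p H D T) x = (T powr (1 / p) * (norm x powr (- H) / (norm x)\<^sup>2) *
     (- H * profile (ln (D / norm x) / T) - profile' (ln (D / norm x) / T) / T)) *\<^sub>R x"
proof -
  have "(extremal_radial p H D T has_real_derivative
     T powr (1 / p) * (- (H / 2) * (norm x powr (- H) / (norm x)\<^sup>2) * profile (ln (D / norm x) / T)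
       - norm x powr (- H) / (norm x)\<^sup>2 * profile' (ln (D / norm x) / T) / (2 * T))) (at (x \<bullet> x))"
    using extremal_radial_derivative[of "x \<bullet> x" T p H D] assms(2,3)
    unfolding tau_norm[OF assms(1,2)] inner_powr_half[OF assms(2)] power2_norm_eq_inner by simp
  from has_derivative_norm_square_compose[OF this]
  have "(extremal p H D T has_derivative (\<lambda>v. ((2 * (T powr (1 / p) * (- (H / 2) * (norm x powr (- H) / (norm x)\<^sup>2) * profile (ln (D / norm x) / T)
       - norm x powr (- H) / (norm x)\<^sup>2 * profile' (ln (D / norm x) / T) / (2 * T)))) *\<^sub>R x) \<bullet> v)) (at x)"
    unfolding extremal_def[abs_def] .
  then have "grad (extremal p H D T) x = (2 * (T powr (1 / p) * (- (H / 2) * (norm x powr (- H) / (norm x)\<^sup>2) * profile (ln (D / norm x) / T)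
       - norm x powr (- H) / (norm x)\<^sup>2 * profile' (ln (D / norm x) / T) / (2 * T)))) *\<^sub>R x"
    by (simp add: vec_eq_iff grad_eqI inner_axis)
  also have "2 * (T powr (1 / p) * (- (H / 2) * (norm x powr (- H) / (norm x)\<^sup>2) * profile (ln (D / norm x) / T)
       - norm x powr (- H) / (norm x)\<^sup>2 * profile' (ln (D / norm x) / T) / (2 * T)))
     = T powr (1 / p) * (norm x powr (- H) / (norm x)\<^sup>2) * (- H * profile (ln (D / norm x) / T) - profile' (ln (D / norm x) / T) / T)"
  proof -
    have "2 * (t * (- (H / 2) * w * a - w * b / (2 * T))) = t * w * (- H * a - b / T)" for t w a b
      using assms(3) by (simp add: field_simps)
    then show ?thesis .
  qed
  finally show ?thesis .
qed

lemma extremal_support: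
  assumes "D > 0" "T > 0" "extremal p H D T x \<noteq> 0"
  shows "x \<noteq> 0" "T < ln (D / norm x)" "ln (D / norm x) < 2 * T"
proof -
  show x: "x \<noteq> 0" using assms(3) by (auto simp: extremal_0)
  have "profile (ln (D / norm x) / T) \<noteq> 0" using assms(3) unfolding extremal_eq[OF assms(1) x] by auto
  then show "T < ln (D / norm x)" "ln (D / norm x) < 2 * T"
    using profile_nonzero[of "ln (D / norm x) / T"] assms(2) by (auto simp: field_simps)
qed

text \<open>The support condition \<open>1 < ln (D / norm x) / T < 2\<close> describes an annulus
  whose closure is compact and avoids the origin.\<close>

lemma extremal_test:
  fixes p H D T :: real
  assumes D: "D > 0" and T: "T > 0" and \<Omega>: "\<And>x :: real ^ 'n. 0 < norm x \<Longrightarrow> norm x \<le> D * exp (- T) \<Longrightarrow> x \<in> \<Omega>"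
  shows "(extremal p H D T :: real ^ 'n \<Rightarrow> real) \<in> test_functions \<Omega>"
proof -
  let ?u = "extremal p H D T :: real ^ 'n \<Rightarrow> real"
  let ?C = "{x :: real ^ 'n. D * exp (- (2 * T)) \<le> norm x \<and> norm x \<le> D * exp (- T)}"
  have Ck: "Ck k ?u" for k unfolding extremal_def[abs_def] by (intro Ck_radial smooth_upto_extremal_radial D T)
  have "?C = cball 0 (D * exp (- T)) \<inter> {x. D * exp (- (2 * T)) \<le> norm x}" by auto
  then have cC: "compact ?C" by (simp add: compact_Int_closed closed_Collect_le continuous_on_norm_id continuous_on_const)
  have sub: "{x. ?u x \<noteq> 0} \<subseteq> ?C"
  proof
    fix x assume "x \<in> {x. ?u x \<noteq> 0}"
    then have u: "?u x \<noteq> 0" by simp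
    note s = extremal_support[OF D T u]
    have nx: "norm x = D * exp (- ln (D / norm x))" using s(1) D by (simp add: exp_minus)
    have "D * exp (- (2 * T)) \<le> D * exp (- ln (D / norm x))" "D * exp (- ln (D / norm x)) \<le> D * exp (- T)"
      using s D by auto
    then show "x \<in> ?C" using nx by simp
  qed
  have cl: "closure {x. ?u x \<noteq> 0} \<subseteq> ?C"
    using sub compact_imp_closed[OF cC] by (rule closure_minimal)
  have "?C \<subseteq> \<Omega>"
  proof
    fix x :: "real ^ 'n" assume "x \<in> ?C"
    moreover have "0 < D * exp (- (2 * T))" using D by simp
    ultimately show "x \<in> \<Omega>" by (intro \<Omega>) auto
  qed
  moreover have "compact (closure {x. ?u x \<noteq> 0})"
    using compact_Int_closed[OF cC closed_closure[of "{x. ?u x \<noteq> 0}"]] cl by (simp only: inf.absorb2)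
  ultimately have "(\<forall>k. Ck k ?u) \<and> compact (closure {x. ?u x \<noteq> 0}) \<and> closure {x. ?u x \<noteq> 0} \<subseteq> \<Omega>"
    using Ck cl by blast
  then show ?thesis unfolding test_functions_def mem_Collect_eq .
qed

lemma int_on_lborel:
  fixes f :: "real ^ 'n \<Rightarrow> real"
  assumes f: "integrable lborel f" "\<And>x. 0 \<le> f x" "\<And>x. x \<notin> \<Omega> \<Longrightarrow> f x = 0"
  shows "int_on \<Omega> f = ereal (\<integral>x. f x \<partial>lborel)"
proof -
  have "int_on \<Omega> f = enn2ereal (\<integral>\<^sup>+x. ennreal (f x) \<partial>lebesgue)"
    by (rule int_on_eq) (use f in auto)
  also have "(\<integral>\<^sup>+x. ennreal (f x) \<partial>lebesgue) = (\<integral>\<^sup>+x. ennreal (f x) \<partial>lborel)"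
    using f by (intro nn_integral_completion)
  also have "\<dots> = ennreal (\<integral>x. f x \<partial>lborel)" using f by (intro nn_integral_eq_integral) auto
  finally show ?thesis using f by (simp add: Bochner_Integration.integral_nonneg)
qed

text \<open>Along the extremal family the defect integral stays below \<open>C' * M\<close>, while
  the weighted integral grows like \<open>n powr (1 + q / p - \<gamma>)\<close>: the amplitude gives
  \<open>n powr (q / p)\<close>, the logarithmic length \<open>n\<close>, and the weight
  \<open>n powr (- \<gamma>)\<close>.\<close>

lemma Hardy_Sobolev_point_optimal:
  fixes \<Omega> :: "(real ^ 'n) set" and p q D \<gamma> :: real
  assumes N: "N = CARD('n)" and \<Omega>: "open \<Omega>" "bounded \<Omega>" "0 \<in> \<Omega>" and D: "D > (SUP x\<in>\<Omega>. norm x)"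
    and p: "1 < p" "p < real N" and q: "p \<le> q" and \<gamma>: "\<gamma> < 1 + q / p"
  shows "\<not> (\<exists>c::real. c > 0 \<and> (\<forall>u g. W01p \<Omega> p u g \<longrightarrow>
          int_on \<Omega> (\<lambda>x. norm (g x) powr p)
            - ereal (\<bar>(real N - p) / p\<bar> powr p) * int_on \<Omega> (\<lambda>x. \<bar>u x\<bar> powr p / norm x powr p)
          \<ge> ereal c * epowr (int_on \<Omega>
                (\<lambda>x. \<bar>u x\<bar> powr q * norm x powr (- q - real N + real N * q / p)
                       * X_log (norm x / D) powr \<gamma>)) (p / q)))"
proof
  assume "\<exists>c::real. c > 0 \<and> (\<forall>u g. W01p \<Omega> p u g \<longrightarrow>
          int_on \<Omega> (\<lambda>x. norm (g x) powr p)
            - ereal (\<bar>(real N - p) / p\<bar> powr p) * int_on \<Omega> (\<lambda>x. \<bar>u x\<bar> powr p / norm x powr p)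
          \<ge> ereal c * epowr (int_on \<Omega>
                (\<lambda>x. \<bar>u x\<bar> powr q * norm x powr (- q - real N + real N * q / p)
                       * X_log (norm x / D) powr \<gamma>)) (p / q))"
  then obtain c where c: "c > 0" and ineq: "\<And>u g. W01p \<Omega> p u g \<Longrightarrow>
      ereal c * epowr (int_on \<Omega> (\<lambda>x. \<bar>u x\<bar> powr q * norm x powr (- q - real N + real N * q / p) * X_log (norm x / D) powr \<gamma>)) (p / q)
      \<le> int_on \<Omega> (\<lambda>x. norm (g x) powr p)
            - ereal (\<bar>(real N - p) / p\<bar> powr p) * int_on \<Omega> (\<lambda>x. \<bar>u x\<bar> powr p / norm x powr p)"
    by blast
  have bdd: "bdd_above (norm ` \<Omega>)" using \<Omega>(2) by (auto simp: bounded_iff bdd_above_def)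
  define R where "R = ((SUP x\<in>\<Omega>. norm x) + D) / 2"
  have le_sup: "norm x \<le> (SUP x\<in>\<Omega>. norm x)" if "x \<in> \<Omega>" for x by (rule cSUP_upper[OF that bdd])
  have R: "0 < R" "R < D" using le_sup[OF \<Omega>(3)] D by (auto simp: R_def)
  have D0: "D > 0" using R by simp
  have \<Omega>R: "norm x < R" if "x \<in> \<Omega>" for x using le_sup[OF that] D by (simp add: R_def)
  obtain \<rho> where \<rho>: "\<rho> > 0" "ball 0 \<rho> \<subseteq> \<Omega>" using \<Omega> by (meson open_contains_ball)
  have card: "card (Basis :: (real ^ 'n) set) = N" using N by simp
  define H where "H = (real N - p) / p"
  have H0: "H > 0" using p by (simp add: H_def)
  have Hp: "(H + 1) * p = real N" using p by (simp add: H_def field_simps)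
  note hyps = p H_def H0
  interpret punctured_ball "Basis :: (real ^ 'n) set" p H D R
    by standard (use p H0 R card in \<open>auto simp: H_def\<close>)
  have y_id: "y x = x" for x by (simp add: y_def euclidean_representation)
  have dst_norm: "dst = norm" by (simp add: dst_def fun_eq_iff y_id)
  have V_eq: "V = {x. 0 < norm x \<and> norm x < R}" by (auto simp: V_def dst_norm)
  have ell_eq: "ell x = ln (D / norm x)" for x by (simp add: ell_def dst_norm)
  have q0: "q > 0" using q hyps by simp
  define s where "s = - q - real N + real N * q / p"
  have s_eq: "- H * q + s = - real N" using hyps by (simp add: H_def s_def field_simps)
  obtain m M where mM: "0 < m" "0 < M"
    "\<And>j. integrable lborel (\<lambda>x. norm x powr (- real N) * indicator (dyadic D j :: (real ^ 'n) set) x)"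
    "\<And>j. m \<le> (\<integral>x. norm x powr (- real N) * indicator (dyadic D j :: (real ^ 'n) set) x \<partial>lborel)"
    "\<And>j. (\<integral>x. norm x powr (- real N) * indicator (dyadic D j :: (real ^ 'n) set) x \<partial>lborel) \<le> M"
    using dyadic_mass[OF D0, where ?'a = "real ^ 'n"] N by auto
  let ?w = "\<lambda>j x. norm x powr (- real N) * indicator (dyadic D j :: (real ^ 'n) set) x :: real"
  have iS: "integrable lborel (\<lambda>x. b * (\<Sum>j\<in>I. ?w j x))" for b I
    by (intro integrable_mult_right Bochner_Integration.integrable_sum mM(3))
  have sum_w: "(\<Sum>j\<in>I. ?w j x) = norm x powr (- real N)"
    if "finite I" "x \<noteq> 0" "i \<in> I" "real i \<le> ell x" "ell x < real i + 1" for I i x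
  proof -
    have "x \<in> dyadic D j \<longleftrightarrow> j = i" for j
      using that dyadic_iff[OF D0 that(2), of j] by (auto simp: ell_eq)
    then have "(\<Sum>j\<in>I. ?w j x) = (\<Sum>j\<in>I. if j = i then norm x powr (- real N) else 0)"
      by (intro sum.cong) auto
    then show ?thesis using that by simp
  qed
  obtain C where C: "C > 0" "\<And>a b :: real ^ 'n. a \<noteq> 0 \<Longrightarrow>
     bregman p a b \<le> C * (norm a powr (p - 2) * (norm b)\<^sup>2 + (if p \<ge> 2 then norm b powr p else 0))"
    using bregman_upper[OF hyps(1)] by metis
  define C' where "C' = C * (64 * H powr (p - 2) + 8 powr p)"
  have C': "C' \<ge> 0" using C by (simp add: C'_def)
  \<comment> \<open>Beyond \<open>n0\<close> the ball of radius \<open>D * exp (- T)\<close> lies in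
    \<open>ball 0 \<rho>\<close> and in the ball of radius \<open>R\<close>, so the extremal
    function is a test function.\<close>
  define n0 where "n0 = nat \<lceil>max 1 (max (ln (D / R)) (ln (D / \<rho>)))\<rceil>"
  \<comment> \<open>There are \<open>2 * n\<close> shells of mass at least \<open>m\<close>, the
    amplitude gives \<open>(4 * n) powr (q / p)\<close>, and the profile is at least
    \<open>exp (- 16)\<close>. The minimum covers both signs of \<gamma> when \<open>ell\<close>
    lies between \<open>5 * n\<close> and \<open>7 * n\<close>.\<close>
  define K where "K = 2 * m * 4 powr (q / p) * exp (- 16) powr q * min (5 powr (- \<gamma>)) (7 powr (- \<gamma>))"
  have K0: "K > 0" using mM by (simp add: K_def)
  have main: "c * (K * real n powr (1 + q / p - \<gamma>)) powr (p / q) \<le> C' * M" if n: "n \<ge> Suc n0" for n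
  proof -
    \<comment> \<open>The factor \<open>4\<close> makes \<open>5/4 * T = 5 * n\<close> and
      \<open>7/4 * T = 7 * n\<close> integers, so the range in \<open>profile_lower\<close> is a
      union of whole shells.\<close>
    define T where "T = 4 * real n"
    have n1: "n \<ge> 1" and nR: "real n > ln (D / R)" and n\<rho>: "real n > ln (D / \<rho>)"
      using n unfolding n0_def by linarith+
    have T1: "T \<ge> 1" "T > 0" using n1 by (auto simp: T_def)
    have expT: "D * exp (- T) < r" if "ln (D / r) < real n" "r > 0" for r
    proof -
      have "D / r = exp (ln (D / r))" using that D0 by simp
      also have "\<dots> < exp T" using that n1 by (simp add: T_def)
      finally show ?thesis using that by (simp add: exp_minus field_simps)
    qed
    let ?u = "extremal p H D T :: real ^ 'n \<Rightarrow> real"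
    let ?g = "grad ?u"
    let ?z = "\<lambda>x. ln (D / norm x) / T"
    have test: "?u \<in> test_functions (\<Omega> \<inter> V)"
    proof (rule extremal_test[OF D0 T1(2)])
      fix x :: "real ^ 'n" assume "0 < norm x" "norm x \<le> D * exp (- T)"
      then show "x \<in> \<Omega> \<inter> V"
        using expT[OF nR R(1)] expT[OF n\<rho> \<rho>(1)] \<rho>(2) by (auto simp: V_eq)
    qed
    then have test\<Omega>: "?u \<in> test_functions \<Omega>" by (auto simp: test_functions_def)
    have u: "C1c V ?u ?g" by (rule C1c_mono[OF test_function_C1c[OF test]]) simp
    have u\<Omega>: "C1c \<Omega> ?u ?g" by (rule test_function_C1c[OF test\<Omega>])
    note uU = C1c_U[OF u]
    have out: "?u x = 0" "?g x = 0" if "x \<notin> \<Omega>" for x using C1c_support[OF u\<Omega>] that by (metis subsetD)+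
    let ?f = "\<lambda>x. \<bar>?u x\<bar> powr q * norm x powr s * X_log (norm x / D) powr \<gamma>"
    have cX: "continuous_on V (\<lambda>x. X_log (norm x / D) powr \<gamma>)"
    proof -
      have "ln (norm x / D) < 0" if "x \<in> V" for x using that R by (auto simp: V_eq ln_div)
      then show ?thesis unfolding X_log_def
        by (intro continuous_on_powr continuous_intros) (use R in \<open>auto simp: V_eq divide_nonpos_neg less_imp_neq\<close>)
    qed
    have if': "integrable lborel ?f"
    proof (rule C1c_integrable[OF u])
      show "continuous_on V ?f"
        using q0 by (intro continuous_on_mult cX continuous_on_powr' continuous_intros C1c_continuous_on[OF u]) (auto simp: V_eq)
    qed (use q0 in auto)
    have ip: "integrable lborel (\<lambda>x. \<bar>?u x\<bar> powr p / norm x powr p)"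
      using C1c_integrable[OF uU continuous_on_potential[OF uU, of p]] hyps by (simp add: dst_norm)
    have ig: "integrable lborel (\<lambda>x. norm (?g x) powr p)"
      using integrable_grad_powr[OF uU, of p] hyps by simp
    let ?Q = "\<integral>x. ?f x \<partial>lborel"
    have Q0: "?Q \<ge> 0" by (intro Bochner_Integration.integral_nonneg) auto
    have "c * ?Q powr (p / q) \<le> Jt ?u ?g"
    proof -
      have "int_on \<Omega> ?f = ereal ?Q" by (rule int_on_lborel[OF if']) (use out q0 in auto)
      moreover have "int_on \<Omega> (\<lambda>x. norm (?g x) powr p) = ereal (\<integral>x. norm (?g x) powr p \<partial>lborel)"
        by (rule int_on_lborel[OF ig]) (use out in auto)
      moreover have "int_on \<Omega> (\<lambda>x. \<bar>?u x\<bar> powr p / norm x powr p) = ereal (\<integral>x. \<bar>?u x\<bar> powr p / norm x powr p \<partial>lborel)"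
        by (rule int_on_lborel[OF ip]) (use out in auto)
      moreover have "ereal c * epowr (int_on \<Omega> ?f) (p / q) \<le> int_on \<Omega> (\<lambda>x. norm (?g x) powr p)
            - ereal (\<bar>H\<bar> powr p) * int_on \<Omega> (\<lambda>x. \<bar>?u x\<bar> powr p / norm x powr p)"
        using ineq[OF test_function_W01p[OF test\<Omega> \<Omega>(1) hyps(1)]] unfolding s_def hyps(3)[symmetric] .
      ultimately have "c * ?Q powr (p / q) \<le> (\<integral>x. norm (?g x) powr p \<partial>lborel) - \<bar>H\<bar> powr p * (\<integral>x. \<bar>?u x\<bar> powr p / norm x powr p \<partial>lborel)"
        by (simp add: epowr_def)
      also have "\<dots> = Jt ?u ?g"
        using integrable_bregman(2)[OF uU hyps(1)] unfolding Jt_def J_def card hyps(3)[symmetric] dst_norm .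
      finally show ?thesis .
    qed
    also have "Jt ?u ?g \<le> C' * M"
    proof -
      \<comment> \<open>The shells with \<open>T < ell < 2 * T\<close>; their number
        \<open>4 * n = T\<close> cancels the factor \<open>1 / T\<close> of the pointwise
        bound.\<close>
      let ?I = "{4 * n..<8 * n}"
      have le: "J ?u ?g x \<le> C' / T * (\<Sum>j\<in>?I. ?w j x)" for x
      proof (cases "?u x = 0")
        case True
        have "?g x = 0"
        proof (cases "x = 0")
          case True
          then show ?thesis using zero_outside(2)[OF u, of x] by (simp add: V_eq)
        next
          case False
          have "profile (?z x) = 0" using \<open>?u x = 0\<close> False D0 T1 by (simp add: extremal_eq)
          then show ?thesis using profile_zero[of "?z x"] False D0 T1 by (simp add: extremal_grad)
        qed
        then have "J ?u ?g x = 0" using zero_at(2)[of ?u x ?g] True by simp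
        then show ?thesis using C' T1 by (simp add: sum_nonneg)
      next
        case False
        note sup = extremal_support[OF D0 T1(2) False]
        have nx: "norm x > 0" using sup by simp
        define r where "r = norm x"
        have r: "r > 0" using nx by (simp add: r_def)
        define P where "P = profile (?z x)"
        define P' where "P' = profile' (?z x)"
        have P0: "P \<noteq> 0" using False sup(1) D0 by (auto simp: extremal_eq P_def)
        have Ppos: "P > 0" using P0 profile_bounds(1)[of "?z x"] by (simp add: P_def less_le)
        let ?a = "rgrad H ?u x" and ?b = "tgrad H ?u ?g x"
        have ux: "?u x = T powr (1 / p) * (r powr (- H) * P)"
          using extremal_eq[OF D0 sup(1)] by (simp add: r_def P_def)
        have b: "?b = - (T powr (1 / p) * (r powr (- H) / r\<^sup>2) * P' / T) *\<^sub>R x"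
        proof -
          have "?b = (T powr (1 / p) * (r powr (- H) / r\<^sup>2) * (- H * P - P' / T) + H * ?u x / r\<^sup>2) *\<^sub>R x"
            unfolding tgrad_def extremal_grad[OF D0 sup(1) T1(2)] dst_norm y_id
            by (simp add: r_def P_def P'_def scaleR_add_left)
          also have "T powr (1 / p) * (r powr (- H) / r\<^sup>2) * (- H * P - P' / T) + H * ?u x / r\<^sup>2
             = - (T powr (1 / p) * (r powr (- H) / r\<^sup>2) * P' / T)"
            unfolding ux by (simp add: right_diff_distrib)
          finally show ?thesis .
        qed
        have rH: "r powr (- H) / r\<^sup>2 * r = r powr (- (H + 1))"
          using r powr_diff[of r "- H" 1] by (simp add: power2_eq_square)
        have nb: "norm ?b = T powr (1 / p - 1) * (r powr (- (H + 1)) * \<bar>P'\<bar>)"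
        proof -
          have "norm ?b = T powr (1 / p) / T * ((r powr (- H) / r\<^sup>2 * r) * \<bar>P'\<bar>)"
            unfolding b using T1 by (simp add: abs_mult r_def mult_ac)
          also have "T powr (1 / p) / T = T powr (1 / p - 1)" using T1 by (simp add: powr_diff)
          finally show ?thesis unfolding rH .
        qed
        have na: "norm ?a = H * (T powr (1 / p) * (r powr (- (H + 1)) * P))"
        proof -
          have "norm ?a = H * (T powr (1 / p) * (r powr (- H) / r\<^sup>2 * r * P))"
            unfolding rgrad_def dst_norm y_id ux using hyps(4) Ppos r by (simp add: abs_mult r_def)
          then show ?thesis unfolding rH .
        qed
        have a0: "?a \<noteq> 0"
        proof -
          have "norm ?a > 0" unfolding na using hyps(4) Ppos r T1 by simp
          then show ?thesis by auto
        qed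
        \<comment> \<open>Because \<open>(H + 1) * p = N\<close>, both terms of
          \<open>bregman_upper\<close> turn into the scale-invariant weight
          \<open>r powr (- N)\<close>.\<close>
        have rN: "r powr (- (H + 1) * p) = r powr (- real N)" unfolding Hp[symmetric] mult_minus_left ..
        have 1: "norm ?a powr (p - 2) * (norm ?b)\<^sup>2 \<le> H powr (p - 2) * 64 * (r powr (- real N) / T)"
        proof -
          have e1: "(T powr (1 / p)) powr (p - 2) * (T powr (1 / p - 1))\<^sup>2 = 1 / T"
          proof -
            have "(T powr (1 / p - 1))\<^sup>2 = T powr (2 * (1 / p - 1))"
              using T1 powr_powr[of T "1 / p - 1" 2] by (simp add: mult.commute)
            then have "(T powr (1 / p)) powr (p - 2) * (T powr (1 / p - 1))\<^sup>2 = T powr (1 / p * (p - 2) + 2 * (1 / p - 1))"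
              by (simp add: powr_powr powr_add)
            also have "1 / p * (p - 2) + 2 * (1 / p - 1) = - 1" using hyps(1) by (simp add: field_simps)
            finally show ?thesis using T1 by (simp add: powr_minus_divide)
          qed
          have e2: "(r powr (- (H + 1))) powr (p - 2) * (r powr (- (H + 1)))\<^sup>2 = r powr (- real N)"
          proof -
            have "(r powr (- (H + 1)))\<^sup>2 = r powr (2 * (- (H + 1)))"
              using r powr_powr[of r "- (H + 1)" 2] by (simp add: mult.commute)
            then have "(r powr (- (H + 1))) powr (p - 2) * (r powr (- (H + 1)))\<^sup>2 = r powr (- (H + 1) * (p - 2) + 2 * (- (H + 1)))"
              by (simp add: powr_powr powr_add)
            also have "- (H + 1) * (p - 2) + 2 * (- (H + 1)) = - (H + 1) * p" by (simp add: algebra_simps)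
            finally show ?thesis unfolding rN .
          qed
          have "norm ?a powr (p - 2) * (norm ?b)\<^sup>2 = H powr (p - 2) *
             ((T powr (1 / p)) powr (p - 2) * (T powr (1 / p - 1))\<^sup>2) *
             ((r powr (- (H + 1))) powr (p - 2) * (r powr (- (H + 1)))\<^sup>2) * (P powr (p - 2) * P'\<^sup>2)"
            unfolding na nb by (simp only: powr_mult power_mult_distrib power2_abs mult_ac)
          also have "\<dots> = H powr (p - 2) * (1 / T) * r powr (- real N) * (P powr (p - 2) * P'\<^sup>2)"
            unfolding e1 e2 ..
          also have "\<dots> \<le> H powr (p - 2) * (1 / T) * r powr (- real N) * 64"
            using profile_weighted[OF hyps(1) P0[unfolded P_def]] T1
            by (intro mult_left_mono) (auto simp: P_def P'_def)
          finally show ?thesis by (simp add: mult_ac)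
        qed
        have 2: "(if p \<ge> 2 then norm ?b powr p else 0) \<le> 8 powr p * (r powr (- real N) / T)"
        proof (cases "p \<ge> 2")
          case True
          have "norm ?b powr p = T powr ((1 / p - 1) * p) * r powr (- (H + 1) * p) * \<bar>P'\<bar> powr p"
            unfolding nb by (simp only: powr_mult powr_powr mult.assoc)
          also have "\<dots> \<le> (1 / T) * r powr (- (H + 1) * p) * 8 powr p"
          proof (intro mult_mono mult_nonneg_nonneg)
            \<comment> \<open>The exponent is \<open>1 - p <= - 1\<close>, and
              \<open>T >= 1\<close>.\<close>
            have "T powr ((1 / p - 1) * p) \<le> T powr (- 1)"
              using T1 True by (intro powr_mono) (auto simp: field_simps)
            then show "T powr ((1 / p - 1) * p) \<le> 1 / T" using T1 by (simp add: powr_minus_divide)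
            show "\<bar>P'\<bar> powr p \<le> 8 powr p" unfolding P'_def using profile_bounds(2)[of "?z x"] True by (intro powr_mono2) auto
          qed (use T1 in auto)
          finally show ?thesis using True unfolding rN by (simp add: mult_ac)
        qed (use T1 in simp)
        have "J ?u ?g x \<le> C * (H powr (p - 2) * 64 * (r powr (- real N) / T) + 8 powr p * (r powr (- real N) / T))"
          unfolding J_def using C(2)[OF a0, of ?b] 1 2 C(1)
          by (elim order_trans) (intro mult_left_mono add_mono, auto)
        also have "\<dots> = C' / T * norm x powr (- real N)"
          by (simp add: C'_def r_def algebra_simps add_divide_distrib)
        also have "norm x powr (- real N) = (\<Sum>j\<in>?I. ?w j x)"
        proof (rule sum_w[symmetric, of _ _ "nat \<lfloor>ell x\<rfloor>"])
          have e: "4 * real n < ell x" "ell x < 8 * real n" using sup by (auto simp: ell_eq T_def)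
          then show "nat \<lfloor>ell x\<rfloor> \<in> ?I" by (auto simp: nat_less_iff le_nat_iff floor_less_iff le_floor_iff)
          show "real (nat \<lfloor>ell x\<rfloor>) \<le> ell x" "ell x < real (nat \<lfloor>ell x\<rfloor>) + 1" using e by auto
        qed (use sup in auto)
        finally show ?thesis .
      qed
      have "Jt ?u ?g \<le> (\<integral>x. C' / T * (\<Sum>j\<in>?I. ?w j x) \<partial>lborel)"
        unfolding Jt_def by (rule integral_mono[OF integrable_AJ(2)[OF u] iS le])
      also have "\<dots> = C' / T * (\<Sum>j\<in>?I. (\<integral>x. ?w j x \<partial>lborel))"
        using mM(3) by (subst integral_mult_right_zero, subst Bochner_Integration.integral_sum) auto
      also have "\<dots> \<le> C' / T * (\<Sum>j\<in>?I. M)"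
        using C' T1 by (intro mult_left_mono sum_mono mM) auto
      also have "\<dots> = C' * M" using T1 n1 by (simp add: T_def)
      finally show ?thesis .
    qed
    finally have up: "c * ?Q powr (p / q) \<le> C' * M" .
    have "K * real n powr (1 + q / p - \<gamma>) \<le> ?Q"
    proof -
      let ?I = "{5 * n..<7 * n}"
      define \<kappa> where "\<kappa> = T powr (q / p) * exp (- 16) powr q * (min (5 powr (- \<gamma>)) (7 powr (- \<gamma>)) * real n powr (- \<gamma>))"
      have k0: "\<kappa> \<ge> 0" by (simp add: \<kappa>_def)
      have f0: "?f x \<ge> 0" for x by simp
      have le: "\<kappa> * (\<Sum>j\<in>?I. ?w j x) \<le> ?f x" for x
      proof (cases "\<exists>j\<in>?I. x \<in> dyadic D j")
        case False
        then have "(\<Sum>j\<in>?I. ?w j x) = 0" by (intro sum.neutral) auto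
        then show ?thesis using f0[of x] by (simp only: mult_zero_right)
      next
        case True
        then obtain j where j: "j \<in> ?I" "x \<in> dyadic D j" by blast
        have "0 < D * exp (- real (Suc j))" using D0 by simp
        then have x0: "x \<noteq> 0" using j(2) by (auto simp: dyadic_def)
        have ej: "real j \<le> ell x" "ell x < real j + 1" using j(2) dyadic_iff[OF D0 x0] by (auto simp: ell_eq)
        have "5 * n \<le> j" "Suc j \<le> 7 * n" using j(1) by auto
        then have "5 * real n \<le> real j" "real j + 1 \<le> 7 * real n" by linarith+
        then have e: "5 * real n \<le> ell x" "ell x \<le> 7 * real n" using ej by auto
        have l0: "ell x > 0" using e n1 by linarith
        define r where "r = norm x"
        have r: "r > 0" using x0 by (simp add: r_def)
        have z: "5/4 \<le> ?z x" "?z x \<le> 7/4" using e n1 unfolding ell_eq T_def by (auto simp: field_simps)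
        have ux: "?u x = T powr (1 / p) * (r powr (- H) * profile (?z x))"
          using extremal_eq[OF D0 x0] by (simp add: r_def)
        have X: "X_log (norm x / D) = 1 / ell x" unfolding X_log_def ell_eq using x0 D0 by (simp add: ln_div divide_simps)
        have g1: "min (5 powr (- \<gamma>)) (7 powr (- \<gamma>)) * real n powr (- \<gamma>) \<le> X_log (norm x / D) powr \<gamma>"
        proof -
          have lp: "X_log (norm x / D) powr \<gamma> = ell x powr (- \<gamma>)"
            unfolding X using l0 by (simp add: powr_divide powr_minus_divide)
          show ?thesis
          proof (cases "\<gamma> \<ge> 0")
            case True
            have "min (5 powr (- \<gamma>)) (7 powr (- \<gamma>)) * real n powr (- \<gamma>) \<le> 7 powr (- \<gamma>) * real n powr (- \<gamma>)"
              by (intro mult_right_mono) auto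
            also have "\<dots> = (7 * real n) powr (- \<gamma>)" by (simp add: powr_mult)
            also have "\<dots> \<le> ell x powr (- \<gamma>)" using True e l0 by (intro powr_mono2') auto
            finally show ?thesis unfolding lp .
          next
            case False
            have "min (5 powr (- \<gamma>)) (7 powr (- \<gamma>)) * real n powr (- \<gamma>) \<le> 5 powr (- \<gamma>) * real n powr (- \<gamma>)"
              by (intro mult_right_mono) auto
            also have "\<dots> = (5 * real n) powr (- \<gamma>)" by (simp add: powr_mult)
            also have "\<dots> \<le> ell x powr (- \<gamma>)" using False e by (intro powr_mono2) auto
            finally show ?thesis unfolding lp .
          qed
        qed
        have "(\<Sum>j\<in>?I. ?w j x) = r powr (- real N)" unfolding r_def by (rule sum_w[OF _ x0 j(1) ej]) simp
        then have "\<kappa> * (\<Sum>j\<in>?I. ?w j x) = (T powr (q / p) * exp (- 16) powr q * r powr (- real N)) *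
           (min (5 powr (- \<gamma>)) (7 powr (- \<gamma>)) * real n powr (- \<gamma>))" by (simp add: \<kappa>_def mult_ac)
        also have "\<dots> \<le> (T powr (q / p) * profile (?z x) powr q * r powr (- real N)) * X_log (norm x / D) powr \<gamma>"
          using profile_lower[OF z] q0 by (intro mult_mono g1 mult_right_mono mult_left_mono powr_mono2) auto
        also have "\<dots> = ?f x"
        proof -
          have "\<bar>?u x\<bar> powr q = T powr (1 / p * q) * (r powr (- H * q) * profile (?z x) powr q)"
            unfolding ux using profile_bounds(1)[of "?z x"] by (simp add: abs_mult powr_mult powr_powr)
          then have "\<bar>?u x\<bar> powr q * norm x powr s = T powr (q / p) * profile (?z x) powr q * (r powr (- H * q) * r powr s)"
            by (simp add: r_def mult_ac)
          also have "r powr (- H * q) * r powr s = r powr (- real N)" unfolding powr_add[symmetric] s_eq ..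
          finally show ?thesis by simp
        qed
        finally show ?thesis .
      qed
      have "K * real n powr (1 + q / p - \<gamma>) = \<kappa> * (real (2 * n) * m)"
      proof -
        have "real n powr (1 + q / p - \<gamma>) = real n * real n powr (q / p) * real n powr (- \<gamma>)"
          using n1 by (simp add: powr_diff powr_add powr_minus_divide)
        moreover have "T powr (q / p) = 4 powr (q / p) * real n powr (q / p)" by (simp add: T_def powr_mult)
        ultimately show ?thesis by (simp add: K_def \<kappa>_def mult_ac)
      qed
      also have "real (2 * n) * m = (\<Sum>j\<in>?I. m)" by simp
      also have "\<kappa> * (\<Sum>j\<in>?I. m) \<le> \<kappa> * (\<Sum>j\<in>?I. (\<integral>x. ?w j x \<partial>lborel))"
        using k0 by (intro mult_left_mono sum_mono mM) auto
      also have "\<dots> = (\<integral>x. \<kappa> * (\<Sum>j\<in>?I. ?w j x) \<partial>lborel)"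
        using mM(3) by (subst integral_mult_right_zero, subst Bochner_Integration.integral_sum) auto
      also have "\<dots> \<le> ?Q"
        by (rule integral_mono[OF iS if' le])
      finally show ?thesis .
    qed
    then have "(K * real n powr (1 + q / p - \<gamma>)) powr (p / q) \<le> ?Q powr (p / q)"
      using K0 hyps(1) q0 by (intro powr_mono2) auto
    then have "c * (K * real n powr (1 + q / p - \<gamma>)) powr (p / q) \<le> c * ?Q powr (p / q)"
      using c by (intro mult_left_mono) auto
    with up show ?thesis by linarith
  qed
  \<comment> \<open>Positive because \<open>\<gamma> < 1 + q / p\<close>; hence
    \<open>n powr \<delta>\<close> outgrows the fixed bound \<open>B\<close>.\<close>
  define \<delta> where "\<delta> = (1 + q / p - \<gamma>) * (p / q)"
  have \<delta>: "\<delta> > 0" using \<gamma> hyps q0 by (simp add: \<delta>_def)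
  define B where "B = C' * M / (c * K powr (p / q))"
  have bound: "real n powr \<delta> \<le> B" if "n \<ge> Suc n0" for n
  proof -
    have "c * (K powr (p / q) * real n powr \<delta>) \<le> C' * M"
      using main[OF that] K0 by (simp add: powr_mult powr_powr \<delta>_def)
    then show ?thesis using c K0 by (simp add: B_def field_simps)
  qed
  obtain n where n: "max (real (Suc n0)) ((\<bar>B\<bar> + 1) powr (1 / \<delta>)) < real n" using reals_Archimedean2 by blast
  have "\<bar>B\<bar> + 1 = ((\<bar>B\<bar> + 1) powr (1 / \<delta>)) powr \<delta>" using \<delta> by (simp add: powr_powr)
  also have "\<dots> \<le> real n powr \<delta>" using n \<delta> by (intro powr_mono2) auto
  also have "\<dots> \<le> B" using n by (intro bound) auto
  finally show False by simp
qed

theorem theoremC: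
  shows
   "(\<forall>(idx :: nat \<Rightarrow> 'n::finite) (k :: nat) (N :: nat) (p :: real) (q :: real)
       (K :: (real ^ 'n) set) (d :: real ^ 'n \<Rightarrow> real).
       N = CARD('n) \<and> bij_betw idx {1..N} UNIV \<and> 1 \<le> k \<and> k \<le> N - 1 \<and>
       K = {x. \<forall>i\<in>{1..k}. x $ idx i = 0} \<and> d = (\<lambda>x. infdist x K) \<and>
       2 \<le> p \<and> p < real N \<and> p < q \<and> q \<le> real N * p / (real N - p) \<longrightarrow>
       (\<exists>c::real. c > 0 \<and> (\<forall>u g. W01p (UNIV - K) p u g \<longrightarrow>
          int_on UNIV (\<lambda>x. norm (g x) powr p)
            - ereal (\<bar>(real k - p) / p\<bar> powr p) * int_on UNIV (\<lambda>x. \<bar>u x\<bar> powr p / d x powr p)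
          \<ge> ereal c * epowr (int_on UNIV
                (\<lambda>x. \<bar>u x\<bar> powr q * d x powr (- q - real N + real N * q / p))) (p / q))))
    \<and>
    (\<forall>(\<Omega> :: (real ^ 'n) set) (N :: nat) (D :: real) (p :: real) (q :: real).
       N = CARD('n) \<and> open \<Omega> \<and> connected \<Omega> \<and> bounded \<Omega> \<and> 0 \<in> \<Omega> \<and>
       D > (SUP x\<in>\<Omega>. norm x) \<and>
       1 < p \<and> p < real N \<and> p \<le> q \<and> q < real N * p / (real N - p) \<longrightarrow>
       (\<exists>c::real. c > 0 \<and> (\<forall>u g. W01p \<Omega> p u g \<longrightarrow>
          int_on \<Omega> (\<lambda>x. norm (g x) powr p)
            - ereal (\<bar>(real N - p) / p\<bar> powr p) * int_on \<Omega> (\<lambda>x. \<bar>u x\<bar> powr p / norm x powr p)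
          \<ge> ereal c * epowr (int_on \<Omega>
                (\<lambda>x. \<bar>u x\<bar> powr q * norm x powr (- q - real N + real N * q / p)
                       * X_log (norm x / D) powr (1 + q / p))) (p / q)))
       \<and>
       (\<forall>\<gamma>::real. \<gamma> < 1 + q / p \<longrightarrow>
         \<not> (\<exists>c::real. c > 0 \<and> (\<forall>u g. W01p \<Omega> p u g \<longrightarrow>
          int_on \<Omega> (\<lambda>x. norm (g x) powr p)
            - ereal (\<bar>(real N - p) / p\<bar> powr p) * int_on \<Omega> (\<lambda>x. \<bar>u x\<bar> powr p / norm x powr p)
          \<ge> ereal c * epowr (int_on \<Omega>
                (\<lambda>x. \<bar>u x\<bar> powr q * norm x powr (- q - real N + real N * q / p)
                       * X_log (norm x / D) powr \<gamma>)) (p / q)))))"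
  by (intro conjI allI impI; elim conjE; (rule Hardy_Sobolev_plane | rule Hardy_Sobolev_point | rule Hardy_Sobolev_point_optimal); assumption)

end
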